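(* Let $m,n,k,l$ be positive integers, let $G=\operatorname{SL}(m+1)\times\operatorname{SL}(n+1)$ and let $X_{k,l}$ be a divisor of bidegree $(k,l)$ in $\mathbb{P}^m\times\mathbb{P}^n$. Let $S_{m,n}^{k,l}$ be the (finite) fundamental set of one-parameter subgroups. Then $X_{k,l}$ is not stable (respectively unstable) if and only if there exist $g\in G$ and $\lambda\in S_{m,n}^{k,l}$ such that $$\mu(g\cdot X_{k,l},\lambda)\ge 0\quad(\text{respectively } >0).$$
   Context: We work over $\mathbb{C}$. Let $x_0,\dots,x_m$ and $y_0,\dots,y_n$ be coordinates on $\mathbb{P}^m$ and $\mathbb{P}^n$, and let $T\subset G$ be the diagonal maximal torus. A divisor $X_{k,l}$ of bidegree $(k,l)$ is given by a nonzero bihomogeneous polynomial $F=\sum_I c_I x^I$, where $x^I=x_0^{k_0}\cdots x_m^{k_m}y_0^{l_0}\cdots y_n^{l_n}$, $I=(k_0,\dots,k_m,l_0,\dots,l_n)$, $\sum k_i=k$, $\sum l_j=l$. Put $\operatorname{Supp}(X_{k,l})=\{x^I: c_I\ne0\}$. Stability (stable, semistable, unstable = not semistable) is GIT stability for the natural linearised action of $G$ on the projective space of such polynomials. A one-parameter subgroup of $T$ is $\lambda(t)=(\operatorname{Diag}(t^{r_0},\dots,t^{r_m}),\operatorname{Diag}(t^{s_0},\dots,t^{s_n}))$ with $r_i,s_j\in\mathbb{Z}$, $\sum r_i=\sum s_j=0$. Set $\langle I,\lambda\rangle=\sum_i r_ik_i+\sum_j s_jl_j$. The Hilbert–Mumford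 function is $\mu(X_{k,l},\lambda)=\min\{\langle I,\lambda\rangle : x^I\in\operatorname{Supp}(X_{k,l})\}$. The fundamental set $S_{m,n}^{k,l}$ consists of all $\lambda(t)=(\operatorname{Diag}(t^{r_0},\dots,t^{r_m}),\operatorname{Diag}(t^{s_0},\dots,t^{s_n}))\in T$ with $(r_0,\dots,r_m,s_0,\dots,s_n)=c(\rho_0,\dots,\rho_m,\sigma_0,\dots,\sigma_n)\in\mathbb{Z}^{m+n+2}$ such that: (1) $\rho_i=a_i/b_i$ and $\sigma_j=c_j/d_j$ are rational numbers in lowest terms; (2) $c=\operatorname{lcm}(b_0,\dots,b_m,d_0,\dots,d_n)$; (3) $\rho_0\ge\cdots\ge\rho_m$, $\sigma_0\ge\cdots\ge\sigma_n$, $\sum_i\rho_i=0$, $\sum_j\sigma_j=0$; (4) after fixing $\rho_0=1$ or $\sigma_0=1$, $(\rho_0,\dots,\rho_m,\sigma_0,\dots,\sigma_n)$ is the unique non-trivial solution of a consistent linear system (together with the two sum conditions in (3)) of $m+n-1$ equations chosen from $$\operatorname{Eq}_{m,n}^{k,l}=\Big\{\sum_{i=0}^m w_i\rho_i+\sum_{j=0}^n v_j\sigma_j=0 \ \Big|\ w_i\in[-k,k]\cap\mathbb{Z},\ \sum_i w_i=0,\ v_j\in[-l,l]\cap\mathbb{Z},\ \sum_j v_j=0\Big\}.$$ *)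

theory Defs
  imports
    "HOL-Algebra.Group"
    "HOL-Library.Poly_Mapping"
    "Jordan_Normal_Form.Determinant"
begin

section \<open>Multivariate polynomials over the complex numbers\<close>

text \<open>Polynomials are finitely supported maps from exponents to coefficients; their ring structure
  is the convolution product of \<^theory>\<open>HOL-Library.Poly_Mapping\<close>.\<close>

type_synonym 'v monomial = "'v \<Rightarrow>\<^sub>0 nat"
type_synonym 'v cpoly = "'v monomial \<Rightarrow>\<^sub>0 complex"

definition Const :: "complex \<Rightarrow> 'v cpoly" where
  "Const c = Poly_Mapping.single 0 c"

definition Var :: "'v \<Rightarrow> 'v cpoly" where
  "Var v = Poly_Mapping.single (Poly_Mapping.single v 1) 1"

text \<open>The substitution \<open>v \<mapsto> \<phi> v\<close>, with coefficients transported along \<open>\<iota>\<close>.\<close>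

definition cpoly_hom :: "(complex \<Rightarrow> 'r::comm_ring_1) \<Rightarrow> ('v \<Rightarrow> 'r) \<Rightarrow> 'v cpoly \<Rightarrow> 'r" where
  "cpoly_hom \<iota> \<phi> P = (\<Sum>\<alpha>\<in>Poly_Mapping.keys P. \<iota> (Poly_Mapping.lookup P \<alpha>) *
      (\<Prod>v\<in>Poly_Mapping.keys \<alpha>. \<phi> v ^ Poly_Mapping.lookup \<alpha> v))"

definition cpoly_eval :: "('v \<Rightarrow> complex) \<Rightarrow> 'v cpoly \<Rightarrow> complex" where
  "cpoly_eval = cpoly_hom (\<lambda>c. c)"

definition cpoly_subst :: "('v \<Rightarrow> 'w cpoly) \<Rightarrow> 'v cpoly \<Rightarrow> 'w cpoly" where
  "cpoly_subst = cpoly_hom Const"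


section \<open>Bihomogeneous polynomials\<close>

datatype bivar = x_var nat | y_var nat

definition bimonomials :: "nat \<Rightarrow> nat \<Rightarrow> nat \<Rightarrow> nat \<Rightarrow> bivar monomial set" where
  "bimonomials m n k l = {I. Poly_Mapping.keys I \<subseteq> x_var ` {..m} \<union> y_var ` {..n} \<and>
      (\<Sum>i\<le>m. Poly_Mapping.lookup I (x_var i)) = k \<and>
      (\<Sum>j\<le>n. Poly_Mapping.lookup I (y_var j)) = l}"

text \<open>The vector space of forms of bidegree \<open>(k, l)\<close>, including 0.\<close>

definition biforms :: "nat \<Rightarrow> nat \<Rightarrow> nat \<Rightarrow> nat \<Rightarrow> bivar cpoly set" where
  "biforms m n k l = {F. Poly_Mapping.keys F \<subseteq> bimonomials m n k l}"


section \<open>The group and its action\<close>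

definition SL :: "nat \<Rightarrow> complex mat monoid" where
  "SL N = \<lparr>carrier = {A \<in> carrier_mat N N. det A = 1}, mult = (*), one = 1\<^sub>m N\<rparr>"

definition SLxSL :: "nat \<Rightarrow> nat \<Rightarrow> (complex mat \<times> complex mat) monoid" where
  "SLxSL m n = SL (m + 1) \<times>\<times> SL (n + 1)"

definition linear_subst ::
    "nat \<Rightarrow> nat \<Rightarrow> complex mat \<times> complex mat \<Rightarrow> bivar \<Rightarrow> bivar cpoly" where
  "linear_subst m n h v = (case v of
      x_var i \<Rightarrow> \<Sum>j\<le>m. Const (fst h $$ (i, j)) * Var (x_var j)
    | y_var i \<Rightarrow> \<Sum>j\<le>n. Const (snd h $$ (i, j)) * Var (y_var j))"

text \<open>The left action \<open>(g \<cdot> F)(x, y) = F(g\<inverse>(x, y))\<close>: the zero divisor of \<open>g \<cdot> F\<close> is the image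
  under \<open>g\<close> of that of \<open>F\<close>.\<close>

definition act ::
    "nat \<Rightarrow> nat \<Rightarrow> complex mat \<times> complex mat \<Rightarrow> bivar cpoly \<Rightarrow> bivar cpoly" where
  "act m n g = cpoly_subst (linear_subst m n (inv\<^bsub>SLxSL m n\<^esub> g))"


section \<open>GIT stability\<close>

text \<open>Points of the projective space of forms are represented by non-zero forms; a subset of that
  space is represented by the set of all non-zero forms lying over it.\<close>

definition same_point :: "bivar cpoly \<Rightarrow> bivar cpoly \<Rightarrow> bool" where
  "same_point F F' \<longleftrightarrow> (\<exists>c. c \<noteq> 0 \<and> F' = Const c * F)"

text \<open>Homogeneous polynomial functions of degree \<open>d\<close> on the space of forms, that is, sections of
  \<open>O(d)\<close>. Their variables are indexed by the monomials \<open>I\<close>: the variable \<open>I\<close> is the coordinate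
  function that sends a form to its coefficient at \<open>I\<close>.\<close>

definition sections ::
    "nat \<Rightarrow> nat \<Rightarrow> nat \<Rightarrow> nat \<Rightarrow> nat \<Rightarrow> bivar monomial cpoly set" where
  "sections m n k l d = {f. \<forall>\<alpha>\<in>Poly_Mapping.keys f.
      Poly_Mapping.keys \<alpha> \<subseteq> bimonomials m n k l \<and>
      (\<Sum>I\<in>Poly_Mapping.keys \<alpha>. Poly_Mapping.lookup \<alpha> I) = d}"

definition section_at :: "bivar monomial cpoly \<Rightarrow> bivar cpoly \<Rightarrow> complex" where
  "section_at f F = cpoly_eval (Poly_Mapping.lookup F) f"

definition invariant_sections ::
    "nat \<Rightarrow> nat \<Rightarrow> nat \<Rightarrow> nat \<Rightarrow> nat \<Rightarrow> bivar monomial cpoly set" where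
  "invariant_sections m n k l d = {f \<in> sections m n k l d.
      \<forall>g\<in>carrier (SLxSL m n). \<forall>F\<in>biforms m n k l. section_at f (act m n g F) = section_at f F}"

definition nonvanishing_locus ::
    "nat \<Rightarrow> nat \<Rightarrow> nat \<Rightarrow> nat \<Rightarrow> bivar monomial cpoly \<Rightarrow> bivar cpoly set" where
  "nonvanishing_locus m n k l f = {F \<in> biforms m n k l. F \<noteq> 0 \<and> section_at f F \<noteq> 0}"

definition zariski_closed ::
    "nat \<Rightarrow> nat \<Rightarrow> nat \<Rightarrow> nat \<Rightarrow> bivar cpoly set \<Rightarrow> bool" where
  "zariski_closed m n k l Z \<longleftrightarrow> (\<exists>H \<subseteq> (\<Union>d. sections m n k l d).
      Z = {F \<in> biforms m n k l. F \<noteq> 0 \<and> (\<forall>h\<in>H. section_at h F = 0)})"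

definition proj_orbit :: "nat \<Rightarrow> nat \<Rightarrow> bivar cpoly \<Rightarrow> bivar cpoly set" where
  "proj_orbit m n F = {F'. \<exists>g\<in>carrier (SLxSL m n). same_point (act m n g F) F'}"

definition proj_stabilizer ::
    "nat \<Rightarrow> nat \<Rightarrow> bivar cpoly \<Rightarrow> (complex mat \<times> complex mat) set" where
  "proj_stabilizer m n F = {g \<in> carrier (SLxSL m n). same_point (act m n g F) F}"

definition semistable :: "nat \<Rightarrow> nat \<Rightarrow> nat \<Rightarrow> nat \<Rightarrow> bivar cpoly \<Rightarrow> bool" where
  "semistable m n k l F \<longleftrightarrow>
     (\<exists>d>0. \<exists>f\<in>invariant_sections m n k l d. F \<in> nonvanishing_locus m n k l f)"

text \<open>Stable in the sense called properly stable by Mumford: finite stabilizers are required.\<close>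

definition stable :: "nat \<Rightarrow> nat \<Rightarrow> nat \<Rightarrow> nat \<Rightarrow> bivar cpoly \<Rightarrow> bool" where
  "stable m n k l F \<longleftrightarrow>
     finite (proj_stabilizer m n F) \<and>
     (\<exists>d>0. \<exists>f\<in>invariant_sections m n k l d.
        F \<in> nonvanishing_locus m n k l f \<and>
        (\<forall>F'\<in>nonvanishing_locus m n k l f.
           \<exists>Z. zariski_closed m n k l Z \<and>
             proj_orbit m n F' = Z \<inter> nonvanishing_locus m n k l f))"

definition unstable :: "nat \<Rightarrow> nat \<Rightarrow> nat \<Rightarrow> nat \<Rightarrow> bivar cpoly \<Rightarrow> bool" where
  "unstable m n k l F \<longleftrightarrow> \<not> semistable m n k l F"


section \<open>One-parameter subgroups\<close>

text \<open>The one-parameter subgroup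
  \<open>t \<mapsto> (Diag(t^r\<^sub>0, \<dots>, t^r\<^sub>m), Diag(t^s\<^sub>0, \<dots>, t^s\<^sub>n))\<close> is represented by its pair of weight
  vectors \<open>(r, s)\<close>.\<close>

type_synonym weights = "int vec \<times> int vec"

definition pairing :: "nat \<Rightarrow> nat \<Rightarrow> bivar monomial \<Rightarrow> weights \<Rightarrow> int" where
  "pairing m n I lam =
     (\<Sum>i\<le>m. fst lam $ i * int (Poly_Mapping.lookup I (x_var i))) +
     (\<Sum>j\<le>n. snd lam $ j * int (Poly_Mapping.lookup I (y_var j)))"

definition HM :: "nat \<Rightarrow> nat \<Rightarrow> bivar cpoly \<Rightarrow> weights \<Rightarrow> int" where
  "HM m n F lam = Min ((\<lambda>I. pairing m n I lam) ` Poly_Mapping.keys F)"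

text \<open>An equation \<open>\<Sum> w\<^sub>i \<rho>\<^sub>i + \<Sum> v\<^sub>j \<sigma>\<^sub>j = 0\<close> is represented by its coefficients \<open>(w, v)\<close>.\<close>

definition Eqs :: "nat \<Rightarrow> nat \<Rightarrow> nat \<Rightarrow> nat \<Rightarrow> (int vec \<times> int vec) set" where
  "Eqs m n k l = {(w, v). w \<in> carrier_vec (m + 1) \<and> v \<in> carrier_vec (n + 1) \<and>
      (\<forall>i\<le>m. w $ i \<in> {- int k..int k}) \<and> (\<Sum>i\<le>m. w $ i) = 0 \<and>
      (\<forall>j\<le>n. v $ j \<in> {- int l..int l}) \<and> (\<Sum>j\<le>n. v $ j) = 0}"

definition solves ::
    "nat \<Rightarrow> nat \<Rightarrow> (int vec \<times> int vec) set \<Rightarrow> rat vec \<times> rat vec \<Rightarrow> bool" where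
  "solves m n E p \<longleftrightarrow> (case p of (\<rho>, \<sigma>) \<Rightarrow>
     \<rho> \<in> carrier_vec (m + 1) \<and> \<sigma> \<in> carrier_vec (n + 1) \<and>
     (\<Sum>i\<le>m. \<rho> $ i) = 0 \<and> (\<Sum>j\<le>n. \<sigma> $ j) = 0 \<and>
     (\<forall>(w, v)\<in>E. (\<Sum>i\<le>m. of_int (w $ i) * \<rho> $ i) + (\<Sum>j\<le>n. of_int (v $ j) * \<sigma> $ j) = 0))"

definition unique_solution ::
    "nat \<Rightarrow> nat \<Rightarrow> (int vec \<times> int vec) set \<Rightarrow> (rat vec \<times> rat vec \<Rightarrow> bool) \<Rightarrow> rat vec \<times> rat vec \<Rightarrow> bool"
  where
  "unique_solution m n E N p \<longleftrightarrow>
     solves m n E p \<and> N p \<and> (\<forall>q. solves m n E q \<and> N q \<longrightarrow> q = p)"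

definition denominator :: "rat \<Rightarrow> int" where
  "denominator q = snd (quotient_of q)"

definition fundamental_set :: "nat \<Rightarrow> nat \<Rightarrow> nat \<Rightarrow> nat \<Rightarrow> weights set" where
  "fundamental_set m n k l = {(r, s). \<exists>\<rho> \<sigma> c.
      \<rho> \<in> carrier_vec (m + 1) \<and> \<sigma> \<in> carrier_vec (n + 1) \<and>
      map_vec rat_of_int r = rat_of_int c \<cdot>\<^sub>v \<rho> \<and> map_vec rat_of_int s = rat_of_int c \<cdot>\<^sub>v \<sigma> \<and>
      c = Lcm ((\<lambda>i. denominator (\<rho> $ i)) ` {..m} \<union> (\<lambda>j. denominator (\<sigma> $ j)) ` {..n}) \<and>
      (\<forall>i<m. \<rho> $ i \<ge> \<rho> $ (i + 1)) \<and> (\<forall>j<n. \<sigma> $ j \<ge> \<sigma> $ (j + 1)) \<and>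
      (\<Sum>i\<le>m. \<rho> $ i) = 0 \<and> (\<Sum>j\<le>n. \<sigma> $ j) = 0 \<and>
      (\<exists>E \<subseteq> Eqs m n k l. finite E \<and> card E = m + n - 1 \<and>
         (unique_solution m n E (\<lambda>(\<rho>', \<sigma>'). \<rho>' $ 0 = 1) (\<rho>, \<sigma>) \<or>
          unique_solution m n E (\<lambda>(\<rho>', \<sigma>'). \<sigma>' $ 0 = 1) (\<rho>, \<sigma>)))}"

end

theory Submission
  imports Defs "HOL-Computational_Algebra.Polynomial" "HOL-Computational_Algebra.Fundamental_Theorem_Algebra"
    "HOL-Analysis.Continuum_Not_Denumerable" "Jordan_Normal_Form.Char_Poly"
begin

text \<open>
  Limits are taken along places. A place is a valuation ring \<open>B\<close> of functions on a parameter set together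
  with its residue map \<open>\<phi>\<close>, and every point in the Zariski closure of a parametrised set is the residue of
  the parametrisation at some place.

  Over a place, a family \<open>h\<close> of group elements is a product of bounded factors and a dominant
  diagonal factor. The valuations of the diagonal entries are elements of an ordered group, but the
  inequalities that they satisfy have an integral solution as well, and the vertices of the cone of all such
  solutions are fundamental one-parameter subgroups. Hence if \<open>h x \<cdot> F\<close> is bounded, then either \<open>h\<close> is
  bounded, or \<open>\<mu>(g \<cdot> F, \<lambda>) \<ge> 0\<close> for some \<open>g\<close> and some fundamental \<open>\<lambda>\<close>; and if \<open>h x \<cdot> F\<close> tends to 0, then
  \<open>\<mu>(g \<cdot> F, \<lambda>) > 0\<close>.

  So if no \<open>\<mu>(g \<cdot> F, \<lambda>)\<close> is positive, then 0 is not in the closure of the orbit, and averaging yields an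
  invariant that does not vanish at \<open>F\<close>. If no \<open>\<mu>(g \<cdot> F, \<lambda>)\<close> is non-negative, then the orbit is closed, the
  stabilizer is finite, and some invariant separates the orbit from all limits along one-parameter subgroups,
  which makes all orbits in its nonvanishing locus closed. For the converse directions one lets the parameter
  of \<open>\<lambda>\<close> tend to 0: invariants are constant along the curve, and its limit is 0 or has an infinite stabilizer.\<close>

section \<open>Substitution into polynomials\<close>

text \<open>Places come from Zorn's lemma and not from curves. This avoids dimension theory and
  curve selection, but the values of a place lie in an unknown ordered group, so integral weights
  have to be recovered from inequalities by a Farkas argument. Averaging uses neither Haar measure
  nor topology: it is an orthogonal projection in a finite-dimensional space of coefficient vectors.

  The number \<open>m + n - 1\<close> has the following origin. Weights form a space of dimension
  \<open>m + n\<close>. The function \<open>\<rho>\<^sub>0 + \<sigma>\<^sub>0\<close> is positive on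
  non-zero dominant weights, so its level 1 cuts the dominant cone in a polytope inside a space of
  dimension \<open>m + n - 1\<close>, and vertices need that many equations. Its constraints are
  differences of adjacent coordinates and differences of monomials, and both have coefficients
  within the bounds \<open>k\<close> and \<open>l\<close>. A monomial alone does not have
  coefficient sums 0 and so is not an admissible equation; for this reason weights are compared with
  that of a monomial of least weight, and only this one weight is an objective.\<close>

lemma poly_mapping_induct [case_names single sum]:
  fixes p :: "'a \<Rightarrow>\<^sub>0 'b::comm_monoid_add"
  assumes s: "\<And>k c. R (Poly_Mapping.single k c)" and p: "\<And>p q. R p \<Longrightarrow> R q \<Longrightarrow> R (p + q)"
  shows "R p"
proof (induction p rule: update_induct)
  case const
  show ?case using s[of undefined 0] by simp
next
  case (update p k c)
  then have "Poly_Mapping.update k c p = p + Poly_Mapping.single k c"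
    by (intro poly_mapping_eqI) (auto simp: lookup_update lookup_add lookup_single when_def in_keys_iff)
  then show ?case using update p s by simp
qed

definition mon_val :: "('v \<Rightarrow> 'r::comm_ring_1) \<Rightarrow> 'v monomial \<Rightarrow> 'r" where
  "mon_val \<phi> \<alpha> = (\<Prod>v\<in>Poly_Mapping.keys \<alpha>. \<phi> v ^ Poly_Mapping.lookup \<alpha> v)"

lemma mon_val_superset:
  assumes "finite A" "Poly_Mapping.keys \<alpha> \<subseteq> A"
  shows "mon_val \<phi> \<alpha> = (\<Prod>v\<in>A. \<phi> v ^ Poly_Mapping.lookup \<alpha> v)"
  unfolding mon_val_def using assms
  by (intro prod.mono_neutral_left) (auto simp: in_keys_iff)

lemma mon_val_0 [simp]: "mon_val \<phi> 0 = 1"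
  by (simp add: mon_val_def)

lemma mon_val_add: "mon_val \<phi> (\<alpha> + \<beta>) = mon_val \<phi> \<alpha> * mon_val \<phi> \<beta>"
proof -
  let ?A = "Poly_Mapping.keys \<alpha> \<union> Poly_Mapping.keys \<beta>"
  have "Poly_Mapping.keys (\<alpha> + \<beta>) \<subseteq> ?A"
    by (rule Poly_Mapping.keys_add)
  then show ?thesis
    by (simp add: mon_val_superset[of ?A] lookup_add power_add prod.distrib)
qed

lemma mon_val_single [simp]: "mon_val \<phi> (Poly_Mapping.single v k) = \<phi> v ^ k"
  by (cases "k = 0") (simp_all add: mon_val_def)

text \<open>Evaluation at a point and substitution of polynomials are one construction over
  different coefficient rings; the instances are the identity and \<open>Const\<close>.\<close>

locale complex_algebra =
  fixes \<iota> :: "complex \<Rightarrow> 'r::comm_ring_1"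
  assumes hom_0: "\<iota> 0 = 0" and hom_1: "\<iota> 1 = 1"
    and hom_add: "\<iota> (a + b) = \<iota> a + \<iota> b" and hom_mult: "\<iota> (a * b) = \<iota> a * \<iota> b"
begin

lemma cpoly_hom_superset:
  assumes "finite A" "Poly_Mapping.keys P \<subseteq> A"
  shows "cpoly_hom \<iota> \<phi> P = (\<Sum>\<alpha>\<in>A. \<iota> (Poly_Mapping.lookup P \<alpha>) * mon_val \<phi> \<alpha>)"
  unfolding cpoly_hom_def mon_val_def using assms
  by (intro sum.mono_neutral_left) (auto simp: in_keys_iff hom_0)

lemma cpoly_hom_0 [simp]: "cpoly_hom \<iota> \<phi> 0 = 0"
  by (simp add: cpoly_hom_def)

lemma cpoly_hom_add: "cpoly_hom \<iota> \<phi> (P + Q) = cpoly_hom \<iota> \<phi> P + cpoly_hom \<iota> \<phi> Q"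
proof -
  let ?A = "Poly_Mapping.keys P \<union> Poly_Mapping.keys Q"
  have "Poly_Mapping.keys (P + Q) \<subseteq> ?A"
    by (rule Poly_Mapping.keys_add)
  then show ?thesis
    by (simp add: cpoly_hom_superset[of ?A] lookup_add hom_add distrib_right sum.distrib)
qed

lemma cpoly_hom_single: "cpoly_hom \<iota> \<phi> (Poly_Mapping.single \<alpha> c) = \<iota> c * mon_val \<phi> \<alpha>"
  by (cases "c = 0") (simp_all add: cpoly_hom_def mon_val_def hom_0)

lemma cpoly_hom_sum: "cpoly_hom \<iota> \<phi> (sum f A) = (\<Sum>x\<in>A. cpoly_hom \<iota> \<phi> (f x))"
  by (induction A rule: infinite_finite_induct) (simp_all add: cpoly_hom_add)

lemma cpoly_hom_mult: "cpoly_hom \<iota> \<phi> (P * Q) = cpoly_hom \<iota> \<phi> P * cpoly_hom \<iota> \<phi> Q"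
proof -
  have *: "cpoly_hom \<iota> \<phi> (Poly_Mapping.single \<alpha> c * Q)
      = cpoly_hom \<iota> \<phi> (Poly_Mapping.single \<alpha> c) * cpoly_hom \<iota> \<phi> Q" for \<alpha> c
  proof (induction Q rule: poly_mapping_induct)
    case (single \<beta> d)
    then show ?case
      by (simp add: mult_single cpoly_hom_single mon_val_add hom_mult mult_ac)
  next
    case (sum f g)
    then show ?case
      by (simp add: cpoly_hom_add distrib_left)
  qed
  show ?thesis
  proof (induction P rule: poly_mapping_induct)
    case (single \<alpha> c)
    then show ?case by (rule *)
  next
    case (sum f g)
    then show ?case
      by (simp add: cpoly_hom_add distrib_right)
  qed
qed

lemma cpoly_hom_Const [simp]: "cpoly_hom \<iota> \<phi> (Const c) = \<iota> c"
  by (simp add: Const_def cpoly_hom_single)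

lemma cpoly_hom_Var [simp]: "cpoly_hom \<iota> \<phi> (Var v) = \<phi> v"
  by (simp add: Var_def cpoly_hom_single hom_1)

lemma cpoly_hom_1 [simp]: "cpoly_hom \<iota> \<phi> 1 = 1"
  using cpoly_hom_single[of \<phi> 0 1] by (simp add: hom_1)

lemma cpoly_hom_prod: "cpoly_hom \<iota> \<phi> (prod f A) = (\<Prod>x\<in>A. cpoly_hom \<iota> \<phi> (f x))"
  by (induction A rule: infinite_finite_induct) (simp_all add: cpoly_hom_mult)

lemma cpoly_hom_prod_list: "cpoly_hom \<iota> \<phi> (prod_list Ps) = prod_list (map (cpoly_hom \<iota> \<phi>) Ps)"
  by (induction Ps) (simp_all add: cpoly_hom_mult)

end

lemma Const_0 [simp]: "Const 0 = 0"
  and Const_1 [simp]: "Const 1 = 1"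
  and Const_add: "Const (a + b) = Const a + Const b"
  and Const_mult: "Const (a * b) = Const a * Const b"
  by (simp_all add: Const_def single_add mult_single)

lemma Const_uminus: "Const (- b) = - Const b"
  by (simp add: Const_def single_uminus)

lemma Const_sum: "Const (sum f A) = (\<Sum>x\<in>A. Const (f x))"
  by (induction A rule: infinite_finite_induct) (simp_all add: Const_add)

lemma Const_prod: "Const (prod f A) = (\<Prod>x\<in>A. Const (f x))"
  by (induction A rule: infinite_finite_induct) (simp_all add: Const_mult)

lemma lookup_Const_mult: "Poly_Mapping.lookup (Const c * P) \<alpha> = c * Poly_Mapping.lookup P \<alpha>"
proof (induction P rule: poly_mapping_induct)
  case (single \<beta> d)
  then show ?case by (simp add: Const_def mult_single lookup_single when_def)
next
  case (sum f g)
  then show ?case by (simp add: distrib_left lookup_add)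
qed

lemma single_eq_Const_Var:
  "Poly_Mapping.single \<alpha> c = Const c * (\<Prod>v\<in>Poly_Mapping.keys \<alpha>. Var v ^ Poly_Mapping.lookup \<alpha> v)"
proof -
  have "Poly_Mapping.single \<alpha> 1 = (\<Prod>v\<in>Poly_Mapping.keys \<alpha>. Var v ^ Poly_Mapping.lookup \<alpha> v :: 'a cpoly)"
  proof (induction \<alpha> rule: poly_mapping_induct)
    case (single v k)
    have "Poly_Mapping.single (Poly_Mapping.single v k) 1 = Var v ^ k"
    proof (induction k)
      case (Suc k)
      have "Var v ^ Suc k = Var v * Poly_Mapping.single (Poly_Mapping.single v k) 1"
        using Suc by simp
      also have "\<dots> = Poly_Mapping.single (Poly_Mapping.single v (Suc k)) 1"
        by (simp add: Var_def mult_single flip: single_add)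
      finally show ?case by simp
    qed (simp add:)
    then show ?case using mon_val_single[of Var v k] by (simp add: mon_val_def)
  next
    case (sum f g)
    have "Poly_Mapping.single (f + g) 1 = Poly_Mapping.single f 1 * Poly_Mapping.single g (1::complex)"
      by (simp add: mult_single)
    then show ?case using sum mon_val_add[of Var f g] by (simp add: mon_val_def)
  qed
  then show ?thesis
    by (simp add: Const_def mult_single flip: \<open>Poly_Mapping.single \<alpha> 1 = _\<close>)
qed

text \<open>Constants and variables generate the polynomial ring. Residues at a place, restrictions
  to curves and evaluation modulo an ideal are all compatible with sums and products, and so they
  are treated by this induction.\<close>

lemma cpoly_induct [case_names Const Var add mult]:
  assumes C: "\<And>c. R (Const c)" and V: "\<And>v. R (Var v)"
    and a: "\<And>P Q. R P \<Longrightarrow> R Q \<Longrightarrow> R (P + Q)" and t: "\<And>P Q. R P \<Longrightarrow> R Q \<Longrightarrow> R (P * Q)"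
  shows "R P"
proof (induction P rule: poly_mapping_induct)
  case (single \<alpha> c)
  have pow: "R (Var v ^ i)" for v i
    by (induction i) (use C[of 1] V t in auto)
  have "R (\<Prod>v\<in>A. Var v ^ Poly_Mapping.lookup \<alpha> v)" for A
    by (induction A rule: infinite_finite_induct) (use C[of 1] pow t in auto)
  then show ?case by (simp add: single_eq_Const_Var C t)
next
  case (sum f g)
  then show ?case by (simp add: a)
qed

interpretation Const: complex_algebra Const
  by standard (simp_all add: Const_add Const_mult)

interpretation ident: complex_algebra "\<lambda>c. c"
  by standard simp_all

context complex_algebra
begin

lemma cpoly_hom_subst:
  "cpoly_hom \<iota> \<phi> (cpoly_subst \<psi> P) = cpoly_hom \<iota> (\<lambda>v. cpoly_hom \<iota> \<phi> (\<psi> v)) P"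
  unfolding cpoly_subst_def
  by (induction P rule: cpoly_induct) (simp_all add: Const.cpoly_hom_add Const.cpoly_hom_mult cpoly_hom_add cpoly_hom_mult)

end

lemma cpoly_subst_simps [simp]:
  "cpoly_subst \<psi> 0 = 0" "cpoly_subst \<psi> 1 = 1" "cpoly_subst \<psi> (Const c) = Const c" "cpoly_subst \<psi> (Var v) = \<psi> v"
  "cpoly_subst \<psi> (P + Q) = cpoly_subst \<psi> P + cpoly_subst \<psi> Q"
  "cpoly_subst \<psi> (P * Q) = cpoly_subst \<psi> P * cpoly_subst \<psi> Q"
  "cpoly_subst \<psi> (sum f A) = (\<Sum>x\<in>A. cpoly_subst \<psi> (f x))"
  "cpoly_subst \<psi> (prod f A) = (\<Prod>x\<in>A. cpoly_subst \<psi> (f x))"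
  "cpoly_subst \<psi> (prod_list Ps) = prod_list (map (cpoly_subst \<psi>) Ps)"
  by (simp_all add: cpoly_subst_def Const.cpoly_hom_add Const.cpoly_hom_mult Const.cpoly_hom_sum Const.cpoly_hom_prod Const.cpoly_hom_prod_list)

lemma cpoly_subst_subst:
  "cpoly_subst \<phi> (cpoly_subst \<psi> P) = cpoly_subst (\<lambda>v. cpoly_subst \<phi> (\<psi> v)) P"
  using Const.cpoly_hom_subst[of \<phi> \<psi> P] by (simp add: cpoly_subst_def)

lemma section_at_simps [simp]:
  "section_at 0 F = 0" "section_at 1 F = 1" "section_at (Const c) F = c"
  "section_at (Var v) F = Poly_Mapping.lookup F v"
  "section_at (p + q) F = section_at p F + section_at q F"
  "section_at (p * q) F = section_at p F * section_at q F"
  "section_at (sum h A) F = (\<Sum>x\<in>A. section_at (h x) F)"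
  "section_at (prod h A) F = (\<Prod>x\<in>A. section_at (h x) F)"
  "section_at (prod_list ps) F = prod_list (map (\<lambda>p. section_at p F) ps)"
  unfolding section_at_def cpoly_eval_def
  by (rule ident.cpoly_hom_0 ident.cpoly_hom_1 ident.cpoly_hom_Const ident.cpoly_hom_Var ident.cpoly_hom_add
      ident.cpoly_hom_mult ident.cpoly_hom_sum ident.cpoly_hom_prod ident.cpoly_hom_prod_list)+

section \<open>Places\<close>

definition subalgebra :: "('z \<Rightarrow> complex) set \<Rightarrow> bool" where
  "subalgebra P \<longleftrightarrow> (\<forall>c. (\<lambda>_. c) \<in> P) \<and> (\<forall>f\<in>P. \<forall>g\<in>P. (\<lambda>z. f z + g z) \<in> P) \<and>
     (\<forall>f\<in>P. \<forall>g\<in>P. (\<lambda>z. f z * g z) \<in> P)"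

lemma subalgebraD:
  assumes "subalgebra P"
  shows "(\<lambda>_. c) \<in> P" "f \<in> P \<Longrightarrow> g \<in> P \<Longrightarrow> (\<lambda>z. f z + g z) \<in> P" "f \<in> P \<Longrightarrow> g \<in> P \<Longrightarrow> (\<lambda>z. f z * g z) \<in> P"
  using assms by (auto simp: subalgebra_def)

lemma subalgebra_diff:
  assumes "subalgebra P" "f \<in> P" "g \<in> P"
  shows "(\<lambda>z. f z - g z) \<in> P"
proof -
  have "(\<lambda>z. f z + (-1) * g z) \<in> P"
    using assms subalgebraD[OF assms(1)] by blast
  then show ?thesis by simp
qed

lemma subalgebra_sum:
  assumes "subalgebra P" "\<And>i. i \<in> A \<Longrightarrow> f i \<in> P"
  shows "(\<lambda>z. \<Sum>i\<in>A. f i z) \<in> P"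
  using assms(2)
  by (induction A rule: infinite_finite_induct) (auto intro: subalgebraD[OF assms(1)])

text \<open>The value at \<open>None\<close> is determined by the values at the points \<open>Some x\<close>:
  \<open>None\<close> plays the role of a point in the Zariski closure of the others.\<close>

definition adherent :: "('x option \<Rightarrow> complex) set \<Rightarrow> bool" where
  "adherent P \<longleftrightarrow> (\<forall>f\<in>P. (\<forall>x. f (Some x) = 0) \<longrightarrow> f None = 0)"

text \<open>These are the elements of \<open>P[X]\<close>, written pointwise; the uniform degree
  bound is what makes a family of polynomials a single polynomial with coefficients in
  \<open>P\<close>.\<close>

definition poly_family :: "('z \<Rightarrow> complex) set \<Rightarrow> ('z \<Rightarrow> complex poly) set" where
  "poly_family P = {Q. (\<forall>i. (\<lambda>z. coeff (Q z) i) \<in> P) \<and> (\<exists>n. \<forall>z. degree (Q z) \<le> n)}"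

lemma poly_family_const:
  assumes "subalgebra P" shows "(\<lambda>_. q) \<in> poly_family P"
  using assms by (auto simp: poly_family_def subalgebra_def)

lemma poly_family_pCons0:
  assumes "subalgebra P" "f \<in> P" shows "(\<lambda>z. [:f z:]) \<in> poly_family P"
proof -
  have "(\<lambda>z. coeff [:f z:] i) \<in> P" for i
    using assms by (cases i) (auto simp: subalgebra_def)
  then show ?thesis by (auto simp: poly_family_def)
qed

lemma poly_family_add:
  assumes "subalgebra P" "Q \<in> poly_family P" "R \<in> poly_family P"
  shows "(\<lambda>z. Q z + R z) \<in> poly_family P"
proof -
  from assms obtain n k where "\<And>z. degree (Q z) \<le> n" "\<And>z. degree (R z) \<le> k"
    by (auto simp: poly_family_def)
  then have "degree (Q z + R z) \<le> max n k" for z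
    by (meson degree_add_le_max max.mono order_trans)
  then show ?thesis using assms by (auto simp: poly_family_def intro: subalgebraD)
qed

lemma poly_family_mult:
  assumes "subalgebra P" "Q \<in> poly_family P" "R \<in> poly_family P"
  shows "(\<lambda>z. Q z * R z) \<in> poly_family P"
proof -
  from assms obtain n k where nk: "\<And>z. degree (Q z) \<le> n" "\<And>z. degree (R z) \<le> k"
    by (auto simp: poly_family_def)
  have "degree (Q z * R z) \<le> n + k" for z
    using degree_mult_le[of "Q z" "R z"] nk[of z] by linarith
  moreover have "(\<lambda>z. coeff (Q z * R z) i) \<in> P" for i
    unfolding coeff_mult using assms
    by (intro subalgebra_sum subalgebraD(3)) (auto simp: poly_family_def)
  ultimately show ?thesis by (auto simp: poly_family_def)
qed

definition adjoin :: "('z \<Rightarrow> complex) set \<Rightarrow> ('z \<Rightarrow> complex) \<Rightarrow> ('z \<Rightarrow> complex) set" where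
  "adjoin P y = {\<lambda>z. poly (Q z) (y z) | Q. Q \<in> poly_family P}"

lemma adjoin:
  assumes "subalgebra P"
  shows "subalgebra (adjoin P y)" "P \<subseteq> adjoin P y" "y \<in> adjoin P y"
proof -
  show "subalgebra (adjoin P y)"
    unfolding subalgebra_def
  proof (intro conjI allI ballI)
    fix c show "(\<lambda>_. c) \<in> adjoin P y"
      unfolding adjoin_def using poly_family_const[OF assms, of "[:c:]"] by force
  next
    fix f g assume "f \<in> adjoin P y" "g \<in> adjoin P y"
    then obtain Q R where QR: "f = (\<lambda>z. poly (Q z) (y z))" "g = (\<lambda>z. poly (R z) (y z))"
      "Q \<in> poly_family P" "R \<in> poly_family P"
      by (auto simp: adjoin_def)
    show "(\<lambda>z. f z + g z) \<in> adjoin P y"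
      unfolding adjoin_def using QR poly_family_add[OF assms QR(3,4)]
      by (auto intro!: exI[of _ "\<lambda>z. Q z + R z"])
    show "(\<lambda>z. f z * g z) \<in> adjoin P y"
      unfolding adjoin_def using QR poly_family_mult[OF assms QR(3,4)]
      by (auto intro!: exI[of _ "\<lambda>z. Q z * R z"])
  qed
  show "P \<subseteq> adjoin P y"
  proof
    fix f assume "f \<in> P"
    then show "f \<in> adjoin P y"
      unfolding adjoin_def using poly_family_pCons0[OF assms, of f]
      by (auto intro!: exI[of _ "\<lambda>z. [:f z:]"])
  qed
  show "y \<in> adjoin P y"
    unfolding adjoin_def using poly_family_const[OF assms, of "[:0, 1:]"]
    by (auto intro!: exI[of _ "\<lambda>_. [:0, 1:]"])
qed

text \<open>Reducing the algebraic relations of \<open>x\<close> over \<open>P\<close> at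
  \<open>None\<close> gives an ideal of complex polynomials. A value \<open>a\<close> can be given
  to \<open>x\<close> at \<open>None\<close> without destroying adherence exactly when
  \<open>a\<close> is a common root of this ideal.\<close>

definition relations :: "('x option \<Rightarrow> complex) set \<Rightarrow> ('x \<Rightarrow> complex) \<Rightarrow> complex poly set" where
  "relations P x = {Q None | Q. Q \<in> poly_family P \<and> (\<forall>a. poly (Q (Some a)) (x a) = 0)}"

text \<open>The Nullstellensatz in one variable. If a non-zero element \<open>q\<close> of least
  degree had a root \<open>a\<close>, then an element \<open>p\<close> that does not vanish at
  \<open>a\<close> would leave a remainder modulo \<open>q\<close> that does not vanish there either
  and has smaller degree. So \<open>q\<close> is a constant.\<close>

lemma ideal_without_root_contains_1:
  fixes J :: "complex poly set"
  assumes add: "\<And>p q. p \<in> J \<Longrightarrow> q \<in> J \<Longrightarrow> p + q \<in> J"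
    and mult: "\<And>p q. q \<in> J \<Longrightarrow> p * q \<in> J"
    and root: "\<And>a. \<exists>q\<in>J. poly q a \<noteq> 0"
  shows "1 \<in> J"
proof -
  obtain q1 where "q1 \<in> J" "q1 \<noteq> 0" using root[of 0] by (metis poly_0)
  then obtain q where q: "q \<in> J" "q \<noteq> 0" and min: "\<And>p. p \<in> J \<Longrightarrow> p \<noteq> 0 \<Longrightarrow> degree q \<le> degree p"
    using ex_has_least_nat[of "\<lambda>p. p \<in> J \<and> p \<noteq> 0" q1 degree] by blast
  show ?thesis
  proof (cases "degree q = 0")
    case True
    then obtain c where "q = [:c:]" by (meson degree_eq_zeroE)
    with q have "[:1 / c:] * q = 1" by (auto simp: one_pCons)
    then show ?thesis using mult[OF q(1), of "[:1 / c:]"] by simp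
  next
    case False
    then obtain a where a: "poly q a = 0"
      using fundamental_theorem_of_algebra constant_degree by metis
    obtain p where p: "p \<in> J" "poly p a \<noteq> 0" using root by blast
    have "p mod q = p + (- (p div q)) * q" by (simp add: minus_div_mult_eq_mod)
    then have "p mod q \<in> J" by (simp only: add[OF p(1) mult[OF q(1)]])
    moreover have "poly (p mod q) a = poly p a"
      using a by (simp add: \<open>p mod q = _\<close>)
    with p have "p mod q \<noteq> 0" by auto
    ultimately show ?thesis
      using min[of "p mod q"] degree_mod_less[OF q(2), of p] by linarith
  qed
qed

text \<open>If \<open>a\<close> is a common root of the reduced relations, then adjoining
  \<open>x\<close> with the value \<open>a\<close> at \<open>None\<close> keeps the ring adherent,
  and by maximality nothing new was adjoined.\<close>

lemma relations_proper_imp_mem: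
  assumes P: "subalgebra P" "adherent P"
    and max: "\<And>P'. subalgebra P' \<Longrightarrow> adherent P' \<Longrightarrow> P \<subseteq> P' \<Longrightarrow> P' = P"
    and root: "\<And>q. q \<in> relations P x \<Longrightarrow> poly q a = 0"
  shows "case_option a x \<in> P"
proof -
  let ?y = "case_option a x"
  have "adherent (adjoin P ?y)"
    unfolding adherent_def
  proof (intro ballI impI)
    fix f assume "f \<in> adjoin P ?y" and 0: "\<forall>x. f (Some x) = 0"
    then obtain Q where Q: "f = (\<lambda>z. poly (Q z) (?y z))" "Q \<in> poly_family P"
      by (auto simp: adjoin_def)
    with 0 have "Q None \<in> relations P x" by (auto simp: relations_def)
    then show "f None = 0" using root Q by simp
  qed
  then have "adjoin P ?y = P" using adjoin[OF P(1)] max by blast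
  then show ?thesis using adjoin(3)[OF P(1)] by blast
qed

lemma relations_improper:
  assumes P: "subalgebra P" "adherent P"
    and max: "\<And>P'. subalgebra P' \<Longrightarrow> adherent P' \<Longrightarrow> P \<subseteq> P' \<Longrightarrow> P' = P"
    and no: "\<And>a. case_option a x \<notin> P"
  shows "1 \<in> relations P x"
proof (rule ideal_without_root_contains_1)
  fix p q assume "p \<in> relations P x" "q \<in> relations P x"
  then show "p + q \<in> relations P x"
    unfolding relations_def using poly_family_add[OF P(1)] by fastforce
next
  fix p q assume "q \<in> relations P x"
  then show "p * q \<in> relations P x"
    unfolding relations_def using poly_family_mult[OF P(1) poly_family_const[OF P(1)], of _ p] by fastforce
next
  fix a show "\<exists>q\<in>relations P x. poly q a \<noteq> 0"
    using relations_proper_imp_mem[OF P max] no by blast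
qed

lemma poly_sum_le:
  fixes p :: "complex poly"
  assumes "degree p \<le> n" shows "poly p x = (\<Sum>i\<le>n. coeff p i * x ^ i)"
proof -
  have "poly p x = (\<Sum>i\<le>degree p. coeff p i * x ^ i)" by (rule poly_altdef)
  also have "\<dots> = (\<Sum>i\<le>n. coeff p i * x ^ i)"
    by (rule sum.mono_neutral_left) (use assms in \<open>auto simp: coeff_eq_0\<close>)
  finally show ?thesis .
qed

lemma coeff_reversal:
  "coeff (\<Sum>j\<le>d. monom (c j) (d - j)) i = (if i \<le> d then c (d - i) else (0::'a::comm_ring_1))"
proof -
  have "coeff (\<Sum>j\<le>d. monom (c j) (d - j)) i = (\<Sum>j\<le>d. if j = d - i \<and> i \<le> d then c j else 0)"
    unfolding coeff_sum by (intro sum.cong) auto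
  also have "\<dots> = (if i \<le> d then c (d - i) else 0)" by (auto simp: sum.delta)
  finally show ?thesis .
qed

text \<open>This is the classical proof that maximal places are valuation rings: relations
  \<open>1 \<in> \<mm>[x]\<close> and \<open>1 \<in> \<mm>[1/x]\<close> of minimal degrees shorten each other. Zeros of \<open>x\<close> are harmless
  since the constant coefficient of a relation vanishes there.\<close>

lemma not_both_improper:
  assumes P: "subalgebra P" "adherent P"
    and "Q \<in> poly_family P" "\<And>z. degree (Q z) \<le> n" "\<And>a. poly (Q (Some a)) (x a) = 0" "Q None = 1"
    and "R \<in> poly_family P" "\<And>z. degree (R z) \<le> k" "\<And>a. poly (R (Some a)) (inverse (x a)) = 0" "R None = 1"
  shows False
  using assms(3-)
proof (induction "n + k" arbitrary: n k x Q R rule: less_induct)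
  case less
  \<comment> \<open>In degree 0 the relation says that an element of \<open>P\<close> vanishes at
    all points \<open>Some a\<close>. Adherence makes it vanish at \<open>None\<close> too, where it
    should be 1.\<close>
  have zero: "\<exists>a. poly (Q (Some a)) (x a) \<noteq> 0"
    if "Q \<in> poly_family P" "\<And>z. degree (Q z) \<le> 0" "Q None = 1" for Q and x :: "'a \<Rightarrow> complex"
  proof (rule ccontr)
    assume "\<not> ?thesis"
    moreover have "Q z = [:coeff (Q z) 0:]" for z
      using that(2)[of z] by (metis degree_eq_zeroE coeff_pCons_0 le_zero_eq)
    ultimately have "coeff (Q (Some a)) 0 = 0" for a
      by (metis mult_zero_right pCons_0_0 poly_pCons poly_0 add_cancel_right_right)
    moreover have "(\<lambda>z. coeff (Q z) 0) \<in> P" using that(1) by (simp add: poly_family_def)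
    ultimately have "coeff (Q None) 0 = 0" using P(2) unfolding adherent_def by fastforce
    then show False using that(3) by simp
  qed
  have reduce: "\<exists>Q'\<in>poly_family P. (\<forall>z. degree (Q' z) \<le> n - 1) \<and> (\<forall>a. poly (Q' (Some a)) (x a) = 0) \<and> Q' None = 1"
    if Q: "Q \<in> poly_family P" "\<And>z. degree (Q z) \<le> n" "\<And>a. poly (Q (Some a)) (x a) = 0" "Q None = 1"
      and R: "R \<in> poly_family P" "\<And>z. degree (R z) \<le> k" "\<And>a. poly (R (Some a)) (inverse (x a)) = 0" "R None = 1"
      and nk: "k \<le> n" "0 < n" for Q R n k and x :: "'a \<Rightarrow> complex"
  proof -
    \<comment> \<open>\<open>S\<close> is the reversal \<open>X^k R(1/X)\<close>, which vanishes at
      \<open>x\<close> wherever \<open>x\<close> is not 0. The factors \<open>u\<close> and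
      \<open>v\<close> cancel the coefficient of degree \<open>n\<close> in \<open>Q'\<close>. Both
      contain the constant coefficient of \<open>Q\<close>, which vanishes at the zeros of
      \<open>x\<close>, where nothing is known about \<open>S\<close>. At \<open>None\<close> they
      are 1 and 0, because there \<open>Q\<close> and \<open>R\<close> are 1 and
      \<open>n > 0\<close>.\<close>
    define S where "S z = (\<Sum>j\<le>k. monom (coeff (R z) j) (k - j))" for z
    define u where "u z = coeff (R z) 0 * coeff (Q z) 0" for z
    define v where "v z = - (coeff (Q z) n * coeff (Q z) 0)" for z
    define Q' where "Q' z = smult (u z) (Q z) + smult (v z) (monom 1 (n - k) * S z)" for z
    have coeffs: "(\<lambda>z. coeff (Q z) i) \<in> P" "(\<lambda>z. coeff (R z) i) \<in> P" for i
      using Q R by (auto simp: poly_family_def)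
    have cS: "coeff (S z) i = (if i \<le> k then coeff (R z) (k - i) else 0)" for z i
      unfolding S_def by (rule coeff_reversal)
    have "S \<in> poly_family P"
    proof -
      have "(\<lambda>z. coeff (S z) i) \<in> P" for i
        unfolding cS using coeffs(2)[of "k - i"] subalgebraD(1)[OF P(1), of 0] by (cases "i \<le> k") auto
      moreover have "degree (S z) \<le> k" for z
        by (rule degree_le) (simp add: cS)
      ultimately show ?thesis by (auto simp: poly_family_def)
    qed
    moreover have "u \<in> P" unfolding u_def by (intro subalgebraD[OF P(1)] coeffs)
    moreover have "v \<in> P"
      using subalgebra_diff[OF P(1) subalgebraD(1)[OF P(1), of 0] subalgebraD(3)[OF P(1) coeffs(1)[of n] coeffs(1)[of 0]]]
      by (simp add: v_def[abs_def])
    ultimately have "(\<lambda>z. [:u z:] * Q z + [:v z:] * (monom 1 (n - k) * S z)) \<in> poly_family P"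
      using Q(1) poly_family_const[OF P(1), of "monom 1 (n - k)"]
      by (intro poly_family_add poly_family_mult poly_family_pCons0 P(1))
    then have fam: "Q' \<in> poly_family P" by (simp add: Q'_def[abs_def])
    have "degree (Q' z) \<le> n - 1" for z
    proof (rule degree_le, intro allI impI)
      fix i assume "n - 1 < i"
      then consider "i = n" | "i > n" by linarith
      then show "coeff (Q' z) i = 0"
      proof cases
        case 1
        then show ?thesis
          using nk by (simp add: Q'_def coeff_monom_mult cS u_def v_def)
      next
        case 2
        then have "coeff (Q z) i = 0" using Q(2)[of z] by (auto intro: coeff_eq_0)
        moreover have "\<not> i - (n - k) \<le> k" using 2 nk by linarith
        ultimately show ?thesis
          by (simp add: Q'_def coeff_monom_mult cS)
      qed
    qed
    moreover have "poly (Q' (Some a)) (x a) = 0" for a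
    proof (cases "x a = 0")
      case True
      then have "coeff (Q (Some a)) 0 = 0" using Q(3)[of a] by (simp add: poly_0_coeff_0)
      then show ?thesis by (simp add: Q'_def u_def v_def)
    next
      case False
      have "poly (S (Some a)) (x a) = (\<Sum>j\<le>k. coeff (R (Some a)) j * x a ^ (k - j))"
        by (simp add: S_def poly_sum poly_monom)
      also have "\<dots> = x a ^ k * (\<Sum>j\<le>k. coeff (R (Some a)) j * inverse (x a) ^ j)"
        unfolding sum_distrib_left
        by (intro sum.cong refl) (use False in \<open>simp add: power_diff field_simps\<close>)
      also have "(\<Sum>j\<le>k. coeff (R (Some a)) j * inverse (x a) ^ j) = poly (R (Some a)) (inverse (x a))"
        by (rule poly_sum_le[OF R(2), symmetric])
      finally show ?thesis using Q(3)[of a] R(3)[of a] by (simp add: Q'_def)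
    qed
    moreover have "Q' None = 1"
    proof -
      have "u None = 1" "v None = 0" using Q(4) R(4) nk by (simp_all add: u_def v_def)
      then show ?thesis using Q(4) by (simp add: Q'_def)
    qed
    ultimately show ?thesis using fam by blast
  qed
  show False
  proof (cases "n = 0 \<or> k = 0")
    case True
    then show False
      using zero[of Q x] zero[of R "\<lambda>a. inverse (x a)"] less.prems by fastforce
  next
    case False
    show False
    proof (cases "k \<le> n")
      case True
      then obtain Q' where Q': "Q' \<in> poly_family P" "\<And>z. degree (Q' z) \<le> n - 1"
        "\<And>a. poly (Q' (Some a)) (x a) = 0" "Q' None = 1"
        using reduce[of Q n x R k] less.prems False by auto
      show False by (rule less.hyps[OF _ Q' less.prems(5-8)]) (use False in auto)
    next
      case kn: False
      then obtain R' where R': "R' \<in> poly_family P" "\<And>z. degree (R' z) \<le> k - 1"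
        "\<And>a. poly (R' (Some a)) (inverse (x a)) = 0" "R' None = 1"
        using reduce[of R k "\<lambda>a. inverse (x a)" Q n] less.prems False by auto
      show False by (rule less.hyps[OF _ less.prems(1-4) R']) (use False in auto)
    qed
  qed
qed

lemma poly_family_None_1:
  assumes "1 \<in> relations P x"
  obtains Q n where "Q \<in> poly_family P" "\<And>z. degree (Q z) \<le> n" "\<And>a. poly (Q (Some a)) (x a) = 0" "Q None = 1"
proof -
  obtain Q where Q: "Q \<in> poly_family P" "\<forall>a. poly (Q (Some a)) (x a) = 0" "Q None = 1"
    using assms by (auto simp: relations_def)
  moreover from Q(1) obtain n where "\<forall>z. degree (Q z) \<le> n" by (auto simp: poly_family_def)
  ultimately show ?thesis using that by blast
qed

text \<open>If \<open>x\<close> has no value at \<open>None\<close>, its reduced relations contain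
  1. If \<open>1/x\<close> had no value either, both kinds of improper relations would exist, which
  is impossible. If \<open>1/x\<close> has a value \<open>b\<close>, then the relation of
  \<open>x\<close>, rewritten in \<open>1/x\<close>, forces \<open>b = 0\<close>.\<close>

lemma maximal_dichotomy:
  assumes P: "subalgebra P" "adherent P"
    and max: "\<And>P'. subalgebra P' \<Longrightarrow> adherent P' \<Longrightarrow> P \<subseteq> P' \<Longrightarrow> P' = P"
  shows "(\<exists>a. case_option a x \<in> P) \<or> case_option 0 (\<lambda>t. inverse (x t)) \<in> P"
proof (rule ccontr)
  assume contr: "\<not> ?thesis"
  then have no: "\<And>a. case_option a x \<notin> P" by auto
  then have x: "1 \<in> relations P x" using relations_improper[OF P max] by blast
  show False
  proof (cases "\<exists>b. case_option b (\<lambda>t. inverse (x t)) \<in> P")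
    case False
    then have y: "1 \<in> relations P (\<lambda>t. inverse (x t))" using relations_improper[OF P max] by blast
    obtain Q n where Q: "Q \<in> poly_family P" "\<And>z. degree (Q z) \<le> n" "\<And>a. poly (Q (Some a)) (x a) = 0" "Q None = 1"
      using poly_family_None_1[OF x] by metis
    obtain R k where R: "R \<in> poly_family P" "\<And>z. degree (R z) \<le> k"
      "\<And>a. poly (R (Some a)) (inverse (x a)) = 0" "R None = 1"
      using poly_family_None_1[OF y] by metis
    show False by (rule not_both_improper[OF P Q R])
  next
    case True
    then obtain b where b: "case_option b (\<lambda>t. inverse (x t)) \<in> P" (is "?y \<in> P") by blast
    with contr have "b \<noteq> 0" by auto
    obtain Q n where Q: "Q \<in> poly_family P" "\<And>z. degree (Q z) \<le> n" "\<And>a. poly (Q (Some a)) (x a) = 0" "Q None = 1"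
      using poly_family_None_1[OF x] by metis
    \<comment> \<open>The relation of \<open>x\<close> is multiplied by
      \<open>inverse (x a) ^ (n + 1)\<close>. The exponent \<open>n + 1\<close> instead of
      \<open>n\<close> leaves a factor \<open>?y\<close> in every term, so that \<open>f\<close>
      also vanishes at the zeros of \<open>x\<close>. At \<open>None\<close> only the term with
      \<open>i = 0\<close> survives.\<close>
    define f where "f z = (\<Sum>i\<le>n. coeff (Q z) i * ?y z ^ (n - i + 1))" for z
    have pow: "(\<lambda>z. ?y z ^ i) \<in> P" for i
      by (induction i) (use subalgebraD[OF P(1)] b in auto)
    have "(\<lambda>z. coeff (Q z) i) \<in> P" for i using Q(1) by (auto simp: poly_family_def)
    from subalgebraD(3)[OF P(1) this pow] have "f \<in> P"
      unfolding f_def[abs_def] by (rule subalgebra_sum[OF P(1)])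
    moreover have "f (Some a) = 0" for a
    proof (cases "x a = 0")
      case False
      have "f (Some a) = (\<Sum>i\<le>n. coeff (Q (Some a)) i * x a ^ i) * inverse (x a) ^ (n + 1)"
        unfolding f_def sum_distrib_right
      proof (intro sum.cong refl)
        fix i assume "i \<in> {..n}"
        then have "inverse (x a) ^ (n + 1) = inverse (x a) ^ i * inverse (x a) ^ (n - i + 1)"
          by (simp flip: power_add)
        moreover have "x a ^ i * inverse (x a) ^ i = 1"
          using False by (simp flip: power_mult_distrib)
        ultimately show "coeff (Q (Some a)) i * ?y (Some a) ^ (n - i + 1)
            = coeff (Q (Some a)) i * x a ^ i * inverse (x a) ^ (n + 1)"
          by (simp only: option.case mult.assoc) (metis mult.assoc mult_1)
      qed
      also have "(\<Sum>i\<le>n. coeff (Q (Some a)) i * x a ^ i) = 0"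
        using Q(3)[of a] poly_sum_le[OF Q(2), of "Some a" "x a"] by simp
      finally show ?thesis by simp
    qed (simp add: f_def)
    ultimately have "f None = 0" using P(2) by (auto simp: adherent_def)
    moreover have "f None = b ^ (n + 1)"
    proof -
      have "f None = (\<Sum>i\<le>n. if i = 0 then b ^ (n + 1) else 0)"
        unfolding f_def Q(4) by (intro sum.cong) auto
      then show ?thesis by simp
    qed
    ultimately show False using \<open>b \<noteq> 0\<close> by simp
  qed
qed

text \<open>Adherence is a condition on single functions and so passes to unions of chains, which
  makes Zorn's lemma applicable.\<close>

lemma maximal_adherent_exists:
  assumes "subalgebra P0" "adherent P0"
  obtains P where "P0 \<subseteq> P" "subalgebra P" "adherent P"
    "\<And>P'. subalgebra P' \<Longrightarrow> adherent P' \<Longrightarrow> P \<subseteq> P' \<Longrightarrow> P' = P"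
proof -
  let ?A = "{P. P0 \<subseteq> P \<and> subalgebra P \<and> adherent P}"
  have "\<exists>M\<in>?A. \<forall>X\<in>?A. M \<subseteq> X \<longrightarrow> X = M"
  proof (rule subset_Zorn_nonempty)
    show "?A \<noteq> {}" using assms by blast
    fix C assume C: "C \<noteq> {}" "subset.chain ?A C"
    then have sub: "C \<subseteq> ?A" and ch: "\<And>X Y. X \<in> C \<Longrightarrow> Y \<in> C \<Longrightarrow> X \<subseteq> Y \<or> Y \<subseteq> X"
      by (auto simp: subset_chain_def)
    have two: "\<exists>X\<in>C. f \<in> X \<and> g \<in> X" if "f \<in> \<Union>C" "g \<in> \<Union>C" for f g
      using that ch by blast
    have "subalgebra (\<Union>C)"
      unfolding subalgebra_def
    proof (intro conjI allI ballI)
      fix c show "(\<lambda>_. c) \<in> \<Union>C" using C(1) sub subalgebraD(1) by fastforce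
    next
      fix f g assume "f \<in> \<Union>C" "g \<in> \<Union>C"
      then obtain X where "X \<in> C" "f \<in> X" "g \<in> X" using two by blast
      then show "(\<lambda>z. f z + g z) \<in> \<Union>C" "(\<lambda>z. f z * g z) \<in> \<Union>C" using sub subalgebraD by blast+
    qed
    moreover have "adherent (\<Union>C)" using sub by (auto simp: adherent_def)
    moreover have "P0 \<subseteq> \<Union>C" using C(1) sub by blast
    ultimately show "\<Union>C \<in> ?A" by blast
  qed
  then obtain M where M: "P0 \<subseteq> M" "subalgebra M" "adherent M"
    and max: "\<And>X. P0 \<subseteq> X \<Longrightarrow> subalgebra X \<Longrightarrow> adherent X \<Longrightarrow> M \<subseteq> X \<Longrightarrow> X = M"
    by auto
  show ?thesis
    by (rule that[OF M]) (rule max, use M in auto)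
qed

text \<open>The elements of \<open>B\<close> are functions and not elements of a field, so there are
  non-zero functions with zeros; the convention \<open>inverse 0 = 0\<close> gives the dichotomy a
  meaning for them. The residue field is the field of complex numbers itself.\<close>

locale place =
  fixes B :: "('x \<Rightarrow> complex) set" and \<phi> :: "('x \<Rightarrow> complex) \<Rightarrow> complex"
  assumes const [simp]: "(\<lambda>_. c) \<in> B" "\<phi> (\<lambda>_. c) = c"
    and add: "f \<in> B \<Longrightarrow> g \<in> B \<Longrightarrow> (\<lambda>x. f x + g x) \<in> B"
      "f \<in> B \<Longrightarrow> g \<in> B \<Longrightarrow> \<phi> (\<lambda>x. f x + g x) = \<phi> f + \<phi> g"
    and mult: "f \<in> B \<Longrightarrow> g \<in> B \<Longrightarrow> (\<lambda>x. f x * g x) \<in> B"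
      "f \<in> B \<Longrightarrow> g \<in> B \<Longrightarrow> \<phi> (\<lambda>x. f x * g x) = \<phi> f * \<phi> g"
    and dichotomy: "f \<in> B \<or> (\<lambda>x. inverse (f x)) \<in> B \<and> \<phi> (\<lambda>x. inverse (f x)) = 0"

text \<open>\<open>B\<close> consists of the functions that have a value at \<open>None\<close> in a
  maximal adherent extension \<open>P\<close> of \<open>P0\<close>. Adherence makes this value
  unique, and maximality yields the dichotomy.\<close>

theorem place_exists:
  assumes "subalgebra P0" "adherent P0"
  obtains B \<phi> where "place B \<phi>" "\<And>f. f \<in> P0 \<Longrightarrow> (\<lambda>x. f (Some x)) \<in> B \<and> \<phi> (\<lambda>x. f (Some x)) = f None"
proof -
  obtain P where P: "P0 \<subseteq> P" "subalgebra P" "adherent P"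
    and max: "\<And>P'. subalgebra P' \<Longrightarrow> adherent P' \<Longrightarrow> P \<subseteq> P' \<Longrightarrow> P' = P"
    using maximal_adherent_exists[OF assms] by metis
  define B where "B = {f. \<exists>a. case_option a f \<in> P}"
  define \<phi> where "\<phi> f = (THE a. case_option a f \<in> P)" for f
  have uniq: "a = b" if "case_option a f \<in> P" "case_option b f \<in> P" for a b and f
    using subalgebra_diff[OF P(2) that] P(3) unfolding adherent_def by force
  have \<phi>: "f \<in> B" "\<phi> f = a" if "case_option a f \<in> P" for a f
    unfolding B_def \<phi>_def using that uniq by blast+
  have B: "case_option (\<phi> f) f \<in> P" if "f \<in> B" for f
    using that \<phi>(2) unfolding B_def by blast
  have norm: "case_option (h None) (\<lambda>x. h (Some x)) = h" for h :: "'a option \<Rightarrow> complex"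
    by (auto simp: fun_eq_iff split: option.split)
  have mem: "(\<lambda>x. h (Some x)) \<in> B" "\<phi> (\<lambda>x. h (Some x)) = h None" if "h \<in> P" for h
    using \<phi>[of "h None" "\<lambda>x. h (Some x)"] that norm[of h] by auto
  have "place B \<phi>"
  proof
    fix c :: complex
    show "(\<lambda>_. c) \<in> B" "\<phi> (\<lambda>_. c) = c"
      using mem[OF subalgebraD(1)[OF P(2), of c]] by auto
  next
    fix f g assume "f \<in> B" "g \<in> B"
    then have fg: "case_option (\<phi> f) f \<in> P" "case_option (\<phi> g) g \<in> P" using B by auto
    show "(\<lambda>x. f x + g x) \<in> B" "\<phi> (\<lambda>x. f x + g x) = \<phi> f + \<phi> g"
      using mem[OF subalgebraD(2)[OF P(2) fg]] by auto
    show "(\<lambda>x. f x * g x) \<in> B" "\<phi> (\<lambda>x. f x * g x) = \<phi> f * \<phi> g"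
      using mem[OF subalgebraD(3)[OF P(2) fg]] by auto
  next
    fix f :: "'a \<Rightarrow> complex"
    show "f \<in> B \<or> (\<lambda>x. inverse (f x)) \<in> B \<and> \<phi> (\<lambda>x. inverse (f x)) = 0"
      using maximal_dichotomy[OF P(2,3) max, of f] \<phi> by blast
  qed
  then show ?thesis using that mem P(1) by blast
qed

section \<open>Almost everywhere, units and divisibility at a place\<close>

context place
begin

definition infinitesimal :: "('x \<Rightarrow> complex) \<Rightarrow> bool" where
  "infinitesimal f \<longleftrightarrow> f \<in> B \<and> \<phi> f = 0"

text \<open>An indicator function equals its own inverse, hence lies in \<open>B\<close>, and being
  idempotent it has residue 0 or 1. The sets of residue 1 form an ultrafilter, and neither
  membership in \<open>B\<close> nor \<phi> is affected by changes outside such a set.\<close>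

definition ae :: "('x \<Rightarrow> bool) \<Rightarrow> bool" where
  "ae Q \<longleftrightarrow> \<phi> (\<lambda>x. if Q x then 1 else 0) = 1"

lemma uminus: "f \<in> B \<Longrightarrow> (\<lambda>x. - f x) \<in> B" "f \<in> B \<Longrightarrow> \<phi> (\<lambda>x. - f x) = - \<phi> f"
  using mult[of "\<lambda>_. -1" f] by auto

lemma diff: "f \<in> B \<Longrightarrow> g \<in> B \<Longrightarrow> (\<lambda>x. f x - g x) \<in> B"
  "f \<in> B \<Longrightarrow> g \<in> B \<Longrightarrow> \<phi> (\<lambda>x. f x - g x) = \<phi> f - \<phi> g"
  using add[OF _ uminus(1), of f g] uminus(2)[of g] by auto

lemma sum:
  assumes "\<And>i. i \<in> A \<Longrightarrow> f i \<in> B"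
  shows "(\<lambda>x. \<Sum>i\<in>A. f i x) \<in> B" "\<phi> (\<lambda>x. \<Sum>i\<in>A. f i x) = (\<Sum>i\<in>A. \<phi> (f i))"
  using assms by (induction A rule: infinite_finite_induct) (auto simp: add)

lemma prod:
  assumes "\<And>i. i \<in> A \<Longrightarrow> f i \<in> B"
  shows "(\<lambda>x. \<Prod>i\<in>A. f i x) \<in> B" "\<phi> (\<lambda>x. \<Prod>i\<in>A. f i x) = (\<Prod>i\<in>A. \<phi> (f i))"
  using assms by (induction A rule: infinite_finite_induct) (auto simp: mult)

lemma power: "f \<in> B \<Longrightarrow> (\<lambda>x. f x ^ i) \<in> B" "f \<in> B \<Longrightarrow> \<phi> (\<lambda>x. f x ^ i) = \<phi> f ^ i"
  using prod[of "{..<i}" "\<lambda>_. f"] by auto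

lemma indicator_mem [simp]: "(\<lambda>x. if Q x then 1 else 0) \<in> B"
proof -
  have "(\<lambda>x. inverse (if Q x then 1 else 0 :: complex)) = (\<lambda>x. if Q x then 1 else 0)" by auto
  then show ?thesis using dichotomy[of "\<lambda>x. if Q x then 1 else 0"] by metis
qed

lemma indicator_cases: "ae Q \<or> \<phi> (\<lambda>x. if Q x then 1 else 0) = 0"
proof -
  have "(\<lambda>x. (if Q x then 1 else 0) * (if Q x then 1 else 0 :: complex)) = (\<lambda>x. if Q x then 1 else 0)" by auto
  then have "\<phi> (\<lambda>x. if Q x then 1 else 0) * \<phi> (\<lambda>x. if Q x then 1 else 0) = \<phi> (\<lambda>x. if Q x then 1 else 0)"
    using mult(2)[of "\<lambda>x. if Q x then 1 else 0" "\<lambda>x. if Q x then 1 else 0"] by simp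
  then show ?thesis by (simp only: mult_cancel_right2 ae_def) blast
qed

lemma ae_not: "ae (\<lambda>x. \<not> Q x) \<longleftrightarrow> \<not> ae Q"
proof -
  have "(\<lambda>x. (if Q x then 1 else 0) + (if \<not> Q x then 1 else 0 :: complex)) = (\<lambda>_. 1)" by auto
  then have "\<phi> (\<lambda>x. if Q x then 1 else 0) + \<phi> (\<lambda>x. if \<not> Q x then 1 else 0) = 1"
    using add(2)[of "\<lambda>x. if Q x then 1 else 0" "\<lambda>x. if \<not> Q x then 1 else 0"] by simp
  then show ?thesis using indicator_cases[of Q] by (auto simp: ae_def)
qed

lemma ae_conj: "ae (\<lambda>x. Q x \<and> R x) \<longleftrightarrow> ae Q \<and> ae R"
proof -
  have "(\<lambda>x. (if Q x then 1 else 0) * (if R x then 1 else 0 :: complex)) = (\<lambda>x. if Q x \<and> R x then 1 else 0)" by auto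
  then have "\<phi> (\<lambda>x. if Q x \<and> R x then 1 else 0) = \<phi> (\<lambda>x. if Q x then 1 else 0) * \<phi> (\<lambda>x. if R x then 1 else 0)"
    using mult(2)[of "\<lambda>x. if Q x then 1 else 0" "\<lambda>x. if R x then 1 else 0"] by simp
  then show ?thesis using indicator_cases[of Q] indicator_cases[of R] by (auto simp: ae_def)
qed

lemma ae_True [simp]: "ae (\<lambda>_. True)"
  by (simp add: ae_def)

lemma ae_mp: "ae Q \<Longrightarrow> (\<And>x. Q x \<Longrightarrow> R x) \<Longrightarrow> ae R"
proof -
  assume "ae Q" and QR: "\<And>x. Q x \<Longrightarrow> R x"
  have "(\<lambda>x. Q x \<and> R x) = Q" using QR by auto
  then show "ae R" using ae_conj[of Q R] \<open>ae Q\<close> by simp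
qed

lemma ae_elim2: "ae Q \<Longrightarrow> ae R \<Longrightarrow> (\<And>x. Q x \<Longrightarrow> R x \<Longrightarrow> S x) \<Longrightarrow> ae S"
  using ae_conj[of Q R] ae_mp[of "\<lambda>x. Q x \<and> R x" S] by blast

lemma ae_ball:
  assumes "finite A" "\<And>i. i \<in> A \<Longrightarrow> ae (Q i)" shows "ae (\<lambda>x. \<forall>i\<in>A. Q i x)"
  using assms
proof (induction A)
  case (insert i A)
  then have "ae (Q i)" "ae (\<lambda>x. \<forall>i\<in>A. Q i x)" by auto
  then show ?case by (rule ae_elim2) auto
qed simp

text \<open>If \<open>f\<close> were not in \<open>B\<close>, then neither would be
  \<open>f + 1\<close>, so \<open>1 / (f + 1)\<close> would have residue 0. But this function is 1
  where \<open>f\<close> vanishes, so multiplying it by the indicator of that set would give the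
  indicator the residue 0.\<close>

lemma ae_zero:
  assumes "ae (\<lambda>x. f x = 0)"
  shows "f \<in> B" "\<phi> f = 0"
proof -
  let ?e = "\<lambda>x. if f x = 0 then 1 else 0 :: complex"
  show "f \<in> B"
  proof (rule ccontr)
    assume "f \<notin> B"
    have "(\<lambda>x. f x + 1) \<notin> B"
    proof
      assume "(\<lambda>x. f x + 1) \<in> B"
      from diff(1)[OF this, of "\<lambda>_. 1"] \<open>f \<notin> B\<close> show False by simp
    qed
    then have i: "(\<lambda>x. inverse (f x + 1)) \<in> B" "\<phi> (\<lambda>x. inverse (f x + 1)) = 0"
      using dichotomy[of "\<lambda>x. f x + 1"] by auto
    have "(\<lambda>x. inverse (f x + 1) * ?e x) = ?e" by auto
    then have "\<phi> ?e = 0" using mult(2)[OF i(1) indicator_mem, of "\<lambda>x. f x = 0"] i(2) by simp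
    with assms show False by (simp add: ae_def)
  qed
  then have "\<phi> (\<lambda>x. f x * ?e x) = \<phi> f * \<phi> ?e" by (intro mult) auto
  moreover have "(\<lambda>x. f x * ?e x) = (\<lambda>_. 0)" by auto
  ultimately show "\<phi> f = 0" using assms by (simp add: ae_def)
qed

lemma ae_cong:
  assumes "ae (\<lambda>x. f x = g x)" "g \<in> B"
  shows "f \<in> B" "\<phi> f = \<phi> g"
proof -
  have "ae (\<lambda>x. f x - g x = 0)" using assms(1) by simp
  from ae_zero[OF this] add[OF _ assms(2), of "\<lambda>x. f x - g x"]
  show "f \<in> B" "\<phi> f = \<phi> g" by auto
qed

lemma unit_ae_nonzero:
  assumes "f \<in> B" "\<phi> f \<noteq> 0" shows "ae (\<lambda>x. f x \<noteq> 0)"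
  using assms ae_not[of "\<lambda>x. f x = 0"] ae_zero(2)[of f] by auto

lemma unit_inverse:
  assumes "f \<in> B" "\<phi> f \<noteq> 0"
  shows "(\<lambda>x. inverse (f x)) \<in> B" "\<phi> (\<lambda>x. inverse (f x)) = inverse (\<phi> f)"
proof -
  show *: "(\<lambda>x. inverse (f x)) \<in> B"
    using dichotomy[of "\<lambda>x. inverse (f x)"] assms(2) by auto
  have "\<phi> (\<lambda>x. f x * inverse (f x)) = \<phi> (\<lambda>_. 1)"
    by (rule ae_cong) (use ae_mp[OF unit_ae_nonzero[OF assms]] in auto)
  then show "\<phi> (\<lambda>x. inverse (f x)) = inverse (\<phi> f)"
    using mult(2)[OF assms(1) *] assms(2) by (simp add: field_simps)
qed

lemma not_mem:
  assumes "f \<notin> B"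
  shows "(\<lambda>x. inverse (f x)) \<in> B" "\<phi> (\<lambda>x. inverse (f x)) = 0" "ae (\<lambda>x. f x \<noteq> 0)"
  using assms dichotomy[of f] ae_not[of "\<lambda>x. f x = 0"] ae_zero(1)[of f] by auto

text \<open>An instance of the integral closedness of valuation rings. It bounds a scalar of which
  an invariant controls only a power.\<close>

lemma power_mem_imp_mem:
  assumes "(\<lambda>x. f x ^ i) \<in> B" "i > 0"
  shows "f \<in> B"
proof (rule ccontr)
  assume "f \<notin> B"
  note f = not_mem[OF this]
  have "\<phi> (\<lambda>x. f x ^ i * inverse (f x) ^ i) = \<phi> (\<lambda>_. 1)"
    by (rule ae_cong) (use ae_mp[OF f(3)] in \<open>auto simp flip: power_mult_distrib\<close>)
  moreover have "\<phi> (\<lambda>x. inverse (f x) ^ i) = 0" using power(2)[OF f(1), of i] f(2) assms(2) by simp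
  ultimately show False using mult(2)[OF assms(1) power(1)[OF f(1)], of i] by simp
qed

text \<open>Comparison of valuations: the value of \<open>g\<close> is at least that of
  \<open>f\<close>, where functions that agree almost everywhere count as equal and 0 has the
  largest value.\<close>

definition divides :: "('x \<Rightarrow> complex) \<Rightarrow> ('x \<Rightarrow> complex) \<Rightarrow> bool" where
  "divides f g \<longleftrightarrow> (\<exists>c\<in>B. ae (\<lambda>x. g x = c x * f x))"

lemma divides_refl: "divides f f"
  unfolding divides_def by (rule bexI[of _ "\<lambda>_. 1"]) auto

lemma divides_total: "divides f g \<or> divides g f"
proof (cases "ae (\<lambda>x. f x = 0)")
  case True
  then have "divides g f"
    unfolding divides_def by (intro bexI[of _ "\<lambda>_. 0"]) auto
  then show ?thesis ..
next
  case False
  then have f: "ae (\<lambda>x. f x \<noteq> 0)" by (simp add: ae_not)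
  show ?thesis
  proof (cases "(\<lambda>x. g x / f x) \<in> B")
    case True
    then have "divides f g"
      unfolding divides_def by (rule bexI[rotated]) (use ae_mp[OF f] in auto)
    then show ?thesis ..
  next
    case False
    note g = not_mem[OF this]
    have "divides g f"
      unfolding divides_def by (rule bexI[OF _ g(1)]) (use ae_mp[OF g(3)] in auto)
    then show ?thesis ..
  qed
qed

lemma divides_trans:
  assumes "divides f g" "divides g h" shows "divides f h"
proof -
  obtain c d where cd: "c \<in> B" "ae (\<lambda>x. g x = c x * f x)" "d \<in> B" "ae (\<lambda>x. h x = d x * g x)"
    using assms by (auto simp: divides_def)
  have "ae (\<lambda>x. h x = (d x * c x) * f x)" by (rule ae_elim2[OF cd(2,4)]) simp
  then show ?thesis unfolding divides_def using mult(1)[OF cd(3,1)] by (intro bexI[of _ "\<lambda>x. d x * c x"])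
qed

lemma divides_mult: "c \<in> B \<Longrightarrow> divides f g \<Longrightarrow> divides f (\<lambda>x. c x * g x)"
  by (rule divides_trans[of _ g]) (auto simp: divides_def intro!: bexI[of _ c])

lemma divides_add:
  assumes "divides f g" "divides f h" shows "divides f (\<lambda>x. g x + h x)"
proof -
  obtain c d where cd: "c \<in> B" "ae (\<lambda>x. g x = c x * f x)" "d \<in> B" "ae (\<lambda>x. h x = d x * f x)"
    using assms by (auto simp: divides_def)
  have "ae (\<lambda>x. g x + h x = (c x + d x) * f x)" by (rule ae_elim2[OF cd(2,4)]) (simp add: algebra_simps)
  then show ?thesis unfolding divides_def using add(1)[OF cd(1,3)] by (intro bexI[of _ "\<lambda>x. c x + d x"])
qed

lemma divides_minimum:
  assumes "finite A" "A \<noteq> {}"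
  obtains i where "i \<in> A" "\<And>j. j \<in> A \<Longrightarrow> divides (f i) (f j)"
proof -
  have "\<exists>i\<in>A. \<forall>j\<in>A. divides (f i) (f j)"
    using assms
  proof (induction A rule: finite_ne_induct)
    case (singleton i)
    then show ?case by (simp add: divides_refl)
  next
    case (insert i A)
    then obtain p where p: "p \<in> A" "\<And>j. j \<in> A \<Longrightarrow> divides (f p) (f j)" by blast
    show ?case
    proof (cases "divides (f p) (f i)")
      case True
      with p show ?thesis by blast
    next
      case False
      then have "divides (f i) (f p)" using divides_total by blast
      with p divides_trans divides_refl show ?thesis by blast
    qed
  qed
  then show ?thesis using that by blast
qed

end

section \<open>Smith normal form over a place\<close>

context place
begin

definition mat_mem :: "nat \<Rightarrow> ('x \<Rightarrow> complex mat) \<Rightarrow> bool" where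
  "mat_mem N M \<longleftrightarrow> (\<forall>x. M x \<in> carrier_mat N N) \<and> (\<forall>i<N. \<forall>j<N. (\<lambda>x. M x $$ (i, j)) \<in> B)"

definition lim_mat :: "nat \<Rightarrow> ('x \<Rightarrow> complex mat) \<Rightarrow> complex mat" where
  "lim_mat N M = mat N N (\<lambda>(i, j). \<phi> (\<lambda>x. M x $$ (i, j)))"

text \<open>The determinant is 1 at every parameter and not only almost everywhere, so that such a
  family consists of group elements throughout.\<close>

definition SL_mem :: "nat \<Rightarrow> ('x \<Rightarrow> complex mat) \<Rightarrow> bool" where
  "SL_mem N M \<longleftrightarrow> mat_mem N M \<and> (\<forall>x. det (M x) = 1)"

lemma mat_memD: "mat_mem N M \<Longrightarrow> M x \<in> carrier_mat N N" "mat_mem N M \<Longrightarrow> i < N \<Longrightarrow> j < N \<Longrightarrow> (\<lambda>x. M x $$ (i, j)) \<in> B"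
  by (auto simp: mat_mem_def)

lemma lim_mat_carrier [simp]: "lim_mat N M \<in> carrier_mat N N"
  by (simp add: lim_mat_def)

lemma lim_mat_index: "i < N \<Longrightarrow> j < N \<Longrightarrow> lim_mat N M $$ (i, j) = \<phi> (\<lambda>x. M x $$ (i, j))"
  by (simp add: lim_mat_def)

lemma mult_mat_index:
  assumes "A \<in> carrier_mat N N" "A' \<in> carrier_mat N N" "i < N" "j < N"
  shows "(A * A') $$ (i, j) = (\<Sum>k<N. A $$ (i, k) * A' $$ (k, j))"
  using assms by (simp add: scalar_prod_def lessThan_atLeast0)

lemma mat_mem_mult:
  assumes "mat_mem N M" "mat_mem N M'"
  shows "mat_mem N (\<lambda>x. M x * M' x)" "lim_mat N (\<lambda>x. M x * M' x) = lim_mat N M * lim_mat N M'"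
proof -
  have *: "(\<lambda>x. (M x * M' x) $$ (i, j)) = (\<lambda>x. \<Sum>k<N. M x $$ (i, k) * M' x $$ (k, j))" if "i < N" "j < N" for i j
    using mult_mat_index[OF mat_memD(1)[OF assms(1)] mat_memD(1)[OF assms(2)] that] by auto
  have mem: "(\<lambda>x. M x $$ (i, k) * M' x $$ (k, j)) \<in> B"
    "\<phi> (\<lambda>x. M x $$ (i, k) * M' x $$ (k, j)) = lim_mat N M $$ (i, k) * lim_mat N M' $$ (k, j)"
    if "i < N" "j < N" "k < N" for i j k
    using mult[OF mat_memD(2)[OF assms(1)] mat_memD(2)[OF assms(2)], of i k k j] that by (simp_all add: lim_mat_index)
  have s: "(\<lambda>x. \<Sum>k<N. M x $$ (i, k) * M' x $$ (k, j)) \<in> B"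
    "\<phi> (\<lambda>x. \<Sum>k<N. M x $$ (i, k) * M' x $$ (k, j)) = (\<Sum>k<N. lim_mat N M $$ (i, k) * lim_mat N M' $$ (k, j))"
    if "i < N" "j < N" for i j
    using sum[of "{..<N}" "\<lambda>k x. M x $$ (i, k) * M' x $$ (k, j)"] mem that by simp_all
  show "mat_mem N (\<lambda>x. M x * M' x)"
    unfolding mat_mem_def using mat_memD(1)[OF assms(1)] mat_memD(1)[OF assms(2)]
    by (auto simp: * s intro!: mult_carrier_mat[of _ N N])
  show "lim_mat N (\<lambda>x. M x * M' x) = lim_mat N M * lim_mat N M'"
  proof (rule eq_matI)
    fix i j assume "i < dim_row (lim_mat N M * lim_mat N M')" "j < dim_col (lim_mat N M * lim_mat N M')"
    then have ij: "i < N" "j < N" by (simp_all add: lim_mat_def)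
    show "lim_mat N (\<lambda>x. M x * M' x) $$ (i, j) = (lim_mat N M * lim_mat N M') $$ (i, j)"
      unfolding lim_mat_index[OF ij] *[OF ij] s(2)[OF ij]
      by (rule mult_mat_index[symmetric]) (use ij in auto)
  qed (simp_all add: lim_mat_def)
qed

lemma mat_mem_det:
  assumes "mat_mem N M"
  shows "(\<lambda>x. det (M x)) \<in> B" "\<phi> (\<lambda>x. det (M x)) = det (lim_mat N M)"
proof -
  let ?P = "{p. p permutes {0..<N}}"
  have d: "(\<lambda>x. det (M x)) = (\<lambda>x. \<Sum>p\<in>?P. signof p * (\<Prod>i = 0..<N. M x $$ (i, p i)))"
    using det_def'[OF mat_memD(1)[OF assms]] by auto
  have mem: "(\<lambda>x. M x $$ (i, p i)) \<in> B" "\<phi> (\<lambda>x. M x $$ (i, p i)) = lim_mat N M $$ (i, p i)" if "p \<in> ?P" "i \<in> {0..<N}" for p i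
  proof -
    have "p i < N" using that permutes_in_image[of p "{0..<N}" i] by simp
    then show "(\<lambda>x. M x $$ (i, p i)) \<in> B" "\<phi> (\<lambda>x. M x $$ (i, p i)) = lim_mat N M $$ (i, p i)"
      using mat_memD(2)[OF assms, of i "p i"] that by (auto simp: lim_mat_index)
  qed
  have p: "(\<lambda>x. \<Prod>i = 0..<N. M x $$ (i, p i)) \<in> B"
    "\<phi> (\<lambda>x. \<Prod>i = 0..<N. M x $$ (i, p i)) = (\<Prod>i = 0..<N. lim_mat N M $$ (i, p i))" if "p \<in> ?P" for p
    using prod[of "{0..<N}" "\<lambda>i x. M x $$ (i, p i)"] mem that by simp_all
  have t: "(\<lambda>x. signof p * (\<Prod>i = 0..<N. M x $$ (i, p i))) \<in> B"
    "\<phi> (\<lambda>x. signof p * (\<Prod>i = 0..<N. M x $$ (i, p i))) = signof p * (\<Prod>i = 0..<N. lim_mat N M $$ (i, p i))" if "p \<in> ?P" for p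
    using mult[OF const(1)[of "signof p"] p(1)[OF that]] p(2)[OF that] by simp_all
  show "(\<lambda>x. det (M x)) \<in> B" "\<phi> (\<lambda>x. det (M x)) = det (lim_mat N M)"
    unfolding d using sum[of ?P "\<lambda>p x. signof p * (\<Prod>i = 0..<N. M x $$ (i, p i))"] t
    by (simp_all add: det_def'[of "lim_mat N M" N])
qed

lemma SL_mem_det_lim: "SL_mem N M \<Longrightarrow> det (lim_mat N M) = 1"
  using mat_mem_det(2)[of N M] by (simp add: SL_mem_def)

lemma SL_mem_mult: "SL_mem N M \<Longrightarrow> SL_mem N M' \<Longrightarrow> SL_mem N (\<lambda>x. M x * M' x)"
  unfolding SL_mem_def using mat_mem_mult(1)[of N M M'] by (auto simp: det_mult[of _ N] mat_mem_def)

lemma mat_mem_const: "A \<in> carrier_mat N N \<Longrightarrow> mat_mem N (\<lambda>_. A)"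
  by (simp add: mat_mem_def)

lemma SL_mem_one: "SL_mem N (\<lambda>_. 1\<^sub>m N)"
  by (simp add: SL_mem_def mat_mem_const)

text \<open>By Cramer's rule the entries of the inverse are minors up to sign, so they stay in
  \<open>B\<close>.\<close>

lemma SL_mem_inverse:
  assumes "SL_mem N M"
  obtains M' where "SL_mem N M'" "\<And>x. M x * M' x = 1\<^sub>m N" "\<And>x. M' x * M x = 1\<^sub>m N"
proof -
  have M: "mat_mem N M" "\<And>x. det (M x) = 1" "\<And>x. M x \<in> carrier_mat N N"
    using assms by (auto simp: SL_mem_def mat_mem_def)
  let ?M' = "\<lambda>x. adj_mat (M x)"
  have inv: "M x * ?M' x = 1\<^sub>m N" "?M' x * M x = 1\<^sub>m N" "?M' x \<in> carrier_mat N N" for x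
    using adj_mat[OF M(3)[of x]] M(2)[of x] by auto
  have "(\<lambda>x. ?M' x $$ (i, j)) \<in> B" if ij: "i < N" "j < N" for i j
  proof -
    have "mat_mem (N - 1) (\<lambda>x. mat_delete (M x) j i)"
      unfolding mat_mem_def
    proof (intro conjI allI impI)
      fix x show "mat_delete (M x) j i \<in> carrier_mat (N - 1) (N - 1)" by (rule mat_delete_carrier[OF M(3)])
    next
      fix a b assume "a < N - 1" "b < N - 1"
      then have "(\<lambda>x. mat_delete (M x) j i $$ (a, b))
          = (\<lambda>x. M x $$ (if a < j then a else Suc a, if b < i then b else Suc b))"
        using M(3) ij by (auto simp: mat_delete_def carrier_matD[OF M(3)])
      then show "(\<lambda>x. mat_delete (M x) j i $$ (a, b)) \<in> B"
        using mat_memD(2)[OF M(1)] \<open>a < N - 1\<close> \<open>b < N - 1\<close> by simp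
    qed
    from mult(1)[OF const(1) mat_mem_det(1)[OF this], of "(-1) ^ (j + i)"]
    have "(\<lambda>x. cofactor (M x) j i) \<in> B" by (simp add: cofactor_def)
    moreover have "(\<lambda>x. ?M' x $$ (i, j)) = (\<lambda>x. cofactor (M x) j i)"
      using ij by (auto simp: adj_mat_def carrier_matD[OF M(3)])
    ultimately show ?thesis by simp
  qed
  moreover have "det (?M' x) = 1" for x
    using det_mult[OF M(3)[of x] inv(3)[of x]] inv(1)[of x] M(2)[of x] by simp
  ultimately have "SL_mem N ?M'"
    using inv(3) by (simp add: SL_mem_def mat_mem_def)
  with inv show ?thesis using that by blast
qed

definition equivalent :: "nat \<Rightarrow> ('x \<Rightarrow> complex mat) \<Rightarrow> ('x \<Rightarrow> complex mat) \<Rightarrow> bool" where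
  "equivalent N D D' \<longleftrightarrow> (\<forall>x. D x \<in> carrier_mat N N) \<and> (\<exists>K L. SL_mem N K \<and> SL_mem N L \<and> (\<forall>x. D' x = K x * D x * L x))"

lemma equivalent_refl:
  assumes "\<And>x. D x \<in> carrier_mat N N" shows "equivalent N D D"
proof -
  have "D x = 1\<^sub>m N * D x * 1\<^sub>m N" for x using assms[of x] by simp
  then show ?thesis
    unfolding equivalent_def using assms SL_mem_one by blast
qed

lemma equivalent_carrier: "equivalent N D D' \<Longrightarrow> D' x \<in> carrier_mat N N"
  unfolding equivalent_def SL_mem_def mat_mem_def by (metis mult_carrier_mat)

lemma equivalent_trans:
  assumes "equivalent N D D'" "equivalent N D' D''" shows "equivalent N D D''"
proof -
  obtain K L K' L' where KL: "SL_mem N K" "SL_mem N L" "\<And>x. D' x = K x * D x * L x"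
    "SL_mem N K'" "SL_mem N L'" "\<And>x. D'' x = K' x * D' x * L' x" and D: "\<And>x. D x \<in> carrier_mat N N"
    using assms by (auto simp: equivalent_def)
  have c: "K x \<in> carrier_mat N N" "L x \<in> carrier_mat N N" "K' x \<in> carrier_mat N N" "L' x \<in> carrier_mat N N" for x
    using KL by (auto simp: SL_mem_def mat_mem_def)
  have "D'' x = (K' x * K x) * D x * (L x * L' x)" for x
  proof -
    have "D'' x = K' x * (K x * D x * L x) * L' x" by (simp add: KL)
    also have "\<dots> = (K' x * (K x * D x) * L x) * L' x"
      using c[of x] D[of x] by (simp add: assoc_mult_mat[of _ N N _ N _ N])
    also have "\<dots> = (K' x * K x * D x * L x) * L' x"
      using c[of x] D[of x] by (simp add: assoc_mult_mat[of _ N N _ N _ N])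
    also have "\<dots> = (K' x * K x) * D x * (L x * L' x)"
      using c[of x] D[of x] by (simp add: assoc_mult_mat[of _ N N _ N _ N])
    finally show ?thesis .
  qed
  then show ?thesis
    unfolding equivalent_def using D SL_mem_mult[OF KL(4,1)] SL_mem_mult[OF KL(2,5)]
    by blast
qed

definition row_op :: "nat \<Rightarrow> nat \<Rightarrow> (nat \<Rightarrow> 'x \<Rightarrow> complex) \<Rightarrow> ('x \<Rightarrow> complex mat) \<Rightarrow> 'x \<Rightarrow> complex mat" where
  "row_op N s c D x = mat N N (\<lambda>(i, j). D x $$ (i, j) + c i x * D x $$ (s, j))"

definition col_op :: "nat \<Rightarrow> nat \<Rightarrow> (nat \<Rightarrow> 'x \<Rightarrow> complex) \<Rightarrow> ('x \<Rightarrow> complex mat) \<Rightarrow> 'x \<Rightarrow> complex mat" where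
  "col_op N s c D x = mat N N (\<lambda>(i, j). D x $$ (i, j) + c j x * D x $$ (i, s))"

text \<open>The matrix differs from the identity only in column \<open>s\<close>. The condition
  \<open>tri\<close> makes it triangular, which gives determinant 1. Multiplication from the left is
  a row operation, and the transpose serves for column operations.\<close>

lemma elementary_SL_mem:
  assumes "s < N" "\<And>i. c i \<in> B" "\<And>x. c s x = 0"
    and tri: "(\<forall>i<s. \<forall>x. c i x = 0) \<or> (\<forall>i>s. \<forall>x. c i x = 0)"
  defines "E \<equiv> \<lambda>x. mat N N (\<lambda>(i, j). if i = j then 1 else if j = s then c i x else 0)"
  shows "SL_mem N E" "SL_mem N (\<lambda>x. transpose_mat (E x))"
proof -
  have c: "E x \<in> carrier_mat N N" for x by (simp add: E_def)
  have mem: "(\<lambda>x. E x $$ (i, j)) \<in> B" if "i < N" "j < N" for i j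
    using that assms(2)[of i] by (cases "i = j"; cases "j = s") (auto simp: E_def)
  have "diag_mat (E x) = replicate N 1" for x
    by (rule nth_equalityI) (auto simp: diag_mat_def E_def)
  moreover have "det (E x) = prod_list (diag_mat (E x))" for x
    using tri
  proof
    assume "\<forall>i<s. \<forall>x. c i x = 0"
    then show ?thesis by (intro det_lower_triangular[OF _ c]) (auto simp: E_def)
  next
    assume "\<forall>i>s. \<forall>x. c i x = 0"
    then show ?thesis by (intro det_upper_triangular[OF _ c]) (auto simp: E_def upper_triangular_def)
  qed
  ultimately have d: "det (E x) = 1" for x by simp
  show "SL_mem N E" "SL_mem N (\<lambda>x. transpose_mat (E x))"
    using c mem d by (auto simp: SL_mem_def mat_mem_def det_transpose[OF c] carrier_matD[OF c])
qed

lemma row_col_op_equivalent: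
  assumes "s < N" "\<And>i. c i \<in> B" "\<And>x. c s x = 0"
    and tri: "(\<forall>i<s. \<forall>x. c i x = 0) \<or> (\<forall>i>s. \<forall>x. c i x = 0)"
    and D: "\<And>x. D x \<in> carrier_mat N N"
  shows "equivalent N D (row_op N s c D)" "equivalent N D (col_op N s c D)"
proof -
  let ?E = "\<lambda>x. mat N N (\<lambda>(i, j). if i = j then 1 else if j = s then c i x else 0)"
  note E = elementary_SL_mem[OF assms(1-4)]
  have c: "?E x \<in> carrier_mat N N" for x by simp
  have *: "(\<Sum>k<N. (if i = k then 1 else if k = s then c i x else 0) * f k) = f i + c i x * f s" if "i < N" for i x and f :: "nat \<Rightarrow> complex"
  proof -
    have "(\<Sum>k<N. (if i = k then 1 else if k = s then c i x else 0) * f k)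
        = (\<Sum>k<N. (if k = i then f i else 0) + (if k = s then c i x * f s else 0))"
      using assms(3) by (intro sum.cong) auto
    also have "\<dots> = f i + c i x * f s" using that assms(1) by (simp add: sum.distrib)
    finally show ?thesis .
  qed
  have "row_op N s c D x = ?E x * D x * 1\<^sub>m N" for x
  proof (rule eq_matI)
    fix i j assume "i < dim_row (?E x * D x * 1\<^sub>m N)" "j < dim_col (?E x * D x * 1\<^sub>m N)"
    then have ij: "i < N" "j < N" using D[of x] by auto
    have "?E x * D x * 1\<^sub>m N = ?E x * D x"
      by (rule right_mult_one_mat[OF mult_carrier_mat[OF c D]])
    then have "(?E x * D x * 1\<^sub>m N) $$ (i, j) = (\<Sum>k<N. ?E x $$ (i, k) * D x $$ (k, j))"
      using mult_mat_index[OF c D ij] by simp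
    also have "\<dots> = (\<Sum>k<N. (if i = k then 1 else if k = s then c i x else 0) * D x $$ (k, j))"
      using ij by (intro sum.cong) auto
    finally show "row_op N s c D x $$ (i, j) = (?E x * D x * 1\<^sub>m N) $$ (i, j)"
      using ij *[of i x "\<lambda>k. D x $$ (k, j)"] by (simp add: row_op_def)
  qed (auto simp: row_op_def)
  then show "equivalent N D (row_op N s c D)"
    unfolding equivalent_def using D E(1) SL_mem_one by blast
  have "col_op N s c D x = 1\<^sub>m N * D x * transpose_mat (?E x)" for x
  proof (rule eq_matI)
    fix i j assume "i < dim_row (1\<^sub>m N * D x * transpose_mat (?E x))" "j < dim_col (1\<^sub>m N * D x * transpose_mat (?E x))"
    then have ij: "i < N" "j < N" by auto
    have "(1\<^sub>m N * D x * transpose_mat (?E x)) $$ (i, j) = (\<Sum>k<N. D x $$ (i, k) * transpose_mat (?E x) $$ (k, j))"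
      unfolding left_mult_one_mat[OF D] by (rule mult_mat_index[OF D _ ij]) simp
    also have "\<dots> = (\<Sum>k<N. (if j = k then 1 else if k = s then c j x else 0) * D x $$ (i, k))"
      using ij by (intro sum.cong) auto
    finally show "col_op N s c D x $$ (i, j) = (1\<^sub>m N * D x * transpose_mat (?E x)) $$ (i, j)"
      using ij *[of j x "\<lambda>k. D x $$ (i, k)"] by (simp add: col_op_def)
  qed (auto simp: col_op_def)
  then show "equivalent N D (col_op N s c D)"
    unfolding equivalent_def using D E(2) SL_mem_one by blast
qed

text \<open>The invariant of the elimination after \<open>r\<close> pivots. Divisibility of the
  whole remaining block is carried along because later operations mix the entries of this block; in
  the end it becomes the chain of divisors on the diagonal.\<close>

definition diagonal_upto :: "nat \<Rightarrow> nat \<Rightarrow> ('x \<Rightarrow> complex mat) \<Rightarrow> bool" where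
  "diagonal_upto N r D \<longleftrightarrow>
     (\<forall>i<N. \<forall>j<N. i \<noteq> j \<and> (i < r \<or> j < r) \<longrightarrow> ae (\<lambda>x. D x $$ (i, j) = 0)) \<and>
     (\<forall>p<r. \<forall>i<N. \<forall>j<N. p \<le> i \<and> p \<le> j \<longrightarrow> divides (\<lambda>x. D x $$ (p, p)) (\<lambda>x. D x $$ (i, j)))"

definition divides_block :: "nat \<Rightarrow> nat \<Rightarrow> ('x \<Rightarrow> complex) \<Rightarrow> ('x \<Rightarrow> complex mat) \<Rightarrow> bool" where
  "divides_block N r d D \<longleftrightarrow> (\<forall>i<N. \<forall>j<N. r \<le> i \<and> r \<le> j \<longrightarrow> divides d (\<lambda>x. D x $$ (i, j)))"

lemma ae_add_mult_zero:
  assumes "ae (\<lambda>x. f x = 0)" "ae (\<lambda>x. g x = 0)" shows "ae (\<lambda>x. f x + c x * g x = (0::complex))"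
  by (rule ae_elim2[OF assms]) simp

lemma divides_add_mult: "c \<in> B \<Longrightarrow> divides d f \<Longrightarrow> divides d g \<Longrightarrow> divides d (\<lambda>x. f x + c x * g x)"
  by (intro divides_add divides_mult)

lemma op_preserves:
  assumes D: "diagonal_upto N r D" and s: "r \<le> s" "s < N" and c: "\<And>i. c i \<in> B" "\<And>i x. i < r \<Longrightarrow> c i x = 0"
  shows "diagonal_upto N r (row_op N s c D)" "diagonal_upto N r (col_op N s c D)"
    "divides_block N r d D \<Longrightarrow> divides_block N r d (row_op N s c D)"
    "divides_block N r d D \<Longrightarrow> divides_block N r d (col_op N s c D)"
proof -
  have z: "ae (\<lambda>x. D x $$ (i, j) = 0)" if "i < N" "j < N" "i \<noteq> j" "i < r \<or> j < r" for i j
    using D that by (auto simp: diagonal_upto_def)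
  have dv: "divides (\<lambda>x. D x $$ (p, p)) (\<lambda>x. D x $$ (i, j))" if "p < r" "i < N" "j < N" "p \<le> i" "p \<le> j" for p i j
    using D that by (auto simp: diagonal_upto_def)
  show "diagonal_upto N r (row_op N s c D)"
    unfolding diagonal_upto_def
  proof (intro conjI allI impI; (elim conjE)?)
    fix i j assume ij: "i < N" "j < N" "i \<noteq> j" "i < r \<or> j < r"
    show "ae (\<lambda>x. row_op N s c D x $$ (i, j) = 0)"
    proof (cases "i < r")
      case True
      then show ?thesis using z[OF ij] ij c(2) by (simp add: row_op_def)
    next
      case False
      then have "j < r" using ij by auto
      then have "ae (\<lambda>x. D x $$ (s, j) = 0)" using z[of s j] s ij by auto
      from ae_add_mult_zero[OF z[OF ij] this] show ?thesis using ij by (simp add: row_op_def)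
    qed
  next
    fix p i j assume *: "p < r" "i < N" "j < N" "p \<le> i" "p \<le> j"
    then have "divides (\<lambda>x. D x $$ (p, p)) (\<lambda>x. D x $$ (i, j) + c i x * D x $$ (s, j))"
      using s by (intro divides_add_mult dv c) auto
    then show "divides (\<lambda>x. row_op N s c D x $$ (p, p)) (\<lambda>x. row_op N s c D x $$ (i, j))"
      using * c(2) by (simp add: row_op_def)
  qed
  show "diagonal_upto N r (col_op N s c D)"
    unfolding diagonal_upto_def
  proof (intro conjI allI impI; (elim conjE)?)
    fix i j assume ij: "i < N" "j < N" "i \<noteq> j" "i < r \<or> j < r"
    show "ae (\<lambda>x. col_op N s c D x $$ (i, j) = 0)"
    proof (cases "j < r")
      case True
      then show ?thesis using z[OF ij] ij c(2) by (simp add: col_op_def)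
    next
      case False
      then have "i < r" using ij by auto
      then have "ae (\<lambda>x. D x $$ (i, s) = 0)" using z[of i s] s ij by auto
      from ae_add_mult_zero[OF z[OF ij] this] show ?thesis using ij by (simp add: col_op_def)
    qed
  next
    fix p i j assume *: "p < r" "i < N" "j < N" "p \<le> i" "p \<le> j"
    then have "divides (\<lambda>x. D x $$ (p, p)) (\<lambda>x. D x $$ (i, j) + c j x * D x $$ (i, s))"
      using s by (intro divides_add_mult dv c) auto
    then show "divides (\<lambda>x. col_op N s c D x $$ (p, p)) (\<lambda>x. col_op N s c D x $$ (i, j))"
      using * c(2) by (simp add: col_op_def)
  qed
  show "divides_block N r d (row_op N s c D)" if "divides_block N r d D"
    using that s by (auto simp: divides_block_def row_op_def intro!: divides_add_mult c)
  show "divides_block N r d (col_op N s c D)" if "divides_block N r d D"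
    using that s by (auto simp: divides_block_def col_op_def intro!: divides_add_mult c)
qed

lemma divides_block_trans: "divides e d \<Longrightarrow> divides_block N r d D \<Longrightarrow> divides_block N r e D"
  unfolding divides_block_def using divides_trans by blast

lemma unit_divides:
  assumes "u \<in> B" "\<phi> u \<noteq> 0" "ae (\<lambda>x. g x = u x * f x)"
  shows "divides g f"
  unfolding divides_def
proof (rule bexI[OF _ unit_inverse(1)[OF assms(1,2)]])
  show "ae (\<lambda>x. f x = inverse (u x) * g x)"
    by (rule ae_elim2[OF assms(3) unit_ae_nonzero[OF assms(1,2)]]) simp
qed

text \<open>A permutation matrix could have determinant -1, so the pivot \<open>d\<close> is moved
  by adding it to another entry \<open>e = c * d\<close> of its row or column. The sum is
  \<open>(c + \<epsilon>) * d\<close>, and \<open>c + \<epsilon>\<close> is a unit for \<epsilon>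
  equal to 1 or 0, according to whether \<open>c\<close> has residue 0 or not.\<close>

lemma pivot_coefficient:
  assumes "divides d e"
  obtains \<epsilon> :: complex where "divides (\<lambda>x. e x + \<epsilon> * d x) d"
proof -
  obtain c where c: "c \<in> B" "ae (\<lambda>x. e x = c x * d x)" using assms by (auto simp: divides_def)
  show ?thesis
  proof (cases "\<phi> c = 0")
    case True
    have "divides (\<lambda>x. e x + 1 * d x) d"
      by (rule unit_divides[OF add(1)[OF c(1) const(1)[of 1]]])
        (use True add(2)[OF c(1) const(1)[of 1]] ae_mp[OF c(2)] in \<open>auto simp: algebra_simps\<close>)
    then show ?thesis by (rule that)
  next
    case False
    have "divides (\<lambda>x. e x + 0 * d x) d"
      using unit_divides[OF c(1) False c(2)] by simp
    then show ?thesis by (rule that)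
  qed
qed

text \<open>An entry of least value divides the whole remaining block. It is brought to position
  \<open>(r, r)\<close>, first along its column and then along row \<open>r\<close>; after that,
  column \<open>r\<close> and row \<open>r\<close> are cleared with quotients that lie in
  \<open>B\<close>.\<close>

lemma smith_step:
  assumes D: "\<And>x. D x \<in> carrier_mat N N" "diagonal_upto N r D" and r: "r < N"
  obtains D' where "equivalent N D D'" "diagonal_upto N (Suc r) D'"
proof -
  have "finite ({r..<N} \<times> {r..<N})" "{r..<N} \<times> {r..<N} \<noteq> {}" using r by auto
  then obtain u where u: "u \<in> {r..<N} \<times> {r..<N}"
    and min_u: "\<And>v. v \<in> {r..<N} \<times> {r..<N} \<Longrightarrow> divides (\<lambda>x. D x $$ u) (\<lambda>x. D x $$ v)"
    using divides_minimum[of "{r..<N} \<times> {r..<N}" "\<lambda>v x. D x $$ v"] by metis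
  obtain p q where pq: "p \<in> {r..<N}" "q \<in> {r..<N}" and "u = (p, q)" using u by auto
  with min_u have min: "\<And>i j. i \<in> {r..<N} \<Longrightarrow> j \<in> {r..<N} \<Longrightarrow> divides (\<lambda>x. D x $$ (p, q)) (\<lambda>x. D x $$ (i, j))"
    by auto
  then have blk: "divides_block N r (\<lambda>x. D x $$ (p, q)) D" by (simp add: divides_block_def)
  \<comment> \<open>A scalar multiple of row \<open>p\<close> is added to row \<open>r\<close>,
    after which the entry at \<open>(r, q)\<close> has the least value and so divides the
    block.\<close>
  obtain D1 where D1: "equivalent N D D1" "diagonal_upto N r D1" "divides_block N r (\<lambda>x. D1 x $$ (r, q)) D1"
  proof (cases "p = r")
    case True
    with that[of D] equivalent_refl[of D N] D blk show ?thesis by blast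
  next
    case False
    obtain \<epsilon> where \<epsilon>: "divides (\<lambda>x. D x $$ (r, q) + \<epsilon> * D x $$ (p, q)) (\<lambda>x. D x $$ (p, q))"
      using pivot_coefficient[OF min[of r q]] pq r by auto
    define c' where "c' i = (if i = r then (\<lambda>_::'x. \<epsilon>) else (\<lambda>_. 0))" for i :: nat
    have c: "c' i \<in> B" "i < r \<Longrightarrow> c' i x = 0" "c' p x = 0" "\<forall>i>p. \<forall>x. c' i x = 0" for i x
      using False pq by (auto simp: c'_def)
    have "equivalent N D (row_op N p c' D)"
      by (rule row_col_op_equivalent) (use pq c D in auto)
    moreover have "diagonal_upto N r (row_op N p c' D)" "divides_block N r (\<lambda>x. D x $$ (p, q)) (row_op N p c' D)"
      using op_preserves(1,3)[OF D(2), of p c'] pq c blk by auto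
    moreover have "(\<lambda>x. row_op N p c' D x $$ (r, q)) = (\<lambda>x. D x $$ (r, q) + \<epsilon> * D x $$ (p, q))"
      using pq r by (auto simp: row_op_def c'_def)
    ultimately show ?thesis using that divides_block_trans \<epsilon> by metis
  qed
  have D1c: "D1 x \<in> carrier_mat N N" for x using equivalent_carrier[OF D1(1)] .
  obtain D2 where D2: "equivalent N D1 D2" "diagonal_upto N r D2" "divides_block N r (\<lambda>x. D2 x $$ (r, r)) D2"
  proof (cases "q = r")
    case True
    with that[of D1] equivalent_refl[of D1 N] D1c D1 show ?thesis by blast
  next
    case False
    have "divides (\<lambda>x. D1 x $$ (r, q)) (\<lambda>x. D1 x $$ (r, r))" using D1(3) r by (auto simp: divides_block_def)
    then obtain \<epsilon> where \<epsilon>: "divides (\<lambda>x. D1 x $$ (r, r) + \<epsilon> * D1 x $$ (r, q)) (\<lambda>x. D1 x $$ (r, q))"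
      using pivot_coefficient by metis
    define c' where "c' i = (if i = r then (\<lambda>_::'x. \<epsilon>) else (\<lambda>_. 0))" for i :: nat
    have c: "c' i \<in> B" "i < r \<Longrightarrow> c' i x = 0" "c' q x = 0" "\<forall>i>q. \<forall>x. c' i x = 0" for i x
      using False pq by (auto simp: c'_def)
    have "equivalent N D1 (col_op N q c' D1)"
      by (rule row_col_op_equivalent) (use pq c D1c in auto)
    moreover have "diagonal_upto N r (col_op N q c' D1)" "divides_block N r (\<lambda>x. D1 x $$ (r, q)) (col_op N q c' D1)"
      using op_preserves(2,4)[OF D1(2), of q c'] pq c D1(3) by auto
    moreover have "(\<lambda>x. col_op N q c' D1 x $$ (r, r)) = (\<lambda>x. D1 x $$ (r, r) + \<epsilon> * D1 x $$ (r, q))"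
      using pq r by (auto simp: col_op_def c'_def)
    ultimately show ?thesis using that divides_block_trans \<epsilon> by metis
  qed
  have D2c: "D2 x \<in> carrier_mat N N" for x using equivalent_carrier[OF D2(1)] .
  have "\<exists>c. c \<in> B \<and> ae (\<lambda>x. D2 x $$ (i, r) = c x * D2 x $$ (r, r))" if "i \<in> {r<..<N}" for i
  proof -
    have "divides (\<lambda>x. D2 x $$ (r, r)) (\<lambda>x. D2 x $$ (i, r))" using D2(3) r that by (simp add: divides_block_def)
    then show ?thesis unfolding divides_def by blast
  qed
  then have "\<forall>i\<in>{r<..<N}. \<exists>c. c \<in> B \<and> ae (\<lambda>x. D2 x $$ (i, r) = c x * D2 x $$ (r, r))" by (rule ballI)
  from bchoice[OF this] obtain a where "\<forall>i\<in>{r<..<N}. a i \<in> B \<and> ae (\<lambda>x. D2 x $$ (i, r) = a i x * D2 x $$ (r, r))"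
    by blast
  then have a: "a i \<in> B \<and> ae (\<lambda>x. D2 x $$ (i, r) = a i x * D2 x $$ (r, r))" if "r < i" "i < N" for i
    using that greaterThanLessThan_iff by blast
  have "\<exists>c. c \<in> B \<and> ae (\<lambda>x. D2 x $$ (r, i) = c x * D2 x $$ (r, r))" if "i \<in> {r<..<N}" for i
  proof -
    have "divides (\<lambda>x. D2 x $$ (r, r)) (\<lambda>x. D2 x $$ (r, i))" using D2(3) r that by (simp add: divides_block_def)
    then show ?thesis unfolding divides_def by blast
  qed
  then have "\<forall>i\<in>{r<..<N}. \<exists>c. c \<in> B \<and> ae (\<lambda>x. D2 x $$ (r, i) = c x * D2 x $$ (r, r))" by (rule ballI)
  from bchoice[OF this] obtain b where "\<forall>i\<in>{r<..<N}. b i \<in> B \<and> ae (\<lambda>x. D2 x $$ (r, i) = b i x * D2 x $$ (r, r))"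
    by blast
  then have b: "b i \<in> B \<and> ae (\<lambda>x. D2 x $$ (r, i) = b i x * D2 x $$ (r, r))" if "r < i" "i < N" for i
    using that greaterThanLessThan_iff by blast
  note ab = a b
  \<comment> \<open>The multipliers vanish up to index \<open>r\<close>, so that the pivot row and
    the rows and columns already cleared are not changed.\<close>
  define a' where "a' i x = (if r < i \<and> i < N then - a i x else 0)" for i x
  define b' where "b' i x = (if r < i \<and> i < N then - b i x else 0)" for i x
  have mem: "a' i \<in> B" "b' i \<in> B" for i
    using ab uminus(1) by (cases "r < i \<and> i < N"; auto simp: a'_def[abs_def] b'_def[abs_def])+
  have zero: "a' i x = 0" "b' i x = 0" if "i \<le> r" for i x using that by (auto simp: a'_def b'_def)
  define D3 where "D3 = row_op N r a' D2"
  define D4 where "D4 = col_op N r b' D3"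
  have e3: "equivalent N D2 D3"
    unfolding D3_def by (rule row_col_op_equivalent) (use r mem zero D2c in auto)
  have D3c: "D3 x \<in> carrier_mat N N" for x using equivalent_carrier[OF e3] .
  have e4: "equivalent N D3 D4"
    unfolding D4_def by (rule row_col_op_equivalent) (use r mem zero D3c in auto)
  have d3: "diagonal_upto N r D3" "divides_block N r (\<lambda>x. D2 x $$ (r, r)) D3"
    unfolding D3_def using op_preserves(1,3)[OF D2(2), of r a'] r mem zero D2(3) by auto
  have d4: "diagonal_upto N r D4" "divides_block N r (\<lambda>x. D2 x $$ (r, r)) D4"
    unfolding D4_def using op_preserves(2,4)[OF d3(1), of r b'] r mem zero d3(2) by auto
  have D3r: "D3 x $$ (r, j) = D2 x $$ (r, j)" if "j < N" for x j
    using that r zero by (simp add: D3_def row_op_def)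
  have D4rr: "D4 x $$ (r, r) = D2 x $$ (r, r)" for x
    using r zero D3r by (simp add: D4_def col_op_def)
  have row0: "ae (\<lambda>x. D4 x $$ (r, j) = 0)" if "r < j" "j < N" for j
    by (rule ae_mp[OF conjunct2[OF ab(2)[OF that]]]) (use that r D3r in \<open>simp add: D4_def col_op_def b'_def\<close>)
  have col0: "ae (\<lambda>x. D4 x $$ (i, r) = 0)" if "r < i" "i < N" for i
    by (rule ae_mp[OF conjunct2[OF ab(1)[OF that]]]) (use that r zero in \<open>simp add: D4_def D3_def col_op_def row_op_def a'_def\<close>)
  have "diagonal_upto N (Suc r) D4"
    unfolding diagonal_upto_def
  proof (intro conjI allI impI; (elim conjE)?)
    fix i j assume ij: "i < N" "j < N" "i \<noteq> j" "i < Suc r \<or> j < Suc r"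
    consider "i < r \<or> j < r" | "i = r" "r < j" | "j = r" "r < i" using ij by linarith
    then show "ae (\<lambda>x. D4 x $$ (i, j) = 0)"
      by cases (use d4(1) ij row0 col0 in \<open>auto simp: diagonal_upto_def\<close>)
  next
    fix p i j assume *: "p < Suc r" "i < N" "j < N" "p \<le> i" "p \<le> j"
    show "divides (\<lambda>x. D4 x $$ (p, p)) (\<lambda>x. D4 x $$ (i, j))"
    proof (cases "p = r")
      case True
      then show ?thesis using d4(2) * by (simp add: divides_block_def D4rr)
    next
      case False
      then show ?thesis using d4(1) * by (simp add: diagonal_upto_def)
    qed
  qed
  then show ?thesis
    using that equivalent_trans[OF equivalent_trans[OF D1(1) D2(1)] equivalent_trans[OF e3 e4]] by blast
qed

theorem smith_normal_form:
  assumes "\<And>x. M x \<in> carrier_mat N N"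
  obtains K L where "SL_mem N K" "SL_mem N L"
    "ae (\<lambda>x. \<forall>i<N. \<forall>j<N. i \<noteq> j \<longrightarrow> (K x * M x * L x) $$ (i, j) = 0)"
    "\<And>i j. i \<le> j \<Longrightarrow> j < N \<Longrightarrow> divides (\<lambda>x. (K x * M x * L x) $$ (i, i)) (\<lambda>x. (K x * M x * L x) $$ (j, j))"
proof -
  have "\<exists>D. equivalent N M D \<and> diagonal_upto N r D" if "r \<le> N" for r
    using that
  proof (induction r)
    case 0
    show ?case
      by (rule exI[of _ M]) (simp add: equivalent_refl assms diagonal_upto_def)
  next
    case (Suc r)
    then obtain D where D: "equivalent N M D" "diagonal_upto N r D" by auto
    obtain D' where "equivalent N D D'" "diagonal_upto N (Suc r) D'"
      using smith_step[OF equivalent_carrier[OF D(1)] D(2)] Suc.prems by auto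
    then show ?case using equivalent_trans[OF D(1)] by blast
  qed
  then obtain D where D: "equivalent N M D" "diagonal_upto N N D" by blast
  then obtain K L where KL: "SL_mem N K" "SL_mem N L" "\<And>x. D x = K x * M x * L x"
    by (auto simp: equivalent_def)
  have "ae (\<lambda>x. \<forall>i\<in>{..<N}. \<forall>j\<in>{..<N}. i \<noteq> j \<longrightarrow> D x $$ (i, j) = 0)"
  proof (intro ae_ball)
    fix i j assume "i \<in> {..<N}" "j \<in> {..<N}"
    then show "ae (\<lambda>x. i \<noteq> j \<longrightarrow> D x $$ (i, j) = 0)"
      using D(2) by (cases "i = j") (auto simp: diagonal_upto_def)
  qed auto
  then have "ae (\<lambda>x. \<forall>i<N. \<forall>j<N. i \<noteq> j \<longrightarrow> D x $$ (i, j) = 0)"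
    by (rule ae_mp) auto
  moreover have "divides (\<lambda>x. D x $$ (i, i)) (\<lambda>x. D x $$ (j, j))" if "i \<le> j" "j < N" for i j
    using D(2) that by (auto simp: diagonal_upto_def)
  ultimately show ?thesis using that[OF KL(1,2)] by (simp add: KL(3))
qed

section \<open>Characters of a torus and inequalities between valuations\<close>

definition torus_char :: "'j set \<Rightarrow> ('j \<Rightarrow> 'x \<Rightarrow> complex) \<Rightarrow> ('j \<Rightarrow> int) \<Rightarrow> 'x \<Rightarrow> complex" where
  "torus_char J t a x = (\<Prod>j\<in>J. t j x powi a j)"

lemma torus_char_combine:
  assumes "\<And>j. j \<in> J \<Longrightarrow> t j x \<noteq> 0"
  shows "torus_char J t (\<lambda>j. int p * a j + int q * b j) x = torus_char J t a x ^ p * torus_char J t b x ^ q"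
proof -
  have "torus_char J t (\<lambda>j. int p * a j + int q * b j) x = (\<Prod>j\<in>J. (t j x powi a j) ^ p * (t j x powi b j) ^ q)"
    unfolding torus_char_def
  proof (intro prod.cong refl)
    fix j assume "j \<in> J"
    then have "t j x \<noteq> 0" by (rule assms)
    then show "t j x powi (int p * a j + int q * b j) = (t j x powi a j) ^ p * (t j x powi b j) ^ q"
      by (simp add: power_int_add mult.commute[of "int _"] power_int_mult)
  qed
  then show ?thesis by (simp add: torus_char_def prod.distrib prod_power_distrib)
qed

lemma infinitesimal_mult: "infinitesimal f \<Longrightarrow> g \<in> B \<Longrightarrow> infinitesimal (\<lambda>x. f x * g x)"
  by (simp add: infinitesimal_def mult)

text \<open>Linear inequalities that hold in the value group of the place are solvable over the integers.\<close>

lemma valuation_transfer: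
  assumes "finite J" "\<And>j x. j \<in> J \<Longrightarrow> t j x \<noteq> 0"
    and "finite A" "\<And>a. a \<in> A \<Longrightarrow> torus_char J t a \<in> B" "infinitesimal (torus_char J t b)"
  shows "\<exists>y :: 'j \<Rightarrow> int. (\<forall>a\<in>A. 0 \<le> (\<Sum>j\<in>J. a j * y j)) \<and> 0 < (\<Sum>j\<in>J. b j * y j)"
  using assms(3-)
proof (induction "card A" arbitrary: A b rule: less_induct)
  case less
  define dot where "dot a y = (\<Sum>j\<in>J. a j * y j)" for a y :: "'j \<Rightarrow> int"
  have dot_lin: "dot (\<lambda>j. p * a j + q * b j) y = p * dot a y + q * dot b y"
    "dot a (\<lambda>j. p * y j + q * z j) = p * dot a y + q * dot a z" for a b y z p q
    by (simp_all add: dot_def sum_distrib_left sum.distrib algebra_simps)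
  show ?case
  proof (cases "A = {}")
    case True
    \<comment> \<open>Without side conditions \<open>y = b\<close> is a solution. The vector
      \<open>b\<close> is not 0, since the trivial character has residue 1.\<close>
    have "\<exists>j\<in>J. b j \<noteq> 0"
    proof (rule ccontr)
      assume "\<not> ?thesis"
      then have "torus_char J t b = (\<lambda>_. 1)" by (auto simp: torus_char_def)
      with less.prems(3) show False by (simp add: infinitesimal_def)
    qed
    then have "0 < (\<Sum>j\<in>J. b j * b j)"
      using assms(1) by (auto intro!: sum_pos2 simp: zero_less_mult_iff linorder_neq_iff)
    with True show ?thesis by auto
  next
    case False
    then obtain a A0 where A: "A = insert a A0" "a \<notin> A0" by (metis all_not_in_conv mk_disjoint_insert)
    with less.prems have A0: "finite A0" "card A0 < card A" by auto
    obtain y where y: "\<And>x. x \<in> A0 \<Longrightarrow> 0 \<le> dot x y" "0 < dot b y"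
      using less.hyps[OF A0(2,1), of b] less.prems A unfolding dot_def by auto
    show ?thesis
    proof (cases "0 \<le> dot a y")
      case True
      with y A show ?thesis unfolding dot_def by blast
    next
      case neg: False
      define p where "p = - dot a y"
      have p: "p > 0" using neg by (simp add: p_def)
      \<comment> \<open>\<open>proj x\<close> is the combination of \<open>x\<close> and
        \<open>a\<close> that vanishes on \<open>y\<close>. Its coefficients \<open>p\<close> and
        \<open>dot x y\<close> are non-negative for the vectors that occur, so the characters of
        projected vectors are products of powers of bounded ones, and the constraint
        \<open>a\<close> is eliminated.\<close>
      define proj where "proj x j = p * x j + dot x y * a j" for x j
      have char: "torus_char J t (proj x) = (\<lambda>z. torus_char J t x z ^ nat p * torus_char J t a z ^ nat (dot x y))"
        if "0 \<le> dot x y" for x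
      proof
        fix z
        have "proj x = (\<lambda>j. int (nat p) * x j + int (nat (dot x y)) * a j)"
          using p that by (auto simp: proj_def)
        then show "torus_char J t (proj x) z = torus_char J t x z ^ nat p * torus_char J t a z ^ nat (dot x y)"
          using torus_char_combine[of J t z "nat p" x "nat (dot x y)" a] assms(2) by simp
      qed
      have "torus_char J t x \<in> B" if "x \<in> proj ` A0" for x
      proof -
        obtain x' where "x = proj x'" "x' \<in> A0" using \<open>x \<in> proj ` A0\<close> by auto
        then show ?thesis
          using char[OF y(1)] less.prems(2) A by (auto intro!: mult(1) power(1))
      qed
      moreover have "infinitesimal (torus_char J t (proj b))"
      proof -
        have "infinitesimal (\<lambda>z. torus_char J t b z ^ nat p)"
          using less.prems(3) p power by (auto simp: infinitesimal_def)
        then show ?thesis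
          using char[of b] y(2) less.prems(2)[of a] A by (auto intro!: infinitesimal_mult power(1))
      qed
      moreover have "card (proj ` A0) < card A" using A0 card_image_le le_less_trans by blast
      ultimately obtain z where z: "\<And>x. x \<in> A0 \<Longrightarrow> 0 \<le> dot (proj x) z" "0 < dot (proj b) z"
        using less.hyps[of "proj ` A0" "proj b"] A0(1) unfolding dot_def by blast
      \<comment> \<open>A multiple of \<open>y\<close> corrects \<open>z\<close> so that
        \<open>a\<close> vanishes on \<open>w\<close>, and any \<open>x\<close> takes on
        \<open>w\<close> the value that \<open>proj x\<close> takes on \<open>z\<close>.\<close>
      define w where "w j = p * z j + dot a z * y j" for j
      have "dot x w = dot (proj x) z" for x
        unfolding w_def[abs_def] proj_def[abs_def] dot_lin by (simp add: algebra_simps)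
      moreover have "dot a w = 0"
        unfolding w_def[abs_def] dot_lin by (simp add: p_def)
      ultimately show ?thesis using z A unfolding dot_def by (intro exI[of _ w]) auto
    qed
  qed
qed

end

section \<open>Fundamental one-parameter subgroups\<close>

text \<open>A walk to a vertex. As long as some non-zero direction in \<open>D\<close> keeps all
  tight constraints tight, one moves along it, oriented so that the objective \<open>c\<close> does
  not decrease, until another constraint becomes tight. The condition \<open>pointed\<close>
  excludes recession directions in \<open>D\<close>, so every move is stopped by a constraint, and
  the number of slack constraints drops.\<close>

lemma polytope_vertex:
  fixes D :: "('j \<Rightarrow> rat) set" and A :: "('j \<Rightarrow> rat) set"
  defines "dot \<equiv> \<lambda>J a (z::'j \<Rightarrow> rat). \<Sum>j\<in>J. a j * z j"
  assumes "finite A"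
    and add: "\<And>u v. u \<in> D \<Longrightarrow> v \<in> D \<Longrightarrow> (\<lambda>j. u j + v j) \<in> D" and scale: "\<And>c u. u \<in> D \<Longrightarrow> (\<lambda>j. c * u j) \<in> D"
    and D0: "(\<lambda>_. 0) \<in> D" and pointed: "\<And>d. d \<in> D \<Longrightarrow> (\<And>a. a \<in> A \<Longrightarrow> 0 \<le> dot J a d) \<Longrightarrow> (\<And>j. d j = 0)"
    and feas: "\<And>a. a \<in> A \<Longrightarrow> 0 \<le> dot J a z"
  shows "\<exists>z'. (\<lambda>j. z' j - z j) \<in> D \<and> (\<forall>a\<in>A. 0 \<le> dot J a z') \<and> dot J c z \<le> dot J c z' \<and>
     (\<forall>d\<in>D. (\<forall>a\<in>A. dot J a z' = 0 \<longrightarrow> dot J a d = 0) \<longrightarrow> (\<forall>j. d j = 0))"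
  using feas
proof (induction "card {a\<in>A. dot J a z \<noteq> 0}" arbitrary: z rule: less_induct)
  case less
  have lin: "dot J a (\<lambda>j. u j + s * v j) = dot J a u + s * dot J a v" "dot J a (\<lambda>j. s * v j) = s * dot J a v" for a u v s
    by (simp_all add: dot_def sum.distrib sum_distrib_left algebra_simps)
  show ?case
  proof (cases "\<forall>d\<in>D. (\<forall>a\<in>A. dot J a z = 0 \<longrightarrow> dot J a d = 0) \<longrightarrow> (\<forall>j. d j = 0)")
    case True
    moreover have "(\<lambda>j. z j - z j) \<in> D" using D0 by simp
    ultimately show ?thesis using less.prems by blast
  next
    case False
    then obtain d0 where d0: "d0 \<in> D" "\<And>a. a \<in> A \<Longrightarrow> dot J a z = 0 \<Longrightarrow> dot J a d0 = 0" "\<exists>j. d0 j \<noteq> 0" by blast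
    define d where "d = (if 0 \<le> dot J c d0 then d0 else (\<lambda>j. (-1) * d0 j))"
    have d: "d \<in> D" "\<And>a. a \<in> A \<Longrightarrow> dot J a z = 0 \<Longrightarrow> dot J a d = 0" "\<exists>j. d j \<noteq> 0" "0 \<le> dot J c d"
      using d0 scale[OF d0(1), of "-1"] by (auto simp: d_def lin(2)[of _ "-1", simplified])
    define N where "N = {a\<in>A. dot J a d < 0}"
    have "N \<noteq> {}"
    proof
      assume "N = {}"
      then have "\<And>a. a \<in> A \<Longrightarrow> 0 \<le> dot J a d" by (force simp: N_def)
      from pointed[OF d(1) this] d(3) show False by blast
    qed
    have fN: "finite N" using assms(2) by (simp add: N_def)
    \<comment> \<open>The longest admissible step; only the constraints that decrease along
      \<open>d\<close> limit it.\<close>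
    define s where "s = Min ((\<lambda>a. dot J a z / - dot J a d) ` N)"
    have "s \<in> (\<lambda>a. dot J a z / - dot J a d) ` N"
      unfolding s_def by (rule Min_in) (use fN \<open>N \<noteq> {}\<close> in auto)
    then obtain a1 where a1: "a1 \<in> N" "s = dot J a1 z / - dot J a1 d" by blast
    have a1': "a1 \<in> A" "dot J a1 d < 0" using a1(1) by (auto simp: N_def)
    then have "dot J a1 z \<noteq> 0" using d(2) by force
    have s_le: "s \<le> dot J a z / - dot J a d" if "a \<in> N" for a
      using that fN by (simp add: s_def)
    have "0 \<le> s" unfolding a1(2) using a1' less.prems[OF a1'(1)] by (intro divide_nonneg_pos) auto
    define z' where "z' j = z j + s * d j" for j
    have z': "dot J a z' = dot J a z + s * dot J a d" for a unfolding z'_def[abs_def] by (rule lin)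
    have feas': "0 \<le> dot J a z'" if "a \<in> A" for a
    proof (cases "a \<in> N")
      case True
      then have "dot J a d < 0" by (simp add: N_def)
      with s_le[OF True] show ?thesis by (simp add: z' field_simps)
    next
      case False
      then have "0 \<le> dot J a d" using that by (simp add: N_def not_less)
      then show ?thesis using less.prems[OF that] \<open>0 \<le> s\<close> by (simp add: z')
    qed
    have "dot J a1 z' = 0" using a1(2) a1' by (simp add: z' field_simps)
    have "{a\<in>A. dot J a z' \<noteq> 0} \<subseteq> {a\<in>A. dot J a z \<noteq> 0}" using d(2) by (auto simp: z')
    then have "{a\<in>A. dot J a z' \<noteq> 0} \<subset> {a\<in>A. dot J a z \<noteq> 0}"
      using \<open>dot J a1 z' = 0\<close> \<open>dot J a1 z \<noteq> 0\<close> a1'(1) by blast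
    then have "card {a\<in>A. dot J a z' \<noteq> 0} < card {a\<in>A. dot J a z \<noteq> 0}"
      using assms(2) by (intro psubset_card_mono) auto
    from less.hyps[OF this feas'] obtain w where w: "(\<lambda>j. w j - z' j) \<in> D" "\<forall>a\<in>A. 0 \<le> dot J a w" "dot J c z' \<le> dot J c w"
      "\<forall>d\<in>D. (\<forall>a\<in>A. dot J a w = 0 \<longrightarrow> dot J a d = 0) \<longrightarrow> (\<forall>j. d j = 0)"
      by blast
    have "(\<lambda>j. w j - z j) = (\<lambda>j. (w j - z' j) + s * d j)" by (auto simp: z'_def)
    then have "(\<lambda>j. w j - z j) \<in> D" using add[OF w(1) scale[OF d(1), of s]] by simp
    moreover have "dot J c z \<le> dot J c w" using w(3) d(4) \<open>0 \<le> s\<close> by (simp add: z' ) (meson add_increasing2 mult_nonneg_nonneg order_trans le_add_same_cancel1)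
    ultimately show ?thesis using w(2,4) by blast
  qed
qed

text \<open>Gaussian elimination: an equation \<open>e0\<close> that involves the variable
  \<open>i\<close> eliminates it from all others, and the induction hypothesis selects as many
  reduced equations as there are remaining variables.\<close>

lemma independent_equations:
  fixes a :: "'e \<Rightarrow> 'j \<Rightarrow> rat"
  assumes "finite J" "finite T"
    and "\<And>x. (\<And>e. e \<in> T \<Longrightarrow> (\<Sum>j\<in>J. a e j * x j) = 0) \<Longrightarrow> (\<And>j. j \<in> J \<Longrightarrow> x j = 0)"
  shows "\<exists>E\<subseteq>T. card E = card J \<and> (\<forall>x. (\<forall>e\<in>E. (\<Sum>j\<in>J. a e j * x j) = 0) \<longrightarrow> (\<forall>j\<in>J. x j = 0))"
  using assms
proof (induction J arbitrary: T a rule: finite_induct)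
  case empty
  then show ?case by (intro exI[of _ "{}"]) auto
next
  case (insert i J)
  have "\<exists>e\<in>T. a e i \<noteq> 0"
  proof (rule ccontr)
    assume c: "\<not> ?thesis"
    have "(\<Sum>j\<in>insert i J. a e j * (if j = i then 1 else 0)) = 0" if "e \<in> T" for e
      using that c by (intro sum.neutral) auto
    from insert.prems(2)[OF this, of i] show False by simp
  qed
  then obtain e0 where e0: "e0 \<in> T" "a e0 i \<noteq> 0" by blast
  define a' where "a' e j = a e j - a e i / a e0 i * a e0 j" for e j
  \<comment> \<open>Solving \<open>e0\<close> for the variable \<open>i\<close> extends a solution
    of the reduced equations to one of the original equations.\<close>
  define ext where "ext x = x(i := - (\<Sum>j\<in>J. a e0 j * x j) / a e0 i)" for x :: "'j \<Rightarrow> rat"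
  have sumins: "(\<Sum>j\<in>insert i J. a e j * x j) = a e i * x i + (\<Sum>j\<in>J. a e j * x j)" for e x
    using insert.hyps by simp
  have a': "(\<Sum>j\<in>J. a' e j * x j) = (\<Sum>j\<in>J. a e j * x j) - a e i / a e0 i * (\<Sum>j\<in>J. a e0 j * x j)" for e x
    by (simp add: a'_def sum_subtractf sum_distrib_left algebra_simps)
  have ext_J: "(\<Sum>j\<in>J. a e j * ext x j) = (\<Sum>j\<in>J. a e j * x j)" for e x
    using insert.hyps by (intro sum.cong) (auto simp: ext_def)
  have sum_ext: "(\<Sum>j\<in>insert i J. a e j * ext x j) = (\<Sum>j\<in>J. a' e j * x j)" for e x
    unfolding sumins ext_J a' by (simp add: ext_def)
  have "\<And>j. j \<in> J \<Longrightarrow> x j = 0" if x: "\<And>e. e \<in> T - {e0} \<Longrightarrow> (\<Sum>j\<in>J. a' e j * x j) = 0" for x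
  proof -
    have "(\<Sum>j\<in>J. a' e0 j * x j) = 0" unfolding a' using e0 by simp
    then have "(\<Sum>j\<in>insert i J. a e j * ext x j) = 0" if "e \<in> T" for e
      unfolding sum_ext using x that by (cases "e = e0") auto
    from insert.prems(2)[OF this] have *: "j \<in> insert i J \<Longrightarrow> ext x j = 0" for j by blast
    fix j assume "j \<in> J"
    then show "x j = 0" using *[of j] insert.hyps by (auto simp: ext_def split: if_splits)
  qed
  then obtain E where E: "E \<subseteq> T - {e0}" "card E = card J"
    "\<And>x. (\<forall>e\<in>E. (\<Sum>j\<in>J. a' e j * x j) = 0) \<Longrightarrow> (\<forall>j\<in>J. x j = 0)"
    using insert.IH[of "T - {e0}" a'] insert.prems(1) by blast
  have "finite E" using E(1) insert.prems(1) by (meson finite_Diff finite_subset)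
  then have "card (insert e0 E) = card (insert i J)"
    using E(1,2) insert.hyps by (subst card_insert_disjoint) auto
  moreover have "\<forall>j\<in>insert i J. x j = 0" if x: "\<forall>e\<in>insert e0 E. (\<Sum>j\<in>insert i J. a e j * x j) = 0" for x
  proof -
    have s0: "(\<Sum>j\<in>J. a e0 j * x j) = - a e0 i * x i" using x sumins[of e0 x] by (simp add: eq_neg_iff_add_eq_0)
    have "(\<Sum>j\<in>J. a' e j * x j) = 0" if "e \<in> E" for e
      unfolding a' s0 using x that sumins[of e x] e0 by (simp add: add.commute)
    then have J0: "\<forall>j\<in>J. x j = 0" using E(3) by blast
    then have "(\<Sum>j\<in>J. a e0 j * x j) = 0" by simp
    with s0 e0 J0 show ?thesis by simp
  qed
  ultimately show ?case using E(1) e0(1) by (intro exI[of _ "insert e0 E"]) auto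
qed

section \<open>Dominant weights and the equations that may cut out a vertex\<close>

definition coords :: "nat \<Rightarrow> nat \<Rightarrow> bivar set" where
  "coords m n = x_var ` {..m} \<union> y_var ` {..n}"

lemma finite_coords [simp]: "finite (coords m n)"
  by (simp add: coords_def)

lemma sum_coords: "(\<Sum>v\<in>coords m n. f v) = (\<Sum>i\<le>m. f (x_var i)) + (\<Sum>j\<le>n. f (y_var j))"
proof -
  have "(\<Sum>v\<in>coords m n. f v) = sum f (x_var ` {..m}) + sum f (y_var ` {..n})"
    unfolding coords_def by (rule sum.union_disjoint) auto
  then show ?thesis by (simp add: sum.reindex inj_on_def)
qed

lemma antimono_sum_zero:
  fixes f :: "nat \<Rightarrow> rat"
  assumes "\<And>i. i < m \<Longrightarrow> f (i + 1) \<le> f i" "(\<Sum>i\<le>m. f i) = 0"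
  shows "0 \<le> f 0" "f 0 = 0 \<Longrightarrow> i \<le> m \<Longrightarrow> f i = 0"
proof -
  have le: "f i \<le> f 0" if "i \<le> m" for i
    using that
  proof (induction i)
    case (Suc i)
    then show ?case using assms(1)[of i] by simp
  qed simp
  show "0 \<le> f 0"
  proof (rule ccontr)
    assume "\<not> ?thesis"
    then have "f i < 0" if "i \<le> m" for i using le[OF that] by linarith
    then have "(\<Sum>i\<le>m. f i) < (\<Sum>i\<le>m. 0)" by (intro sum_strict_mono) auto
    with assms(2) show False by simp
  qed
  show "f i = 0" if "f 0 = 0" "i \<le> m"
  proof -
    have "(\<Sum>i\<le>m. - f i) = 0" using assms(2) by (simp add: sum_negf)
    then have "\<forall>i\<in>{..m}. - f i = 0"
      using le that(1) by (subst (asm) sum_nonneg_eq_0_iff) auto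
    then show ?thesis using that(2) by simp
  qed
qed

text \<open>The closed Weyl chamber of the diagonal torus. The type is general because weights occur
  as integers and, after scaling, as rationals.\<close>

definition dominant :: "nat \<Rightarrow> nat \<Rightarrow> (bivar \<Rightarrow> 'a::linordered_idom) \<Rightarrow> bool" where
  "dominant m n z \<longleftrightarrow> (\<forall>i<m. z (x_var (i + 1)) \<le> z (x_var i)) \<and> (\<forall>j<n. z (y_var (j + 1)) \<le> z (y_var j)) \<and>
     (\<Sum>i\<le>m. z (x_var i)) = 0 \<and> (\<Sum>j\<le>n. z (y_var j)) = 0"

text \<open>The sum of the two leading coordinates is positive on non-zero dominant vectors, so it
  can serve as the level function that cuts a bounded slice out of the cone.\<close>

lemma dominant_nonneg:
  fixes z :: "bivar \<Rightarrow> rat"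
  assumes "dominant m n z"
  shows "0 \<le> z (x_var 0)" "0 \<le> z (y_var 0)"
    "z (x_var 0) + z (y_var 0) = 0 \<Longrightarrow> v \<in> coords m n \<Longrightarrow> z v = 0"
proof -
  note x = antimono_sum_zero[of m "\<lambda>i. z (x_var i)"] and y = antimono_sum_zero[of n "\<lambda>i. z (y_var i)"]
  show *: "0 \<le> z (x_var 0)" "0 \<le> z (y_var 0)"
    using assms x(1) y(1) by (auto simp: dominant_def)
  assume "z (x_var 0) + z (y_var 0) = 0" "v \<in> coords m n"
  with * have z0: "z (x_var 0) = 0" "z (y_var 0) = 0" by linarith+
  have "z (x_var i) = 0" if "i \<le> m" for i
    by (rule x(2)) (use assms z0 that in \<open>auto simp: dominant_def\<close>)
  moreover have "z (y_var j) = 0" if "j \<le> n" for j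
    by (rule y(2)) (use assms z0 that in \<open>auto simp: dominant_def\<close>)
  ultimately show "z v = 0" using \<open>v \<in> coords m n\<close> by (auto simp: coords_def)
qed

lemma bimonomialsD:
  assumes "I \<in> bimonomials m n k l"
  shows "v \<notin> coords m n \<Longrightarrow> Poly_Mapping.lookup I v = 0"
    "i \<le> m \<Longrightarrow> Poly_Mapping.lookup I (x_var i) \<le> k" "j \<le> n \<Longrightarrow> Poly_Mapping.lookup I (y_var j) \<le> l"
    "(\<Sum>i\<le>m. Poly_Mapping.lookup I (x_var i)) = k" "(\<Sum>j\<le>n. Poly_Mapping.lookup I (y_var j)) = l"
proof -
  show *: "(\<Sum>i\<le>m. Poly_Mapping.lookup I (x_var i)) = k" "(\<Sum>j\<le>n. Poly_Mapping.lookup I (y_var j)) = l"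
    using assms by (auto simp: bimonomials_def)
  show "v \<notin> coords m n \<Longrightarrow> Poly_Mapping.lookup I v = 0"
    using assms by (auto simp: bimonomials_def coords_def in_keys_iff subset_iff)
  show "i \<le> m \<Longrightarrow> Poly_Mapping.lookup I (x_var i) \<le> k"
    unfolding *(1)[symmetric] by (rule member_le_sum) auto
  show "j \<le> n \<Longrightarrow> Poly_Mapping.lookup I (y_var j) \<le> l"
    unfolding *(2)[symmetric] by (rule member_le_sum) auto
qed

definition encode_equation :: "nat \<Rightarrow> nat \<Rightarrow> (bivar \<Rightarrow> 'a) \<Rightarrow> 'a vec \<times> 'a vec" where
  "encode_equation m n e = (vec (m + 1) (\<lambda>i. e (x_var i)), vec (n + 1) (\<lambda>j. e (y_var j)))"

lemma encode_equation_eqD: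
  assumes "encode_equation m n e = encode_equation m n e'" "v \<in> coords m n"
  shows "e v = e' v"
proof -
  have eq: "vec (m + 1) (\<lambda>i. e (x_var i)) $ i = vec (m + 1) (\<lambda>i. e' (x_var i)) $ i"
    "vec (n + 1) (\<lambda>i. e (y_var i)) $ i = vec (n + 1) (\<lambda>i. e' (y_var i)) $ i" for i
    using assms(1) by (simp_all add: encode_equation_def)
  have "e (x_var i) = e' (x_var i)" if "i \<le> m" for i using eq(1)[of i] that by simp
  moreover have "e (y_var j) = e' (y_var j)" if "j \<le> n" for j using eq(2)[of j] that by simp
  ultimately show ?thesis using assms(2) by (auto simp: coords_def)
qed

definition monomial_difference :: "bivar monomial \<Rightarrow> bivar monomial \<Rightarrow> bivar \<Rightarrow> int" where
  "monomial_difference I I' v = int (Poly_Mapping.lookup I v) - int (Poly_Mapping.lookup I' v)"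

definition difference :: "bivar \<Rightarrow> bivar \<Rightarrow> bivar \<Rightarrow> int" where
  "difference u w v = (if v = u then 1 else if v = w then -1 else 0)"

text \<open>Exponents lie between 0 and \<open>k\<close> or \<open>l\<close>, and both monomials
  have the same bidegree; this gives the bounds and the zero sums that \<open>Eqs\<close>
  demands.\<close>

lemma monomial_difference_Eqs:
  assumes "I \<in> bimonomials m n k l" "I' \<in> bimonomials m n k l"
  shows "encode_equation m n (monomial_difference I I') \<in> Eqs m n k l"
proof -
  have "(\<Sum>i\<le>m. int (Poly_Mapping.lookup I (x_var i))) = int k" "(\<Sum>j\<le>n. int (Poly_Mapping.lookup I (y_var j))) = int l"
    if "I \<in> bimonomials m n k l" for I
    using bimonomialsD(4,5)[OF that] by (simp_all flip: of_nat_sum)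
  then show ?thesis
    using bimonomialsD(2,3)[OF assms(1)] bimonomialsD(2,3)[OF assms(2)] assms
    by (fastforce simp: Eqs_def encode_equation_def monomial_difference_def less_Suc_eq_le sum_subtractf)
qed

lemma difference_Eqs:
  assumes "k > 0" "l > 0"
  shows "i < m \<Longrightarrow> encode_equation m n (difference (x_var i) (x_var (i + 1))) \<in> Eqs m n k l"
    "j < n \<Longrightarrow> encode_equation m n (difference (y_var j) (y_var (j + 1))) \<in> Eqs m n k l"
proof -
  have "(\<Sum>a\<le>N. if a = b then 1 else if a = Suc b then - 1 else 0 :: int) = 0" if "b < N" for b N :: nat
  proof -
    have "(\<Sum>a\<le>N. if a = b then 1 else if a = Suc b then - 1 else 0 :: int)
        = (\<Sum>a\<le>N. (if a = b then 1 else 0) - (if a = Suc b then 1 else 0))"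
      by (intro sum.cong) auto
    also have "\<dots> = 0" using that by (simp add: sum_subtractf)
    finally show ?thesis .
  qed
  moreover have "1 \<le> int k" "1 \<le> int l" using assms by simp_all
  ultimately show "i < m \<Longrightarrow> encode_equation m n (difference (x_var i) (x_var (i + 1))) \<in> Eqs m n k l"
    "j < n \<Longrightarrow> encode_equation m n (difference (y_var j) (y_var (j + 1))) \<in> Eqs m n k l"
    by (simp_all add: Eqs_def encode_equation_def difference_def cong: if_cong)
qed

lemma difference_dot:
  fixes z :: "bivar \<Rightarrow> rat"
  assumes "u \<in> coords m n" "w \<in> coords m n" "u \<noteq> w"
  shows "(\<Sum>v\<in>coords m n. of_int (difference u w v) * z v) = z u - z w"
proof -
  have "(\<Sum>v\<in>coords m n. of_int (difference u w v) * z v)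
      = (\<Sum>v\<in>coords m n. (if v = u then z u else 0) - (if v = w then z w else 0))"
    using assms(3) by (intro sum.cong) (auto simp: difference_def)
  also have "\<dots> = z u - z w" using assms by (simp add: sum_subtractf)
  finally show ?thesis .
qed

text \<open>The hyperplane \<open>\<rho>\<^sub>0 + \<sigma>\<^sub>0 = 0\<close> in the space of weights is parametrised by all coordinates except
  \<open>\<rho>\<^sub>m\<close>, \<open>\<sigma>\<^sub>0\<close> and \<open>\<sigma>\<^sub>n\<close>.\<close>

definition balanced :: "nat \<Rightarrow> nat \<Rightarrow> (bivar \<Rightarrow> rat) set" where
  "balanced m n = {d. (\<forall>v. v \<notin> coords m n \<longrightarrow> d v = 0) \<and> (\<Sum>i\<le>m. d (x_var i)) = 0 \<and> (\<Sum>j\<le>n. d (y_var j)) = 0 \<and>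
      d (x_var 0) + d (y_var 0) = 0}"

definition free_coords :: "nat \<Rightarrow> nat \<Rightarrow> bivar set" where
  "free_coords m n = x_var ` {..<m} \<union> y_var ` {1..<n}"

definition extend :: "nat \<Rightarrow> nat \<Rightarrow> (bivar \<Rightarrow> rat) \<Rightarrow> bivar \<Rightarrow> rat" where
  "extend m n x v = (case v of
      x_var i \<Rightarrow> if i < m then x v else if i = m then - (\<Sum>i<m. x (x_var i)) else 0
    | y_var j \<Rightarrow> if j = 0 then - x (x_var 0) else if j < n then x v
        else if j = n then x (x_var 0) - (\<Sum>j\<in>{1..<n}. x (y_var j)) else 0)"

text \<open>The pullback of a linear form along \<open>extend\<close>. The coefficient of
  \<open>x_var 0\<close> has an extra term because this coordinate also enters through
  \<open>\<sigma>\<^sub>0 = - \<rho>\<^sub>0\<close> and through the last coordinate of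
  \<sigma>.\<close>

definition restrict_equation :: "nat \<Rightarrow> nat \<Rightarrow> (bivar \<Rightarrow> rat) \<Rightarrow> bivar \<Rightarrow> rat" where
  "restrict_equation m n a v = (case v of
      x_var i \<Rightarrow> a v - a (x_var m) + (if i = 0 then a (y_var n) - a (y_var 0) else 0)
    | y_var j \<Rightarrow> a v - a (y_var n))"

lemma card_free_coords: "m > 0 \<Longrightarrow> n > 0 \<Longrightarrow> card (free_coords m n) = m + n - 1"
  unfolding free_coords_def by (subst card_Un_disjoint) (auto simp: card_image inj_on_def)

lemma finite_free_coords [simp]: "finite (free_coords m n)"
  by (simp add: free_coords_def)

lemma sum_free_coords: "(\<Sum>v\<in>free_coords m n. f v) = (\<Sum>i<m. f (x_var i)) + (\<Sum>j\<in>{1..<n}. f (y_var j))"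
proof -
  have "(\<Sum>v\<in>free_coords m n. f v) = sum f (x_var ` {..<m}) + sum f (y_var ` {1..<n})"
    unfolding free_coords_def by (rule sum.union_disjoint) auto
  then show ?thesis by (simp add: sum.reindex inj_on_def)
qed

lemma sum_atMost_split:
  fixes f :: "nat \<Rightarrow> 'a::comm_monoid_add"
  assumes "n > 0" shows "(\<Sum>j\<le>n. f j) = f 0 + (\<Sum>j\<in>{1..<n}. f j) + f n"
proof -
  have "{..n} = insert 0 (insert n {1..<n})" using assms by auto
  then show ?thesis using assms by (simp add: ac_simps)
qed

lemma sum_atMost_split_last:
  fixes f :: "nat \<Rightarrow> 'a::comm_monoid_add"
  shows "(\<Sum>j\<le>n. f j) = (\<Sum>j<n. f j) + f n"
  by (metis lessThan_Suc_atMost sum.lessThan_Suc)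

context
  fixes m n :: nat
  assumes mn: "m > 0" "n > 0"
begin

lemma extend_simps:
  "i < m \<Longrightarrow> extend m n x (x_var i) = x (x_var i)" "extend m n x (x_var m) = - (\<Sum>i<m. x (x_var i))"
  "extend m n x (y_var 0) = - x (x_var 0)" "0 < j \<Longrightarrow> j < n \<Longrightarrow> extend m n x (y_var j) = x (y_var j)"
  "extend m n x (y_var n) = x (x_var 0) - (\<Sum>j\<in>{1..<n}. x (y_var j))"
  "v \<notin> coords m n \<Longrightarrow> extend m n x v = 0"
  using mn by (auto simp: extend_def coords_def split: bivar.split)

lemma extend_balanced: "extend m n x \<in> balanced m n"
  using mn by (simp add: balanced_def extend_simps sum_atMost_split_last[of _ m] sum_atMost_split[of n])

lemma extend_eq: assumes "d \<in> balanced m n" shows "extend m n d = d"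
proof
  fix v
  have d: "v \<notin> coords m n \<Longrightarrow> d v = 0" "d (x_var m) = - (\<Sum>i<m. d (x_var i))"
    "d (y_var 0) = - d (x_var 0)" "d (y_var n) = d (x_var 0) - (\<Sum>j\<in>{1..<n}. d (y_var j))" for v
    using assms mn by (auto simp: balanced_def sum_atMost_split_last[of _ m] sum_atMost_split[of n] algebra_simps)
  show "extend m n d v = d v"
  proof (cases "v \<in> coords m n")
    case False
    then show ?thesis using d(1) by (simp add: extend_simps)
  next
    case True
    then consider i where "v = x_var i" "i < m" | "v = x_var m" | "v = y_var 0" | j where "v = y_var j" "0 < j" "j < n" | "v = y_var n"
      by (force simp: coords_def)
    then show ?thesis by cases (simp_all add: extend_simps d(2-4))
  qed
qed

lemma dot_extend:
  "(\<Sum>v\<in>coords m n. a v * extend m n x v) = (\<Sum>v\<in>free_coords m n. restrict_equation m n a v * x v)"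
proof -
  have "(\<Sum>i<m. restrict_equation m n a (x_var i) * x (x_var i))
      = (\<Sum>i<m. a (x_var i) * x (x_var i) - a (x_var m) * x (x_var i) + (if i = 0 then (a (y_var n) - a (y_var 0)) * x (x_var 0) else 0))"
    by (intro sum.cong) (auto simp: restrict_equation_def algebra_simps)
  also have "\<dots> = (\<Sum>i<m. a (x_var i) * x (x_var i)) - a (x_var m) * (\<Sum>i<m. x (x_var i)) + (a (y_var n) - a (y_var 0)) * x (x_var 0)"
    using mn by (simp add: sum.distrib sum_subtractf sum_distrib_left)
  finally have 1: "(\<Sum>i<m. restrict_equation m n a (x_var i) * x (x_var i)) = \<dots>" .
  have 2: "(\<Sum>j\<in>{1..<n}. restrict_equation m n a (y_var j) * x (y_var j))
      = (\<Sum>j\<in>{1..<n}. a (y_var j) * x (y_var j)) - a (y_var n) * (\<Sum>j\<in>{1..<n}. x (y_var j))"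
    by (simp add: restrict_equation_def sum_distrib_left sum_subtractf algebra_simps)
  have 3: "(\<Sum>i<m. a (x_var i) * extend m n x (x_var i)) = (\<Sum>i<m. a (x_var i) * x (x_var i))"
    "(\<Sum>j\<in>{1..<n}. a (y_var j) * extend m n x (y_var j)) = (\<Sum>j\<in>{1..<n}. a (y_var j) * x (y_var j))"
    by (intro sum.cong; auto simp: extend_simps)+
  show ?thesis
    unfolding sum_coords sum_free_coords sum_atMost_split_last[of _ m] sum_atMost_split[OF mn(2)] 1 2 3
    by (simp add: extend_simps algebra_simps)
qed

end

section \<open>Integrality and finiteness of the fundamental set\<close>

lemma denominator_dvd_integral:
  assumes "denominator q dvd c" shows "\<exists>z. rat_of_int c * q = rat_of_int z"
proof -
  obtain a b where ab: "quotient_of q = (a, b)" using prod.exhaust by blast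
  then have q: "q = of_int a / of_int b" "b > 0" using quotient_of_div quotient_of_denom_pos by blast+
  obtain e where "c = b * e" using assms ab by (auto simp: denominator_def)
  then have "rat_of_int c * q = of_int (e * a)" using q by simp
  then show ?thesis by blast
qed

lemma denominator_pos: "denominator q > 0"
  using quotient_of_denom_pos[of q] by (cases "quotient_of q") (auto simp: denominator_def)

definition scaling :: "nat \<Rightarrow> nat \<Rightarrow> rat vec \<Rightarrow> rat vec \<Rightarrow> int" where
  "scaling m n \<rho> \<sigma> = Lcm ((\<lambda>i. denominator (\<rho> $ i)) ` {..m} \<union> (\<lambda>j. denominator (\<sigma> $ j)) ` {..n})"

lemma scaling_pos: "scaling m n \<rho> \<sigma> > 0"
proof -
  have "denominator q \<noteq> 0" for q using denominator_pos[of q] by simp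
  then have "scaling m n \<rho> \<sigma> \<noteq> 0"
    unfolding scaling_def by (subst Lcm_0_iff) (auto simp: image_iff)
  moreover have "scaling m n \<rho> \<sigma> \<ge> 0" unfolding scaling_def by simp
  ultimately show ?thesis by linarith
qed

lemma finite_bounded_vecs: "finite (A :: 'a set) \<Longrightarrow> finite {w \<in> carrier_vec N. \<forall>i<N. w $ i \<in> A}"
proof (rule finite_subset)
  show "{w \<in> carrier_vec N. \<forall>i<N. w $ i \<in> A} \<subseteq> vec_of_list ` {xs. set xs \<subseteq> A \<and> length xs = N}"
  proof
    fix w assume "w \<in> {w \<in> carrier_vec N. \<forall>i<N. w $ i \<in> A}"
    then have "w = vec_of_list (list_of_vec w)" "set (list_of_vec w) \<subseteq> A" "length (list_of_vec w) = N"
      by (auto simp: vec_list in_set_conv_nth)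
    then show "w \<in> vec_of_list ` {xs. set xs \<subseteq> A \<and> length xs = N}" by blast
  qed
  show "finite A \<Longrightarrow> finite (vec_of_list ` {xs. set xs \<subseteq> A \<and> length xs = N})"
    using finite_lists_length_eq by blast
qed

lemma finite_Eqs: "finite (Eqs m n k l)"
proof (rule finite_subset)
  show "Eqs m n k l \<subseteq> {w \<in> carrier_vec (m + 1). \<forall>i<m+1. w $ i \<in> {- int k..int k}} \<times>
      {w \<in> carrier_vec (n + 1). \<forall>i<n+1. w $ i \<in> {- int l..int l}}"
    by (auto simp: Eqs_def less_Suc_eq_le)
qed (intro finite_cartesian_product finite_bounded_vecs finite_atLeastAtMost_int)

text \<open>By uniqueness of the solution an element is determined by its set of equations, a subset
  of the finite set \<open>Eqs\<close>, and by the choice of the leading coordinate that is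
  normalised to 1.\<close>

lemma finite_fundamental_set: "finite (fundamental_set m n k l)"
proof (rule finite_subset)
  define N' where "N' b = (if b then (\<lambda>(\<rho>' :: rat vec, \<sigma>' :: rat vec). \<rho>' $ 0 = 1) else (\<lambda>(\<rho>', \<sigma>'). \<sigma>' $ 0 = 1))" for b
  \<comment> \<open>For the vectors in question the scaled vector is integral, so taking floors only
    undoes the embedding of the integers.\<close>
  define g where "g p = (case p of (\<rho>, \<sigma>) \<Rightarrow> let c = rat_of_int (scaling m n \<rho> \<sigma>) in
      (map_vec floor (c \<cdot>\<^sub>v \<rho>), map_vec floor (c \<cdot>\<^sub>v \<sigma>)))" for p
  define h where "h q = g (THE p. unique_solution m n (fst q) (N' (snd q)) p)" for q
  have floor_map: "map_vec floor (map_vec rat_of_int r) = r" for r by (auto simp: vec_eq_iff)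
  show "fundamental_set m n k l \<subseteq> h ` (Pow (Eqs m n k l) \<times> UNIV)"
  proof
    fix lam assume "lam \<in> fundamental_set m n k l"
    then obtain r s \<rho> \<sigma> E b where lam: "lam = (r, s)"
      and r: "map_vec rat_of_int r = rat_of_int (scaling m n \<rho> \<sigma>) \<cdot>\<^sub>v \<rho>"
      and s: "map_vec rat_of_int s = rat_of_int (scaling m n \<rho> \<sigma>) \<cdot>\<^sub>v \<sigma>"
      and E: "E \<subseteq> Eqs m n k l" "unique_solution m n E (N' b) (\<rho>, \<sigma>)"
      unfolding fundamental_set_def scaling_def N'_def by (smt (verit, ccfv_threshold) case_prodE mem_Collect_eq)
    have "(THE p. unique_solution m n E (N' b) p) = (\<rho>, \<sigma>)"
      by (rule the_equality[where a = "(\<rho>, \<sigma>)"]) (use E(2) in \<open>auto simp: unique_solution_def\<close>)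
    then have "lam = h (E, b)"
      using floor_map[of r] floor_map[of s] r s by (simp add: h_def g_def lam Let_def)
    then show "lam \<in> h ` (Pow (Eqs m n k l) \<times> UNIV)" using E(1) by auto
  qed
  show "finite (h ` (Pow (Eqs m n k l) \<times> UNIV))"
    by (intro finite_imageI finite_cartesian_product) (auto simp: finite_Eqs)
qed

definition weight_fun :: "weights \<Rightarrow> bivar \<Rightarrow> int" where
  "weight_fun lam v = (case v of x_var i \<Rightarrow> fst lam $ i | y_var j \<Rightarrow> snd lam $ j)"

lemma weight_fun_simps [simp]: "weight_fun lam (x_var i) = fst lam $ i" "weight_fun lam (y_var j) = snd lam $ j"
  by (simp_all add: weight_fun_def)

definition weight :: "nat \<Rightarrow> nat \<Rightarrow> (bivar \<Rightarrow> int) \<Rightarrow> bivar monomial \<Rightarrow> int" where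
  "weight m n z I = (\<Sum>v\<in>coords m n. z v * int (Poly_Mapping.lookup I v))"

lemma pairing_eq_weight: "pairing m n I lam = weight m n (weight_fun lam) I"
  by (simp add: pairing_def weight_def sum_coords)

lemma fundamental_set_weight:
  assumes "lam \<in> fundamental_set m n k l"
  shows "dominant m n (weight_fun lam)" "fst lam $ 0 > 0 \<or> snd lam $ 0 > 0"
proof -
  obtain \<rho> \<sigma> E where c: "\<rho> \<in> carrier_vec (m + 1)" "\<sigma> \<in> carrier_vec (n + 1)"
    and r: "map_vec rat_of_int (fst lam) = rat_of_int (scaling m n \<rho> \<sigma>) \<cdot>\<^sub>v \<rho>"
    and s: "map_vec rat_of_int (snd lam) = rat_of_int (scaling m n \<rho> \<sigma>) \<cdot>\<^sub>v \<sigma>"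
    and dom: "\<forall>i<m. \<rho> $ i \<ge> \<rho> $ (i + 1)" "\<forall>j<n. \<sigma> $ j \<ge> \<sigma> $ (j + 1)"
      "(\<Sum>i\<le>m. \<rho> $ i) = 0" "(\<Sum>j\<le>n. \<sigma> $ j) = 0"
    and E: "unique_solution m n E (\<lambda>(\<rho>', \<sigma>'). \<rho>' $ 0 = 1) (\<rho>, \<sigma>) \<or>
          unique_solution m n E (\<lambda>(\<rho>', \<sigma>'). \<sigma>' $ 0 = 1) (\<rho>, \<sigma>)"
    using assms unfolding fundamental_set_def scaling_def by (cases lam) auto
  let ?c = "scaling m n \<rho> \<sigma>"
  have dims: "dim_vec (fst lam) = m + 1" "dim_vec (snd lam) = n + 1"
    using arg_cong[OF r, of dim_vec] arg_cong[OF s, of dim_vec] c by auto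
  have R: "rat_of_int (fst lam $ i) = of_int ?c * \<rho> $ i" if "i \<le> m" for i
    using arg_cong[OF r, of "\<lambda>v. v $ i"] that dims c by simp
  have S: "rat_of_int (snd lam $ i) = of_int ?c * \<sigma> $ i" if "i \<le> n" for i
    using arg_cong[OF s, of "\<lambda>v. v $ i"] that dims c by simp
  have cp: "rat_of_int ?c > 0" using scaling_pos by simp
  have "fst lam $ (i + 1) \<le> fst lam $ i" if "i < m" for i
  proof -
    have "rat_of_int (fst lam $ (i + 1)) \<le> rat_of_int (fst lam $ i)"
      using dom(1) that cp by (simp add: R)
    then show ?thesis by (simp only: of_int_le_iff)
  qed
  moreover have "snd lam $ (i + 1) \<le> snd lam $ i" if "i < n" for i
  proof -
    have "rat_of_int (snd lam $ (i + 1)) \<le> rat_of_int (snd lam $ i)"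
      using dom(2) that cp by (simp add: S)
    then show ?thesis by (simp only: of_int_le_iff)
  qed
  moreover have "rat_of_int (\<Sum>i\<le>m. fst lam $ i) = 0" "rat_of_int (\<Sum>i\<le>n. snd lam $ i) = 0"
    using dom(3,4) by (simp_all add: R S flip: sum_distrib_left)
  then have "(\<Sum>i\<le>m. fst lam $ i) = 0" "(\<Sum>i\<le>n. snd lam $ i) = 0" by (simp_all only: of_int_eq_0_iff)
  ultimately show "dominant m n (weight_fun lam)" by (simp add: dominant_def)
  from E have "\<rho> $ 0 = 1 \<or> \<sigma> $ 0 = 1" by (auto simp: unique_solution_def)
  then have "rat_of_int (fst lam $ 0) > 0 \<or> rat_of_int (snd lam $ 0) > 0"
    using cp by (auto simp: R S)
  then show "fst lam $ 0 > 0 \<or> snd lam $ 0 > 0" by simp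
qed

lemma unique_solutionI:
  "solves m n E p \<Longrightarrow> N p \<Longrightarrow> (\<And>q. solves m n E q \<Longrightarrow> N q \<Longrightarrow> q = p) \<Longrightarrow> unique_solution m n E N p"
  unfolding unique_solution_def by blast

text \<open>The weight \<open>y\<close> is scaled to the slice
  \<open>\<rho>\<^sub>0 + \<sigma>\<^sub>0 = 1\<close> of the cone of those dominant vectors for
  which a fixed monomial \<open>I0\<close> keeps the least weight in \<open>S\<close>. A vertex of
  this polytope is reached without decreasing the weight of \<open>I0\<close>, so all weights on
  \<open>S\<close> stay non-negative or positive. The equations that are tight at the vertex belong
  to \<open>Eqs\<close> and determine its ray.\<close>

theorem fundamental_ray:
  fixes y :: "bivar \<Rightarrow> int"
  assumes pos: "m > 0" "n > 0" "k > 0" "l > 0" and S: "S \<subseteq> bimonomials m n k l" "finite S" "S \<noteq> {}"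
    and y: "dominant m n y" "\<exists>v\<in>coords m n. y v \<noteq> 0" "\<And>I. I \<in> S \<Longrightarrow> 0 \<le> weight m n y I"
  shows "\<exists>lam\<in>fundamental_set m n k l. (\<forall>I\<in>S. 0 \<le> pairing m n I lam) \<and>
    ((\<forall>I\<in>S. 0 < weight m n y I) \<longrightarrow> (\<forall>I\<in>S. 0 < pairing m n I lam))"
proof -
  let ?J = "coords m n" and ?q = "rat_of_int"
  define dot where "dot a z = (\<Sum>v\<in>?J. a v * z v)" for a z :: "bivar \<Rightarrow> rat"
  define lev where "lev z = z (x_var 0) + z (y_var 0)" for z :: "bivar \<Rightarrow> rat"
  define yq where "yq v = (if v \<in> ?J then ?q (y v) else 0)" for v
  have J: "i \<le> m \<Longrightarrow> x_var i \<in> ?J" "j \<le> n \<Longrightarrow> y_var j \<in> ?J" for i j by (auto simp: coords_def)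
  have yq_dom: "dominant m n yq"
    using y(1) J by (auto simp: dominant_def yq_def simp flip: of_int_sum)
  have "lev yq \<noteq> 0"
  proof
    assume "lev yq = 0"
    then have "yq v = 0" if "v \<in> ?J" for v using dominant_nonneg(3)[OF yq_dom _ that] by (simp add: lev_def)
    with y(2) show False by (auto simp: yq_def)
  qed
  then have l_pos: "lev yq > 0" using dominant_nonneg(1,2)[OF yq_dom] by (simp add: lev_def)
  define z where "z v = yq v / lev yq" for v
  have z_dom: "dominant m n z"
    using yq_dom l_pos by (auto simp: dominant_def z_def divide_right_mono simp flip: sum_divide_distrib)
  have lz: "lev z = 1" using l_pos by (simp add: lev_def z_def flip: add_divide_distrib)
  define mono where "mono I v = rat_of_nat (Poly_Mapping.lookup I v)" for I and v :: bivar
  have dot_z: "dot (mono I) z = ?q (weight m n y I) / lev yq" for I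
    unfolding dot_def z_def weight_def by (simp add: sum_divide_distrib mono_def yq_def mult.commute)
  obtain I0 where I0: "I0 \<in> S" "\<And>I. I \<in> S \<Longrightarrow> weight m n y I0 \<le> weight m n y I"
    using ex_min_if_finite[of "weight m n y ` S"] S(2,3) by (auto simp: not_less)
  \<comment> \<open>The monomials themselves have coefficient sums \<open>k\<close> and
    \<open>l\<close> and are not in \<open>Eqs\<close>. The constraints therefore compare each
    monomial with \<open>I0\<close>, and the weight of \<open>I0\<close> becomes the
    objective.\<close>
  define A where "A = (\<lambda>I. monomial_difference I I0) ` S \<union> (\<lambda>i. difference (x_var i) (x_var (i + 1))) ` {..<m}
    \<union> (\<lambda>j. difference (y_var j) (y_var (j + 1))) ` {..<n}"
  define Aq where "Aq = (\<lambda>e v. ?q (e v)) ` A"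
  have A_off: "e v = 0" if "e \<in> A" "v \<notin> ?J" for e v
    using that(1) unfolding A_def
  proof (elim UnE imageE)
    fix I assume "e = monomial_difference I I0" "I \<in> S"
    then show ?thesis
      using S(1) I0(1) bimonomialsD(1)[OF subsetD[OF S(1)] that(2)] by (simp add: monomial_difference_def)
  next
    fix i assume "e = difference (x_var i) (x_var (i + 1))" "i \<in> {..<m}"
    moreover from this have "v \<noteq> x_var i" "v \<noteq> x_var (i + 1)" using that(2) J(1)[of i] J(1)[of "i + 1"] by auto
    ultimately show ?thesis by (simp add: difference_def)
  next
    fix i assume "e = difference (y_var i) (y_var (i + 1))" "i \<in> {..<n}"
    moreover from this have "v \<noteq> y_var i" "v \<noteq> y_var (i + 1)" using that(2) J(2)[of i] J(2)[of "i + 1"] by auto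
    ultimately show ?thesis by (simp add: difference_def)
  qed
  have A_Eqs: "encode_equation m n e \<in> Eqs m n k l" if "e \<in> A" for e
    using that unfolding A_def
  proof (elim UnE imageE)
    fix I assume "e = monomial_difference I I0" "I \<in> S"
    then show ?thesis using S(1) I0(1) monomial_difference_Eqs by blast
  next
    fix i assume "e = difference (x_var i) (x_var (i + 1))" "i \<in> {..<m}"
    then show ?thesis using difference_Eqs(1)[OF pos(3,4)] by simp
  next
    fix i assume "e = difference (y_var i) (y_var (i + 1))" "i \<in> {..<n}"
    then show ?thesis using difference_Eqs(2)[OF pos(3,4)] by simp
  qed
  have finA: "finite A" using S(2) by (simp add: A_def)
  have dot_md: "dot (\<lambda>v. ?q (monomial_difference I I0 v)) u = dot (mono I) u - dot (mono I0) u" for I u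
    by (simp add: dot_def monomial_difference_def mono_def algebra_simps sum_subtractf)
  have dot_dx: "dot (\<lambda>v. ?q (difference (x_var i) (x_var (i + 1)) v)) u = u (x_var i) - u (x_var (i + 1))" if "i < m" for i u
    unfolding dot_def by (rule difference_dot) (use that J in auto)
  have dot_dy: "dot (\<lambda>v. ?q (difference (y_var j) (y_var (j + 1)) v)) u = u (y_var j) - u (y_var (j + 1))" if "j < n" for j u
    unfolding dot_def by (rule difference_dot) (use that J in auto)
  have A_dom: "dominant m n u" if "\<And>a. a \<in> Aq \<Longrightarrow> 0 \<le> dot a u" "(\<Sum>i\<le>m. u (x_var i)) = 0" "(\<Sum>j\<le>n. u (y_var j)) = 0" for u
  proof -
    have "u (x_var (i + 1)) \<le> u (x_var i)" if "i < m" for i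
      using \<open>\<And>a. a \<in> Aq \<Longrightarrow> 0 \<le> dot a u\<close>[of "\<lambda>v. ?q (difference (x_var i) (x_var (i + 1)) v)"] dot_dx[OF that, of u] that
      by (auto simp: Aq_def A_def)
    moreover have "u (y_var (j + 1)) \<le> u (y_var j)" if "j < n" for j
      using \<open>\<And>a. a \<in> Aq \<Longrightarrow> 0 \<le> dot a u\<close>[of "\<lambda>v. ?q (difference (y_var j) (y_var (j + 1)) v)"] dot_dy[OF that, of u] that
      by (auto simp: Aq_def A_def)
    ultimately show ?thesis using that(2,3) by (simp add: dominant_def)
  qed
  have "\<exists>z'. (\<lambda>j. z' j - z j) \<in> balanced m n \<and> (\<forall>a\<in>Aq. 0 \<le> dot a z') \<and> dot (mono I0) z \<le> dot (mono I0) z' \<and>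
     (\<forall>d\<in>balanced m n. (\<forall>a\<in>Aq. dot a z' = 0 \<longrightarrow> dot a d = 0) \<longrightarrow> (\<forall>j. d j = 0))"
    unfolding dot_def
  proof (rule polytope_vertex)
    show "finite Aq" using finA by (simp add: Aq_def)
    show "(\<lambda>j. u j + v j) \<in> balanced m n" if "u \<in> balanced m n" "v \<in> balanced m n" for u v
      using that by (auto simp: balanced_def sum.distrib)
    show "(\<lambda>j. c * u j) \<in> balanced m n" if "u \<in> balanced m n" for c u
      using that by (auto simp: balanced_def simp flip: sum_distrib_left distrib_left)
    show "(\<lambda>_. 0) \<in> balanced m n" by (simp add: balanced_def)
    show "d v = 0" if d: "d \<in> balanced m n" "\<And>a. a \<in> Aq \<Longrightarrow> 0 \<le> (\<Sum>v\<in>?J. a v * d v)" for d v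
      using dominant_nonneg(3)[OF A_dom, of d v] d by (cases "v \<in> ?J") (auto simp: balanced_def dot_def)
    show "0 \<le> (\<Sum>v\<in>?J. a v * z v)" if "a \<in> Aq" for a
    proof -
      have "0 \<le> dot (\<lambda>v. ?q (monomial_difference I I0 v)) z" if "I \<in> S" for I
        unfolding dot_md dot_z using I0(2)[OF that] l_pos by (simp add: divide_right_mono)
      moreover have "0 \<le> dot (\<lambda>v. ?q (difference (x_var i) (x_var (i + 1)) v)) z" if "i < m" for i
        unfolding dot_dx[OF that] using z_dom that by (simp add: dominant_def)
      moreover have "0 \<le> dot (\<lambda>v. ?q (difference (y_var i) (y_var (i + 1)) v)) z" if "i < n" for i
        unfolding dot_dy[OF that] using z_dom that by (simp add: dominant_def)
      ultimately show ?thesis using that by (auto simp: Aq_def A_def dot_def)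
    qed
  qed
  then obtain z' where raw: "(\<lambda>j. z' j - z j) \<in> balanced m n \<and> (\<forall>a\<in>Aq. 0 \<le> dot a z') \<and>
     dot (mono I0) z \<le> dot (mono I0) z' \<and>
     (\<forall>d\<in>balanced m n. (\<forall>a\<in>Aq. dot a z' = 0 \<longrightarrow> dot a d = 0) \<longrightarrow> (\<forall>j. d j = 0))"
    by blast
  have z': "(\<lambda>j. z' j - z j) \<in> balanced m n" "\<And>a. a \<in> Aq \<Longrightarrow> 0 \<le> dot a z'" "dot (mono I0) z \<le> dot (mono I0) z'"
    using raw by simp_all
  have vert: "d j = 0" if "d \<in> balanced m n" "\<And>a. a \<in> Aq \<Longrightarrow> dot a z' = 0 \<Longrightarrow> dot a d = 0" for d j
    using raw that by simp
  have z'_off: "z' v = 0" if "v \<notin> ?J" for v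
    using z'(1) that by (auto simp: balanced_def z_def yq_def)
  have z'_sum: "(\<Sum>i\<le>m. z' (x_var i)) = 0" "(\<Sum>j\<le>n. z' (y_var j)) = 0" "lev z' = 1"
    using z'(1) z_dom lz by (auto simp: balanced_def dominant_def lev_def sum_subtractf)
  have z'_dom: "dominant m n z'" by (rule A_dom) (use z'(2) z'_sum in auto)
  define T where "T = {e\<in>A. dot (\<lambda>v. ?q (e v)) z' = 0}"
  have vertT: "d v = 0" if "d \<in> balanced m n" "\<And>e. e \<in> T \<Longrightarrow> dot (\<lambda>v. ?q (e v)) d = 0" for d v
    by (rule vert[OF that(1)]) (use that(2) in \<open>auto simp: Aq_def T_def\<close>)
  \<comment> \<open>A balanced vector has \<open>m + n - 1\<close> free coordinates, so this many
    tight equations suffice to exclude non-zero balanced solutions.\<close>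
  have "\<exists>E\<subseteq>T. card E = card (free_coords m n) \<and>
      (\<forall>x. (\<forall>e\<in>E. (\<Sum>v\<in>free_coords m n. restrict_equation m n (\<lambda>v. ?q (e v)) v * x v) = 0) \<longrightarrow> (\<forall>v\<in>free_coords m n. x v = 0))"
  proof (rule independent_equations)
    show "finite T" using finA by (simp add: T_def)
    fix x v assume x: "\<And>e. e \<in> T \<Longrightarrow> (\<Sum>v\<in>free_coords m n. restrict_equation m n (\<lambda>v. ?q (e v)) v * x v) = 0"
      and v: "v \<in> free_coords m n"
    have "extend m n x v = 0"
      by (rule vertT[OF extend_balanced[OF pos(1,2)]]) (simp add: dot_def dot_extend[OF pos(1,2)] x)
    then show "x v = 0" using v pos by (auto simp: free_coords_def extend_simps[OF pos(1,2)])
  qed simp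
  then obtain E where E: "E \<subseteq> T" "card E = m + n - 1"
    and E0: "\<And>x. (\<forall>e\<in>E. (\<Sum>v\<in>free_coords m n. restrict_equation m n (\<lambda>v. ?q (e v)) v * x v) = 0) \<Longrightarrow> \<forall>v\<in>free_coords m n. x v = 0"
    unfolding card_free_coords[OF pos(1,2)] by blast
  have E_zero: "d v = 0" if d: "d \<in> balanced m n" "\<And>e. e \<in> E \<Longrightarrow> dot (\<lambda>v. ?q (e v)) d = 0" for d v
  proof -
    have "\<forall>v\<in>free_coords m n. d v = 0"
      by (rule E0) (use d(2) extend_eq[OF pos(1,2) d(1)] in \<open>simp add: dot_def flip: dot_extend[OF pos(1,2)]\<close>)
    then have "extend m n d v = 0"
      using pos by (auto simp: free_coords_def extend_def split: bivar.split intro!: sum.neutral)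
    then show ?thesis by (simp add: extend_eq[OF pos(1,2) d(1)])
  qed
  have EA: "E \<subseteq> A" using E(1) by (auto simp: T_def)
  define E' where "E' = encode_equation m n ` E"
  \<comment> \<open>Encoding forgets the values outside \<open>coords m n\<close>, where all members
    of \<open>A\<close> vanish; hence the number of equations is preserved.\<close>
  have "inj_on (encode_equation m n) E"
  proof (rule inj_onI)
    fix e e' assume "e \<in> E" "e' \<in> E" "encode_equation m n e = encode_equation m n e'"
    then show "e = e'" using encode_equation_eqD A_off EA by (metis ext subsetD)
  qed
  then have E': "E' \<subseteq> Eqs m n k l" "finite E'" "card E' = m + n - 1"
    using EA A_Eqs E(2) finA finite_subset by (auto simp: E'_def card_image)
  \<comment> \<open>At level 1 one of the two leading coordinates is positive, and dividing by it
    gives the required normalisation.\<close>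
  define t where "t = (if z' (x_var 0) > 0 then z' (x_var 0) else z' (y_var 0))"
  have t: "t > 0" using z'_sum(3) dominant_nonneg(1,2)[OF z'_dom] by (auto simp: t_def lev_def)
  define p where "p v = z' v / t" for v
  define \<rho> where "\<rho> = vec (m + 1) (\<lambda>i. p (x_var i))"
  define \<sigma> where "\<sigma> = vec (n + 1) (\<lambda>j. p (y_var j))"
  have solves_iff: "solves m n E' (\<rho>', \<sigma>') \<longleftrightarrow> \<rho>' \<in> carrier_vec (m + 1) \<and> \<sigma>' \<in> carrier_vec (n + 1) \<and>
     (\<Sum>i\<le>m. \<rho>' $ i) = 0 \<and> (\<Sum>j\<le>n. \<sigma>' $ j) = 0 \<and>
     (\<forall>e\<in>E. dot (\<lambda>v. ?q (e v)) (\<lambda>v. case v of x_var i \<Rightarrow> \<rho>' $ i | y_var j \<Rightarrow> \<sigma>' $ j) = 0)" for \<rho>' \<sigma>'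
    unfolding solves_def E'_def encode_equation_def by (simp add: dot_def sum_coords)
  have p_dom: "dominant m n p"
    using z'_dom t by (auto simp: dominant_def p_def divide_right_mono simp flip: sum_divide_distrib)
  have sol: "solves m n E' (\<rho>, \<sigma>)"
  proof -
    have "dot (\<lambda>v. ?q (e v)) (\<lambda>v. case v of x_var i \<Rightarrow> \<rho> $ i | y_var j \<Rightarrow> \<sigma> $ j) = 0" if "e \<in> E" for e
    proof -
      have "dot (\<lambda>v. ?q (e v)) (\<lambda>v. case v of x_var i \<Rightarrow> \<rho> $ i | y_var j \<Rightarrow> \<sigma> $ j) = dot (\<lambda>v. ?q (e v)) z' / t"
        unfolding dot_def sum_coords by (simp add: \<rho>_def \<sigma>_def p_def add_divide_distrib sum_divide_distrib)
      then show ?thesis using that E(1) by (auto simp: T_def)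
    qed
    moreover have "\<rho> \<in> carrier_vec (m + 1)" "\<sigma> \<in> carrier_vec (n + 1)" "(\<Sum>i\<le>m. \<rho> $ i) = 0" "(\<Sum>j\<le>n. \<sigma> $ j) = 0"
      using p_dom by (simp_all add: \<rho>_def \<sigma>_def dominant_def)
    ultimately show ?thesis unfolding solves_iff by blast
  qed
  have uniq: "\<exists>c. (\<forall>i\<le>m. \<rho>' $ i = c * z' (x_var i)) \<and> (\<forall>j\<le>n. \<sigma>' $ j = c * z' (y_var j))" if "solves m n E' (\<rho>', \<sigma>')" for \<rho>' \<sigma>'
  proof -
    define w where "w v = (case v of x_var i \<Rightarrow> \<rho>' $ i | y_var j \<Rightarrow> \<sigma>' $ j)" for v
    \<comment> \<open>Subtracting the multiple of \<open>z'\<close> of the same level leaves a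
      balanced solution of the equations in \<open>E\<close>, which must be 0.\<close>
    define d where "d v = (if v \<in> ?J then w v - lev w * z' v else 0)" for v
    have w: "(\<Sum>i\<le>m. w (x_var i)) = 0" "(\<Sum>j\<le>n. w (y_var j)) = 0" "\<And>e. e \<in> E \<Longrightarrow> dot (\<lambda>v. ?q (e v)) w = 0"
      using that unfolding solves_iff w_def[abs_def] by auto
    have "w (x_var 0) - lev w * z' (x_var 0) + (w (y_var 0) - lev w * z' (y_var 0)) = lev w - lev w * lev z'"
      by (simp add: lev_def algebra_simps)
    then have "d \<in> balanced m n"
      using w z'_sum J by (simp add: balanced_def d_def sum_subtractf flip: sum_distrib_left)
    moreover have "dot (\<lambda>v. ?q (e v)) d = 0" if "e \<in> E" for e
    proof -
      have "dot (\<lambda>v. ?q (e v)) d = dot (\<lambda>v. ?q (e v)) w - lev w * dot (\<lambda>v. ?q (e v)) z'"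
        unfolding dot_def sum_distrib_left sum_subtractf[symmetric] by (intro sum.cong) (auto simp: d_def algebra_simps)
      then show ?thesis using w(3)[OF that] that E(1) by (auto simp: T_def)
    qed
    ultimately have "d v = 0" for v using E_zero by blast
    then have "w v = lev w * z' v" if "v \<in> ?J" for v using that by (metis d_def eq_iff_diff_eq_0)
    then have "\<rho>' $ i = lev w * z' (x_var i)" "\<sigma>' $ j = lev w * z' (y_var j)" if "i \<le> m" "j \<le> n" for i j
      using J that by (force simp: w_def)+
    then show ?thesis by (intro exI[of _ "lev w"]) auto
  qed
  have unique: "(\<rho>', \<sigma>') = (\<rho>, \<sigma>)" if "solves m n E' (\<rho>', \<sigma>')"
    "if z' (x_var 0) > 0 then \<rho>' $ 0 = 1 else \<sigma>' $ 0 = 1" for \<rho>' \<sigma>'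
  proof -
    obtain c where c: "\<forall>i\<le>m. \<rho>' $ i = c * z' (x_var i)" "\<forall>j\<le>n. \<sigma>' $ j = c * z' (y_var j)" using uniq[OF \<open>solves m n E' (\<rho>', \<sigma>')\<close>] by blast
    have "c * t = 1" using that(2) c by (auto simp: t_def split: if_splits)
    then have "c = 1 / t" using t by (simp add: field_simps)
    then show ?thesis
      using that(1) c by (auto simp: solves_def \<rho>_def \<sigma>_def p_def less_Suc_eq_le)
  qed
  have us: "unique_solution m n E' (\<lambda>(\<rho>', \<sigma>'). \<rho>' $ 0 = 1) (\<rho>, \<sigma>) \<or> unique_solution m n E' (\<lambda>(\<rho>', \<sigma>'). \<sigma>' $ 0 = 1) (\<rho>, \<sigma>)"
  proof (cases "z' (x_var 0) > 0")
    case True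
    then have "\<rho> $ 0 = 1" using t by (simp add: \<rho>_def p_def t_def)
    moreover have "q = (\<rho>, \<sigma>)" if "solves m n E' q" "(case q of (\<rho>', \<sigma>') \<Rightarrow> \<rho>' $ 0 = 1)" for q
      using unique[of "fst q" "snd q"] that True by (cases q) auto
    ultimately have "unique_solution m n E' (\<lambda>(\<rho>', \<sigma>'). \<rho>' $ 0 = 1) (\<rho>, \<sigma>)"
      by (intro unique_solutionI[OF sol]) (simp only: prod.case, blast)
    then show ?thesis ..
  next
    case False
    then have "\<sigma> $ 0 = 1" using t by (simp add: \<sigma>_def p_def t_def)
    moreover have "q = (\<rho>, \<sigma>)" if "solves m n E' q" "(case q of (\<rho>', \<sigma>') \<Rightarrow> \<sigma>' $ 0 = 1)" for q
      using unique[of "fst q" "snd q"] that False by (cases q) auto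
    ultimately have "unique_solution m n E' (\<lambda>(\<rho>', \<sigma>'). \<sigma>' $ 0 = 1) (\<rho>, \<sigma>)"
      by (intro unique_solutionI[OF sol]) (simp only: prod.case, blast)
    then show ?thesis ..
  qed
  define c where "c = scaling m n \<rho> \<sigma>"
  have cp: "?q c > 0" using scaling_pos by (simp add: c_def)
  have int_x: "\<exists>u. ?q c * \<rho> $ i = ?q u" if "i \<le> m" for i
    by (rule denominator_dvd_integral) (use that in \<open>auto simp: c_def scaling_def intro!: dvd_Lcm\<close>)
  have int_y: "\<exists>u. ?q c * \<sigma> $ j = ?q u" if "j \<le> n" for j
    by (rule denominator_dvd_integral) (use that in \<open>auto simp: c_def scaling_def intro!: dvd_Lcm\<close>)
  define r where "r = vec (m + 1) (\<lambda>i. \<lfloor>?q c * \<rho> $ i\<rfloor>)"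
  define s where "s = vec (n + 1) (\<lambda>j. \<lfloor>?q c * \<sigma> $ j\<rfloor>)"
  have r_eq: "?q (r $ i) = ?q c * p (x_var i)" if "i \<le> m" for i
    using int_x[OF that] that by (auto simp: r_def \<rho>_def)
  have s_eq: "?q (s $ j) = ?q c * p (y_var j)" if "j \<le> n" for j
    using int_y[OF that] that by (auto simp: s_def \<sigma>_def)
  have "(r, s) \<in> fundamental_set m n k l"
    unfolding fundamental_set_def mem_Collect_eq prod.case
  proof (rule exI[of _ \<rho>], rule exI[of _ \<sigma>], rule exI[of _ c], intro conjI)
    have dims: "dim_vec r = m + 1" "dim_vec s = n + 1" "dim_vec \<rho> = m + 1" "dim_vec \<sigma> = n + 1"
      by (simp_all add: r_def s_def \<rho>_def \<sigma>_def)
    have "\<rho> $ i = p (x_var i)" if "i \<le> m" for i using that by (simp add: \<rho>_def)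
    then show "map_vec ?q r = ?q c \<cdot>\<^sub>v \<rho>" by (intro eq_vecI) (simp_all add: dims r_eq less_Suc_eq_le)
    have "\<sigma> $ i = p (y_var i)" if "i \<le> n" for i using that by (simp add: \<sigma>_def)
    then show "map_vec ?q s = ?q c \<cdot>\<^sub>v \<sigma>" by (intro eq_vecI) (simp_all add: dims s_eq less_Suc_eq_le)
    show "c = Lcm ((\<lambda>i. denominator (\<rho> $ i)) ` {..m} \<union> (\<lambda>j. denominator (\<sigma> $ j)) ` {..n})"
      by (simp add: c_def scaling_def)
    show "\<exists>E\<subseteq>Eqs m n k l. finite E \<and> card E = m + n - 1 \<and> (unique_solution m n E (\<lambda>(\<rho>', \<sigma>'). \<rho>' $ 0 = 1) (\<rho>, \<sigma>) \<or>
          unique_solution m n E (\<lambda>(\<rho>', \<sigma>'). \<sigma>' $ 0 = 1) (\<rho>, \<sigma>))"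
      using E' us by blast
  qed (use p_dom in \<open>auto simp: \<rho>_def \<sigma>_def dominant_def\<close>)
  moreover have pair: "?q (pairing m n I (r, s)) = ?q c / t * dot (mono I) z'" for I
    unfolding pairing_def dot_def sum_coords
    by (simp add: r_eq s_eq p_def mono_def sum_distrib_left distrib_left mult_ac)
  have ge: "dot (mono I0) z \<le> dot (mono I) z'" if "I \<in> S" for I
  proof -
    have "0 \<le> dot (\<lambda>v. ?q (monomial_difference I I0 v)) z'" by (rule z'(2)) (use that in \<open>auto simp: Aq_def A_def\<close>)
    then show ?thesis using z'(3) by (simp add: dot_md)
  qed
  have "0 \<le> pairing m n I (r, s)" if "I \<in> S" for I
  proof -
    have "0 \<le> dot (mono I0) z" unfolding dot_z using y(3)[OF I0(1)] l_pos by simp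
    then have "0 \<le> ?q (pairing m n I (r, s))" unfolding pair using ge[OF that] cp t by simp
    then show ?thesis by simp
  qed
  moreover have "0 < pairing m n I (r, s)" if "I \<in> S" "\<forall>I\<in>S. 0 < weight m n y I" for I
  proof -
    have "0 < dot (mono I0) z" unfolding dot_z using that(2) I0(1) l_pos by simp
    then have "0 < ?q (pairing m n I (r, s))" unfolding pair using ge[OF that(1)] cp t by simp
    then show ?thesis by simp
  qed
  ultimately show ?thesis by blast
qed

section \<open>The action on forms\<close>

text \<open>Pairs of words index a basis of a tensor power, and monomials arise by forgetting the
  order of the letters. On words a linear substitution acts by products of matrix entries, which
  makes its adjoint easy to see.\<close>

definition indices :: "nat \<Rightarrow> nat \<Rightarrow> nat \<Rightarrow> nat \<Rightarrow> (nat list \<times> nat list) set" where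
  "indices m n k l = {xs. length xs = k \<and> set xs \<subseteq> {..m}} \<times> {ys. length ys = l \<and> set ys \<subseteq> {..n}}"

definition letters :: "nat list \<times> nat list \<Rightarrow> bivar list" where
  "letters e = map x_var (fst e) @ map y_var (snd e)"

definition word_monomial :: "'v list \<Rightarrow> 'v monomial" where
  "word_monomial vs = (\<Sum>v\<leftarrow>vs. Poly_Mapping.single v 1)"

abbreviation index_monomial :: "nat list \<times> nat list \<Rightarrow> bivar monomial" where
  "index_monomial e \<equiv> word_monomial (letters e)"

lemma prod_list_Var: "prod_list (map Var vs) = Poly_Mapping.single (word_monomial vs) 1"
  by (induction vs) (simp_all add: word_monomial_def Var_def mult_single)

lemma lookup_word_monomial: "Poly_Mapping.lookup (word_monomial vs) v = count (mset vs) v"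
  by (induction vs) (auto simp: word_monomial_def lookup_add lookup_single when_def)

lemma finite_lists_length: "finite A \<Longrightarrow> finite {xs. length xs = k \<and> set xs \<subseteq> A}"
  using finite_lists_length_eq[of A k] by (simp add: conj_commute)

lemma finite_indices [simp]: "finite (indices m n k l)"
  unfolding indices_def by (intro finite_cartesian_product finite_lists_length) auto

lemma count_map_constructor:
  "count (mset (map x_var xs)) (x_var i) = count (mset xs) i" "count (mset (map y_var xs)) (y_var i) = count (mset xs) i"
  "count (mset (map y_var xs)) (x_var i) = 0" "count (mset (map x_var xs)) (y_var i) = 0"
  by (induction xs) auto

lemma lookup_index_monomial:
  "Poly_Mapping.lookup (index_monomial (xs, ys)) (x_var i) = count (mset xs) i"
  "Poly_Mapping.lookup (index_monomial (xs, ys)) (y_var i) = count (mset ys) i"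
  by (simp_all add: lookup_word_monomial letters_def count_map_constructor del: mset_map)

lemma sum_count_length: "set xs \<subseteq> {..m} \<Longrightarrow> (\<Sum>i\<le>m. count (mset xs) i) = length xs" for xs :: "nat list"
  using sum.mono_neutral_right[of "{..m}" "set xs" "count (mset xs)"] size_multiset_overloaded_eq[of "mset xs"]
  by (auto simp: count_eq_zero_iff)

lemma bimonomials_eq_image: "bimonomials m n k l = index_monomial ` indices m n k l"
proof (intro equalityI subsetI)
  fix I assume I: "I \<in> bimonomials m n k l"
  obtain xs where xs: "mset xs = (\<Sum>i\<le>m. replicate_mset (Poly_Mapping.lookup I (x_var i)) i)" using ex_mset by blast
  obtain ys where ys: "mset ys = (\<Sum>i\<le>n. replicate_mset (Poly_Mapping.lookup I (y_var i)) i)" using ex_mset by blast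
  have cx: "count (mset xs) i = (if i \<le> m then Poly_Mapping.lookup I (x_var i) else 0)" for i
    unfolding xs count_sum count_replicate_mset by (auto simp: sum.delta)
  have cy: "count (mset ys) i = (if i \<le> n then Poly_Mapping.lookup I (y_var i) else 0)" for i
    unfolding ys count_sum count_replicate_mset by (auto simp: sum.delta)
  have "set xs \<subseteq> {..m}" "set ys \<subseteq> {..n}"
    using cx cy by (metis atMost_iff count_mset_0_iff subsetI)+
  moreover from this have "length xs = k" "length ys = l"
    using sum_count_length[of xs m] sum_count_length[of ys n] cx cy bimonomialsD(4,5)[OF I] by simp_all
  ultimately have "(xs, ys) \<in> indices m n k l" by (simp add: indices_def)
  moreover have "I = index_monomial (xs, ys)"
  proof (rule poly_mapping_eqI)
    fix v show "Poly_Mapping.lookup I v = Poly_Mapping.lookup (index_monomial (xs, ys)) v"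
      using bimonomialsD(1)[OF I, of v]
      by (cases v) (auto simp: lookup_index_monomial cx cy coords_def)
  qed
  ultimately show "I \<in> index_monomial ` indices m n k l" by blast
next
  fix I assume "I \<in> index_monomial ` indices m n k l"
  then obtain xs ys where e: "I = index_monomial (xs, ys)" "length xs = k" "length ys = l" "set xs \<subseteq> {..m}" "set ys \<subseteq> {..n}"
    by (auto simp: indices_def)
  have "v \<in> x_var ` {..m} \<union> y_var ` {..n}" if "Poly_Mapping.lookup I v \<noteq> 0" for v
    using that e(4,5) unfolding e(1) by (cases v) (auto simp: lookup_index_monomial)
  then show "I \<in> bimonomials m n k l"
    using e sum_count_length[OF e(4)] sum_count_length[OF e(5)]
    by (auto simp: bimonomials_def lookup_index_monomial in_keys_iff)
qed

lemma finite_bimonomials [simp]: "finite (bimonomials m n k l)"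
  by (simp add: bimonomials_eq_image)

definition substitute :: "nat \<Rightarrow> nat \<Rightarrow> complex mat \<times> complex mat \<Rightarrow> bivar cpoly \<Rightarrow> bivar cpoly" where
  "substitute m n h = cpoly_subst (linear_subst m n h)"

lemma substitute_simps [simp]:
  "substitute m n h 0 = 0" "substitute m n h (Const c * F) = Const c * substitute m n h F"
  "substitute m n h (F + F') = substitute m n h F + substitute m n h F'"
  "substitute m n h (sum f A) = (\<Sum>x\<in>A. substitute m n h (f x))"
  by (simp_all add: substitute_def)

lemma biform_expansion:
  assumes "F \<in> biforms m n k l"
  shows "F = (\<Sum>J\<in>bimonomials m n k l. Const (Poly_Mapping.lookup F J) * Poly_Mapping.single J 1)"
proof (rule poly_mapping_eqI)
  fix I
  have "(\<Sum>J\<in>bimonomials m n k l. Poly_Mapping.lookup F J * (1 when J = I)) =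
      (\<Sum>J\<in>bimonomials m n k l. if J = I then Poly_Mapping.lookup F J else 0)"
    by (intro sum.cong) (auto simp: when_def)
  also have "\<dots> = Poly_Mapping.lookup F I"
    using assms by (auto simp: biforms_def in_keys_iff)
  finally show "Poly_Mapping.lookup F I = Poly_Mapping.lookup (\<Sum>J\<in>bimonomials m n k l. Const (Poly_Mapping.lookup F J) * Poly_Mapping.single J 1) I"
    by (simp add: lookup_sum lookup_Const_mult lookup_single)
qed

lemma biforms_single: "I \<in> bimonomials m n k l \<Longrightarrow> Poly_Mapping.single I c \<in> biforms m n k l"
  by (simp add: biforms_def)

lemma biforms_add: "F \<in> biforms m n k l \<Longrightarrow> F' \<in> biforms m n k l \<Longrightarrow> F + F' \<in> biforms m n k l"
  unfolding biforms_def using Poly_Mapping.keys_add[of F F'] by auto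

lemma biforms_Const_mult: "F \<in> biforms m n k l \<Longrightarrow> Const c * F \<in> biforms m n k l"
  by (auto simp: biforms_def in_keys_iff lookup_Const_mult subset_iff)

lemma biforms_0 [simp]: "0 \<in> biforms m n k l"
  by (simp add: biforms_def)

lemma biforms_sum: "(\<And>i. i \<in> A \<Longrightarrow> f i \<in> biforms m n k l) \<Longrightarrow> sum f A \<in> biforms m n k l"
  by (induction A rule: infinite_finite_induct) (auto intro: biforms_add)

lemma biforms_lookup: "F \<in> biforms m n k l \<Longrightarrow> I \<notin> bimonomials m n k l \<Longrightarrow> Poly_Mapping.lookup F I = 0"
  by (auto simp: biforms_def in_keys_iff)

lemma prod_list_sum:
  fixes f :: "'i \<Rightarrow> 'j \<Rightarrow> 'a::comm_semiring_1"
  assumes "finite S"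
  shows "prod_list (map (\<lambda>i. \<Sum>j\<in>S. f i j) xs) = (\<Sum>zs\<in>{zs. length zs = length xs \<and> set zs \<subseteq> S}. prod_list (map2 f xs zs))"
proof (induction xs)
  case Nil
  have "{zs. length zs = 0 \<and> set zs \<subseteq> S} = {[]}" by auto
  then show ?case by simp
next
  case (Cons i xs)
  let ?L = "\<lambda>k. {zs. length zs = k \<and> set zs \<subseteq> S}"
  have L: "?L (Suc (length xs)) = (\<lambda>(j, zs). j # zs) ` (S \<times> ?L (length xs))"
  proof (intro equalityI subsetI)
    fix zs assume "zs \<in> ?L (Suc (length xs))"
    then show "zs \<in> (\<lambda>(j, zs). j # zs) ` (S \<times> ?L (length xs))" by (cases zs) auto
  qed auto
  have "(\<Sum>zs\<in>?L (Suc (length xs)). prod_list (map2 f (i # xs) zs))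
      = (\<Sum>(j, zs)\<in>S \<times> ?L (length xs). f i j * prod_list (map2 f xs zs))"
    unfolding L by (subst sum.reindex) (auto simp: inj_on_def case_prod_unfold)
  also have "\<dots> = (\<Sum>j\<in>S. f i j) * (\<Sum>zs\<in>?L (length xs). prod_list (map2 f xs zs))"
    unfolding sum_product sum.cartesian_product ..
  finally show ?case using Cons by simp
qed

definition index_kernel :: "complex mat \<times> complex mat \<Rightarrow> nat list \<times> nat list \<Rightarrow> nat list \<times> nat list \<Rightarrow> complex" where
  "index_kernel h e e' = prod_list (map2 (\<lambda>i j. fst h $$ (i, j)) (fst e) (fst e')) * prod_list (map2 (\<lambda>i j. snd h $$ (i, j)) (snd e) (snd e'))"

lemma prod_list_map2_mult:
  "length xs = length ys \<Longrightarrow> prod_list (map2 (\<lambda>i j. f i j * g j) xs ys) = prod_list (map2 f xs ys) * prod_list (map g ys)"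
  for g :: "'b \<Rightarrow> 'c::comm_monoid_mult"
  by (induction xs ys rule: list_induct2) (simp_all add: mult_ac)

lemma Const_prod_list: "Const (prod_list cs) = prod_list (map Const cs)"
  by (induction cs) (simp_all add: Const_mult)

lemma substitute_index_monomial:
  assumes "e \<in> indices m n k l"
  shows "substitute m n h (Poly_Mapping.single (index_monomial e) 1)
    = (\<Sum>e'\<in>indices m n k l. Const (index_kernel h e e') * Poly_Mapping.single (index_monomial e') 1)"
proof -
  obtain xs ys where e: "e = (xs, ys)" "length xs = k" "length ys = l" using assms by (auto simp: indices_def)
  let ?X = "{zs. length zs = k \<and> set zs \<subseteq> {..m}}" and ?Y = "{zs. length zs = l \<and> set zs \<subseteq> {..n}}"
  have half: "prod_list (map (\<lambda>i. \<Sum>j\<le>N. Const (M $$ (i, j)) * Var (c j)) zs)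
      = (\<Sum>ws\<in>{ws. length ws = length zs \<and> set ws \<subseteq> {..N}}. Const (prod_list (map2 (\<lambda>i j. M $$ (i, j)) zs ws)) * prod_list (map (\<lambda>j. Var (c j)) ws))"
    for zs N M and c :: "nat \<Rightarrow> bivar"
  proof -
    have "Const (prod_list (map2 (\<lambda>i j. M $$ (i, j)) zs ws)) = prod_list (map2 (\<lambda>i j. Const (M $$ (i, j)) :: bivar cpoly) zs ws)" for ws
      by (simp add: Const_prod_list comp_def case_prod_unfold)
    then show ?thesis
      unfolding prod_list_sum[OF finite_atMost]
      by (intro sum.cong refl) (simp add: prod_list_map2_mult)
  qed
  have "substitute m n h (Poly_Mapping.single (index_monomial e) 1)
      = prod_list (map (\<lambda>i. \<Sum>j\<le>m. Const (fst h $$ (i, j)) * Var (x_var j)) xs) *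
        prod_list (map (\<lambda>i. \<Sum>j\<le>n. Const (snd h $$ (i, j)) * Var (y_var j)) ys)"
    unfolding prod_list_Var[symmetric] substitute_def
    by (simp add: e(1) letters_def linear_subst_def comp_def)
  also have "\<dots> = (\<Sum>(ws, zs)\<in>?X \<times> ?Y. (Const (prod_list (map2 (\<lambda>i j. fst h $$ (i, j)) xs ws)) * prod_list (map (\<lambda>j. Var (x_var j)) ws)) *
      (Const (prod_list (map2 (\<lambda>i j. snd h $$ (i, j)) ys zs)) * prod_list (map (\<lambda>j. Var (y_var j)) zs)))"
    unfolding half e(2,3) sum_product sum.cartesian_product ..
  also have "\<dots> = (\<Sum>e'\<in>indices m n k l. Const (index_kernel h e e') * Poly_Mapping.single (index_monomial e') 1)"
    unfolding indices_def prod_list_Var[symmetric]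
    by (intro sum.cong) (auto simp: e(1) index_kernel_def letters_def Const_mult comp_def mult_ac)
  finally show ?thesis .
qed

definition form_kernel :: "nat \<Rightarrow> nat \<Rightarrow> complex mat \<times> complex mat \<Rightarrow> bivar monomial \<Rightarrow> bivar monomial \<Rightarrow> complex" where
  "form_kernel m n h J I = Poly_Mapping.lookup (substitute m n h (Poly_Mapping.single J 1)) I"

lemma form_kernel_index:
  assumes "e \<in> indices m n k l"
  shows "form_kernel m n h (index_monomial e) I = (\<Sum>e'\<in>{e'\<in>indices m n k l. index_monomial e' = I}. index_kernel h e e')"
proof -
  have "form_kernel m n h (index_monomial e) I = (\<Sum>e'\<in>indices m n k l. if index_monomial e' = I then index_kernel h e e' else 0)"
    unfolding form_kernel_def substitute_index_monomial[OF assms]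
    by (auto simp: lookup_sum lookup_Const_mult lookup_single when_def intro!: sum.cong)
  then show ?thesis by (simp add: sum.inter_filter)
qed

lemma lookup_substitute:
  assumes "F \<in> biforms m n k l"
  shows "Poly_Mapping.lookup (substitute m n h F) I = (\<Sum>J\<in>bimonomials m n k l. Poly_Mapping.lookup F J * form_kernel m n h J I)"
  by (subst biform_expansion[OF assms]) (simp add: lookup_sum lookup_Const_mult form_kernel_def)

lemma substitute_biforms:
  assumes "F \<in> biforms m n k l"
  shows "substitute m n h F \<in> biforms m n k l"
proof -
  have "substitute m n h (Poly_Mapping.single J 1) \<in> biforms m n k l" if J: "J \<in> bimonomials m n k l" for J
  proof -
    obtain e where e: "e \<in> indices m n k l" "J = index_monomial e" using J by (auto simp: bimonomials_eq_image)
    show ?thesis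
      unfolding e(2) substitute_index_monomial[OF e(1)]
      by (intro biforms_sum biforms_Const_mult biforms_single) (auto simp: bimonomials_eq_image)
  qed
  then show ?thesis
    by (subst biform_expansion[OF assms]) (auto intro: biforms_sum biforms_Const_mult)
qed

lemma cpoly_subst_cong:
  assumes "\<And>\<alpha> v. \<alpha> \<in> Poly_Mapping.keys F \<Longrightarrow> v \<in> Poly_Mapping.keys \<alpha> \<Longrightarrow> \<phi> v = \<psi> v"
  shows "cpoly_subst \<phi> F = cpoly_subst \<psi> F"
  unfolding cpoly_subst_def cpoly_hom_def using assms by (intro sum.cong prod.cong arg_cong2[of _ _ _ _ "(*)"]) auto

lemma biforms_vars:
  assumes "F \<in> biforms m n k l" "\<alpha> \<in> Poly_Mapping.keys F" "v \<in> Poly_Mapping.keys \<alpha>"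
  shows "v \<in> coords m n"
  using assms by (auto simp: biforms_def bimonomials_def coords_def)

lemma linear_subst_mult:
  assumes "fst g \<in> carrier_mat (m + 1) (m + 1)" "snd g \<in> carrier_mat (n + 1) (n + 1)"
    "fst h \<in> carrier_mat (m + 1) (m + 1)" "snd h \<in> carrier_mat (n + 1) (n + 1)" and v: "v \<in> coords m n"
  shows "cpoly_subst (linear_subst m n g) (linear_subst m n h v) = linear_subst m n (fst h * fst g, snd h * snd g) v"
proof -
  have half: "(\<Sum>j\<le>N. Const (A $$ (i, j)) * (\<Sum>p\<le>N. Const (A' $$ (j, p)) * Var (c p))) = (\<Sum>p\<le>N. Const ((A * A') $$ (i, p)) * Var (c p))"
    if "A \<in> carrier_mat (N + 1) (N + 1)" "A' \<in> carrier_mat (N + 1) (N + 1)" "i \<le> N" for A A' N i and c :: "nat \<Rightarrow> bivar"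
  proof -
    have "(\<Sum>j\<le>N. Const (A $$ (i, j)) * (\<Sum>p\<le>N. Const (A' $$ (j, p)) * Var (c p)))
        = (\<Sum>j\<le>N. \<Sum>p\<le>N. Const (A $$ (i, j) * A' $$ (j, p)) * Var (c p))"
      by (simp add: sum_distrib_left Const_mult mult.assoc)
    also have "\<dots> = (\<Sum>p\<le>N. \<Sum>j\<le>N. Const (A $$ (i, j) * A' $$ (j, p)) * Var (c p))"
      by (rule sum.swap)
    also have "\<dots> = (\<Sum>p\<le>N. Const ((A * A') $$ (i, p)) * Var (c p))"
    proof (intro sum.cong refl)
      fix p assume "p \<in> {..N}"
      then have "(A * A') $$ (i, p) = (\<Sum>j\<le>N. A $$ (i, j) * A' $$ (j, p))"
        using that by (simp add: scalar_prod_def atLeast0LessThan lessThan_Suc_atMost)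
      then show "(\<Sum>j\<le>N. Const (A $$ (i, j) * A' $$ (j, p)) * Var (c p)) = Const ((A * A') $$ (i, p)) * Var (c p)"
        by (simp add: Const_sum sum_distrib_right)
    qed
    finally show ?thesis .
  qed
  from v show ?thesis
  proof (cases v)
    case (x_var i)
    then show ?thesis using half[OF assms(3,1), of i x_var] v by (simp add: linear_subst_def coords_def image_iff)
  next
    case (y_var i)
    then show ?thesis using half[OF assms(4,2), of i y_var] v by (simp add: linear_subst_def coords_def image_iff)
  qed
qed

text \<open>Substitution is a right action, so the factors appear in reverse order; the inverse in
  \<open>act\<close> turns it into a left action.\<close>

lemma substitute_substitute:
  assumes "fst g \<in> carrier_mat (m + 1) (m + 1)" "snd g \<in> carrier_mat (n + 1) (n + 1)"
    "fst h \<in> carrier_mat (m + 1) (m + 1)" "snd h \<in> carrier_mat (n + 1) (n + 1)" and "F \<in> biforms m n k l"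
  shows "substitute m n g (substitute m n h F) = substitute m n (fst h * fst g, snd h * snd g) F"
  unfolding substitute_def cpoly_subst_subst
  by (intro cpoly_subst_cong linear_subst_mult assms) (use biforms_vars[OF assms(5)] in auto)

lemma linear_subst_diagonal:
  assumes "v \<in> coords m n" "\<And>i j. i \<le> m \<Longrightarrow> j \<le> m \<Longrightarrow> fst h $$ (i, j) = (if i = j then t (x_var i) else 0)"
    "\<And>i j. i \<le> n \<Longrightarrow> j \<le> n \<Longrightarrow> snd h $$ (i, j) = (if i = j then t (y_var i) else 0)"
  shows "linear_subst m n h v = Const (t v) * Var v"
proof -
  have *: "(\<Sum>j\<le>N. Const (if i = j then a else 0) * Var (c j)) = Const a * Var (c i)" if "i \<le> N" for i N a and c :: "nat \<Rightarrow> bivar"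
  proof -
    have "(\<Sum>j\<le>N. Const (if i = j then a else 0) * Var (c j)) = (\<Sum>j\<le>N. if i = j then Const a * Var (c j) else 0)"
      by (intro sum.cong) auto
    then show ?thesis using that by simp
  qed
  show ?thesis using assms by (cases v) (auto simp: linear_subst_def coords_def *)
qed

lemma lookup_substitute_diagonal:
  assumes F: "F \<in> biforms m n k l" and "\<And>i j. i \<le> m \<Longrightarrow> j \<le> m \<Longrightarrow> fst h $$ (i, j) = (if i = j then t (x_var i) else 0)"
    "\<And>i j. i \<le> n \<Longrightarrow> j \<le> n \<Longrightarrow> snd h $$ (i, j) = (if i = j then t (y_var i) else 0)"
  shows "Poly_Mapping.lookup (substitute m n h F) I = (\<Prod>v\<in>coords m n. t v ^ Poly_Mapping.lookup I v) * Poly_Mapping.lookup F I"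
proof -
  have mon: "substitute m n h (Poly_Mapping.single J 1) = Const (\<Prod>v\<in>coords m n. t v ^ Poly_Mapping.lookup J v) * Poly_Mapping.single J 1"
    if "J \<in> bimonomials m n k l" for J
  proof -
    have k: "Poly_Mapping.keys J \<subseteq> coords m n" using that by (simp add: bimonomials_def coords_def)
    have "substitute m n h (Poly_Mapping.single J 1) = mon_val (linear_subst m n h) J"
      by (simp add: substitute_def cpoly_subst_def Const.cpoly_hom_single)
    also have "\<dots> = (\<Prod>v\<in>coords m n. (Const (t v) * Var v) ^ Poly_Mapping.lookup J v)"
      unfolding mon_val_superset[OF finite_coords k] using assms(2,3) by (intro prod.cong) (simp_all add: linear_subst_diagonal)
    also have "\<dots> = Const (\<Prod>v\<in>coords m n. t v ^ Poly_Mapping.lookup J v) * mon_val Var J"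
    proof -
      have pow: "Const (c ^ i) = (Const c ^ i :: bivar cpoly)" for c i by (induction i) (simp_all add: Const_mult)
      show ?thesis by (simp add: mon_val_superset[OF finite_coords k] power_mult_distrib prod.distrib Const_prod pow)
    qed
    also have "mon_val Var J = Poly_Mapping.single J (1::complex)"
      using single_eq_Const_Var[of J 1] by (simp add: mon_val_def)
    finally show ?thesis .
  qed
  have "Poly_Mapping.lookup (substitute m n h F) I = (\<Sum>J\<in>bimonomials m n k l. if J = I then (\<Prod>v\<in>coords m n. t v ^ Poly_Mapping.lookup J v) * Poly_Mapping.lookup F J else 0)"
    unfolding lookup_substitute[OF F] form_kernel_def
    by (intro sum.cong refl) (simp add: mon lookup_Const_mult lookup_single when_def)
  also have "\<dots> = (\<Prod>v\<in>coords m n. t v ^ Poly_Mapping.lookup I v) * Poly_Mapping.lookup F I"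
    using biforms_lookup[OF F] by auto
  finally show ?thesis .
qed

lemma substitute_one:
  assumes "F \<in> biforms m n k l"
  shows "substitute m n (1\<^sub>m (m + 1), 1\<^sub>m (n + 1)) F = F"
  by (rule poly_mapping_eqI, subst lookup_substitute_diagonal[OF assms, of _ "\<lambda>_. 1"]) auto

section \<open>Averaging over the group\<close>

text \<open>Induction over the coordinates: the vectors of \<open>D\<close> that vanish at the new
  coordinate \<open>a\<close> form a subspace of codimension at most 1, and a single Gram-Schmidt
  step with a vector \<open>e\<close> orthogonal to it does the rest. No basis of \<open>D\<close>
  has to be chosen.\<close>

lemma orthogonal_projection:
  fixes \<omega> :: "'w \<Rightarrow> real" and D :: "('w \<Rightarrow> complex) set"
  assumes "finite W" "\<And>w. w \<in> W \<Longrightarrow> \<omega> w > 0"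
    and "(\<lambda>_. 0) \<in> D" "\<And>u v. u \<in> D \<Longrightarrow> v \<in> D \<Longrightarrow> (\<lambda>w. u w + v w) \<in> D" "\<And>c u. u \<in> D \<Longrightarrow> (\<lambda>w. c * u w) \<in> D"
  shows "\<exists>d\<in>D. \<forall>v\<in>D. (\<Sum>w\<in>W. \<omega> w * (u w - d w) * cnj (v w)) = 0"
  using assms
proof (induction W arbitrary: D u rule: finite_induct)
  case empty
  then show ?case by auto
next
  case (insert a W)
  define ip where "ip u v = (\<Sum>w\<in>insert a W. \<omega> w * u w * cnj (v w))" for u v :: "'w \<Rightarrow> complex"
  have ip_lin: "ip (\<lambda>w. u w - v w) x = ip u x - ip v x" "ip (\<lambda>w. c * u w) x = c * ip u x"
    "ip x (\<lambda>w. u w + v w) = ip x u + ip x v" "ip x (\<lambda>w. c * u w) = cnj c * ip x u" for u v x c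
    by (simp_all add: ip_def sum_subtractf sum.distrib sum_distrib_left algebra_simps)
  have ip_cnj: "cnj (ip u v) = ip v u" for u v
    by (simp add: ip_def mult_ac)
  define D' where "D' = {d \<in> D. d a = 0}"
  have D': "(\<lambda>_. 0) \<in> D'" "\<And>u v. u \<in> D' \<Longrightarrow> v \<in> D' \<Longrightarrow> (\<lambda>w. u w + v w) \<in> D'" "\<And>c u. u \<in> D' \<Longrightarrow> (\<lambda>w. c * u w) \<in> D'"
    using insert.prems by (auto simp: D'_def)
  have proj: "\<exists>d\<in>D'. \<forall>v\<in>D'. ip (\<lambda>w. u w - d w) v = 0" for u
  proof -
    obtain d where "d \<in> D'" "\<And>v. v \<in> D' \<Longrightarrow> (\<Sum>w\<in>W. \<omega> w * (u w - d w) * cnj (v w)) = 0"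
      using insert.IH[OF insert.prems(1) D', of u] by auto
    then show ?thesis
      unfolding ip_def using insert.hyps by (intro bexI[of _ d] ballI) (auto simp: D'_def)
  qed
  have "\<exists>d\<in>D. \<forall>v\<in>D. ip (\<lambda>w. u w - d w) v = 0"
  proof (cases "D \<subseteq> D'")
    case True
    then have "D' = D" by (auto simp: D'_def)
    then show ?thesis using proj[of u] by simp
  next
    case False
    then obtain e0 where e0: "e0 \<in> D" "e0 a \<noteq> 0" by (auto simp: D'_def)
    obtain d0 where d0: "d0 \<in> D'" "\<And>v. v \<in> D' \<Longrightarrow> ip (\<lambda>w. e0 w - d0 w) v = 0" using proj[of e0] by auto
    define e where "e = (\<lambda>w. e0 w - d0 w)"
    have eD: "e \<in> D"
    proof -
      have "(\<lambda>w. e0 w + (-1) * d0 w) \<in> D"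
        using insert.prems(3)[OF e0(1) insert.prems(4)[of d0 "-1"]] d0(1) by (simp add: D'_def)
      then show ?thesis by (simp add: e_def)
    qed
    have ea: "e a \<noteq> 0" using d0(1) e0(2) by (simp add: e_def D'_def)
    have e_perp: "ip e v = 0" if "v \<in> D'" for v using d0(2)[OF that] by (simp add: e_def)
    have "ip e e \<noteq> 0"
    proof -
      have "ip e e = complex_of_real (\<Sum>w\<in>insert a W. \<omega> w * (cmod (e w))\<^sup>2)"
        unfolding ip_def of_real_sum by (intro sum.cong refl) (simp only: mult.assoc complex_norm_square of_real_mult)
      moreover have "(\<Sum>w\<in>insert a W. \<omega> w * (cmod (e w))\<^sup>2) > 0"
        using insert.hyps insert.prems(1) ea
        by (intro sum_pos2[of _ a]) (auto intro!: mult_pos_pos mult_nonneg_nonneg less_imp_le[OF insert.prems(1)])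
      ultimately show ?thesis by (metis of_real_eq_0_iff less_irrefl)
    qed
    obtain d' where d': "d' \<in> D'" "\<And>v. v \<in> D' \<Longrightarrow> ip (\<lambda>w. u w - d' w) v = 0" using proj[of u] by auto
    define c where "c = ip u e / ip e e"
    define d where "d = (\<lambda>w. d' w + c * e w)"
    have "d \<in> D" unfolding d_def using d'(1) eD insert.prems(3,4) by (simp add: D'_def)
    moreover have "ip (\<lambda>w. u w - d w) v = 0" if v: "v \<in> D" for v
    proof -
      have split: "ip (\<lambda>w. u w - d w) x = ip (\<lambda>w. u w - d' w) x - c * ip e x" for x
        unfolding ip_lin(2)[symmetric] ip_lin(1)[symmetric] by (rule arg_cong2[of _ _ _ _ ip]) (auto simp: d_def)
      define b where "b = v a / e a"
      define v1 where "v1 = (\<lambda>w. v w + (- b) * e w)"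
      have v1: "v1 \<in> D'"
        unfolding v1_def using insert.prems(3)[OF v insert.prems(4)[OF eD, of "- b"]] ea by (simp add: D'_def b_def)
      have "ip d' e = 0" using e_perp[OF d'(1)] ip_cnj by (metis complex_cnj_zero)
      then have "ip (\<lambda>w. u w - d w) e = 0"
        unfolding split ip_lin(1) using \<open>ip e e \<noteq> 0\<close> by (simp add: c_def)
      moreover have "ip (\<lambda>w. u w - d w) v1 = 0"
        unfolding split using d'(2)[OF v1] e_perp[OF v1] by simp
      moreover have veq: "(\<lambda>w. v1 w + b * e w) = v" by (auto simp: v1_def)
      have "ip x (\<lambda>w. v1 w + b * e w) = ip x v1 + cnj b * ip x e" for x by (simp add: ip_lin(3,4))
      ultimately show ?thesis by (simp add: veq)
    qed
    ultimately show ?thesis by blast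
  qed
  then show ?case unfolding ip_def .
qed

text \<open>The linear span of the vectors \<open>R g u - u\<close>. Generating it inductively
  allows one to check on single differences that an evaluation vanishes on the whole span.\<close>

inductive_set orbit_differences :: "('g \<Rightarrow> ('w \<Rightarrow> complex) \<Rightarrow> 'w \<Rightarrow> complex) \<Rightarrow> 'g set \<Rightarrow> ('w \<Rightarrow> complex) \<Rightarrow> ('w \<Rightarrow> complex) set"
  for R G u where
    zero: "(\<lambda>_. 0) \<in> orbit_differences R G u"
  | step: "d \<in> orbit_differences R G u \<Longrightarrow> g \<in> G \<Longrightarrow> (\<lambda>w. d w + c * (R g u w - u w)) \<in> orbit_differences R G u"

lemma orbit_differences_add:
  assumes "d \<in> orbit_differences R G u" "e \<in> orbit_differences R G u"
  shows "(\<lambda>w. d w + e w) \<in> orbit_differences R G u"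
  using assms(2)
proof induction
  case zero
  then show ?case using assms(1) by simp
next
  case (step e g c)
  from orbit_differences.step[OF step(3,2), where c = c] show ?case by (simp add: add.assoc)
qed

lemma orbit_differences_scale:
  assumes "d \<in> orbit_differences R G u"
  shows "(\<lambda>w. a * d w) \<in> orbit_differences R G u"
  using assms
proof induction
  case zero
  then show ?case by (simp add: orbit_differences.zero)
next
  case (step e g c)
  from orbit_differences.step[OF step(3,2), where c = "a * c"] show ?case by (simp add: algebra_simps)
qed

text \<open>The point of smallest norm in the affine span of an orbit is invariant, because the orbit
  differences form an invariant subspace and the group is closed under adjoints. It plays the role of
  the Reynolds operator.\<close>

lemma invariant_point:
  fixes K :: "'g \<Rightarrow> 'w \<Rightarrow> 'w \<Rightarrow> complex" and gmul :: "'g \<Rightarrow> 'g \<Rightarrow> 'g" and star :: "'g \<Rightarrow> 'g"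
  assumes "finite W" "\<And>w. w \<in> W \<Longrightarrow> \<omega> w > (0::real)"
    and mult: "\<And>g h. g \<in> G \<Longrightarrow> h \<in> G \<Longrightarrow> gmul g h \<in> G"
      "\<And>g h w w'. g \<in> G \<Longrightarrow> h \<in> G \<Longrightarrow> w \<in> W \<Longrightarrow> w' \<in> W \<Longrightarrow> K (gmul g h) w w' = (\<Sum>z\<in>W. K g w z * K h z w')"
    and adjoint: "\<And>g. g \<in> G \<Longrightarrow> star g \<in> G"
      "\<And>g w w'. g \<in> G \<Longrightarrow> w \<in> W \<Longrightarrow> w' \<in> W \<Longrightarrow> \<omega> w * K g w w' = cnj (\<omega> w' * K (star g) w' w)"
  defines "R \<equiv> \<lambda>g u w. if w \<in> W then (\<Sum>w'\<in>W. K g w w' * u w') else 0"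
  assumes u: "\<And>w. w \<notin> W \<Longrightarrow> u w = 0"
  shows "\<exists>d\<in>orbit_differences R G u. \<forall>g\<in>G. \<forall>w\<in>W. R g (\<lambda>w. u w - d w) w = u w - d w"
proof -
  let ?D = "orbit_differences R G u"
  have R_lin: "R g (\<lambda>w. u w + c * v w) = (\<lambda>w. R g u w + c * R g v w)" "R g (\<lambda>w. u w - v w) = (\<lambda>w. R g u w - R g v w)"
    "R g (\<lambda>_. 0) = (\<lambda>_. 0)" for g u v c
    by (auto simp: R_def sum.distrib sum_subtractf sum_distrib_left algebra_simps)
  have R_mult: "R g (R h v) = R (gmul g h) v" if "g \<in> G" "h \<in> G" for g h v
  proof
    fix w
    show "R g (R h v) w = R (gmul g h) v w"
    proof (cases "w \<in> W")
      case True
      have "R g (R h v) w = (\<Sum>z\<in>W. K g w z * (\<Sum>w'\<in>W. K h z w' * v w'))"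
        using True by (simp add: R_def)
      also have "\<dots> = (\<Sum>w'\<in>W. (\<Sum>z\<in>W. K g w z * K h z w') * v w')"
        unfolding sum_distrib_left sum_distrib_right mult.assoc by (rule sum.swap)
      also have "\<dots> = R (gmul g h) v w" using True that by (simp add: R_def mult(2))
      finally show ?thesis .
    qed (simp add: R_def)
  qed
  have base: "(\<lambda>w. R g u w - u w) \<in> ?D" if "g \<in> G" for g
    using orbit_differences.step[where R = R and u = u and c = 1, OF orbit_differences.zero that] by simp
  have stable: "R g d \<in> ?D" if g: "g \<in> G" and "d \<in> ?D" for g d
    using that(2)
  proof induction
    case zero
    then show ?case by (simp add: R_lin orbit_differences.zero)
  next
    case (step d h c)
    \<comment> \<open>Applied to the difference of \<open>h\<close>, the element \<open>g\<close>
      gives the difference of \<open>gmul g h\<close> minus that of \<open>g\<close>, so the span is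
      stable.\<close>
    have "R g (\<lambda>w. d w + c * (R h u w - u w)) = (\<lambda>w. (R g d w + c * (R (gmul g h) u w - u w)) + (- c) * (R g u w - u w))"
      unfolding R_lin R_mult[OF g step(2)] by (auto simp: algebra_simps)
    then show ?case
      using orbit_differences.step[OF orbit_differences.step[OF step(3) mult(1)[OF g step(2)], where c = c] g, where c = "- c"] by simp
  qed
  have "\<exists>d\<in>?D. \<forall>v\<in>?D. (\<Sum>w\<in>W. \<omega> w * (u w - d w) * cnj (v w)) = 0"
    by (rule orthogonal_projection[OF assms(1,2) orbit_differences.zero orbit_differences_add orbit_differences_scale])
  then obtain d where d: "d \<in> ?D" "\<And>v. v \<in> ?D \<Longrightarrow> (\<Sum>w\<in>W. \<omega> w * (u w - d w) * cnj (v w)) = 0"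
    by blast
  define u0 where "u0 = (\<lambda>w. u w - d w)"
  have "R g u0 w = u0 w" if g: "g \<in> G" and w: "w \<in> W" for g w
  proof -
    \<comment> \<open>\<open>v\<close> lies in the span, and so does its image under
      \<open>star g\<close>. Since \<open>u0\<close> is orthogonal to the span, \<open>v\<close> is
      orthogonal to \<open>u0\<close> and, after passing to the adjoint, also to
      \<open>R g u0\<close>. Hence \<open>v\<close> is orthogonal to itself.\<close>
    define v where "v = (\<lambda>w. R g u0 w - u0 w)"
    have "v = (\<lambda>w. ((R g u w - u w) + (-1) * R g d w) + d w)"
      unfolding v_def u0_def R_lin by auto
    then have vD: "v \<in> ?D"
      using orbit_differences_add[OF orbit_differences_add[OF base[OF g] orbit_differences_scale[OF stable[OF g d(1)], of "-1"]] d(1)]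
      by simp
    have "(\<Sum>w\<in>W. \<omega> w * R g u0 w * cnj (v w)) = (\<Sum>w\<in>W. \<Sum>w'\<in>W. (\<omega> w * K g w w') * u0 w' * cnj (v w))"
      by (intro sum.cong refl) (simp add: R_def sum_distrib_left sum_distrib_right mult.assoc)
    also have "\<dots> = (\<Sum>w\<in>W. \<Sum>w'\<in>W. cnj (\<omega> w' * K (star g) w' w) * u0 w' * cnj (v w))"
      by (intro sum.cong refl) (simp only: adjoint(2)[OF g])
    also have "\<dots> = (\<Sum>w'\<in>W. \<Sum>w\<in>W. cnj (\<omega> w' * K (star g) w' w) * u0 w' * cnj (v w))"
      by (rule sum.swap)
    also have "\<dots> = (\<Sum>w'\<in>W. \<omega> w' * u0 w' * cnj (R (star g) v w'))"
      by (intro sum.cong refl) (simp add: R_def sum_distrib_left mult_ac)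
    also have "\<dots> = 0"
      using d(2)[OF stable[OF adjoint(1)[OF g] vD]] by (simp add: u0_def)
    finally have z: "(\<Sum>w\<in>W. \<omega> w * R g u0 w * cnj (v w)) = 0" .
    have "(\<Sum>w\<in>W. \<omega> w * v w * cnj (v w)) = (\<Sum>w\<in>W. \<omega> w * R g u0 w * cnj (v w)) - (\<Sum>w\<in>W. \<omega> w * (u w - d w) * cnj (v w))"
      unfolding sum_subtractf[symmetric] by (intro sum.cong refl) (simp add: v_def u0_def algebra_simps)
    then have "(\<Sum>w\<in>W. \<omega> w * v w * cnj (v w)) = 0" using z d(2)[OF vD] by simp
    moreover have "complex_of_real (\<Sum>w\<in>W. \<omega> w * (cmod (v w))\<^sup>2) = (\<Sum>w\<in>W. \<omega> w * v w * cnj (v w))"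
      unfolding of_real_sum by (intro sum.cong refl) (simp only: mult.assoc complex_norm_square of_real_mult)
    ultimately have "complex_of_real (\<Sum>w\<in>W. \<omega> w * (cmod (v w))\<^sup>2) = 0" by (simp only:)
    then have "(\<Sum>w\<in>W. \<omega> w * (cmod (v w))\<^sup>2) = 0" by (simp only: of_real_eq_0_iff)
    moreover have "0 \<le> \<omega> w * (cmod (v w))\<^sup>2" if "w \<in> W" for w using assms(2)[OF that] by simp
    ultimately have "\<forall>w\<in>W. \<omega> w * (cmod (v w))\<^sup>2 = 0"
      using sum_nonneg_eq_0_iff[OF assms(1), of "\<lambda>w. \<omega> w * (cmod (v w))\<^sup>2"] by blast
    then have "v w = 0" using w assms(2)[OF w] by auto
    then show ?thesis by (simp add: v_def)
  qed
  then show ?thesis using d(1) unfolding u0_def by blast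
qed

text \<open>Words index a basis of the truncated tensor algebra. Polynomial functions are
  represented by vectors on words, not uniquely, but on such vectors the group acts by tensor powers
  of one matrix.\<close>

definition words :: "'a set \<Rightarrow> nat \<Rightarrow> 'a list set" where
  "words A D = {w. set w \<subseteq> A \<and> length w \<le> D}"

lemma finite_words: "finite A \<Longrightarrow> finite (words A D)"
  unfolding words_def by (rule finite_lists_length_le)

definition list_kernel :: "('a \<Rightarrow> 'a \<Rightarrow> complex) \<Rightarrow> 'a list \<Rightarrow> 'a list \<Rightarrow> complex" where
  "list_kernel k w w' = (if length w = length w' then prod_list (map2 k w w') else 0)"

lemma sum_words_prod_list:
  fixes f :: "'i \<Rightarrow> 'a \<Rightarrow> complex"
  assumes "finite A" "length xs \<le> D"
  shows "(\<Sum>w\<in>words A D. if length w = length xs then prod_list (map2 f xs w) else 0) = prod_list (map (\<lambda>i. \<Sum>j\<in>A. f i j) xs)"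
proof -
  have "{w \<in> words A D. length w = length xs} = {w. length w = length xs \<and> set w \<subseteq> A}"
    using assms(2) by (auto simp: words_def)
  then show ?thesis
    unfolding prod_list_sum[OF assms(1)] sum.inter_filter[OF finite_words[OF assms(1)], symmetric] by simp
qed

lemma prod_list_map2_mult2:
  "length xs = length ys \<Longrightarrow> length ys = length zs \<Longrightarrow>
    prod_list (map2 f xs ys) * prod_list (map2 g ys zs) = prod_list (map2 (\<lambda>(x, z) y. f x y * g y z) (zip xs zs) ys)"
  for f :: "'a \<Rightarrow> 'b \<Rightarrow> 'c::comm_monoid_mult"
  by (induction xs ys zs rule: list_induct3) (simp_all add: mult_ac)

text \<open>Tensor powers of matrices multiply like the matrices, because the sum over words of a
  given length factors letter by letter.\<close>

lemma list_kernel_mult: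
  assumes "finite A" "w \<in> words A D" "w' \<in> words A D"
    and k: "\<And>a b. a \<in> A \<Longrightarrow> b \<in> A \<Longrightarrow> k3 a b = (\<Sum>c\<in>A. k1 a c * k2 c b)"
  shows "list_kernel k3 w w' = (\<Sum>z\<in>words A D. list_kernel k1 w z * list_kernel k2 z w')"
proof (cases "length w = length w'")
  case False
  then show ?thesis by (auto simp: list_kernel_def intro!: sum.neutral)
next
  case True
  let ?zip = "zip w w'"
  have len: "length ?zip = length w" "length ?zip \<le> D" using True assms(2) by (auto simp: words_def)
  have "(\<Sum>z\<in>words A D. list_kernel k1 w z * list_kernel k2 z w')
      = (\<Sum>z\<in>words A D. if length z = length ?zip then prod_list (map2 (\<lambda>(x, z) y. k1 x y * k2 y z) ?zip z) else 0)"
  proof (intro sum.cong refl)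
    fix z
    show "list_kernel k1 w z * list_kernel k2 z w' = (if length z = length ?zip then prod_list (map2 (\<lambda>(x, z) y. k1 x y * k2 y z) ?zip z) else 0)"
    proof (cases "length z = length w")
      case z: True
      then show ?thesis using prod_list_map2_mult2[of w z w' k1 k2] True len by (simp add: list_kernel_def)
    next
      case z: False
      then show ?thesis using len True by (simp add: list_kernel_def)
    qed
  qed
  also have "\<dots> = prod_list (map (\<lambda>i. \<Sum>j\<in>A. (case i of (x, z) \<Rightarrow> \<lambda>y. k1 x y * k2 y z) j) ?zip)"
    by (rule sum_words_prod_list[OF assms(1) len(2)])
  also have "\<dots> = prod_list (map (\<lambda>(a, b). k3 a b) ?zip)"
  proof (rule arg_cong[where f = prod_list], rule map_cong[OF refl])
    fix i assume "i \<in> set ?zip"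
    then obtain a b where "i = (a, b)" "a \<in> set w" "b \<in> set w'" by (metis in_set_zipE surj_pair)
    then show "(\<Sum>j\<in>A. (case i of (x, z) \<Rightarrow> \<lambda>y. k1 x y * k2 y z) j) = (case i of (a, b) \<Rightarrow> k3 a b)"
      using assms(2,3) by (auto simp: k words_def subset_iff)
  qed
  also have "\<dots> = list_kernel k3 w w'" using True by (simp add: list_kernel_def case_prod_unfold)
  finally show ?thesis ..
qed

lemma list_kernel_adjoint:
  assumes "set w \<subseteq> A" "set w' \<subseteq> A" and k: "\<And>a b. a \<in> A \<Longrightarrow> b \<in> A \<Longrightarrow> \<omega> a * k1 a b = cnj (\<omega> b * k2 b a)"
  shows "prod_list (map \<omega> w) * list_kernel k1 w w' = cnj (prod_list (map \<omega> w') * list_kernel k2 w' w)"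
proof (cases "length w = length w'")
  case True
  have "prod_list (map \<omega> w) * prod_list (map2 k1 w w') = cnj (prod_list (map \<omega> w') * prod_list (map2 k2 w' w))"
    using True assms(1,2)
  proof (induction w w' rule: list_induct2)
    case (Cons a w b w')
    then have "(\<omega> a * k1 a b) * (prod_list (map \<omega> w) * prod_list (map2 k1 w w'))
        = cnj (\<omega> b * k2 b a) * cnj (prod_list (map \<omega> w') * prod_list (map2 k2 w' w))"
      by (simp only: k list.simps insert_subset)
    then show ?case by (simp add: mult_ac)
  qed simp
  then show ?thesis using True by (simp add: list_kernel_def)
qed (simp add: list_kernel_def)

section \<open>The group, its adjoints and its operators on forms\<close>

abbreviation group_elements :: "nat \<Rightarrow> nat \<Rightarrow> (complex mat \<times> complex mat) set" where
  "group_elements m n \<equiv> carrier (SLxSL m n)"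

lemma group_elements_iff:
  "h \<in> group_elements m n \<longleftrightarrow> fst h \<in> carrier_mat (m + 1) (m + 1) \<and> det (fst h) = 1 \<and>
     snd h \<in> carrier_mat (n + 1) (n + 1) \<and> det (snd h) = 1"
  by (cases h) (auto simp: SLxSL_def SL_def DirProd_def)

lemma group_SL: "group (SL N)"
proof (rule groupI)
  fix A assume "A \<in> carrier (SL N)"
  then have A: "A \<in> carrier_mat N N" "det A = 1" by (auto simp: SL_def)
  have inv: "adj_mat A \<in> carrier_mat N N" "adj_mat A * A = 1\<^sub>m N" using adj_mat[OF A(1)] A(2) by auto
  have "det (adj_mat A) = 1" using det_mult[OF inv(1) A(1)] inv(2) A(2) by simp
  with inv show "\<exists>B\<in>carrier (SL N). B \<otimes>\<^bsub>SL N\<^esub> A = \<one>\<^bsub>SL N\<^esub>" by (auto simp: SL_def)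
next
  fix A B C assume "A \<in> carrier (SL N)" "B \<in> carrier (SL N)" "C \<in> carrier (SL N)"
  then show "A \<otimes>\<^bsub>SL N\<^esub> B \<otimes>\<^bsub>SL N\<^esub> C = A \<otimes>\<^bsub>SL N\<^esub> (B \<otimes>\<^bsub>SL N\<^esub> C)"
    by (auto simp: SL_def assoc_mult_mat[of _ N N _ N _ N])
qed (auto simp: SL_def det_mult[of _ N])

lemma group_SLxSL: "group (SLxSL m n)"
  unfolding SLxSL_def by (rule DirProd_group[OF group_SL group_SL])

lemma SLxSL_mult: "g \<otimes>\<^bsub>SLxSL m n\<^esub> h = (fst g * fst h, snd g * snd h)"
  by (cases g; cases h) (simp add: SLxSL_def SL_def DirProd_def)

lemma SLxSL_one: "\<one>\<^bsub>SLxSL m n\<^esub> = (1\<^sub>m (m + 1), 1\<^sub>m (n + 1))"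
  by (simp add: SLxSL_def SL_def DirProd_def)

lemma act_eq_substitute: "act m n g F = substitute m n (inv\<^bsub>SLxSL m n\<^esub> g) F"
  by (simp add: act_def substitute_def)

lemma inv_in_group: "g \<in> group_elements m n \<Longrightarrow> inv\<^bsub>SLxSL m n\<^esub> g \<in> group_elements m n"
  by (rule group.inv_closed[OF group_SLxSL])

lemma inv_inv_group: "g \<in> group_elements m n \<Longrightarrow> inv\<^bsub>SLxSL m n\<^esub> (inv\<^bsub>SLxSL m n\<^esub> g) = g"
  by (rule group.inv_inv[OF group_SLxSL])

text \<open>Inversion permutes the group, so existential statements about the left action may be
  read with plain substitutions, with which the later arguments work.\<close>

lemma ex_act_iff_ex_substitute: "(\<exists>g\<in>group_elements m n. Q (act m n g F)) \<longleftrightarrow> (\<exists>h\<in>group_elements m n. Q (substitute m n h F))"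
  unfolding act_eq_substitute using inv_in_group inv_inv_group by metis

lemma mult_in_group: "g \<in> group_elements m n \<Longrightarrow> h \<in> group_elements m n \<Longrightarrow> (fst g * fst h, snd g * snd h) \<in> group_elements m n"
  using group.subgroup_self[OF group_SLxSL] monoid.m_closed[OF group.is_monoid[OF group_SLxSL]] SLxSL_mult by metis

lemma substitute_mult:
  assumes "g \<in> group_elements m n" "h \<in> group_elements m n" "F \<in> biforms m n k l"
  shows "substitute m n g (substitute m n h F) = substitute m n (h \<otimes>\<^bsub>SLxSL m n\<^esub> g) F"
  unfolding SLxSL_mult using assms by (intro substitute_substitute) (auto simp: group_elements_iff)

lemma substitute_inverse:
  assumes "g \<in> group_elements m n" "F \<in> biforms m n k l"
  shows "substitute m n g (substitute m n (inv\<^bsub>SLxSL m n\<^esub> g) F) = F" "substitute m n (inv\<^bsub>SLxSL m n\<^esub> g) (substitute m n g F) = F"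
  using substitute_mult[OF assms(1) inv_in_group[OF assms(1)] assms(2)] substitute_mult[OF inv_in_group[OF assms(1)] assms(1) assms(2)]
    group.l_inv[OF group_SLxSL assms(1)] group.r_inv[OF group_SLxSL assms(1)] substitute_one[OF assms(2)]
  by (simp_all add: SLxSL_one)

lemma substitute_eq_0_iff:
  assumes "g \<in> group_elements m n" "F \<in> biforms m n k l"
  shows "substitute m n g F = 0 \<longleftrightarrow> F = 0"
  using substitute_inverse(2)[OF assms] by (metis substitute_simps(1))

definition conj_transpose :: "complex mat \<times> complex mat \<Rightarrow> complex mat \<times> complex mat" where
  "conj_transpose h = (transpose_mat (map_mat cnj (fst h)), transpose_mat (map_mat cnj (snd h)))"

lemma det_map_cnj: "det (map_mat cnj A) = cnj (det A)"
proof -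
  interpret comm_ring_hom cnj by unfold_locales auto
  show ?thesis by (rule hom_det)
qed

lemma conj_transpose_in_group: "h \<in> group_elements m n \<Longrightarrow> conj_transpose h \<in> group_elements m n"
  by (auto simp: group_elements_iff conj_transpose_def det_transpose[of _ "m + 1"] det_transpose[of _ "n + 1"] det_map_cnj)

lemma prod_list_map2_cnj:
  assumes "length xs = length ys" "set xs \<subseteq> A" "set ys \<subseteq> A" "\<And>i j. i \<in> A \<Longrightarrow> j \<in> A \<Longrightarrow> f i j = cnj (g j i)"
  shows "prod_list (map2 f xs ys) = cnj (prod_list (map2 g ys xs))"
  using assms(1-3) by (induction xs ys rule: list_induct2) (auto simp: assms(4))

lemma index_kernel_adjoint:
  assumes "h \<in> group_elements m n" "e \<in> indices m n k l" "e' \<in> indices m n k l"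
  shows "index_kernel h e e' = cnj (index_kernel (conj_transpose h) e' e)"
proof -
  have "prod_list (map2 (\<lambda>i j. fst h $$ (i, j)) (fst e) (fst e')) = cnj (prod_list (map2 (\<lambda>i j. fst (conj_transpose h) $$ (i, j)) (fst e') (fst e)))"
    by (rule prod_list_map2_cnj[of _ _ "{..m}"]) (use assms in \<open>auto simp: indices_def group_elements_iff conj_transpose_def\<close>)
  moreover have "prod_list (map2 (\<lambda>i j. snd h $$ (i, j)) (snd e) (snd e')) = cnj (prod_list (map2 (\<lambda>i j. snd (conj_transpose h) $$ (i, j)) (snd e') (snd e)))"
    by (rule prod_list_map2_cnj[of _ _ "{..n}"]) (use assms in \<open>auto simp: indices_def group_elements_iff conj_transpose_def\<close>)
  ultimately show ?thesis by (simp add: index_kernel_def)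
qed

text \<open>The number of words above a monomial, a product of two multinomial coefficients. With
  these weights a matrix entry of the operator of \<open>h\<close> becomes a sum over all words
  above both monomials, so that conjugate transposition of \<open>h\<close> gives the adjoint
  operator.\<close>

definition multinomial :: "nat \<Rightarrow> nat \<Rightarrow> nat \<Rightarrow> nat \<Rightarrow> bivar monomial \<Rightarrow> nat" where
  "multinomial m n k l J = card {e \<in> indices m n k l. index_monomial e = J}"

lemma multinomial_pos: "J \<in> bimonomials m n k l \<Longrightarrow> multinomial m n k l J > 0"
  by (auto simp: multinomial_def bimonomials_eq_image card_gt_0_iff)

lemma form_kernel_adjoint:
  assumes "h \<in> group_elements m n" "J \<in> bimonomials m n k l" "I \<in> bimonomials m n k l"
  shows "of_nat (multinomial m n k l J) * form_kernel m n h J I = cnj (of_nat (multinomial m n k l I) * form_kernel m n (conj_transpose h) I J)"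
proof -
  let ?E = "\<lambda>I. {e \<in> indices m n k l. index_monomial e = I}"
  have s: "of_nat (multinomial m n k l J) * form_kernel m n h J I = (\<Sum>e\<in>?E J. \<Sum>e'\<in>?E I. index_kernel h e e')" for h J I
  proof -
    have "(\<Sum>e\<in>?E J. \<Sum>e'\<in>?E I. index_kernel h e e') = (\<Sum>e\<in>?E J. form_kernel m n h J I)"
      by (intro sum.cong refl) (auto simp: form_kernel_index)
    then show ?thesis by (simp add: multinomial_def)
  qed
  have "(\<Sum>e\<in>?E J. \<Sum>e'\<in>?E I. index_kernel h e e') = (\<Sum>e\<in>?E J. \<Sum>e'\<in>?E I. cnj (index_kernel (conj_transpose h) e' e))"
    by (intro sum.cong refl) (use index_kernel_adjoint[OF assms(1)] in auto)
  also have "\<dots> = cnj (\<Sum>e'\<in>?E I. \<Sum>e\<in>?E J. index_kernel (conj_transpose h) e' e)"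
    by (subst sum.swap) simp
  finally show ?thesis unfolding s .
qed

lemma form_kernel_mult:
  assumes "g \<in> group_elements m n" "h \<in> group_elements m n" "J \<in> bimonomials m n k l"
  shows "form_kernel m n (g \<otimes>\<^bsub>SLxSL m n\<^esub> h) J I = (\<Sum>K\<in>bimonomials m n k l. form_kernel m n g J K * form_kernel m n h K I)"
  unfolding form_kernel_def[of _ _ _ J] substitute_mult[OF assms(2,1) biforms_single[OF assms(3)], symmetric]
  by (rule lookup_substitute[OF substitute_biforms[OF biforms_single[OF assms(3)]]])

section \<open>Sections as vectors on words\<close>

lemma sections_0: "0 \<in> sections m n k l d"
  by (simp add: sections_def)

lemma sections_Const: "Const c \<in> sections m n k l 0"
  by (auto simp: sections_def Const_def in_keys_iff lookup_single when_def split: if_splits)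

lemma sections_Var: "I \<in> bimonomials m n k l \<Longrightarrow> Var I \<in> sections m n k l 1"
  by (auto simp: sections_def Var_def)

lemma sections_add: "f \<in> sections m n k l d \<Longrightarrow> g \<in> sections m n k l d \<Longrightarrow> f + g \<in> sections m n k l d"
  using Poly_Mapping.keys_add[of f g] by (auto simp: sections_def)

lemma sections_mult:
  assumes "f \<in> sections m n k l d" "g \<in> sections m n k l e"
  shows "f * g \<in> sections m n k l (d + e)"
  unfolding sections_def
proof (intro CollectI ballI)
  fix \<gamma> assume "\<gamma> \<in> Poly_Mapping.keys (f * g)"
  then obtain \<alpha> \<beta> where ab: "\<gamma> = \<alpha> + \<beta>" "\<alpha> \<in> Poly_Mapping.keys f" "\<beta> \<in> Poly_Mapping.keys g"
    using Poly_Mapping.keys_mult[of f g] by auto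
  have sup: "(\<Sum>I\<in>Poly_Mapping.keys \<delta>. Poly_Mapping.lookup \<delta> I) = (\<Sum>I\<in>bimonomials m n k l. Poly_Mapping.lookup \<delta> I)"
    if "Poly_Mapping.keys \<delta> \<subseteq> bimonomials m n k l" for \<delta> :: "bivar monomial monomial"
    using that by (intro sum.mono_neutral_left) (auto simp: in_keys_iff)
  have k: "Poly_Mapping.keys \<alpha> \<subseteq> bimonomials m n k l" "Poly_Mapping.keys \<beta> \<subseteq> bimonomials m n k l"
    using assms ab by (auto simp: sections_def)
  then have k': "Poly_Mapping.keys \<gamma> \<subseteq> bimonomials m n k l"
    using Poly_Mapping.keys_add[of \<alpha> \<beta>] ab(1) by auto
  have "(\<Sum>I\<in>bimonomials m n k l. Poly_Mapping.lookup \<alpha> I) = d" "(\<Sum>I\<in>bimonomials m n k l. Poly_Mapping.lookup \<beta> I) = e"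
    unfolding sup[OF k(1), symmetric] sup[OF k(2), symmetric] using assms ab(2,3) by (auto simp: sections_def)
  then have "(\<Sum>I\<in>Poly_Mapping.keys \<gamma>. Poly_Mapping.lookup \<gamma> I) = d + e"
    unfolding sup[OF k'] by (simp add: ab(1) lookup_add sum.distrib)
  with k' show "Poly_Mapping.keys \<gamma> \<subseteq> bimonomials m n k l \<and> (\<Sum>I\<in>Poly_Mapping.keys \<gamma>. Poly_Mapping.lookup \<gamma> I) = d + e" ..
qed

lemma sections_sum: "(\<And>i. i \<in> A \<Longrightarrow> f i \<in> sections m n k l d) \<Longrightarrow> sum f A \<in> sections m n k l d"
  by (induction A rule: infinite_finite_induct) (auto intro: sections_add sections_0)

lemma sections_prod_list: "set w \<subseteq> bimonomials m n k l \<Longrightarrow> prod_list (map Var w) \<in> sections m n k l (length w)"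
proof (induction w)
  case Nil
  then show ?case using sections_Const[of 1] by simp
next
  case (Cons I w)
  then show ?case using sections_mult[OF sections_Var Cons.IH, of I] by simp
qed

lemma section_at_homogeneous:
  assumes "f \<in> sections m n k l d"
  shows "section_at f (Const c * F) = c ^ d * section_at f F"
proof -
  have "section_at f G = (\<Sum>\<alpha>\<in>Poly_Mapping.keys f. Poly_Mapping.lookup f \<alpha> * mon_val (Poly_Mapping.lookup G) \<alpha>)" for G
    by (simp add: section_at_def cpoly_eval_def ident.cpoly_hom_superset)
  moreover have "mon_val (Poly_Mapping.lookup (Const c * F)) \<alpha> = c ^ d * mon_val (Poly_Mapping.lookup F) \<alpha>"
    if "\<alpha> \<in> Poly_Mapping.keys f" for \<alpha>
  proof -
    have "(\<Sum>I\<in>Poly_Mapping.keys \<alpha>. Poly_Mapping.lookup \<alpha> I) = d" using assms that by (auto simp: sections_def)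
    then show ?thesis
      by (simp add: mon_val_def lookup_Const_mult power_mult_distrib prod.distrib flip: power_sum)
  qed
  ultimately show ?thesis by (simp add: sum_distrib_left mult_ac)
qed

definition word_eval :: "'v set \<Rightarrow> nat \<Rightarrow> ('v list \<Rightarrow> complex) \<Rightarrow> ('v \<Rightarrow> complex) \<Rightarrow> complex" where
  "word_eval M D u c = (\<Sum>w\<in>words M D. u w * prod_list (map c w))"

lemma monomial_word: "\<exists>w. set w = Poly_Mapping.keys \<alpha> \<and> (\<forall>x :: 'v \<Rightarrow> complex. mon_val x \<alpha> = prod_list (map x w))"
proof (induction \<alpha> rule: poly_mapping_induct)
  case (single v k)
  show ?case by (rule exI[of _ "replicate k v"]) (simp add: prod_list_replicate)
next
  case (sum \<alpha> \<beta>)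
  then obtain w w' where w: "set w = Poly_Mapping.keys \<alpha>" "set w' = Poly_Mapping.keys \<beta>"
    "\<And>x :: 'v \<Rightarrow> complex. mon_val x \<alpha> = prod_list (map x w)" "\<And>x :: 'v \<Rightarrow> complex. mon_val x \<beta> = prod_list (map x w')" by blast
  have "Poly_Mapping.keys (\<alpha> + \<beta>) = Poly_Mapping.keys \<alpha> \<union> Poly_Mapping.keys \<beta>"
    by (auto simp: in_keys_iff lookup_add)
  then show ?case using w by (intro exI[of _ "w @ w'"]) (simp add: mon_val_add)
qed

text \<open>A monomial in the coefficients is a word in some order of its letters. Words with a
  letter outside \<open>bimonomials m n k l\<close> evaluate to 0 on forms and are dropped, which
  leaves a finite-dimensional space.\<close>

lemma section_at_word_eval:
  "\<exists>D u. (\<forall>w. w \<notin> words (bimonomials m n k l) D \<longrightarrow> u w = 0) \<and>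
     (\<forall>F\<in>biforms m n k l. section_at p F = word_eval (bimonomials m n k l) D u (Poly_Mapping.lookup F))"
proof (induction p rule: poly_mapping_induct)
  case (single \<alpha> c)
  let ?M = "bimonomials m n k l"
  obtain w where w: "set w = Poly_Mapping.keys \<alpha>" "\<And>x :: bivar monomial \<Rightarrow> complex. mon_val x \<alpha> = prod_list (map x w)"
    using monomial_word[of \<alpha>] by blast
  have v: "section_at (Poly_Mapping.single \<alpha> c) F = c * prod_list (map (Poly_Mapping.lookup F) w)" for F
    by (simp add: section_at_def cpoly_eval_def ident.cpoly_hom_single w(2))
  show ?case
  proof (cases "set w \<subseteq> ?M")
    case True
    have "word_eval ?M (length w) (\<lambda>w'. if w' = w then c else 0) x = c * prod_list (map x w)" for x
    proof -
      have "word_eval ?M (length w) (\<lambda>w'. if w' = w then c else 0) x = (\<Sum>w'\<in>words ?M (length w). if w' = w then c * prod_list (map x w) else 0)"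
        unfolding word_eval_def by (intro sum.cong) auto
      then show ?thesis using True finite_words[of ?M "length w"] by (simp add: words_def)
    qed
    then show ?thesis using v True by (intro exI[of _ "length w"] exI[of _ "\<lambda>w'. if w' = w then c else 0"]) (auto simp: words_def)
  next
    case False
    then obtain I where "I \<in> set w" "I \<notin> ?M" by blast
    then have "prod_list (map (Poly_Mapping.lookup F) w) = 0" if "F \<in> biforms m n k l" for F
      using biforms_lookup[OF that, of I] by (force simp: prod_list_zero_iff)
    then show ?thesis using v by (intro exI[of _ 0] exI[of _ "\<lambda>_. 0"]) (simp add: word_eval_def)
  qed
next
  case (sum p q)
  let ?M = "bimonomials m n k l"
  obtain D u D' u' where u: "\<forall>w. w \<notin> words ?M D \<longrightarrow> u w = 0" "\<forall>w. w \<notin> words ?M D' \<longrightarrow> u' w = 0"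
    "\<forall>F\<in>biforms m n k l. section_at p F = word_eval ?M D u (Poly_Mapping.lookup F)"
    "\<forall>F\<in>biforms m n k l. section_at q F = word_eval ?M D' u' (Poly_Mapping.lookup F)"
    using sum by blast
  have ext: "word_eval ?M E v x = word_eval ?M (max D D') v x" if "\<forall>w. w \<notin> words ?M E \<longrightarrow> v w = 0" "E \<le> max D D'" for E v x
    unfolding word_eval_def using that finite_words[of ?M]
    by (intro sum.mono_neutral_left) (auto simp: words_def)
  have "section_at (p + q) F = word_eval ?M (max D D') (\<lambda>w. u w + u' w) (Poly_Mapping.lookup F)" if "F \<in> biforms m n k l" for F
    using u(3,4) that ext[OF u(1)] ext[OF u(2)]
    by (simp add: word_eval_def sum.distrib distrib_right)
  moreover have "u w + u' w = 0" if "w \<notin> words ?M (max D D')" for w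
  proof -
    have "w \<notin> words ?M D" "w \<notin> words ?M D'" using that by (auto simp: words_def)
    then show ?thesis using u(1,2) by simp
  qed
  ultimately show ?case
    by (intro exI[of _ "max D D'"] exI[of _ "\<lambda>w. u w + u' w"]) blast
qed

definition word_section :: "nat \<Rightarrow> nat \<Rightarrow> nat \<Rightarrow> nat \<Rightarrow> nat \<Rightarrow> (bivar monomial list \<Rightarrow> complex) \<Rightarrow> nat \<Rightarrow> bivar monomial cpoly" where
  "word_section m n k l D u d = (\<Sum>w\<in>{w\<in>words (bimonomials m n k l) D. length w = d}. Const (u w) * prod_list (map Var w))"

lemma word_section_sections: "word_section m n k l D u d \<in> sections m n k l d"
  unfolding word_section_def
proof (rule sections_sum)
  fix w assume "w \<in> {w \<in> words (bimonomials m n k l) D. length w = d}"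
  then show "Const (u w) * prod_list (map Var w) \<in> sections m n k l d"
    using sections_mult[OF sections_Const sections_prod_list, of w m n k l "u w"] by (auto simp: words_def)
qed

lemma section_at_word_section:
  "section_at (word_section m n k l D u d) F = word_eval (bimonomials m n k l) D (\<lambda>w. if length w = d then u w else 0) (Poly_Mapping.lookup F)"
  unfolding word_section_def word_eval_def sum.inter_filter[OF finite_words[OF finite_bimonomials]] section_at_simps
  by (intro sum.cong refl) (simp add: comp_def)

lemma sum_word_section:
  "(\<Sum>d\<le>D. section_at (word_section m n k l D u d) F) = word_eval (bimonomials m n k l) D u (Poly_Mapping.lookup F)"
proof -
  have "(\<Sum>d\<le>D. section_at (word_section m n k l D u d) F)
      = (\<Sum>w\<in>words (bimonomials m n k l) D. \<Sum>d\<le>D. if length w = d then u w * prod_list (map (Poly_Mapping.lookup F) w) else 0)"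
    unfolding section_at_word_section word_eval_def by (subst sum.swap) (simp add: if_distrib[of "\<lambda>x. x * _"] cong: if_cong)
  also have "\<dots> = word_eval (bimonomials m n k l) D u (Poly_Mapping.lookup F)"
    unfolding word_eval_def by (intro sum.cong refl) (auto simp: words_def)
  finally show ?thesis .
qed

lemma homogeneous_components:
  obtains D f where "\<And>d. f d \<in> sections m n k l d" "\<And>F. F \<in> biforms m n k l \<Longrightarrow> section_at p F = (\<Sum>d\<le>D. section_at (f d) F)"
proof -
  obtain D u where "\<forall>F\<in>biforms m n k l. section_at p F = word_eval (bimonomials m n k l) D u (Poly_Mapping.lookup F)"
    using section_at_word_eval by blast
  then show ?thesis
    using that[of "word_section m n k l D u" D] word_section_sections sum_word_section by metis
qed

text \<open>The action is moved from the form to the coefficient vector \<open>u\<close>, where it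
  is a linear map on a fixed space of finite dimension.\<close>

lemma word_eval_substitute:
  assumes "F \<in> biforms m n k l"
  shows "word_eval (bimonomials m n k l) D u (Poly_Mapping.lookup (substitute m n h F)) =
    word_eval (bimonomials m n k l) D
      (\<lambda>w. if w \<in> words (bimonomials m n k l) D then \<Sum>w'\<in>words (bimonomials m n k l) D. list_kernel (form_kernel m n h) w w' * u w' else 0)
      (Poly_Mapping.lookup F)"
proof -
  let ?M = "bimonomials m n k l" and ?W = "words (bimonomials m n k l) D"
  have swap: "prod_list (map2 (\<lambda>I J. a J * b J I) w' w) = prod_list (map2 (\<lambda>J I. b J I) w w') * prod_list (map a w)"
    if "length w = length w'" for a and b :: "bivar monomial \<Rightarrow> bivar monomial \<Rightarrow> complex" and w w'
    using that by (induction w w' rule: list_induct2) (simp_all add: mult_ac)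
  have "prod_list (map (Poly_Mapping.lookup (substitute m n h F)) w')
      = (\<Sum>w\<in>?W. list_kernel (form_kernel m n h) w w' * prod_list (map (Poly_Mapping.lookup F) w))" if "w' \<in> ?W" for w'
  proof -
    have "prod_list (map (Poly_Mapping.lookup (substitute m n h F)) w')
        = prod_list (map (\<lambda>I. \<Sum>J\<in>?M. Poly_Mapping.lookup F J * form_kernel m n h J I) w')"
      by (intro arg_cong[where f = prod_list] map_cong refl lookup_substitute[OF assms])
    also have "\<dots> = (\<Sum>w\<in>?W. if length w = length w' then prod_list (map2 (\<lambda>I J. Poly_Mapping.lookup F J * form_kernel m n h J I) w' w) else 0)"
      by (rule sum_words_prod_list[symmetric]) (use that in \<open>auto simp: words_def\<close>)
    also have "\<dots> = (\<Sum>w\<in>?W. list_kernel (form_kernel m n h) w w' * prod_list (map (Poly_Mapping.lookup F) w))"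
      by (intro sum.cong refl) (simp add: list_kernel_def swap)
    finally show ?thesis .
  qed
  then have "word_eval ?M D u (Poly_Mapping.lookup (substitute m n h F))
      = (\<Sum>w'\<in>?W. \<Sum>w\<in>?W. u w' * (list_kernel (form_kernel m n h) w w' * prod_list (map (Poly_Mapping.lookup F) w)))"
    unfolding word_eval_def sum_distrib_left[symmetric] by (intro sum.cong) auto
  also have "\<dots> = (\<Sum>w\<in>?W. \<Sum>w'\<in>?W. u w' * (list_kernel (form_kernel m n h) w w' * prod_list (map (Poly_Mapping.lookup F) w)))"
    by (rule sum.swap)
  also have "\<dots> = word_eval ?M D (\<lambda>w. if w \<in> ?W then \<Sum>w'\<in>?W. list_kernel (form_kernel m n h) w w' * u w' else 0) (Poly_Mapping.lookup F)"
    unfolding word_eval_def by (intro sum.cong) (auto simp: sum_distrib_left sum_distrib_right mult_ac)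
  finally show ?thesis .
qed

text \<open>The vector \<open>u\<close> of \<open>p\<close> is replaced by an invariant vector
  \<open>u - d\<close>, with \<open>d\<close> a combination of orbit differences of
  \<open>u\<close>. At a form on whose orbit \<open>p\<close> is constant all these differences
  evaluate to 0, so the value is kept. The components \<open>f\<close> depend on \<open>p\<close>
  alone, so they serve for several forms at once.\<close>

theorem reynolds:
  obtains D f where "\<And>d. f d \<in> invariant_sections m n k l d"
    "\<And>F c. F \<in> biforms m n k l \<Longrightarrow> (\<And>h. h \<in> group_elements m n \<Longrightarrow> section_at p (substitute m n h F) = c) \<Longrightarrow>
       (\<Sum>d\<le>D. section_at (f d) F) = c"
proof -
  let ?M = "bimonomials m n k l" and ?G = "group_elements m n"
  obtain D u where u: "\<And>w. w \<notin> words ?M D \<Longrightarrow> u w = 0"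
    "\<And>F. F \<in> biforms m n k l \<Longrightarrow> section_at p F = word_eval ?M D u (Poly_Mapping.lookup F)"
    using section_at_word_eval[of m n k l p] by blast
  let ?W = "words ?M D"
  define K where "K h = list_kernel (form_kernel m n h)" for h
  define R where "R h v w = (if w \<in> ?W then \<Sum>w'\<in>?W. K h w w' * v w' else 0)" for h v w
  have "\<exists>d\<in>orbit_differences (\<lambda>g u w. if w \<in> ?W then (\<Sum>w'\<in>?W. K g w w' * u w') else 0) ?G u.
      \<forall>g\<in>?G. \<forall>w\<in>?W. (\<lambda>g u w. if w \<in> ?W then (\<Sum>w'\<in>?W. K g w w' * u w') else 0) g (\<lambda>w. u w - d w) w = u w - d w"
  proof (rule invariant_point[where gmul = "(\<otimes>\<^bsub>SLxSL m n\<^esub>)" and star = conj_transpose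
        and \<omega> = "\<lambda>w. prod_list (map (\<lambda>J. real (multinomial m n k l J)) w)"])
    show "finite ?W" by (simp add: finite_words)
    show "prod_list (map (\<lambda>J. real (multinomial m n k l J)) w) > 0" if "w \<in> ?W" for w
    proof -
      have "set w \<subseteq> ?M" using that by (simp add: words_def)
      then show ?thesis by (induction w) (simp_all add: multinomial_pos)
    qed
    show "g \<otimes>\<^bsub>SLxSL m n\<^esub> h \<in> ?G" if "g \<in> ?G" "h \<in> ?G" for g h
      unfolding SLxSL_mult using that by (rule mult_in_group)
    show "K (g \<otimes>\<^bsub>SLxSL m n\<^esub> h) w w' = (\<Sum>z\<in>?W. K g w z * K h z w')" if "g \<in> ?G" "h \<in> ?G" "w \<in> ?W" "w' \<in> ?W" for g h w w'
      unfolding K_def by (rule list_kernel_mult[OF finite_bimonomials that(3,4) form_kernel_mult[OF that(1,2)]])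
    show "conj_transpose g \<in> ?G" if "g \<in> ?G" for g using that by (rule conj_transpose_in_group)
    show "prod_list (map (\<lambda>J. real (multinomial m n k l J)) w) * K g w w'
        = cnj (prod_list (map (\<lambda>J. real (multinomial m n k l J)) w') * K (conj_transpose g) w' w)"
      if "g \<in> ?G" "w \<in> ?W" "w' \<in> ?W" for g w w'
    proof -
      have o: "complex_of_real (prod_list (map (\<lambda>J. real (multinomial m n k l J)) w)) = prod_list (map (\<lambda>J. of_nat (multinomial m n k l J)) w)" for w
        by (induction w) simp_all
      show ?thesis
        unfolding K_def o
        by (rule list_kernel_adjoint[where A = ?M]) (use that form_kernel_adjoint[OF that(1)] in \<open>auto simp: words_def\<close>)
    qed
  qed (rule u(1))
  then obtain d where d: "d \<in> orbit_differences R ?G u" "\<And>g w. g \<in> ?G \<Longrightarrow> w \<in> ?W \<Longrightarrow> R g (\<lambda>w. u w - d w) w = u w - d w"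
    unfolding R_def by blast
  define u0 where "u0 = (\<lambda>w. u w - d w)"
  have evR: "word_eval ?M D (R h v) (Poly_Mapping.lookup F) = word_eval ?M D v (Poly_Mapping.lookup (substitute m n h F))"
    if "F \<in> biforms m n k l" for h v F
    unfolding word_eval_substitute[OF that] R_def K_def ..
  have "word_section m n k l D u0 i \<in> invariant_sections m n k l i" for i
    unfolding invariant_sections_def
  proof (intro CollectI conjI ballI)
    show "word_section m n k l D u0 i \<in> sections m n k l i" by (rule word_section_sections)
    fix g F assume g: "g \<in> ?G" and F: "F \<in> biforms m n k l"
    let ?h = "inv\<^bsub>SLxSL m n\<^esub> g" and ?u = "\<lambda>w. if length w = i then u0 w else 0"
    have "R ?h ?u w = ?u w" if "w \<in> ?W" for w
    proof -
      \<comment> \<open>The kernel links only words of equal length, so each homogeneous part of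
        \<open>u0\<close> is invariant by itself.\<close>
      have "R ?h ?u w = (if length w = i then R ?h u0 w else 0)"
        unfolding R_def K_def using that by (auto simp: list_kernel_def intro!: sum.cong sum.neutral)
      then show ?thesis using d(2)[OF inv_in_group[OF g] that] by (simp add: u0_def)
    qed
    then have "word_eval ?M D (R ?h ?u) (Poly_Mapping.lookup F) = word_eval ?M D ?u (Poly_Mapping.lookup F)"
      by (simp add: word_eval_def)
    then show "section_at (word_section m n k l D u0 i) (act m n g F) = section_at (word_section m n k l D u0 i) F"
      unfolding act_eq_substitute section_at_word_section evR[OF F] .
  qed
  moreover have "(\<Sum>i\<le>D. section_at (word_section m n k l D u0 i) F) = c"
    if F: "F \<in> biforms m n k l" and c: "\<And>h. h \<in> ?G \<Longrightarrow> section_at p (substitute m n h F) = c" for F c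
  proof -
    have lin: "word_eval ?M D (\<lambda>w. v w + a * (v' w - v'' w)) x = word_eval ?M D v x + a * (word_eval ?M D v' x - word_eval ?M D v'' x)" for v v' v'' a x
      by (simp add: word_eval_def sum.distrib sum_subtractf sum_distrib_left algebra_simps)
    have one: "(1\<^sub>m (m + 1), 1\<^sub>m (n + 1)) \<in> ?G" by (simp add: group_elements_iff)
    have uc: "word_eval ?M D u (Poly_Mapping.lookup F) = c"
      using c[OF one] substitute_one[OF F] u(2)[OF F] by simp
    have "word_eval ?M D (R h u) (Poly_Mapping.lookup F) = c" if "h \<in> ?G" for h
      unfolding evR[OF F] using c[OF that] u(2)[OF substitute_biforms[OF F]] by simp
    with d(1) have "word_eval ?M D d (Poly_Mapping.lookup F) = 0"
      by induction (simp_all add: lin uc, simp add: word_eval_def)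
    then have "word_eval ?M D u0 (Poly_Mapping.lookup F) = c"
      using uc by (simp add: u0_def word_eval_def algebra_simps sum_subtractf)
    then show ?thesis unfolding sum_word_section .
  qed
  ultimately show ?thesis using that by blast
qed

section \<open>The Nullstellensatz in countably many variables\<close>

lemma linear_dependence:
  fixes a :: "'c \<Rightarrow> 'k \<Rightarrow> complex"
  assumes "finite K" "finite C" "card C > card K"
  shows "\<exists>\<xi>. (\<exists>c\<in>C. \<xi> c \<noteq> 0) \<and> (\<forall>j\<in>K. (\<Sum>c\<in>C. \<xi> c * a c j) = 0)"
  using assms
proof (induction K arbitrary: C a rule: finite_induct)
  case empty
  then have "C \<noteq> {}" by auto
  then show ?case by (intro exI[of _ "\<lambda>_. 1"]) auto
next
  case (insert i K)
  show ?case
  proof (cases "\<forall>c\<in>C. a c i = 0")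
    case True
    obtain \<xi> where "\<exists>c\<in>C. \<xi> c \<noteq> 0" "\<forall>j\<in>K. (\<Sum>c\<in>C. \<xi> c * a c j) = 0"
      using insert.IH[OF insert.prems(1), of a] insert.prems insert.hyps by auto
    with True show ?thesis by (intro exI[of _ \<xi>]) auto
  next
    case False
    then obtain c0 where c0: "c0 \<in> C" "a c0 i \<noteq> 0" by blast
    define a' where "a' c j = a c j - a c i / a c0 i * a c0 j" for c j
    have "card (C - {c0}) > card K" using insert.prems insert.hyps c0 by simp
    then obtain \<xi> where l: "\<exists>c\<in>C - {c0}. \<xi> c \<noteq> 0" "\<forall>j\<in>K. (\<Sum>c\<in>C - {c0}. \<xi> c * a' c j) = 0"
      using insert.IH[of "C - {c0}" a'] insert.prems by auto
    define \<mu> where "\<mu> c = (if c = c0 then - (\<Sum>c\<in>C - {c0}. \<xi> c * a c i) / a c0 i else \<xi> c)" for c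
    have "(\<Sum>c\<in>C. \<mu> c * a c j) = (\<Sum>c\<in>C - {c0}. \<xi> c * a' c j)" for j
    proof -
      have "(\<Sum>c\<in>C. \<mu> c * a c j) = \<mu> c0 * a c0 j + (\<Sum>c\<in>C - {c0}. \<mu> c * a c j)"
        using insert.prems(1) c0(1) by (rule sum.remove)
      also have "(\<Sum>c\<in>C - {c0}. \<mu> c * a c j) = (\<Sum>c\<in>C - {c0}. \<xi> c * a c j)"
        by (intro sum.cong) (auto simp: \<mu>_def)
      also have "\<mu> c0 * a c0 j = (\<Sum>c\<in>C - {c0}. - (\<xi> c * (a c i / a c0 i * a c0 j)))"
        by (simp add: \<mu>_def sum_negf sum_distrib_left sum_distrib_right sum_divide_distrib mult_ac)
      also have "\<dots> + (\<Sum>c\<in>C - {c0}. \<xi> c * a c j) = (\<Sum>c\<in>C - {c0}. \<xi> c * a' c j)"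
        unfolding sum.distrib[symmetric] by (intro sum.cong) (auto simp: a'_def algebra_simps)
      finally show ?thesis .
    qed
    moreover have "a' c i = 0" for c using c0 by (simp add: a'_def)
    ultimately have "\<forall>j\<in>insert i K. (\<Sum>c\<in>C. \<mu> c * a c j) = 0" using l(2) by simp
    moreover have "\<exists>c\<in>C. \<mu> c \<noteq> 0" using l(1) by (auto simp: \<mu>_def)
    ultimately show ?thesis by blast
  qed
qed

definition cpoly_ideal :: "'v cpoly set \<Rightarrow> bool" where
  "cpoly_ideal I \<longleftrightarrow> 0 \<in> I \<and> (\<forall>p\<in>I. \<forall>q\<in>I. p + q \<in> I) \<and> (\<forall>p. \<forall>q\<in>I. p * q \<in> I)"

lemma cpoly_idealD:
  assumes "cpoly_ideal I"
  shows "0 \<in> I" "p \<in> I \<Longrightarrow> q \<in> I \<Longrightarrow> p + q \<in> I" "q \<in> I \<Longrightarrow> p * q \<in> I" "q \<in> I \<Longrightarrow> q * p \<in> I"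
    "p \<in> I \<Longrightarrow> q \<in> I \<Longrightarrow> p - q \<in> I"
proof -
  show "0 \<in> I" "p \<in> I \<Longrightarrow> q \<in> I \<Longrightarrow> p + q \<in> I" "q \<in> I \<Longrightarrow> p * q \<in> I" "q \<in> I \<Longrightarrow> q * p \<in> I"
    using assms by (auto simp: cpoly_ideal_def mult.commute)
  show "p \<in> I \<Longrightarrow> q \<in> I \<Longrightarrow> p - q \<in> I"
  proof -
    assume "p \<in> I" "q \<in> I"
    moreover from this have "(- 1) * q \<in> I" using assms unfolding cpoly_ideal_def by blast
    ultimately have "p + (- 1) * q \<in> I" using assms unfolding cpoly_ideal_def by blast
    then show ?thesis by simp
  qed
qed

lemma cpoly_ideal_sum: "cpoly_ideal I \<Longrightarrow> (\<And>i. i \<in> A \<Longrightarrow> f i \<in> I) \<Longrightarrow> sum f A \<in> I"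
  by (induction A rule: infinite_finite_induct) (auto intro: cpoly_idealD)

lemma maximal_ideal_exists:
  assumes "cpoly_ideal I" "1 \<notin> I"
  obtains M where "I \<subseteq> M" "cpoly_ideal M" "1 \<notin> M" "\<And>p. p \<notin> M \<Longrightarrow> \<exists>q. p * q - 1 \<in> M"
proof -
  let ?A = "{M. I \<subseteq> M \<and> cpoly_ideal M \<and> 1 \<notin> M}"
  have "\<exists>M\<in>?A. \<forall>X\<in>?A. M \<subseteq> X \<longrightarrow> X = M"
  proof (rule subset_Zorn_nonempty)
    show "?A \<noteq> {}" using assms by blast
    fix C assume C: "C \<noteq> {}" "subset.chain ?A C"
    then have sub: "C \<subseteq> ?A" and ch: "\<And>X Y. X \<in> C \<Longrightarrow> Y \<in> C \<Longrightarrow> X \<subseteq> Y \<or> Y \<subseteq> X"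
      by (auto simp: subset_chain_def)
    have "cpoly_ideal (\<Union>C)"
      unfolding cpoly_ideal_def
    proof (intro conjI allI ballI)
      show "0 \<in> \<Union>C" using C(1) sub cpoly_idealD(1) by fastforce
      fix p q assume "p \<in> \<Union>C" "q \<in> \<Union>C"
      then obtain X where "X \<in> C" "p \<in> X" "q \<in> X" using ch by blast
      then show "p + q \<in> \<Union>C" using sub cpoly_idealD(2) by blast
    next
      fix p q assume "q \<in> \<Union>C"
      then show "p * q \<in> \<Union>C" using sub cpoly_idealD(3) by blast
    qed
    moreover have "I \<subseteq> \<Union>C" "1 \<notin> \<Union>C" using C(1) sub by blast+
    ultimately show "\<Union>C \<in> ?A" by blast
  qed
  then obtain M where M: "I \<subseteq> M" "cpoly_ideal M" "1 \<notin> M"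
    and max: "\<And>X. I \<subseteq> X \<Longrightarrow> cpoly_ideal X \<Longrightarrow> 1 \<notin> X \<Longrightarrow> M \<subseteq> X \<Longrightarrow> X = M" by auto
  have "\<exists>q. p * q - 1 \<in> M" if p: "p \<notin> M" for p
  proof -
    let ?X = "{a + p * q | a q. a \<in> M}"
    have "cpoly_ideal ?X"
      unfolding cpoly_ideal_def
    proof (intro conjI allI ballI)
      have "0 = 0 + p * 0" by simp
      then show "0 \<in> ?X" using cpoly_idealD(1)[OF M(2)] by blast
      fix x y assume "x \<in> ?X" "y \<in> ?X"
      then obtain a q b r where "x = a + p * q" "y = b + p * r" "a \<in> M" "b \<in> M" by blast
      then have "x + y = (a + b) + p * (q + r)" "a + b \<in> M" using cpoly_idealD(2)[OF M(2)] by (simp_all add: algebra_simps)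
      then show "x + y \<in> ?X" by blast
    next
      fix x y assume "y \<in> ?X"
      then obtain b r where "y = b + p * r" "b \<in> M" by blast
      then have "x * y = x * b + p * (x * r)" "x * b \<in> M" using cpoly_idealD(3)[OF M(2)] by (simp_all add: algebra_simps)
      then show "x * y \<in> ?X" by blast
    qed
    moreover have "M \<subseteq> ?X"
    proof
      fix a assume "a \<in> M"
      then have "a = a + p * 0" by simp
      then show "a \<in> ?X" using \<open>a \<in> M\<close> by blast
    qed
    moreover have "p \<in> ?X" using cpoly_idealD(1)[OF M(2)] by (metis (mono_tags, lifting) add_0 mem_Collect_eq mult.right_neutral)
    ultimately have "1 \<in> ?X" using max[of ?X] M(1) p by blast
    then obtain a q where aq: "1 = a + p * q" "a \<in> M" by blast
    then have "p * q - 1 = 0 - a" by (simp add: algebra_simps)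
    then have "p * q - 1 \<in> M" using cpoly_idealD(5)[OF M(2) cpoly_idealD(1)[OF M(2)] aq(2)] by simp
    then show ?thesis ..
  qed
  with M show ?thesis using that by blast
qed

lemma countable_poly_mapping: "countable (UNIV :: 'a set) \<Longrightarrow> countable (UNIV :: ('a \<Rightarrow>\<^sub>0 nat) set)"
proof -
  assume c: "countable (UNIV :: 'a set)"
  define g where "g p = (\<lambda>k. (k, Poly_Mapping.lookup p k)) ` Poly_Mapping.keys p" for p :: "'a \<Rightarrow>\<^sub>0 nat"
  have "inj g"
  proof (rule injI)
    fix p q assume eq: "g p = g q"
    show "p = q"
    proof (rule poly_mapping_eqI)
      fix k
      have "(k, v) \<in> g p \<longleftrightarrow> v = Poly_Mapping.lookup p k \<and> v \<noteq> 0" "(k, v) \<in> g q \<longleftrightarrow> v = Poly_Mapping.lookup q k \<and> v \<noteq> 0" for v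
        by (auto simp: g_def in_keys_iff)
      with eq show "Poly_Mapping.lookup p k = Poly_Mapping.lookup q k" by metis
    qed
  qed
  moreover have "g ` UNIV \<subseteq> {F. finite F \<and> F \<subseteq> UNIV \<times> UNIV}" by (auto simp: g_def)
  moreover have "countable {F :: ('a \<times> nat) set. finite F \<and> F \<subseteq> UNIV \<times> UNIV}"
    by (intro countable_Collect_finite_subset countable_SIGMA c) auto
  ultimately show ?thesis
    using countable_subset[of "range g"] countable_image_inj_on[of g UNIV] by simp
qed

text \<open>The ring of polynomials has countable dimension, while the inverses of all \<open>X - c\<close> would be
  linearly independent in a transcendental residue field.\<close>

lemma maximal_ideal_contains_linear:
  assumes cnt: "countable (UNIV :: 'v set)" and M: "cpoly_ideal (M :: 'v cpoly set)" "1 \<notin> M" "\<And>p. p \<notin> M \<Longrightarrow> \<exists>q. p * q - 1 \<in> M"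
  shows "\<exists>c. Var v - Const c \<in> M"
proof (rule ccontr)
  assume "\<not> ?thesis"
  then have "\<forall>c. \<exists>q. (Var v - Const c) * q - 1 \<in> M" using M(3) by blast
  then obtain a where a: "\<And>c. (Var v - Const c) * a c - 1 \<in> M" by metis
  \<comment> \<open>Finite supports in a countable set are countable in number, whereas there are
    uncountably many \<open>c\<close>. So infinitely many of the inverses \<open>a c\<close> share
    one support \<open>K\<close>, and more than \<open>card K\<close> of them are linearly
    dependent.\<close>
  define f where "f c = Poly_Mapping.keys (a c)" for c
  have "countable (range f)"
  proof (rule countable_subset)
    show "range f \<subseteq> {K. finite K \<and> K \<subseteq> UNIV}" by (auto simp: f_def)
    show "countable {K :: 'v monomial set. finite K \<and> K \<subseteq> UNIV}"
      by (intro countable_Collect_finite_subset countable_poly_mapping cnt)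
  qed
  then obtain K where K: "infinite (f -` {K})" "K \<in> range f"
  proof -
    have "\<exists>K\<in>range f. infinite (f -` {K})"
    proof (rule ccontr)
      assume "\<not> ?thesis"
      then have "countable (f -` {K})" if "K \<in> range f" for K using that by (auto intro: countable_finite)
      then have "countable (\<Union>K\<in>range f. f -` {K})" using \<open>countable (range f)\<close> by blast
      moreover have "(\<Union>K\<in>range f. f -` {K}) = (UNIV :: complex set)" by auto
      ultimately have "countable (UNIV :: complex set)" by simp
      then show False using uncountable_UNIV_complex by blast
    qed
    then show ?thesis using that by blast
  qed
  have fK: "finite K" using K(2) by (auto simp: f_def)
  obtain C where C: "C \<subseteq> f -` {K}" "finite C" "card C = Suc (card K)"
    using infinite_arbitrarily_large[OF K(1)] by blast
  have keys: "Poly_Mapping.keys (a c) = K" if "c \<in> C" for c using C(1) that by (auto simp: f_def)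
  obtain \<xi> where l: "\<exists>c\<in>C. \<xi> c \<noteq> 0" "\<forall>j\<in>K. (\<Sum>c\<in>C. \<xi> c * Poly_Mapping.lookup (a c) j) = 0"
    using linear_dependence[OF fK C(2), of "\<lambda>c. Poly_Mapping.lookup (a c)"] C(3) by auto
  have dep: "(\<Sum>c\<in>C. Const (\<xi> c) * a c) = 0"
  proof (rule poly_mapping_eqI)
    fix j
    show "Poly_Mapping.lookup (\<Sum>c\<in>C. Const (\<xi> c) * a c) j = Poly_Mapping.lookup 0 j"
    proof (cases "j \<in> K")
      case True
      then show ?thesis using l(2) by (simp add: lookup_sum lookup_Const_mult)
    next
      case False
      then have "Poly_Mapping.lookup (a c) j = 0" if "c \<in> C" for c using keys[OF that] by (auto simp: in_keys_iff)
      then show ?thesis by (simp add: lookup_sum lookup_Const_mult)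
    qed
  qed
  define E where "E q = poly (map_poly Const q) (Var v :: 'v cpoly)" for q
  have E_0: "E 0 = 0" and E_pCons: "E (pCons c q) = Const c + Var v * E q" for c q
    by (simp_all add: E_def Polynomial.map_poly_pCons)
  have E: "E (p + q) = E p + E q" "E (p * q) = E p * E q" "E [:c:] = Const c" "E [:- c, 1:] = Var v - Const c" "E (sum g A) = (\<Sum>x\<in>A. E (g x))" "E 1 = 1" for p q c g and A :: "complex set"
  proof -
    show add: "E (p + q) = E p + E q" for p q
      by (induction p q rule: poly_induct2) (simp_all add: E_0 E_pCons Const_add algebra_simps)
    have smult: "E (smult a q) = Const a * E q" for a q
      by (induction q) (simp_all add: E_0 E_pCons Const_mult algebra_simps)
    show mult: "E (p * q) = E p * E q" for p q
      by (induction p) (simp_all add: E_0 E_pCons add smult algebra_simps)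
    show "E [:c:] = Const c" for c by (simp add: E_0 E_pCons)
    show "E [:- c, 1:] = Var v - Const c" for c by (simp add: E_0 E_pCons Const_uminus)
    show "E (sum g A) = (\<Sum>x\<in>A. E (g x))" by (induction A rule: infinite_finite_induct) (simp_all add: add E_0)
    show "E 1 = 1" by (simp add: one_pCons E_0 E_pCons)
  qed
  \<comment> \<open>\<open>Q\<close> is the numerator of the sum of the fractions
    \<open>\<xi> c / (X - c)\<close>. Clearing denominators in the linear dependence puts
    \<open>E Q\<close> into \<open>M\<close>. At a point \<open>c\<close> of \<open>C\<close> only
    the summand of \<open>c\<close> survives, so \<open>Q\<close> is not 0.\<close>
  define Q where "Q = (\<Sum>c\<in>C. [:\<xi> c:] * (\<Prod>d\<in>C - {c}. [:- d, 1:]))"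
  have "E Q \<in> M"
  proof -
    define co where "co c = E (\<Prod>d\<in>C - {c}. [:- d, 1:])" for c
    have P: "E (\<Prod>d\<in>C. [:- d, 1:]) = (Var v - Const c) * co c" if "c \<in> C" for c
      unfolding co_def using prod.remove[OF C(2) that, of "\<lambda>d. [:- d, 1:]"] E(2,4) by metis
    have "(\<Sum>c\<in>C. (Const (\<xi> c) * co c) * ((Var v - Const c) * a c - 1)) \<in> M"
      by (intro cpoly_ideal_sum cpoly_idealD(3) M(1) a)
    also have "(\<Sum>c\<in>C. (Const (\<xi> c) * co c) * ((Var v - Const c) * a c - 1))
        = (\<Sum>c\<in>C. (Const (\<xi> c) * a c) * E (\<Prod>d\<in>C. [:- d, 1:]) - Const (\<xi> c) * co c)"
      by (intro sum.cong refl) (simp add: P algebra_simps)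
    also have "\<dots> = 0 - (\<Sum>c\<in>C. Const (\<xi> c) * co c)"
      by (simp add: sum_subtractf dep flip: sum_distrib_right)
    also have "(\<Sum>c\<in>C. Const (\<xi> c) * co c) = E Q" by (simp only: Q_def E(2,3,5) co_def)
    finally have "0 - (0 - E Q) \<in> M" using cpoly_idealD(1,5)[OF M(1)] by blast
    then show ?thesis by simp
  qed
  moreover have "Q \<noteq> 0"
  proof
    assume "Q = 0"
    obtain c where c: "c \<in> C" "\<xi> c \<noteq> 0" using l(1) by blast
    have "poly Q c = (\<Sum>c'\<in>C. \<xi> c' * (\<Prod>d\<in>C - {c'}. c - d))" by (simp add: Q_def poly_sum poly_prod)
    also have "\<dots> = (\<Sum>c'\<in>C. if c' = c then \<xi> c * (\<Prod>d\<in>C - {c}. c - d) else 0)"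
    proof (intro sum.cong refl)
      fix c' assume "c' \<in> C"
      show "\<xi> c' * (\<Prod>d\<in>C - {c'}. c - d) = (if c' = c then \<xi> c * (\<Prod>d\<in>C - {c}. c - d) else 0)"
      proof (cases "c' = c")
        case False
        then have "(\<Prod>d\<in>C - {c'}. c - d) = 0" using c(1) C(2) by (intro prod_zero) auto
        then show ?thesis using False by simp
      qed simp
    qed
    also have "\<dots> \<noteq> 0" using c C(2) by auto
    finally show False using \<open>Q = 0\<close> by simp
  qed
  \<comment> \<open>Over the complex numbers \<open>q\<close> has a linear factor. The cofactor has
    lower degree, so it is invertible modulo \<open>M\<close>, and the linear factor itself would
    lie in \<open>M\<close>.\<close>
  moreover have "\<not> (q \<noteq> 0 \<and> E q \<in> M)" for q
  proof (induction "degree q" arbitrary: q rule: less_induct)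
    case less
    show ?case
    proof
      assume q: "q \<noteq> 0 \<and> E q \<in> M"
      show False
      proof (cases "degree q = 0")
        case True
        then obtain c where "q = [:c:]" by (meson degree_eq_zeroE)
        with q have "c \<noteq> 0" "Const c \<in> M" using E(3) by auto
        then have "Const (inverse c) * Const c \<in> M" using cpoly_idealD(3)[OF M(1)] by blast
        then show False using M(2) \<open>c \<noteq> 0\<close> by (simp flip: Const_mult)
      next
        case False
        then obtain r where "poly q r = 0" using fundamental_theorem_of_algebra constant_degree by metis
        then obtain q' where q': "q = [:- r, 1:] * q'" using poly_eq_0_iff_dvd by (metis dvdE)
        with q have "q' \<noteq> 0" by auto
        then have "degree q = degree [:- r, 1:] + degree q'" unfolding q' by (intro degree_mult_eq) auto
        then have "degree q' < degree q" by simp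
        with less \<open>q' \<noteq> 0\<close> have "E q' \<notin> M" by blast
        then obtain b where b: "E q' * b - 1 \<in> M" using M(3) by blast
        have "(Var v - Const r) * E q' * b \<in> M"
          using q q' E(2,4) cpoly_idealD(4)[OF M(1)] by metis
        moreover have "(Var v - Const r) * (E q' * b - 1) \<in> M" using cpoly_idealD(3)[OF M(1) b] .
        ultimately have "(Var v - Const r) * E q' * b - (Var v - Const r) * (E q' * b - 1) \<in> M"
          using cpoly_idealD(5)[OF M(1)] by blast
        then have "Var v - Const r \<in> M" by (simp add: algebra_simps)
        then show False using \<open>\<not> (\<exists>c. Var v - Const c \<in> M)\<close> by blast
      qed
    qed
  qed
  ultimately show False by blast
qed

text \<open>Modulo a maximal ideal every variable is congruent to a constant, hence every polynomial
  to its value at these constants. Countably many variables are allowed because the type of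
  monomials, which indexes the coordinates of a form, is countably infinite.\<close>

theorem weak_nullstellensatz:
  assumes cnt: "countable (UNIV :: 'v set)" and I: "cpoly_ideal (I :: 'v cpoly set)" "1 \<notin> I"
  obtains w where "\<And>p. p \<in> I \<Longrightarrow> cpoly_eval w p = 0"
proof -
  obtain M where M: "I \<subseteq> M" "cpoly_ideal M" "1 \<notin> M" "\<And>p. p \<notin> M \<Longrightarrow> \<exists>q. p * q - 1 \<in> M"
    using maximal_ideal_exists[OF I] by metis
  have "\<forall>v. \<exists>c. Var v - Const c \<in> M" using maximal_ideal_contains_linear[OF cnt M(2-4)] by blast
  then obtain w where w: "\<And>v. Var v - Const (w v) \<in> M" by metis
  have ev: "p - Const (cpoly_eval w p) \<in> M" for p
  proof (induction p rule: cpoly_induct)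
    case (Const c)
    then show ?case using cpoly_idealD(1)[OF M(2)] by (simp add: cpoly_eval_def)
  next
    case (Var v)
    then show ?case using w by (simp add: cpoly_eval_def)
  next
    case (add p q)
    have "(p - Const (cpoly_eval w p)) + (q - Const (cpoly_eval w q)) \<in> M" using cpoly_idealD(2)[OF M(2)] add by blast
    then show ?case by (simp add: cpoly_eval_def ident.cpoly_hom_add Const_add algebra_simps)
  next
    case (mult p q)
    have "q * (p - Const (cpoly_eval w p)) + Const (cpoly_eval w p) * (q - Const (cpoly_eval w q)) \<in> M"
      using cpoly_idealD(2,3)[OF M(2)] mult by blast
    then show ?case by (simp add: cpoly_eval_def ident.cpoly_hom_mult Const_mult algebra_simps)
  qed
  have "cpoly_eval w p = 0" if "p \<in> I" for p
  proof (rule ccontr)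
    assume c: "cpoly_eval w p \<noteq> 0"
    have "p - (p - Const (cpoly_eval w p)) \<in> M" using cpoly_idealD(5)[OF M(2) _ ev] that M(1) by blast
    then have "Const (inverse (cpoly_eval w p)) * Const (cpoly_eval w p) \<in> M" using cpoly_idealD(3)[OF M(2)] by simp
    then show False using M(3) c by (simp flip: Const_mult)
  qed
  then show ?thesis using that by blast
qed

section \<open>Families of forms over a place\<close>

text \<open>The numerical criterion without the minimum in \<open>HM\<close>, which is meaningful
  only for non-zero forms, and with substitutions in place of the left action.\<close>

definition weakly_destabilized :: "nat \<Rightarrow> nat \<Rightarrow> nat \<Rightarrow> nat \<Rightarrow> bivar cpoly \<Rightarrow> bool" where
  "weakly_destabilized m n k l F \<longleftrightarrow> (\<exists>h\<in>group_elements m n. \<exists>lam\<in>fundamental_set m n k l.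
     \<forall>I\<in>Poly_Mapping.keys (substitute m n h F). 0 \<le> pairing m n I lam)"

definition destabilized :: "nat \<Rightarrow> nat \<Rightarrow> nat \<Rightarrow> nat \<Rightarrow> bivar cpoly \<Rightarrow> bool" where
  "destabilized m n k l F \<longleftrightarrow> (\<exists>h\<in>group_elements m n. \<exists>lam\<in>fundamental_set m n k l.
     \<forall>I\<in>Poly_Mapping.keys (substitute m n h F). 0 < pairing m n I lam)"

lemma biforms_eqI:
  assumes "F \<in> biforms m n k l" "F' \<in> biforms m n k l" "\<And>I. I \<in> bimonomials m n k l \<Longrightarrow> Poly_Mapping.lookup F I = Poly_Mapping.lookup F' I"
  shows "F = F'"
  using assms biforms_lookup by (intro poly_mapping_eqI) metis

lemma weight_eq_sum: "weight m n y I = (\<Sum>v\<in>coords m n. int (Poly_Mapping.lookup I v) * y v)"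
  by (simp add: weight_def mult.commute)

lemma keys_biforms: "F \<in> biforms m n k l \<Longrightarrow> Poly_Mapping.keys F \<subseteq> bimonomials m n k l"
  by (simp add: biforms_def)

context place
begin

lemma prod_list:
  assumes "\<And>i. i \<in> set is \<Longrightarrow> f i \<in> B"
  shows "(\<lambda>x. prod_list (map (\<lambda>i. f i x) is)) \<in> B" "\<phi> (\<lambda>x. prod_list (map (\<lambda>i. f i x) is)) = prod_list (map (\<lambda>i. \<phi> (f i)) is)"
  using assms by (induction "is") (auto simp: mult)

definition group_mem :: "nat \<Rightarrow> nat \<Rightarrow> ('x \<Rightarrow> complex mat \<times> complex mat) \<Rightarrow> bool" where
  "group_mem m n h \<longleftrightarrow> SL_mem (m + 1) (\<lambda>x. fst (h x)) \<and> SL_mem (n + 1) (\<lambda>x. snd (h x))"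

definition lim_pair :: "nat \<Rightarrow> nat \<Rightarrow> ('x \<Rightarrow> complex mat \<times> complex mat) \<Rightarrow> complex mat \<times> complex mat" where
  "lim_pair m n h = (lim_mat (m + 1) (\<lambda>x. fst (h x)), lim_mat (n + 1) (\<lambda>x. snd (h x)))"

lemma lim_pair_in_group: "group_mem m n h \<Longrightarrow> lim_pair m n h \<in> group_elements m n"
  using SL_mem_det_lim[of "m + 1"] SL_mem_det_lim[of "n + 1"] by (auto simp: group_elements_iff lim_pair_def group_mem_def)

lemma index_kernel_mem:
  assumes "group_mem m n h" "e \<in> indices m n k l" "e' \<in> indices m n k l"
  shows "(\<lambda>x. index_kernel (h x) e e') \<in> B" "\<phi> (\<lambda>x. index_kernel (h x) e e') = index_kernel (lim_pair m n h) e e'"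
proof -
  have half: "(\<lambda>x. prod_list (map2 (\<lambda>i j. M x $$ (i, j)) xs ys)) \<in> B"
    "\<phi> (\<lambda>x. prod_list (map2 (\<lambda>i j. M x $$ (i, j)) xs ys)) = prod_list (map2 (\<lambda>i j. lim_mat N M $$ (i, j)) xs ys)"
    if "mat_mem N M" "set xs \<subseteq> {..<N}" "set ys \<subseteq> {..<N}" for N M xs ys
  proof -
    have ij: "i < N" "j < N" if "(i, j) \<in> set (zip xs ys)" for i j
      using set_zip_leftD[OF that] set_zip_rightD[OF that] \<open>set xs \<subseteq> {..<N}\<close> \<open>set ys \<subseteq> {..<N}\<close> by auto
    have mem: "(\<lambda>x. M x $$ p) \<in> B" "\<phi> (\<lambda>x. M x $$ p) = lim_mat N M $$ p" if "p \<in> set (zip xs ys)" for p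
      using ij[of "fst p" "snd p"] that mat_memD(2)[OF \<open>mat_mem N M\<close>, of "fst p" "snd p"] lim_mat_index[of "fst p" N "snd p" M]
      by simp_all
    have map_eq: "map2 (\<lambda>i j. A $$ (i, j)) xs ys = map (\<lambda>p. A $$ p) (zip xs ys)" for A :: "complex mat"
      by (simp add: case_prod_unfold)
    show "(\<lambda>x. prod_list (map2 (\<lambda>i j. M x $$ (i, j)) xs ys)) \<in> B"
      unfolding map_eq by (rule prod_list(1)) (rule mem(1))
    have "\<phi> (\<lambda>x. prod_list (map (\<lambda>p. M x $$ p) (zip xs ys))) = prod_list (map (\<lambda>p. \<phi> (\<lambda>x. M x $$ p)) (zip xs ys))"
      by (rule prod_list(2)) (rule mem(1))
    also have "map (\<lambda>p. \<phi> (\<lambda>x. M x $$ p)) (zip xs ys) = map (\<lambda>p. lim_mat N M $$ p) (zip xs ys)"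
      by (intro map_cong refl mem(2))
    finally show "\<phi> (\<lambda>x. prod_list (map2 (\<lambda>i j. M x $$ (i, j)) xs ys)) = prod_list (map2 (\<lambda>i j. lim_mat N M $$ (i, j)) xs ys)"
      unfolding map_eq .
  qed
  have M: "mat_mem (m + 1) (\<lambda>x. fst (h x))" "mat_mem (n + 1) (\<lambda>x. snd (h x))"
    using assms(1) by (auto simp: group_mem_def SL_mem_def)
  have s: "set (fst e) \<subseteq> {..<m + 1}" "set (fst e') \<subseteq> {..<m + 1}" "set (snd e) \<subseteq> {..<n + 1}" "set (snd e') \<subseteq> {..<n + 1}"
    using assms(2,3) by (auto simp: indices_def less_Suc_eq_le)
  show "(\<lambda>x. index_kernel (h x) e e') \<in> B" "\<phi> (\<lambda>x. index_kernel (h x) e e') = index_kernel (lim_pair m n h) e e'"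
    unfolding index_kernel_def lim_pair_def fst_conv snd_conv
    using mult[OF half(1)[OF M(1) s(1,2)] half(1)[OF M(2) s(3,4)]] half(2)[OF M(1) s(1,2)] half(2)[OF M(2) s(3,4)]
    by simp_all
qed

lemma form_kernel_mem:
  assumes "group_mem m n h" "J \<in> bimonomials m n k l"
  shows "(\<lambda>x. form_kernel m n (h x) J I) \<in> B" "\<phi> (\<lambda>x. form_kernel m n (h x) J I) = form_kernel m n (lim_pair m n h) J I"
proof -
  obtain e where e: "e \<in> indices m n k l" "J = index_monomial e" using assms(2) by (auto simp: bimonomials_eq_image)
  let ?E = "{e' \<in> indices m n k l. index_monomial e' = I}"
  have "(\<lambda>x. index_kernel (h x) e e') \<in> B" "\<phi> (\<lambda>x. index_kernel (h x) e e') = index_kernel (lim_pair m n h) e e'" if "e' \<in> ?E" for e'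
    using index_kernel_mem[OF assms(1) e(1)] that by auto
  then show "(\<lambda>x. form_kernel m n (h x) J I) \<in> B" "\<phi> (\<lambda>x. form_kernel m n (h x) J I) = form_kernel m n (lim_pair m n h) J I"
    unfolding e(2) form_kernel_index[OF e(1)] using sum[of ?E "\<lambda>e' x. index_kernel (h x) e e'"] by simp_all
qed

definition form_mem :: "nat \<Rightarrow> nat \<Rightarrow> nat \<Rightarrow> nat \<Rightarrow> ('x \<Rightarrow> bivar cpoly) \<Rightarrow> bool" where
  "form_mem m n k l v \<longleftrightarrow> (\<forall>x. v x \<in> biforms m n k l) \<and> (\<forall>I\<in>bimonomials m n k l. (\<lambda>x. Poly_Mapping.lookup (v x) I) \<in> B)"

definition lim_form :: "nat \<Rightarrow> nat \<Rightarrow> nat \<Rightarrow> nat \<Rightarrow> ('x \<Rightarrow> bivar cpoly) \<Rightarrow> bivar cpoly" where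
  "lim_form m n k l v = (\<Sum>I\<in>bimonomials m n k l. Const (\<phi> (\<lambda>x. Poly_Mapping.lookup (v x) I)) * Poly_Mapping.single I 1)"

lemma lim_form_biforms [simp]: "lim_form m n k l v \<in> biforms m n k l"
  unfolding lim_form_def by (intro biforms_sum biforms_Const_mult biforms_single)

lemma lookup_lim_form:
  "I \<in> bimonomials m n k l \<Longrightarrow> Poly_Mapping.lookup (lim_form m n k l v) I = \<phi> (\<lambda>x. Poly_Mapping.lookup (v x) I)"
proof -
  assume I: "I \<in> bimonomials m n k l"
  have "Poly_Mapping.lookup (lim_form m n k l v) I
      = (\<Sum>J\<in>bimonomials m n k l. if J = I then \<phi> (\<lambda>x. Poly_Mapping.lookup (v x) I) else 0)"
    unfolding lim_form_def lookup_sum by (intro sum.cong refl) (simp add: lookup_Const_mult lookup_single when_def)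
  then show ?thesis using I by simp
qed

lemma lim_form_eqI:
  assumes "F \<in> biforms m n k l" "\<And>I. I \<in> bimonomials m n k l \<Longrightarrow> \<phi> (\<lambda>x. Poly_Mapping.lookup (v x) I) = Poly_Mapping.lookup F I"
  shows "lim_form m n k l v = F"
  by (rule biforms_eqI[OF lim_form_biforms assms(1)]) (simp add: lookup_lim_form assms(2))

lemma form_mem_const: "F \<in> biforms m n k l \<Longrightarrow> form_mem m n k l (\<lambda>_. F)"
  by (simp add: form_mem_def)

lemma lim_form_const: "F \<in> biforms m n k l \<Longrightarrow> lim_form m n k l (\<lambda>_. F) = F"
  by (rule lim_form_eqI) simp_all

lemma form_memD:
  assumes "form_mem m n k l v"
  shows "v x \<in> biforms m n k l" "(\<lambda>x. Poly_Mapping.lookup (v x) I) \<in> B" "\<phi> (\<lambda>x. Poly_Mapping.lookup (v x) I) = Poly_Mapping.lookup (lim_form m n k l v) I"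
proof -
  show v: "v x \<in> biforms m n k l" for x using assms by (simp add: form_mem_def)
  have z: "(\<lambda>x. Poly_Mapping.lookup (v x) I) = (\<lambda>_. 0)" if "I \<notin> bimonomials m n k l"
    using biforms_lookup[OF v that] by auto
  show "(\<lambda>x. Poly_Mapping.lookup (v x) I) \<in> B"
    using assms z by (cases "I \<in> bimonomials m n k l") (auto simp: form_mem_def)
  show "\<phi> (\<lambda>x. Poly_Mapping.lookup (v x) I) = Poly_Mapping.lookup (lim_form m n k l v) I"
    using z biforms_lookup[OF lim_form_biforms] by (cases "I \<in> bimonomials m n k l") (auto simp: lookup_lim_form)
qed

text \<open>The coefficients of the transformed form are polynomial in the matrix entries and in the
  coefficients of the form, so they stay bounded and residues can be taken factor by factor.\<close>

lemma substitute_mem: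
  assumes "group_mem m n h" "form_mem m n k l v"
  shows "form_mem m n k l (\<lambda>x. substitute m n (h x) (v x))"
    "lim_form m n k l (\<lambda>x. substitute m n (h x) (v x)) = substitute m n (lim_pair m n h) (lim_form m n k l v)"
proof -
  let ?M = "bimonomials m n k l"
  have l: "(\<lambda>x. Poly_Mapping.lookup (substitute m n (h x) (v x)) I) = (\<lambda>x. \<Sum>J\<in>?M. Poly_Mapping.lookup (v x) J * form_kernel m n (h x) J I)" for I
    using lookup_substitute[OF form_memD(1)[OF assms(2)]] by auto
  have t: "(\<lambda>x. Poly_Mapping.lookup (v x) J * form_kernel m n (h x) J I) \<in> B"
    "\<phi> (\<lambda>x. Poly_Mapping.lookup (v x) J * form_kernel m n (h x) J I) = Poly_Mapping.lookup (lim_form m n k l v) J * form_kernel m n (lim_pair m n h) J I"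
    if "J \<in> ?M" for J I
    using mult[OF form_memD(2)[OF assms(2)] form_kernel_mem(1)[OF assms(1) that]] form_memD(3)[OF assms(2)] form_kernel_mem(2)[OF assms(1) that]
    by simp_all
  have s: "(\<lambda>x. Poly_Mapping.lookup (substitute m n (h x) (v x)) I) \<in> B"
    "\<phi> (\<lambda>x. Poly_Mapping.lookup (substitute m n (h x) (v x)) I) = Poly_Mapping.lookup (substitute m n (lim_pair m n h) (lim_form m n k l v)) I" for I
    unfolding l lookup_substitute[OF lim_form_biforms]
    using sum[of ?M "\<lambda>J x. Poly_Mapping.lookup (v x) J * form_kernel m n (h x) J I"] t by simp_all
  show "form_mem m n k l (\<lambda>x. substitute m n (h x) (v x))"
    unfolding form_mem_def using s(1) substitute_biforms form_memD(1)[OF assms(2)] by blast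
  show "lim_form m n k l (\<lambda>x. substitute m n (h x) (v x)) = substitute m n (lim_pair m n h) (lim_form m n k l v)"
    by (rule lim_form_eqI) (simp_all add: s(2) substitute_biforms)
qed

lemma section_at_mem:
  assumes "form_mem m n k l v"
  shows "(\<lambda>x. section_at p (v x)) \<in> B \<and> \<phi> (\<lambda>x. section_at p (v x)) = section_at p (lim_form m n k l v)"
proof (induction p rule: cpoly_induct)
  case (Var I)
  then show ?case using form_memD(2,3)[OF assms] by simp
qed (simp_all add: add mult)

section \<open>Cartan decomposition and properness over a place\<close>

definition smith_data :: "nat \<Rightarrow> ('x \<Rightarrow> complex mat) \<Rightarrow> ('x \<Rightarrow> complex mat) \<Rightarrow> ('x \<Rightarrow> complex mat) \<Rightarrow> bool" where
  "smith_data N M K L \<longleftrightarrow> SL_mem N K \<and> SL_mem N L \<and>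
     ae (\<lambda>x. \<forall>i<N. \<forall>j<N. i \<noteq> j \<longrightarrow> (K x * M x * L x) $$ (i, j) = 0) \<and>
     (\<forall>i j. i \<le> j \<longrightarrow> j < N \<longrightarrow> divides (\<lambda>x. (K x * M x * L x) $$ (i, i)) (\<lambda>x. (K x * M x * L x) $$ (j, j)))"

definition cartan_data :: "nat \<Rightarrow> ('x \<Rightarrow> complex mat) \<Rightarrow> ('x \<Rightarrow> complex mat) \<Rightarrow> (nat \<Rightarrow> 'x \<Rightarrow> complex) \<Rightarrow> ('x \<Rightarrow> complex mat) \<Rightarrow> bool" where
  "cartan_data N A L t K \<longleftrightarrow> SL_mem N L \<and> SL_mem N K \<and> (\<forall>i x. t i x \<noteq> 0) \<and>
     ae (\<lambda>x. A x = L x * mat N N (\<lambda>(i, j). if i = j then t i x else 0) * K x) \<and>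
     (\<forall>i j. i \<le> j \<longrightarrow> j < N \<longrightarrow> (\<lambda>x. t i x / t j x) \<in> B) \<and> ae (\<lambda>x. (\<Prod>i<N. t i x) = 1)"

lemma smith_data_exists: "(\<And>x. M x \<in> carrier_mat N N) \<Longrightarrow> \<exists>K L. smith_data N M K L"
  by (rule smith_normal_form[of M N]) (blast, unfold smith_data_def, blast)

text \<open>The Smith form is applied to the inverse of \<open>A\<close>. Each of its diagonal
  entries divides the later ones, so their inverses \<open>t\<close> have bounded quotients
  \<open>t i / t j\<close> for \<open>i \<le> j\<close>, which is the order of a dominant
  weight.\<close>

theorem cartan_decomposition:
  assumes A: "\<And>x. A x \<in> carrier_mat N N" "\<And>x. det (A x) = 1"
  shows "\<exists>L t K. cartan_data N A L t K"
proof -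
  let ?A' = "\<lambda>x. adj_mat (A x)"
  have A': "?A' x \<in> carrier_mat N N" "A x * ?A' x = 1\<^sub>m N" "?A' x * A x = 1\<^sub>m N" for x
    using adj_mat[OF A(1)[of x]] A(2)[of x] by auto
  have dA': "det (?A' x) = 1" for x using det_mult[OF A(1)[of x] A'(1)[of x]] A'(2)[of x] A(2)[of x] by simp
  obtain K L where "smith_data N ?A' K L" using smith_data_exists[of ?A' N] A'(1) by blast
  then have KL: "SL_mem N K" "SL_mem N L"
    and diag: "ae (\<lambda>x. \<forall>i<N. \<forall>j<N. i \<noteq> j \<longrightarrow> (K x * ?A' x * L x) $$ (i, j) = 0)"
    and dv: "\<And>i j. i \<le> j \<Longrightarrow> j < N \<Longrightarrow> divides (\<lambda>x. (K x * ?A' x * L x) $$ (i, i)) (\<lambda>x. (K x * ?A' x * L x) $$ (j, j))"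
    unfolding smith_data_def by blast+
  define D where "D x = K x * ?A' x * L x" for x
  have c: "K x \<in> carrier_mat N N" "L x \<in> carrier_mat N N" "D x \<in> carrier_mat N N" for x
    using KL A'(1) by (auto simp: SL_mem_def mat_mem_def D_def intro!: mult_carrier_mat[of _ N N])
  obtain K' where K': "SL_mem N K'" "\<And>x. K x * K' x = 1\<^sub>m N" "\<And>x. K' x * K x = 1\<^sub>m N" using SL_mem_inverse[OF KL(1)] by metis
  obtain L' where L': "SL_mem N L'" "\<And>x. L x * L' x = 1\<^sub>m N" "\<And>x. L' x * L x = 1\<^sub>m N" using SL_mem_inverse[OF KL(2)] by metis
  have c': "K' x \<in> carrier_mat N N" "L' x \<in> carrier_mat N N" for x
    using K'(1) L'(1) by (auto simp: SL_mem_def mat_mem_def)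
  define good where "good x \<longleftrightarrow> (\<forall>i<N. \<forall>j<N. i \<noteq> j \<longrightarrow> D x $$ (i, j) = 0)" for x
  have good: "ae good" using diag by (simp add: good_def[abs_def] D_def)
  have dD: "(\<Prod>i<N. D x $$ (i, i)) = 1" if "good x" for x
  proof -
    have "det (D x) = prod_list (diag_mat (D x))"
      by (rule det_upper_triangular[OF _ c(3)]) (use that c(3)[of x] in \<open>auto simp: good_def upper_triangular_def\<close>)
    also have "\<dots> = (\<Prod>i<N. D x $$ (i, i))"
      using c(3)[of x] by (simp add: prod_list_diag_prod atLeast0LessThan)
    finally have "det (D x) = (\<Prod>i<N. D x $$ (i, i))" .
    moreover have "det (D x) = 1"
      using KL dA'[of x] det_mult[OF mult_carrier_mat[OF c(1)[of x] A'(1)] c(2)[of x]] det_mult[OF c(1)[of x] A'(1)[of x]]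
      by (simp add: D_def SL_mem_def)
    ultimately show ?thesis by simp
  qed
  have Dnz: "D x $$ (i, i) \<noteq> 0" if "good x" "i < N" for x i
    using dD[OF that(1)] that(2) by (metis finite_lessThan lessThan_iff prod_zero_iff zero_neq_one)
  \<comment> \<open>The value 1 outside the good set keeps \<open>t\<close> non-zero everywhere,
    since negative powers of \<open>t\<close> will be formed.\<close>
  define t where "t i x = (if good x \<and> i < N then inverse (D x $$ (i, i)) else 1)" for i x
  define T where "T x = mat N N (\<lambda>(i, j). if i = j then t i x else 0)" for x
  have tnz: "t i x \<noteq> 0" for i x using Dnz by (auto simp: t_def)
  have "A x = L x * T x * K x" if g: "good x" for x
  proof -
    have Tc: "T x \<in> carrier_mat N N" by (simp add: T_def)
    have TD: "T x * D x = 1\<^sub>m N"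
    proof (rule eq_matI)
      fix i j assume "i < dim_row (1\<^sub>m N)" "j < dim_col (1\<^sub>m N)"
      then have ij: "i < N" "j < N" by auto
      have "(T x * D x) $$ (i, j) = (\<Sum>k<N. T x $$ (i, k) * D x $$ (k, j))" by (rule mult_mat_index[OF Tc c(3) ij])
      also have "\<dots> = (\<Sum>k<N. if k = i then t i x * D x $$ (i, j) else 0)"
        using ij by (intro sum.cong) (auto simp: T_def)
      also have "\<dots> = t i x * D x $$ (i, j)" using ij by simp
      also have "\<dots> = 1\<^sub>m N $$ (i, j)" using ij g Dnz[OF g] by (auto simp: t_def good_def)
      finally show "(T x * D x) $$ (i, j) = 1\<^sub>m N $$ (i, j)" .
    qed (use Tc c in auto)
    have D': "?A' x = K' x * D x * L' x"
    proof -
      have "K' x * D x * L' x = K' x * (K x * (?A' x * L x)) * L' x"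
        unfolding D_def using c[of x] c'[of x] A'(1)[of x] by (simp add: assoc_mult_mat[of _ N N _ N _ N])
      also have "\<dots> = (K' x * K x) * ?A' x * (L x * L' x)"
        using c[of x] c'[of x] A'(1)[of x] by (simp add: assoc_mult_mat[of _ N N _ N _ N])
      finally show ?thesis using A'(1)[of x] K'(3) L'(2) by simp
    qed
    have "L x * T x * K x * ?A' x = L x * T x * (K x * K' x) * D x * L' x"
      unfolding D' using c[of x] c'[of x] Tc by (simp add: assoc_mult_mat[of _ N N _ N _ N])
    also have "\<dots> = L x * (T x * D x) * L' x"
      using c[of x] c'[of x] Tc K'(2) by (simp add: assoc_mult_mat[of _ N N _ N _ N])
    also have "\<dots> = 1\<^sub>m N" using TD L'(2) c[of x] by simp
    finally have "L x * T x * K x * ?A' x = 1\<^sub>m N" .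
    then have "L x * T x * K x * (?A' x * A x) = A x"
      using c[of x] Tc A(1)[of x] A'(1)[of x] assoc_mult_mat[of "L x * T x * K x" N N "?A' x" N "A x" N] by simp
    then show ?thesis using c[of x] Tc by (simp add: A'(3))
  qed
  then have dec: "ae (\<lambda>x. A x = L x * T x * K x)" by (rule ae_mp[OF good])
  have ratio: "(\<lambda>x. t i x / t j x) \<in> B" if ij: "i \<le> j" "j < N" for i j
  proof -
    obtain r where r: "r \<in> B" "ae (\<lambda>x. D x $$ (j, j) = r x * D x $$ (i, i))"
      using dv[OF ij] unfolding divides_def D_def by blast
    have "ae (\<lambda>x. t i x / t j x = r x)"
      by (rule ae_elim2[OF r(2) good]) (use that Dnz in \<open>auto simp: t_def field_simps\<close>)
    then show ?thesis by (rule ae_cong(1)[OF _ r(1)])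
  qed
  have prod1: "ae (\<lambda>x. (\<Prod>i<N. t i x) = 1)"
  proof (rule ae_mp[OF good])
    fix x assume g: "good x"
    have "(\<Prod>i<N. t i x) = inverse (\<Prod>i<N. D x $$ (i, i))"
      unfolding prod_inversef[symmetric] using g by (intro prod.cong) (auto simp: t_def comp_def)
    then show "(\<Prod>i<N. t i x) = 1" using dD[OF g] by simp
  qed
  have "cartan_data N A L t K"
    unfolding cartan_data_def using KL tnz dec[unfolded T_def] ratio prod1 by blast
  then show ?thesis by blast
qed

lemma torus_char_power: "torus_char J t (\<lambda>v. int (a v)) x = (\<Prod>v\<in>J. t v x ^ a v)"
  by (simp add: torus_char_def)

lemma torus_char_difference:
  assumes "u \<in> coords m n" "w \<in> coords m n" "u \<noteq> w"
  shows "torus_char (coords m n) t (difference u w) = (\<lambda>x. t u x / t w x)"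
proof
  fix x
  have "torus_char (coords m n) t (difference u w) x
      = (\<Prod>v\<in>coords m n. (if v = u then t u x else 1) * (if v = w then inverse (t w x) else 1))"
    unfolding torus_char_def difference_def using assms(3) by (intro prod.cong) (auto simp: power_int_minus)
  also have "\<dots> = t u x * inverse (t w x)" using assms(1,2) by (simp add: prod.distrib)
  finally show "torus_char (coords m n) t (difference u w) x = t u x / t w x" by (simp add: divide_inverse)
qed

lemma torus_char_single:
  assumes "finite J" "w \<in> J"
  shows "torus_char J t (\<lambda>v. if v = w then -1 else 0) x = inverse (t w x)"
proof -
  have "torus_char J t (\<lambda>v. if v = w then -1 else 0) x = (\<Prod>v\<in>J. if v = w then inverse (t w x) else 1)"
    unfolding torus_char_def by (intro prod.cong) (auto simp: power_int_minus)
  then show ?thesis using assms by simp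
qed

text \<open>The inequalities of the Weyl chamber join the set \<open>A\<close> before valuations are
  replaced by integers. Determinant 1 amounts to vanishing sums of the weights, each expressed by
  two opposite inequalities.\<close>

lemma dominant_vector_exists:
  assumes t: "\<And>v x. t v x \<noteq> 0"
    and dec: "\<And>i. i < m \<Longrightarrow> (\<lambda>x. t (x_var i) x / t (x_var (i + 1)) x) \<in> B" "\<And>j. j < n \<Longrightarrow> (\<lambda>x. t (y_var j) x / t (y_var (j + 1)) x) \<in> B"
    and one: "ae (\<lambda>x. (\<Prod>i\<le>m. t (x_var i) x) = 1)" "ae (\<lambda>x. (\<Prod>j\<le>n. t (y_var j) x) = 1)"
    and A: "finite A" "\<And>a. a \<in> A \<Longrightarrow> torus_char (coords m n) t a \<in> B" and b: "infinitesimal (torus_char (coords m n) t b)"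
  shows "\<exists>y. dominant m n y \<and> (\<forall>a\<in>A. 0 \<le> (\<Sum>v\<in>coords m n. a v * y v)) \<and> 0 < (\<Sum>v\<in>coords m n. b v * y v)"
proof -
  let ?J = "coords m n"
  define X where "X c v = (case v of x_var i \<Rightarrow> c | y_var j \<Rightarrow> 0)" for c :: int and v
  define Y where "Y c v = (case v of x_var i \<Rightarrow> 0 | y_var j \<Rightarrow> c)" for c :: int and v
  define A' where "A' = A \<union> (\<lambda>i. difference (x_var i) (x_var (i + 1))) ` {..<m} \<union> (\<lambda>j. difference (y_var j) (y_var (j + 1))) ` {..<n}
    \<union> {X 1, X (-1), Y 1, Y (-1)}"
  have J: "i \<le> m \<Longrightarrow> x_var i \<in> ?J" "j \<le> n \<Longrightarrow> y_var j \<in> ?J" for i j by (auto simp: coords_def)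
  have prod_coords: "(\<Prod>v\<in>?J. f v) = (\<Prod>i\<le>m. f (x_var i)) * (\<Prod>j\<le>n. f (y_var j))" for f :: "bivar \<Rightarrow> complex"
  proof -
    have "(\<Prod>v\<in>?J. f v) = prod f (x_var ` {..m}) * prod f (y_var ` {..n})"
      unfolding coords_def by (rule prod.union_disjoint) auto
    then show ?thesis by (simp add: prod.reindex inj_on_def)
  qed
  have c1: "torus_char ?J t (X c) = (\<lambda>x. (\<Prod>i\<le>m. t (x_var i) x) powi c)" "torus_char ?J t (Y c) = (\<lambda>x. (\<Prod>j\<le>n. t (y_var j) x) powi c)" for c
  proof -
    have pw: "(\<Prod>i\<in>S. f i powi c) = (\<Prod>i\<in>S. f i) powi c" for S :: "nat set" and f :: "nat \<Rightarrow> complex"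
      by (induction S rule: infinite_finite_induct) (simp_all add: power_int_mult_distrib)
    show "torus_char ?J t (X c) = (\<lambda>x. (\<Prod>i\<le>m. t (x_var i) x) powi c)" "torus_char ?J t (Y c) = (\<lambda>x. (\<Prod>j\<le>n. t (y_var j) x) powi c)"
      unfolding torus_char_def prod_coords X_def Y_def bivar.case pw by simp_all
  qed
  have "(\<lambda>x. (\<Prod>i\<le>m. t (x_var i) x) powi c) \<in> B" "(\<lambda>x. (\<Prod>j\<le>n. t (y_var j) x) powi c) \<in> B" for c
    by (rule ae_cong(1)[OF _ const(1)[of 1]], rule ae_mp[OF one(1)], simp)
      (rule ae_cong(1)[OF _ const(1)[of 1]], rule ae_mp[OF one(2)], simp)
  then have XY: "torus_char ?J t (X c) \<in> B" "torus_char ?J t (Y c) \<in> B" for c unfolding c1 .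
  have "torus_char ?J t a \<in> B" if "a \<in> A'" for a
    using that unfolding A'_def
  proof (elim UnE imageE)
    assume "a \<in> A" then show ?thesis by (rule A(2))
  next
    fix i assume "a = difference (x_var i) (x_var (i + 1))" "i \<in> {..<m}"
    moreover from this have "torus_char ?J t a = (\<lambda>x. t (x_var i) x / t (x_var (i + 1)) x)"
      using torus_char_difference[OF J(1)[of i] J(1)[of "i + 1"], of t] by simp
    ultimately show ?thesis using dec(1) by simp
  next
    fix i assume "a = difference (y_var i) (y_var (i + 1))" "i \<in> {..<n}"
    moreover from this have "torus_char ?J t a = (\<lambda>x. t (y_var i) x / t (y_var (i + 1)) x)"
      using torus_char_difference[OF J(2)[of i] J(2)[of "i + 1"], of t] by simp
    ultimately show ?thesis using dec(2) by simp
  next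
    assume "a \<in> {X 1, X (-1), Y 1, Y (-1)}" then show ?thesis using XY by auto
  qed
  moreover have "finite A'" using A(1) by (simp add: A'_def)
  ultimately obtain y where y: "\<forall>a\<in>A'. 0 \<le> (\<Sum>v\<in>?J. a v * y v)" "0 < (\<Sum>v\<in>?J. b v * y v)"
    using valuation_transfer[where J = ?J and t = t and A = A' and b = b] finite_coords t b by blast
  have "dominant m n y"
  proof -
    have d: "(\<Sum>v\<in>?J. difference u w v * y v) = y u - y w" if "u \<in> ?J" "w \<in> ?J" "u \<noteq> w" for u w
    proof -
      have "rat_of_int (\<Sum>v\<in>?J. difference u w v * y v) = rat_of_int (y u - y w)"
        using difference_dot[OF that, of "\<lambda>v. rat_of_int (y v)"] by simp
      then show ?thesis by (simp only: of_int_eq_iff)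
    qed
    have "y (x_var (i + 1)) \<le> y (x_var i)" if "i < m" for i
    proof -
      have "difference (x_var i) (x_var (i + 1)) \<in> A'" using that by (auto simp: A'_def)
      then have "0 \<le> (\<Sum>v\<in>?J. difference (x_var i) (x_var (i + 1)) v * y v)" using y(1) by blast
      then show ?thesis using d[OF J(1)[of i] J(1)[of "i + 1"]] that by simp
    qed
    moreover have "y (y_var (i + 1)) \<le> y (y_var i)" if "i < n" for i
    proof -
      have "difference (y_var i) (y_var (i + 1)) \<in> A'" using that by (auto simp: A'_def)
      then have "0 \<le> (\<Sum>v\<in>?J. difference (y_var i) (y_var (i + 1)) v * y v)" using y(1) by blast
      then show ?thesis using d[OF J(2)[of i] J(2)[of "i + 1"]] that by simp
    qed
    moreover have "X c \<in> A'" "Y c \<in> A'" if "c = 1 \<or> c = -1" for c using that by (auto simp: A'_def)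
    then have "0 \<le> c * (\<Sum>i\<le>m. y (x_var i))" "0 \<le> c * (\<Sum>j\<le>n. y (y_var j))" if "c = 1 \<or> c = -1" for c
      using y(1)[rule_format, of "X c"] y(1)[rule_format, of "Y c"] that by (auto simp: sum_coords X_def Y_def sum_distrib_left)
    from this[of 1] this[of "-1"] have "(\<Sum>i\<le>m. y (x_var i)) = 0" "(\<Sum>j\<le>n. y (y_var j)) = 0" by auto
    ultimately show ?thesis by (simp add: dominant_def)
  qed
  moreover have "\<forall>a\<in>A. 0 \<le> (\<Sum>v\<in>?J. a v * y v)" using y(1) by (simp add: A'_def)
  ultimately show ?thesis using y(2) by blast
qed

text \<open>Here \<open>K\<close> is the inverse of the right-hand factor of the Cartan decomposition of \<open>h\<close>.\<close>

definition cartan_form :: "nat \<Rightarrow> nat \<Rightarrow> ('x \<Rightarrow> complex mat \<times> complex mat) \<Rightarrow> ('x \<Rightarrow> bivar cpoly) \<Rightarrow>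
    ('x \<Rightarrow> complex mat \<times> complex mat) \<Rightarrow> (bivar \<Rightarrow> 'x \<Rightarrow> complex) \<Rightarrow> ('x \<Rightarrow> complex mat \<times> complex mat) \<Rightarrow> bool" where
  "cartan_form m n h v L t K \<longleftrightarrow> group_mem m n L \<and> group_mem m n K \<and> (\<forall>v x. t v x \<noteq> 0) \<and>
    (\<forall>i j. i \<le> j \<longrightarrow> j \<le> m \<longrightarrow> (\<lambda>x. t (x_var i) x / t (x_var j) x) \<in> B) \<and>
    (\<forall>i j. i \<le> j \<longrightarrow> j \<le> n \<longrightarrow> (\<lambda>x. t (y_var i) x / t (y_var j) x) \<in> B) \<and>
    ae (\<lambda>x. (\<Prod>i\<le>m. t (x_var i) x) = 1) \<and> ae (\<lambda>x. (\<Prod>j\<le>n. t (y_var j) x) = 1) \<and>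
    (\<forall>I. ae (\<lambda>x. torus_char (coords m n) t (\<lambda>v. int (Poly_Mapping.lookup I v)) x * Poly_Mapping.lookup (substitute m n (L x) (v x)) I
       = Poly_Mapping.lookup (substitute m n (K x) (substitute m n (h x) (v x))) I)) \<and>
    ((\<forall>v\<in>coords m n. t v \<in> B) \<longrightarrow> group_mem m n h)"

lemma cartan_form_exists:
  assumes h: "\<And>x. h x \<in> group_elements m n" and v: "form_mem m n k l v"
  shows "\<exists>L t K. cartan_form m n h v L t K"
proof -
  let ?A = "\<lambda>x. fst (h x)" and ?C = "\<lambda>x. snd (h x)"
  have A: "?A x \<in> carrier_mat (m + 1) (m + 1)" "det (?A x) = 1" "?C x \<in> carrier_mat (n + 1) (n + 1)" "det (?C x) = 1" for x
    using h[of x] by (auto simp: group_elements_iff)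
  obtain L1 t1 K1 where "cartan_data (m + 1) ?A L1 t1 K1" using cartan_decomposition[of ?A "m + 1"] A by blast
  then have 1: "SL_mem (m + 1) L1" "SL_mem (m + 1) K1" "\<And>i x. t1 i x \<noteq> 0"
    "ae (\<lambda>x. ?A x = L1 x * mat (m + 1) (m + 1) (\<lambda>(i, j). if i = j then t1 i x else 0) * K1 x)"
    "\<And>i j. i \<le> j \<Longrightarrow> j < m + 1 \<Longrightarrow> (\<lambda>x. t1 i x / t1 j x) \<in> B" "ae (\<lambda>x. (\<Prod>i<m + 1. t1 i x) = 1)"
    unfolding cartan_data_def by blast+
  obtain L2 t2 K2 where "cartan_data (n + 1) ?C L2 t2 K2" using cartan_decomposition[of ?C "n + 1"] A by blast
  then have 2: "SL_mem (n + 1) L2" "SL_mem (n + 1) K2" "\<And>i x. t2 i x \<noteq> 0"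
    "ae (\<lambda>x. ?C x = L2 x * mat (n + 1) (n + 1) (\<lambda>(i, j). if i = j then t2 i x else 0) * K2 x)"
    "\<And>i j. i \<le> j \<Longrightarrow> j < n + 1 \<Longrightarrow> (\<lambda>x. t2 i x / t2 j x) \<in> B" "ae (\<lambda>x. (\<Prod>i<n + 1. t2 i x) = 1)"
    unfolding cartan_data_def by blast+
  obtain R1 where R1: "SL_mem (m + 1) R1" "\<And>x. K1 x * R1 x = 1\<^sub>m (m + 1)" using SL_mem_inverse[OF 1(2)] by metis
  obtain R2 where R2: "SL_mem (n + 1) R2" "\<And>x. K2 x * R2 x = 1\<^sub>m (n + 1)" using SL_mem_inverse[OF 2(2)] by metis
  define t where "t v x = (case v of x_var i \<Rightarrow> t1 i x | y_var j \<Rightarrow> t2 j x)" for v x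
  define T1 where "T1 x = mat (m + 1) (m + 1) (\<lambda>(i, j). if i = j then t1 i x else 0)" for x
  define T2 where "T2 x = mat (n + 1) (n + 1) (\<lambda>(i, j). if i = j then t2 i x else 0)" for x
  have c: "L1 x \<in> carrier_mat (m + 1) (m + 1)" "K1 x \<in> carrier_mat (m + 1) (m + 1)" "R1 x \<in> carrier_mat (m + 1) (m + 1)" "T1 x \<in> carrier_mat (m + 1) (m + 1)"
    "L2 x \<in> carrier_mat (n + 1) (n + 1)" "K2 x \<in> carrier_mat (n + 1) (n + 1)" "R2 x \<in> carrier_mat (n + 1) (n + 1)" "T2 x \<in> carrier_mat (n + 1) (n + 1)" for x
    using 1 2 R1 R2 by (auto simp: SL_mem_def mat_mem_def T1_def T2_def)
  have L: "group_mem m n (\<lambda>x. (L1 x, L2 x))" and R: "group_mem m n (\<lambda>x. (R1 x, R2 x))"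
    using 1 2 R1 R2 by (auto simp: group_mem_def)
  \<comment> \<open>In each factor \<open>h\<close> is a product \<open>L T K\<close> and
    \<open>R\<close> inverts \<open>K\<close>, so the product of \<open>h\<close> and
    \<open>R\<close> is \<open>L T\<close>. Up to bounded invertible factors, \<open>h\<close>
    therefore acts through the diagonal part \<open>T\<close> alone.\<close>
  have key: "ae (\<lambda>x. (\<Prod>u\<in>coords m n. t u x ^ Poly_Mapping.lookup I u) * Poly_Mapping.lookup (substitute m n (L1 x, L2 x) (v x)) I
       = Poly_Mapping.lookup (substitute m n (R1 x, R2 x) (substitute m n (h x) (v x))) I)" for I
  proof (rule ae_elim2[OF 1(4) 2(4)])
    fix x assume dec: "?A x = L1 x * mat (m + 1) (m + 1) (\<lambda>(i, j). if i = j then t1 i x else 0) * K1 x"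
      "?C x = L2 x * mat (n + 1) (n + 1) (\<lambda>(i, j). if i = j then t2 i x else 0) * K2 x"
    have vx: "v x \<in> biforms m n k l" by (rule form_memD(1)[OF v])
    have "?A x * R1 x = L1 x * T1 x * (K1 x * R1 x)" "?C x * R2 x = L2 x * T2 x * (K2 x * R2 x)"
      unfolding dec T1_def[symmetric] T2_def[symmetric] using c[of x]
      by (simp_all add: assoc_mult_mat[of _ "m + 1" "m + 1" _ "m + 1" _ "m + 1"] assoc_mult_mat[of _ "n + 1" "n + 1" _ "n + 1" _ "n + 1"])
    then have e: "?A x * R1 x = L1 x * T1 x" "?C x * R2 x = L2 x * T2 x"
      using R1(2)[of x] R2(2)[of x] right_mult_one_mat[OF mult_carrier_mat[OF c(1,4)]] right_mult_one_mat[OF mult_carrier_mat[OF c(5,8)]] by simp_all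
    have "substitute m n (R1 x, R2 x) (substitute m n (h x) (v x)) = substitute m n (?A x * R1 x, ?C x * R2 x) (v x)"
      using substitute_substitute[of "(R1 x, R2 x)" m n "h x", OF _ _ _ _ vx] A c by simp
    also have "\<dots> = substitute m n (T1 x, T2 x) (substitute m n (L1 x, L2 x) (v x))"
      using substitute_substitute[of "(T1 x, T2 x)" m n "(L1 x, L2 x)", OF _ _ _ _ vx] c unfolding e by simp
    finally show "(\<Prod>u\<in>coords m n. t u x ^ Poly_Mapping.lookup I u) * Poly_Mapping.lookup (substitute m n (L1 x, L2 x) (v x)) I
       = Poly_Mapping.lookup (substitute m n (R1 x, R2 x) (substitute m n (h x) (v x))) I"
      using lookup_substitute_diagonal[OF substitute_biforms[OF vx], where h = "(T1 x, T2 x)" and t = "\<lambda>u. t u x"]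
      by (simp add: T1_def T2_def t_def)
  qed
  have mem: "group_mem m n h" if tB: "\<And>v. v \<in> coords m n \<Longrightarrow> t v \<in> B"
  proof -
    have half: "SL_mem N M" if "SL_mem N L'" "SL_mem N K'" "ae (\<lambda>x. M x = L' x * mat N N (\<lambda>(i, j). if i = j then s i x else 0) * K' x)"
      "\<And>i. i < N \<Longrightarrow> s i \<in> B" "\<And>x. M x \<in> carrier_mat N N \<and> det (M x) = 1" for N L' K' M s
    proof -
      have "mat_mem N (\<lambda>x. mat N N (\<lambda>(i, j). if i = j then s i x else 0))"
        unfolding mat_mem_def
      proof (intro conjI allI impI)
        fix i j assume "i < N" "j < N"
        then show "(\<lambda>x. mat N N (\<lambda>(i, j). if i = j then s i x else 0) $$ (i, j)) \<in> B"
          using that(4) by (cases "i = j") auto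
      qed simp
      then have m: "mat_mem N (\<lambda>x. L' x * mat N N (\<lambda>(i, j). if i = j then s i x else 0) * K' x)"
        using that(1,2) by (intro mat_mem_mult(1)) (auto simp: SL_mem_def)
      have "(\<lambda>x. M x $$ (i, j)) \<in> B" if "i < N" "j < N" for i j
        by (rule ae_cong(1)[OF ae_mp[OF \<open>ae (\<lambda>x. M x = _ x)\<close>] mat_memD(2)[OF m that]]) simp
      then show ?thesis using that(5) by (auto simp: SL_mem_def mat_mem_def)
    qed
    have "t1 i \<in> B" if "i < m + 1" for i using tB[of "x_var i"] that by (simp add: t_def[abs_def] coords_def)
    moreover have "t2 i \<in> B" if "i < n + 1" for i using tB[of "y_var i"] that by (simp add: t_def[abs_def] coords_def)
    ultimately show ?thesis
      unfolding group_mem_def using half[OF 1(1,2,4)] half[OF 2(1,2,4)] A by blast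
  qed
  have "cartan_form m n h v (\<lambda>x. (L1 x, L2 x)) t (\<lambda>x. (R1 x, R2 x))"
    unfolding cartan_form_def torus_char_power
  proof (intro conjI allI impI L R key)
    show "t v x \<noteq> 0" for v x using 1(3) 2(3) by (cases v) (auto simp: t_def)
    show "(\<lambda>x. t (x_var i) x / t (x_var j) x) \<in> B" if "i \<le> j" "j \<le> m" for i j using 1(5)[of i j] that by (simp add: t_def)
    show "(\<lambda>x. t (y_var i) x / t (y_var j) x) \<in> B" if "i \<le> j" "j \<le> n" for i j using 2(5)[of i j] that by (simp add: t_def)
    show "ae (\<lambda>x. (\<Prod>i\<le>m. t (x_var i) x) = 1)" "ae (\<lambda>x. (\<Prod>j\<le>n. t (y_var j) x) = 1)"
      using 1(6) 2(6) by (simp_all add: t_def lessThan_Suc_atMost)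
    show "group_mem m n h" if "\<forall>v\<in>coords m n. t v \<in> B" using mem that by blast
  qed
  then show ?thesis by blast
qed

lemma cartan_formD:
  assumes "cartan_form m n h v L t K"
  shows "group_mem m n L" "group_mem m n K" "\<And>v x. t v x \<noteq> 0"
    "\<And>i j. i \<le> j \<Longrightarrow> j \<le> m \<Longrightarrow> (\<lambda>x. t (x_var i) x / t (x_var j) x) \<in> B"
    "\<And>i j. i \<le> j \<Longrightarrow> j \<le> n \<Longrightarrow> (\<lambda>x. t (y_var i) x / t (y_var j) x) \<in> B"
    "ae (\<lambda>x. (\<Prod>i\<le>m. t (x_var i) x) = 1)" "ae (\<lambda>x. (\<Prod>j\<le>n. t (y_var j) x) = 1)"
    "\<And>I. ae (\<lambda>x. torus_char (coords m n) t (\<lambda>v. int (Poly_Mapping.lookup I v)) x * Poly_Mapping.lookup (substitute m n (L x) (v x)) I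
       = Poly_Mapping.lookup (substitute m n (K x) (substitute m n (h x) (v x))) I)"
    "(\<forall>v\<in>coords m n. t v \<in> B) \<longrightarrow> group_mem m n h"
proof -
  note C = assms[unfolded cartan_form_def]
  show "group_mem m n L" using C by (elim conjE)
  show "group_mem m n K" using C by (elim conjE)
  show "ae (\<lambda>x. (\<Prod>i\<le>m. t (x_var i) x) = 1)" using C by (elim conjE)
  show "ae (\<lambda>x. (\<Prod>j\<le>n. t (y_var j) x) = 1)" using C by (elim conjE)
  show "(\<forall>v\<in>coords m n. t v \<in> B) \<longrightarrow> group_mem m n h" using C by (elim conjE)
  show "\<And>v x. t v x \<noteq> 0" using C by (elim conjE) blast
  show "\<And>i j. i \<le> j \<Longrightarrow> j \<le> m \<Longrightarrow> (\<lambda>x. t (x_var i) x / t (x_var j) x) \<in> B"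
    "\<And>i j. i \<le> j \<Longrightarrow> j \<le> n \<Longrightarrow> (\<lambda>x. t (y_var i) x / t (y_var j) x) \<in> B"
    using C by blast+
  show "\<And>I. ae (\<lambda>x. torus_char (coords m n) t (\<lambda>v. int (Poly_Mapping.lookup I v)) x * Poly_Mapping.lookup (substitute m n (L x) (v x)) I
       = Poly_Mapping.lookup (substitute m n (K x) (substitute m n (h x) (v x))) I)"
    using C by (elim conjE allE)
qed

lemma torus_char_nonzero: "(\<And>v x. t v x \<noteq> 0) \<Longrightarrow> torus_char J t a x \<noteq> 0"
  by (induction J rule: infinite_finite_induct) (simp_all add: torus_char_def)

lemma torus_char_monomial_difference:
  assumes "\<And>v x. t v x \<noteq> 0"
  shows "torus_char J t (monomial_difference I I') x
    = torus_char J t (\<lambda>v. int (Poly_Mapping.lookup I v)) x / torus_char J t (\<lambda>v. int (Poly_Mapping.lookup I' v)) x"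
  unfolding torus_char_def monomial_difference_def by (simp add: power_int_diff assms prod_dividef)

text \<open>Properness: after a Cartan decomposition only the torus part matters, and its valuations form a
  one-parameter subgroup in an ordered group, to be replaced by an integral one.\<close>

theorem group_mem_of_form_mem:
  assumes pos: "m > 0" "n > 0" "k > 0" "l > 0" and h: "\<And>x. h x \<in> group_elements m n"
    and v: "form_mem m n k l v" "form_mem m n k l (\<lambda>x. substitute m n (h x) (v x))"
    and F: "lim_form m n k l v \<noteq> 0" "\<not> weakly_destabilized m n k l (lim_form m n k l v)"
  shows "group_mem m n h"
proof (rule ccontr)
  assume "\<not> group_mem m n h"
  obtain L t K where C: "cartan_form m n h v L t K" using cartan_form_exists[of h m n k l v, OF h v(1)] by blast
  note L = cartan_formD(1)[OF C] and K = cartan_formD(2)[OF C] and t = cartan_formD(3)[OF C] and dx = cartan_formD(4)[OF C]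
    and dy = cartan_formD(5)[OF C] and one = cartan_formD(6,7)[OF C] and key = cartan_formD(8)[OF C] and mem = cartan_formD(9)[OF C]
  let ?F = "lim_form m n k l v" and ?J = "coords m n"
  let ?S = "Poly_Mapping.keys (substitute m n (lim_pair m n L) ?F)"
  note v1 = substitute_mem[OF L v(1)] and w1 = substitute_mem(1)[OF K v(2)]
  have S: "?S \<subseteq> bimonomials m n k l" "finite ?S" "?S \<noteq> {}"
    using keys_biforms[OF substitute_biforms[OF lim_form_biforms]] F(1)
      substitute_eq_0_iff[OF lim_pair_in_group[OF L] lim_form_biforms[of m n k l v]] by auto
  \<comment> \<open>For a monomial in the support of the limit, the coefficient before the torus
    acts is a unit. Dividing the bounded coefficient after the action by it bounds the
    character.\<close>
  have charB: "torus_char ?J t (\<lambda>v. int (Poly_Mapping.lookup I v)) \<in> B" if "I \<in> ?S" for I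
  proof -
    let ?c = "\<lambda>x. Poly_Mapping.lookup (substitute m n (L x) (v x)) I"
    have c: "?c \<in> B" "\<phi> ?c \<noteq> 0" using form_memD(2,3)[OF v1(1), of I] v1(2) that by (auto simp: in_keys_iff)
    have "(\<lambda>x. Poly_Mapping.lookup (substitute m n (K x) (substitute m n (h x) (v x))) I * inverse (?c x)) \<in> B"
      by (rule mult(1)[OF form_memD(2)[OF w1] unit_inverse(1)[OF c]])
    then show ?thesis
      by (rule ae_cong(1)[rotated]) (rule ae_elim2[OF key[of I] unit_ae_nonzero[OF c]], simp add: field_simps)
  qed
  obtain w where w: "w \<in> ?J" "t w \<notin> B" using mem \<open>\<not> group_mem m n h\<close> by blast
  \<comment> \<open>In each block every diagonal entry is a bounded multiple of the last one. If
    both last entries were bounded, then so would be all of \<open>t\<close>, and with it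
    \<open>h\<close>.\<close>
  have "\<exists>u\<in>{x_var m, y_var n}. t u \<notin> B"
  proof -
    have "t u \<in> B" if "t u' \<in> B" "(\<lambda>x. t u x / t u' x) \<in> B" for u u'
      using mult(1)[OF that(2,1)] t by simp
    then show ?thesis using w dx dy by (auto simp: coords_def)
  qed
  then obtain u where u: "u \<in> {x_var m, y_var n}" "t u \<notin> B" by blast
  \<comment> \<open>The inverse of an unbounded entry is infinitesimal; this is the strict
    inequality that prevents the resulting weight from being 0.\<close>
  define b where "b v = (if v = u then -1 else 0 :: int)" for v
  have uJ: "u \<in> ?J" using u(1) by (auto simp: coords_def)
  have "torus_char ?J t b = (\<lambda>x. inverse (t u x))"
    unfolding b_def[abs_def] using torus_char_single[OF finite_coords uJ] by auto
  then have b: "infinitesimal (torus_char ?J t b)"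
    using not_mem(1,2)[OF u(2)] by (simp add: infinitesimal_def)
  have "\<exists>y. dominant m n y \<and> (\<forall>a\<in>(\<lambda>I v. int (Poly_Mapping.lookup I v)) ` ?S. 0 \<le> (\<Sum>v\<in>?J. a v * y v)) \<and> 0 < (\<Sum>v\<in>?J. b v * y v)"
    by (rule dominant_vector_exists[OF t _ _ one]) (use dx dy S charB b in auto)
  then obtain y where y: "dominant m n y" "\<And>I. I \<in> ?S \<Longrightarrow> 0 \<le> weight m n y I" "0 < (\<Sum>v\<in>?J. b v * y v)"
    by (auto simp: weight_eq_sum)
  have "(\<Sum>v\<in>?J. b v * y v) = (\<Sum>v\<in>?J. if v = u then - y u else 0)" by (intro sum.cong) (auto simp: b_def)
  then have "y u \<noteq> 0" using y(3) uJ by auto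
  then obtain lam where "lam \<in> fundamental_set m n k l" "\<forall>I\<in>?S. 0 \<le> pairing m n I lam"
    using fundamental_ray[OF pos S y(1)] y(2) uJ by blast
  then show False using F(2) lim_pair_in_group[OF L] by (auto simp: weakly_destabilized_def)
qed

text \<open>The characters of all monomials in the support are now infinitesimal. Only one strict
  inequality can be carried over to the integers, so it is imposed on a monomial \<open>I0\<close>
  of least valuation, and the other weights are required to be at least that of
  \<open>I0\<close>.\<close>

theorem not_infinitesimal_orbit:
  assumes pos: "m > 0" "n > 0" "k > 0" "l > 0" and h: "\<And>x. h x \<in> group_elements m n"
    and v: "form_mem m n k l v" "form_mem m n k l (\<lambda>x. substitute m n (h x) (v x))"
    and zero: "lim_form m n k l (\<lambda>x. substitute m n (h x) (v x)) = 0"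
    and F: "lim_form m n k l v \<noteq> 0"
  shows "destabilized m n k l (lim_form m n k l v)"
proof -
  obtain L t K where C: "cartan_form m n h v L t K" using cartan_form_exists[of h m n k l v, OF h v(1)] by blast
  note L = cartan_formD(1)[OF C] and K = cartan_formD(2)[OF C] and t = cartan_formD(3)[OF C] and dx = cartan_formD(4)[OF C]
    and dy = cartan_formD(5)[OF C] and one = cartan_formD(6,7)[OF C] and key = cartan_formD(8)[OF C] and mem = cartan_formD(9)[OF C]
  let ?F = "lim_form m n k l v" and ?J = "coords m n"
  let ?S = "Poly_Mapping.keys (substitute m n (lim_pair m n L) ?F)"
  let ?T = "\<lambda>I. torus_char ?J t (\<lambda>v. int (Poly_Mapping.lookup I v))"
  note v1 = substitute_mem[OF L v(1)] and w1 = substitute_mem[OF K v(2)]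
  have S: "?S \<subseteq> bimonomials m n k l" "finite ?S" "?S \<noteq> {}"
    using keys_biforms[OF substitute_biforms[OF lim_form_biforms]] F(1)
      substitute_eq_0_iff[OF lim_pair_in_group[OF L] lim_form_biforms[of m n k l v]] by auto
  have char_inf: "infinitesimal (?T I)" if "I \<in> ?S" for I
  proof -
    let ?c = "\<lambda>x. Poly_Mapping.lookup (substitute m n (L x) (v x)) I"
    let ?d = "\<lambda>x. Poly_Mapping.lookup (substitute m n (K x) (substitute m n (h x) (v x))) I"
    have c: "?c \<in> B" "\<phi> ?c \<noteq> 0" using form_memD(2,3)[OF v1(1), of I] v1(2) that by (auto simp: in_keys_iff)
    have d: "?d \<in> B" "\<phi> ?d = 0" using form_memD(2,3)[OF w1(1), of I] w1(2) zero by simp_all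
    have e: "(\<lambda>x. ?d x * inverse (?c x)) \<in> B" "\<phi> (\<lambda>x. ?d x * inverse (?c x)) = 0"
      using mult[OF d(1) unit_inverse(1)[OF c]] d(2) by simp_all
    have "ae (\<lambda>x. ?T I x = ?d x * inverse (?c x))"
      by (rule ae_elim2[OF key unit_ae_nonzero[OF c]]) (simp add: field_simps)
    from ae_cong[OF this e(1)] e(2) show ?thesis by (simp add: infinitesimal_def)
  qed
  obtain I0 where I0: "I0 \<in> ?S" "\<And>I. I \<in> ?S \<Longrightarrow> divides (?T I0) (?T I)"
    using divides_minimum[OF S(2,3), of ?T] by metis
  have ratio: "torus_char ?J t (monomial_difference I I0) \<in> B" if I: "I \<in> ?S" for I
  proof -
    obtain c where c: "c \<in> B" "ae (\<lambda>x. ?T I x = c x * ?T I0 x)" using I0(2)[OF I] unfolding divides_def by blast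
    have "ae (\<lambda>x. torus_char ?J t (monomial_difference I I0) x = c x)"
      by (rule ae_mp[OF c(2)]) (simp add: torus_char_monomial_difference[OF t] torus_char_nonzero[OF t])
    then show ?thesis by (rule ae_cong(1)[OF _ c(1)])
  qed
  have "\<exists>y. dominant m n y \<and> (\<forall>a\<in>(\<lambda>I. monomial_difference I I0) ` ?S. 0 \<le> (\<Sum>v\<in>?J. a v * y v)) \<and>
      0 < (\<Sum>v\<in>?J. int (Poly_Mapping.lookup I0 v) * y v)"
    by (rule dominant_vector_exists[OF t _ _ one]) (use dx dy S ratio char_inf[OF I0(1)] in auto)
  then obtain y where y: "dominant m n y" "\<And>I. I \<in> ?S \<Longrightarrow> 0 \<le> (\<Sum>v\<in>?J. monomial_difference I I0 v * y v)" "0 < weight m n y I0"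
    by (auto simp: weight_eq_sum)
  have pos_w: "0 < weight m n y I" if "I \<in> ?S" for I
  proof -
    have "(\<Sum>v\<in>?J. monomial_difference I I0 v * y v) = weight m n y I - weight m n y I0"
      by (simp add: weight_eq_sum monomial_difference_def left_diff_distrib sum_subtractf)
    then show ?thesis using y(2)[OF that] y(3) by linarith
  qed
  have "\<exists>v\<in>?J. y v \<noteq> 0"
  proof (rule ccontr)
    assume "\<not> ?thesis"
    then have "weight m n y I0 = 0" by (simp add: weight_def)
    with y(3) show False by simp
  qed
  moreover have "\<And>I. I \<in> ?S \<Longrightarrow> 0 \<le> weight m n y I" using pos_w by (simp add: less_imp_le)
  ultimately obtain lam where "lam \<in> fundamental_set m n k l" "\<forall>I\<in>?S. 0 < pairing m n I lam"
    using fundamental_ray[OF pos S y(1)] pos_w by blast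
  then show ?thesis using lim_pair_in_group[OF L] by (auto simp: destabilized_def)
qed

end

lemma cpoly_eval_simps [simp]:
  "cpoly_eval x (Const c) = c" "cpoly_eval x (Var v) = x v" "cpoly_eval x (p + q) = cpoly_eval x p + cpoly_eval x q"
  "cpoly_eval x (p * q) = cpoly_eval x p * cpoly_eval x q" "cpoly_eval x 0 = 0" "cpoly_eval x 1 = 1"
  unfolding cpoly_eval_def
  by (rule ident.cpoly_hom_0 ident.cpoly_hom_1 ident.cpoly_hom_Const ident.cpoly_hom_Var ident.cpoly_hom_add ident.cpoly_hom_mult)+

text \<open>Polynomials in the coordinates are functions on the parameter set with one additional
  point, at which they are evaluated at \<open>w\<close>. The hypothesis that \<open>w\<close> lies
  in the Zariski closure is the adherence of this algebra.\<close>

theorem place_of_adherent_point: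
  fixes \<psi> :: "'x \<Rightarrow> 'v \<Rightarrow> complex"
  assumes "\<And>p. (\<And>x. cpoly_eval (\<psi> x) p = 0) \<Longrightarrow> cpoly_eval w p = 0"
  shows "\<exists>B \<phi>. place B \<phi> \<and> (\<forall>v. (\<lambda>x. \<psi> x v) \<in> B \<and> \<phi> (\<lambda>x. \<psi> x v) = w v)"
proof -
  define P0 where "P0 = range (\<lambda>p z. cpoly_eval (case z of None \<Rightarrow> w | Some x \<Rightarrow> \<psi> x) p)"
  have "subalgebra P0"
    unfolding subalgebra_def
  proof (intro conjI allI ballI)
    fix c show "(\<lambda>_. c) \<in> P0" unfolding P0_def by (rule range_eqI[of _ _ "Const c"]) simp
  next
    fix f g assume "f \<in> P0" "g \<in> P0"
    then obtain p q where "f = (\<lambda>z. cpoly_eval (case z of None \<Rightarrow> w | Some x \<Rightarrow> \<psi> x) p)"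
      "g = (\<lambda>z. cpoly_eval (case z of None \<Rightarrow> w | Some x \<Rightarrow> \<psi> x) q)" by (auto simp: P0_def)
    then have fg: "(\<lambda>z. f z + g z) = (\<lambda>z. cpoly_eval (case z of None \<Rightarrow> w | Some x \<Rightarrow> \<psi> x) (p + q))"
      "(\<lambda>z. f z * g z) = (\<lambda>z. cpoly_eval (case z of None \<Rightarrow> w | Some x \<Rightarrow> \<psi> x) (p * q))" by simp_all
    show "(\<lambda>z. f z + g z) \<in> P0" "(\<lambda>z. f z * g z) \<in> P0"
      unfolding P0_def fg by (rule rangeI)+
  qed
  moreover have "adherent P0"
    unfolding adherent_def P0_def using assms by auto
  ultimately obtain B \<phi> where B: "place B \<phi>" "\<And>f. f \<in> P0 \<Longrightarrow> (\<lambda>x. f (Some x)) \<in> B \<and> \<phi> (\<lambda>x. f (Some x)) = f None"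
    using place_exists by metis
  have "(\<lambda>x. \<psi> x v) \<in> B \<and> \<phi> (\<lambda>x. \<psi> x v) = w v" for v
  proof -
    have "(\<lambda>z. cpoly_eval (case z of None \<Rightarrow> w | Some x \<Rightarrow> \<psi> x) (Var v)) \<in> P0" unfolding P0_def by (rule rangeI)
    from B(2)[OF this] show ?thesis by simp
  qed
  then show ?thesis using B(1) by blast
qed

lemma section_at_eq_eval: "section_at p F = cpoly_eval (Poly_Mapping.lookup F) p"
  by (simp add: section_at_def)

lemma section_at_zero_form:
  assumes "f \<in> sections m n k l d" "d > 0" shows "section_at f 0 = 0"
proof -
  have "section_at f (Const 0 * 0) = 0 ^ d * section_at f 0" by (rule section_at_homogeneous[OF assms(1)])
  moreover have "(0 :: complex) ^ d = 0" using assms(2) by simp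
  ultimately show ?thesis by (simp only: mult_zero_left mult_zero_right)
qed

lemma invariant_sectionsD:
  assumes "f \<in> invariant_sections m n k l d"
  shows "f \<in> sections m n k l d"
    "h \<in> group_elements m n \<Longrightarrow> F \<in> biforms m n k l \<Longrightarrow> section_at f (substitute m n h F) = section_at f F"
proof -
  show "f \<in> sections m n k l d" using assms by (simp add: invariant_sections_def)
  assume "h \<in> group_elements m n" "F \<in> biforms m n k l"
  then show "section_at f (substitute m n h F) = section_at f F"
    using assms inv_in_group[of h m n] inv_inv_group[of h m n] by (auto simp: invariant_sections_def act_eq_substitute)
qed

lemma one_in_group: "(1\<^sub>m (m + 1), 1\<^sub>m (n + 1)) \<in> group_elements m n"
  by (simp add: group_elements_iff)

theorem invariant_of_not_destabilized:
  assumes pos: "m > 0" "n > 0" "k > 0" "l > 0" and F: "F \<in> biforms m n k l" "F \<noteq> 0" "\<not> destabilized m n k l F"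
  shows "\<exists>d>0. \<exists>f\<in>invariant_sections m n k l d. section_at f F \<noteq> 0"
proof -
  let ?G = "group_elements m n"
  have "\<exists>p. (\<forall>h\<in>?G. section_at p (substitute m n h F) = 0) \<and> section_at p 0 \<noteq> 0"
  proof (rule ccontr)
    assume contr: "\<not> ?thesis"
    define h where "h x = (if x \<in> ?G then x else (1\<^sub>m (m + 1), 1\<^sub>m (n + 1)))" for x
    have h: "h x \<in> ?G" for x using one_in_group by (simp add: h_def)
    have "cpoly_eval (\<lambda>_. 0) p = 0" if "\<And>x. cpoly_eval (Poly_Mapping.lookup (substitute m n (h x) F)) p = 0" for p
    proof -
      have "section_at p (substitute m n g F) = 0" if "g \<in> ?G" for g
        using \<open>\<And>x. cpoly_eval (Poly_Mapping.lookup (substitute m n (h x) F)) p = 0\<close>[of g] that by (simp add: section_at_eq_eval h_def)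
      then have "section_at p 0 = 0" using contr by blast
      moreover have "Poly_Mapping.lookup (0 :: bivar cpoly) = (\<lambda>_. 0)" by auto
      ultimately show ?thesis by (simp add: section_at_eq_eval)
    qed
    from place_of_adherent_point[of "\<lambda>x. Poly_Mapping.lookup (substitute m n (h x) F)" "\<lambda>_. 0", OF this]
    obtain B \<phi> where "place B \<phi>" and B: "\<And>I. (\<lambda>x. Poly_Mapping.lookup (substitute m n (h x) F) I) \<in> B"
      "\<And>I. \<phi> (\<lambda>x. Poly_Mapping.lookup (substitute m n (h x) F) I) = 0" by blast
    interpret place B \<phi> by fact
    have w: "form_mem m n k l (\<lambda>x. substitute m n (h x) F)"
      unfolding form_mem_def using B(1) substitute_biforms[OF F(1)] by blast
    have "lim_form m n k l (\<lambda>x. substitute m n (h x) F) = 0"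
      by (rule lim_form_eqI) (simp_all add: B(2))
    from not_infinitesimal_orbit[OF pos h form_mem_const[OF F(1)] w this] F(2,3)
    show False by (simp add: lim_form_const[OF F(1)])
  qed
  then obtain p where p: "\<And>h. h \<in> ?G \<Longrightarrow> section_at p (substitute m n h F) = 0" "section_at p 0 \<noteq> 0" by blast
  \<comment> \<open>\<open>q\<close> is 1 on the orbit of \<open>F\<close> and 0 on the orbit of the
    zero form. It is constant on both, so averaging keeps both values.\<close>
  define q where "q = 1 + Const (- 1 / section_at p 0) * p"
  have q: "section_at q (substitute m n h F) = 1" "section_at q (substitute m n h 0) = 0" if "h \<in> ?G" for h
    using p that by (simp_all add: q_def)
  obtain D f where f: "\<And>d. f d \<in> invariant_sections m n k l d"
    "\<And>F c. F \<in> biforms m n k l \<Longrightarrow> (\<And>h. h \<in> ?G \<Longrightarrow> section_at q (substitute m n h F) = c) \<Longrightarrow> (\<Sum>d\<le>D. section_at (f d) F) = c"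
    using reynolds[of m n k l q] by metis
  have fs: "f d \<in> sections m n k l d" for d using f(1) invariant_sectionsD(1) by blast
  have s1: "(\<Sum>d\<le>D. section_at (f d) F) = 1" using f(2)[OF F(1)] q(1) by blast
  have "(\<Sum>d\<le>D. section_at (f d) 0) = 0" using f(2)[OF biforms_0] q(2) by blast
  moreover have "(\<Sum>d\<le>D. section_at (f d) 0) = (\<Sum>d\<le>D. if d = 0 then section_at (f 0) 0 else 0)"
    by (intro sum.cong refl) (use section_at_zero_form[OF fs] in auto)
  ultimately have "section_at (f 0) 0 = 0" by simp
  then have f0: "section_at (f 0) F = 0" using section_at_homogeneous[OF fs[of 0], of 0 F] by simp
  have "\<exists>d\<le>D. section_at (f d) F \<noteq> 0"
  proof (rule ccontr)
    assume "\<not> ?thesis"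
    then have "(\<Sum>d\<le>D. section_at (f d) F) = 0" by (intro sum.neutral) auto
    with s1 show False by simp
  qed
  then obtain d where "section_at (f d) F \<noteq> 0" by blast
  then show ?thesis using f0 f(1) by (metis gr0I)
qed

section \<open>Limits along one-parameter subgroups\<close>

text \<open>This is the orbit of \<open>F\<close> under the one-parameter subgroup, extended to \<open>s = 0\<close>, provided that all
  weights of \<open>F\<close> are non-negative; negative weights are truncated to 0.\<close>

definition limit_curve :: "nat \<Rightarrow> nat \<Rightarrow> nat \<Rightarrow> nat \<Rightarrow> weights \<Rightarrow> bivar cpoly \<Rightarrow> complex \<Rightarrow> bivar cpoly" where
  "limit_curve m n k l lam F s = (\<Sum>I\<in>bimonomials m n k l. Const (s ^ nat (pairing m n I lam) * Poly_Mapping.lookup F I) * Poly_Mapping.single I 1)"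

definition one_parameter :: "nat \<Rightarrow> nat \<Rightarrow> weights \<Rightarrow> complex \<Rightarrow> complex mat \<times> complex mat" where
  "one_parameter m n lam s = (mat (m + 1) (m + 1) (\<lambda>(i, j). if i = j then s powi (fst lam $ i) else 0),
     mat (n + 1) (n + 1) (\<lambda>(i, j). if i = j then s powi (snd lam $ i) else 0))"

lemma limit_curve_biforms [simp]: "limit_curve m n k l lam F s \<in> biforms m n k l"
  unfolding limit_curve_def by (intro biforms_sum biforms_Const_mult biforms_single)

lemma lookup_limit_curve:
  assumes "I \<in> bimonomials m n k l"
  shows "Poly_Mapping.lookup (limit_curve m n k l lam F s) I = s ^ nat (pairing m n I lam) * Poly_Mapping.lookup F I"
proof -
  have "Poly_Mapping.lookup (limit_curve m n k l lam F s) I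
      = (\<Sum>J\<in>bimonomials m n k l. if J = I then s ^ nat (pairing m n I lam) * Poly_Mapping.lookup F I else 0)"
    unfolding limit_curve_def lookup_sum by (intro sum.cong refl) (simp add: lookup_Const_mult lookup_single when_def)
  then show ?thesis using assms by simp
qed

lemma prod_powi_sum: "(\<Prod>i\<in>A. s powi f i) = s powi (\<Sum>i\<in>A. f i)" if "s \<noteq> (0::complex)"
  using that by (induction A rule: infinite_finite_induct) (simp_all add: power_int_add)

lemma det_diagonal: "det (mat N N (\<lambda>(i, j). if i = j then f i else 0)) = (\<Prod>i<N. f i :: complex)"
proof -
  have "det (mat N N (\<lambda>(i, j). if i = j then f i else 0)) = prod_list (diag_mat (mat N N (\<lambda>(i, j). if i = j then f i else 0)))"
    by (rule det_upper_triangular[where n = N]) (auto simp: upper_triangular_def)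
  then show ?thesis by (simp add: prod_list_diag_prod atLeast0LessThan)
qed

lemma one_parameter_in_group:
  assumes "s \<noteq> 0" "dominant m n (weight_fun lam)"
  shows "one_parameter m n lam s \<in> group_elements m n"
  using assms unfolding group_elements_iff one_parameter_def
  by (simp add: det_diagonal prod_powi_sum dominant_def del: sum.lessThan_Suc prod.lessThan_Suc add: lessThan_Suc_atMost)

lemma lookup_one_parameter:
  assumes "s \<noteq> 0" "F \<in> biforms m n k l"
  shows "Poly_Mapping.lookup (substitute m n (one_parameter m n lam s) F) I = s powi (pairing m n I lam) * Poly_Mapping.lookup F I"
proof -
  have "(\<Prod>v\<in>coords m n. (s powi weight_fun lam v) ^ Poly_Mapping.lookup I v) = s powi (pairing m n I lam)"
  proof -
    have "(\<Prod>v\<in>coords m n. (s powi weight_fun lam v) ^ Poly_Mapping.lookup I v) = (\<Prod>v\<in>coords m n. s powi (weight_fun lam v * int (Poly_Mapping.lookup I v)))"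
      by (intro prod.cong refl) (simp add: power_int_mult)
    then show ?thesis using assms(1) by (simp add: prod_powi_sum pairing_eq_weight weight_def)
  qed
  then show ?thesis
    by (subst lookup_substitute_diagonal[OF assms(2), where t = "\<lambda>v. s powi weight_fun lam v"]) (auto simp: one_parameter_def)
qed

lemma limit_curve_eq_substitute:
  assumes "s \<noteq> 0" "F \<in> biforms m n k l" "\<And>I. I \<in> Poly_Mapping.keys F \<Longrightarrow> 0 \<le> pairing m n I lam"
  shows "limit_curve m n k l lam F s = substitute m n (one_parameter m n lam s) F"
proof (rule biforms_eqI[OF limit_curve_biforms substitute_biforms[OF assms(2)]])
  fix I assume I: "I \<in> bimonomials m n k l"
  show "Poly_Mapping.lookup (limit_curve m n k l lam F s) I = Poly_Mapping.lookup (substitute m n (one_parameter m n lam s) F) I"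
  proof (cases "I \<in> Poly_Mapping.keys F")
    case True
    then have "s powi (pairing m n I lam) = s ^ nat (pairing m n I lam)"
      using assms(3) by (simp add: power_int_def)
    then show ?thesis by (simp add: lookup_limit_curve[OF I] lookup_one_parameter[OF assms(1,2)])
  next
    case False
    then show ?thesis by (simp add: lookup_limit_curve[OF I] lookup_one_parameter[OF assms(1,2)] in_keys_iff)
  qed
qed

lemma section_at_limit_curve: "\<exists>q. \<forall>s. section_at p (limit_curve m n k l lam F s) = poly q s"
proof (induction p rule: cpoly_induct)
  case (Const c)
  show ?case by (intro exI[of _ "[:c:]"]) simp
next
  case (Var I)
  show ?case
  proof (cases "I \<in> bimonomials m n k l")
    case True
    then show ?thesis
      by (intro exI[of _ "monom (Poly_Mapping.lookup F I) (nat (pairing m n I lam))"]) (simp add: lookup_limit_curve poly_monom)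
  next
    case False
    then show ?thesis by (intro exI[of _ 0]) (simp add: biforms_lookup[OF limit_curve_biforms])
  qed
next
  case (add p q)
  then obtain p' q' where "\<forall>s. section_at p (limit_curve m n k l lam F s) = poly p' s" "\<forall>s. section_at q (limit_curve m n k l lam F s) = poly q' s"
    by blast
  then show ?case by (intro exI[of _ "p' + q'"]) simp
next
  case (mult p q)
  then obtain p' q' where "\<forall>s. section_at p (limit_curve m n k l lam F s) = poly p' s" "\<forall>s. section_at q (limit_curve m n k l lam F s) = poly q' s"
    by blast
  then show ?case by (intro exI[of _ "p' * q'"]) simp
qed

lemma poly_eq_const:
  fixes q :: "complex poly"
  assumes "\<And>s. s \<noteq> 0 \<Longrightarrow> poly q s = c" shows "poly q s = c"
proof (rule ccontr)
  assume *: "poly q s \<noteq> c"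
  then have "q - [:c:] \<noteq> 0" by auto
  then have "finite {s. poly (q - [:c:]) s = 0}" by (rule poly_roots_finite)
  moreover have "UNIV - {0} \<subseteq> {s. poly (q - [:c:]) s = 0}" using assms by auto
  ultimately have "finite (UNIV - {0 :: complex})" by (rule rev_finite_subset)
  then show False by (simp add: infinite_UNIV_char_0)
qed

text \<open>Along the curve a section is a polynomial in \<open>s\<close>, so a value that it takes
  for all non-zero \<open>s\<close> is also taken at 0. This replaces a passage to the
  limit.\<close>

lemma section_at_limit:
  assumes "\<And>s. s \<noteq> 0 \<Longrightarrow> section_at p (limit_curve m n k l lam F s) = c"
  shows "section_at p (limit_curve m n k l lam F s) = c"
proof -
  obtain q where q: "\<And>s. section_at p (limit_curve m n k l lam F s) = poly q s" using section_at_limit_curve by blast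
  then show ?thesis using assms poly_eq_const[of q c s] by simp
qed

lemma invariant_at_limit:
  assumes "f \<in> invariant_sections m n k l d" "F \<in> biforms m n k l" "lam \<in> fundamental_set m n k l"
    "\<And>I. I \<in> Poly_Mapping.keys F \<Longrightarrow> 0 \<le> pairing m n I lam"
  shows "section_at f (limit_curve m n k l lam F 0) = section_at f F"
proof (rule section_at_limit)
  fix s :: complex assume s: "s \<noteq> 0"
  have "limit_curve m n k l lam F s = substitute m n (one_parameter m n lam s) F"
    by (rule limit_curve_eq_substitute[OF s assms(2)]) (use assms(4) in blast)
  then show "section_at f (limit_curve m n k l lam F s) = section_at f F"
    using invariant_sectionsD(2)[OF assms(1) one_parameter_in_group[OF s fundamental_set_weight(1)[OF assms(3)]] assms(2)] by simp
qed

lemma not_destabilized_of_semistable: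
  assumes "semistable m n k l F" shows "\<not> destabilized m n k l F"
proof
  assume "destabilized m n k l F"
  then obtain h lam where h: "h \<in> group_elements m n" and lam: "lam \<in> fundamental_set m n k l"
    and pos: "\<And>I. I \<in> Poly_Mapping.keys (substitute m n h F) \<Longrightarrow> 0 < pairing m n I lam"
    unfolding destabilized_def by blast
  obtain d f where d: "d > 0" and f: "f \<in> invariant_sections m n k l d" and F: "F \<in> biforms m n k l" "section_at f F \<noteq> 0"
    using assms by (auto simp: semistable_def nonvanishing_locus_def)
  let ?F = "substitute m n h F"
  have "limit_curve m n k l lam ?F 0 = 0"
  proof (rule biforms_eqI[OF limit_curve_biforms biforms_0])
    fix I assume I: "I \<in> bimonomials m n k l"
    show "Poly_Mapping.lookup (limit_curve m n k l lam ?F 0) I = Poly_Mapping.lookup 0 I"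
      using pos[of I] by (cases "I \<in> Poly_Mapping.keys ?F") (auto simp: lookup_limit_curve[OF I] in_keys_iff power_0_left)
  qed
  moreover have "section_at f (limit_curve m n k l lam ?F 0) = section_at f ?F"
    by (rule invariant_at_limit[OF f substitute_biforms[OF F(1)] lam]) (use pos less_imp_le in blast)
  moreover have "section_at f ?F = section_at f F" by (rule invariant_sectionsD(2)[OF f h F(1)])
  ultimately show False using F(2) section_at_zero_form[OF invariant_sectionsD(1)[OF f] d] by simp
qed

lemma HM_nonneg_iff:
  assumes "F \<noteq> 0"
  shows "0 \<le> HM m n F lam \<longleftrightarrow> (\<forall>I\<in>Poly_Mapping.keys F. 0 \<le> pairing m n I lam)"
    "0 < HM m n F lam \<longleftrightarrow> (\<forall>I\<in>Poly_Mapping.keys F. 0 < pairing m n I lam)"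
proof -
  have "finite ((\<lambda>I. pairing m n I lam) ` Poly_Mapping.keys F)" "(\<lambda>I. pairing m n I lam) ` Poly_Mapping.keys F \<noteq> {}"
    using assms by auto
  from Min_ge_iff[OF this] Min_gr_iff[OF this]
  show "0 \<le> HM m n F lam \<longleftrightarrow> (\<forall>I\<in>Poly_Mapping.keys F. 0 \<le> pairing m n I lam)"
    "0 < HM m n F lam \<longleftrightarrow> (\<forall>I\<in>Poly_Mapping.keys F. 0 < pairing m n I lam)"
    by (auto simp: HM_def)
qed

lemma destabilized_iff_HM:
  assumes "F \<in> biforms m n k l" "F \<noteq> 0"
  shows "weakly_destabilized m n k l F \<longleftrightarrow> (\<exists>g\<in>group_elements m n. \<exists>lam\<in>fundamental_set m n k l. 0 \<le> HM m n (act m n g F) lam)"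
    "destabilized m n k l F \<longleftrightarrow> (\<exists>g\<in>group_elements m n. \<exists>lam\<in>fundamental_set m n k l. 0 < HM m n (act m n g F) lam)"
  unfolding weakly_destabilized_def destabilized_def
    ex_act_iff_ex_substitute[of m n "\<lambda>F. \<exists>lam\<in>fundamental_set m n k l. 0 \<le> HM m n F lam"]
    ex_act_iff_ex_substitute[of m n "\<lambda>F. \<exists>lam\<in>fundamental_set m n k l. 0 < HM m n F lam"]
  using HM_nonneg_iff substitute_eq_0_iff[OF _ assms(1)] assms(2) by (simp_all cong: bex_cong)

lemma weakly_destabilized_substitute:
  assumes "g \<in> group_elements m n" "F \<in> biforms m n k l" "weakly_destabilized m n k l (substitute m n g F)"
  shows "weakly_destabilized m n k l F"
proof -
  obtain h lam where h: "h \<in> group_elements m n" "lam \<in> fundamental_set m n k l"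
    "\<forall>I\<in>Poly_Mapping.keys (substitute m n h (substitute m n g F)). 0 \<le> pairing m n I lam"
    using assms(3) unfolding weakly_destabilized_def by blast
  moreover have "g \<otimes>\<^bsub>SLxSL m n\<^esub> h \<in> group_elements m n"
    using monoid.m_closed[OF group.is_monoid[OF group_SLxSL] assms(1) h(1)] .
  ultimately show ?thesis unfolding weakly_destabilized_def substitute_mult[OF h(1) assms(1,2)] by blast
qed

lemma not_destabilized_of_not_weakly: "\<not> weakly_destabilized m n k l F \<Longrightarrow> \<not> destabilized m n k l F"
  unfolding weakly_destabilized_def destabilized_def by (meson less_imp_le)

text \<open>Places consist of functions on a whole type. Sending all other points to a chosen
  element of \<open>A\<close> turns the type into a parameter set for \<open>A\<close>.\<close>

definition retract :: "'g set \<Rightarrow> 'g \<Rightarrow> 'g \<Rightarrow> 'g" where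
  "retract A a x = (if x \<in> A then x else a)"

lemma retract [simp]: "a \<in> A \<Longrightarrow> retract A a x \<in> A" "x \<in> A \<Longrightarrow> retract A a x = x"
  by (simp_all add: retract_def)

text \<open>A point of the closure is the residue of the orbit map at a place. Properness bounds the
  group elements there, and their limit carries \<open>F\<close> to that point.\<close>

theorem orbit_closed:
  assumes pos: "m > 0" "n > 0" "k > 0" "l > 0" and F: "F \<in> biforms m n k l" "F \<noteq> 0" "\<not> weakly_destabilized m n k l F"
    and w: "\<And>p. (\<And>h. h \<in> group_elements m n \<Longrightarrow> section_at p (substitute m n h F) = 0) \<Longrightarrow> cpoly_eval w p = 0"
  shows "\<exists>a\<in>group_elements m n. w = Poly_Mapping.lookup (substitute m n a F)"
proof -
  let ?G = "group_elements m n"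
  define h where "h = retract ?G (1\<^sub>m (m + 1), 1\<^sub>m (n + 1))"
  have h: "h x \<in> ?G" "x \<in> ?G \<Longrightarrow> h x = x" for x using one_in_group by (simp_all add: h_def)
  have "cpoly_eval w p = 0" if "\<And>x. cpoly_eval (Poly_Mapping.lookup (substitute m n (h x) F)) p = 0" for p
    using that h(2) by (intro w) (metis section_at_eq_eval)
  from place_of_adherent_point[of "\<lambda>x. Poly_Mapping.lookup (substitute m n (h x) F)" w, OF this]
  obtain B \<phi> where "place B \<phi>" and B: "\<And>I. (\<lambda>x. Poly_Mapping.lookup (substitute m n (h x) F) I) \<in> B"
    "\<And>I. \<phi> (\<lambda>x. Poly_Mapping.lookup (substitute m n (h x) F) I) = w I" by blast
  interpret place B \<phi> by fact
  have v: "form_mem m n k l (\<lambda>x. substitute m n (h x) F)"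
    unfolding form_mem_def using B(1) substitute_biforms[OF F(1)] by blast
  have c: "form_mem m n k l (\<lambda>_. F)" "lim_form m n k l (\<lambda>_. F) = F" using form_mem_const lim_form_const F(1) by blast+
  have "group_mem m n h"
    by (rule group_mem_of_form_mem[OF pos h(1) c(1) v]) (simp_all add: c(2) F)
  note lim = substitute_mem(2)[OF this c(1), unfolded c(2)] lim_pair_in_group[OF this]
  have "w I = Poly_Mapping.lookup (substitute m n (lim_pair m n h) F) I" for I
    using form_memD(3)[OF v, of I] B(2)[of I] lim(1) by simp
  then show ?thesis using lim(2) by blast
qed

section \<open>Stabilizers\<close>

lemma cpoly_eval_unit: "\<exists>q :: complex poly. \<forall>z. cpoly_eval (\<lambda>_ :: unit. z) p = poly q z"
proof (induction p rule: cpoly_induct)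
  case (Const c)
  show ?case by (intro exI[of _ "[:c:]"]) simp
next
  case (Var v)
  show ?case by (intro exI[of _ "[:0, 1:]"]) simp
next
  case (add p q)
  then obtain p' q' where "\<forall>z. cpoly_eval (\<lambda>_. z) p = poly p' z" "\<forall>z. cpoly_eval (\<lambda>_. z) q = poly q' z" by blast
  then show ?case by (intro exI[of _ "p' + q'"]) simp
next
  case (mult p q)
  then obtain p' q' where "\<forall>z. cpoly_eval (\<lambda>_. z) p = poly p' z" "\<forall>z. cpoly_eval (\<lambda>_. z) q = poly q' z" by blast
  then show ?case by (intro exI[of _ "p' * q'"]) simp
qed

lemma infinite_matrices:
  assumes "infinite S" "\<And>A. A \<in> S \<Longrightarrow> A \<in> carrier_mat N N"
  shows "\<exists>i<N. \<exists>j<N. infinite ((\<lambda>A. A $$ (i, j)) ` S)"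
proof (rule ccontr)
  assume "\<not> ?thesis"
  then have fin: "finite (\<Union>i\<in>{..<N}. \<Union>j\<in>{..<N}. (\<lambda>A. A $$ (i, j)) ` S)" (is "finite ?V") by auto
  have "A \<in> (\<lambda>f. mat N N f) ` (({..<N} \<times> {..<N}) \<rightarrow>\<^sub>E ?V)" if A: "A \<in> S" for A
  proof (rule image_eqI[of _ _ "restrict (\<lambda>ij. A $$ ij) ({..<N} \<times> {..<N})"])
    show "A = mat N N (restrict (\<lambda>ij. A $$ ij) ({..<N} \<times> {..<N}))" using assms(2)[OF A] by (intro eq_matI) auto
    show "restrict (\<lambda>ij. A $$ ij) ({..<N} \<times> {..<N}) \<in> ({..<N} \<times> {..<N}) \<rightarrow>\<^sub>E ?V" using A by auto
  qed
  then have "S \<subseteq> (\<lambda>f. mat N N f) ` (({..<N} \<times> {..<N}) \<rightarrow>\<^sub>E ?V)" by blast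
  moreover have "finite ((\<lambda>f. mat N N f) ` (({..<N} \<times> {..<N}) \<rightarrow>\<^sub>E ?V))" by (intro finite_imageI finite_PiE fin) simp_all
  ultimately show False using assms(1) finite_subset by blast
qed

lemma infinite_group_elements:
  assumes "infinite S" "S \<subseteq> group_elements m n"
  shows "(\<exists>i\<le>m. \<exists>j\<le>m. infinite ((\<lambda>h. fst h $$ (i, j)) ` S)) \<or> (\<exists>i\<le>n. \<exists>j\<le>n. infinite ((\<lambda>h. snd h $$ (i, j)) ` S))"
proof -
  have "infinite (fst ` S) \<or> infinite (snd ` S)"
  proof (rule ccontr)
    assume "\<not> ?thesis"
    then have "finite (fst ` S \<times> snd ` S)" by auto
    moreover have "S \<subseteq> fst ` S \<times> snd ` S" by (auto simp: image_iff) (metis fst_conv snd_conv)+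
    ultimately show False using assms(1) finite_subset by blast
  qed
  then show ?thesis
  proof
    assume "infinite (fst ` S)"
    then have "\<exists>i<m + 1. \<exists>j<m + 1. infinite ((\<lambda>A. A $$ (i, j)) ` fst ` S)"
      by (rule infinite_matrices) (use assms(2) group_elements_iff in blast)
    then show ?thesis by (auto simp: image_image less_Suc_eq_le)
  next
    assume "infinite (snd ` S)"
    then have "\<exists>i<n + 1. \<exists>j<n + 1. infinite ((\<lambda>A. A $$ (i, j)) ` snd ` S)"
      by (rule infinite_matrices) (use assms(2) group_elements_iff in blast)
    then show ?thesis by (auto simp: image_image less_Suc_eq_le)
  qed
qed

text \<open>On an infinite set of group elements some matrix entry \<open>e\<close> takes infinitely
  many values, and then it is unbounded at some place. But on the stabilizer up to scalars an
  invariant that does not vanish at \<open>F\<close> forces the scalars to be roots of unity, so the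
  transformed form is bounded, and properness bounds \<open>e\<close>.\<close>

theorem finite_stabilizer:
  assumes pos: "m > 0" "n > 0" "k > 0" "l > 0" and F: "F \<in> biforms m n k l" "F \<noteq> 0" "\<not> weakly_destabilized m n k l F"
  shows "finite {h \<in> group_elements m n. \<exists>c. substitute m n h F = Const c * F}" (is "finite ?S")
proof (rule ccontr)
  assume inf: "infinite ?S"
  obtain d f where d: "d > 0" and f: "f \<in> invariant_sections m n k l d" "section_at f F \<noteq> 0"
    using invariant_of_not_destabilized[OF pos F(1,2) not_destabilized_of_not_weakly[OF F(3)]] by blast
  \<comment> \<open>An entry of either factor is recorded only as a function that is bounded
    wherever the group element is, so both cases continue as one.\<close>
  have "\<exists>e. infinite (e ` ?S) \<and> (\<forall>B \<phi> (r :: complex mat \<times> complex mat \<Rightarrow> complex mat \<times> complex mat). place B \<phi> \<longrightarrow> place.group_mem B m n r \<longrightarrow> (\<lambda>x. e (r x)) \<in> B)"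
  proof -
    have S: "?S \<subseteq> group_elements m n" by blast
    from infinite_group_elements[OF inf S] show ?thesis
    proof (elim disjE exE conjE)
      fix i j assume "i \<le> m" "j \<le> m" "infinite ((\<lambda>h. fst h $$ (i, j)) ` ?S)"
      moreover have "(\<lambda>x. fst (r x) $$ (i, j)) \<in> B" if "place B \<phi>" "place.group_mem B m n r" for B \<phi> and r :: "complex mat \<times> complex mat \<Rightarrow> _"
        using that(2) \<open>i \<le> m\<close> \<open>j \<le> m\<close> unfolding place.group_mem_def[OF that(1)] place.SL_mem_def[OF that(1)] place.mat_mem_def[OF that(1)] by simp
      ultimately show ?thesis by (intro exI[of _ "\<lambda>h. fst h $$ (i, j)"]) simp
    next
      fix i j assume "i \<le> n" "j \<le> n" "infinite ((\<lambda>h. snd h $$ (i, j)) ` ?S)"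
      moreover have "(\<lambda>x. snd (r x) $$ (i, j)) \<in> B" if "place B \<phi>" "place.group_mem B m n r" for B \<phi> and r :: "complex mat \<times> complex mat \<Rightarrow> _"
        using that(2) \<open>i \<le> n\<close> \<open>j \<le> n\<close> unfolding place.group_mem_def[OF that(1)] place.SL_mem_def[OF that(1)] place.mat_mem_def[OF that(1)] by simp
      ultimately show ?thesis by (intro exI[of _ "\<lambda>h. snd h $$ (i, j)"]) simp
    qed
  qed
  then obtain e where e: "infinite (e ` ?S)" "\<And>B \<phi> (r :: complex mat \<times> complex mat \<Rightarrow> complex mat \<times> complex mat). place B \<phi> \<Longrightarrow> place.group_mem B m n r \<Longrightarrow> (\<lambda>x. e (r x)) \<in> B"
    by blast
  \<comment> \<open>Zeros of \<open>e\<close> are removed so that \<open>e\<close> times its inverse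
    is 1 at every parameter.\<close>
  define S0 where "S0 = {h \<in> ?S. e h \<noteq> 0}"
  have "e ` ?S \<subseteq> insert 0 (e ` S0)" by (auto simp: S0_def)
  then have inf0: "infinite (e ` S0)" using e(1) finite_subset by blast
  then obtain h0 where h0: "h0 \<in> S0" by fastforce
  define r where "r = retract S0 h0"
  have r: "r x \<in> S0" "x \<in> S0 \<Longrightarrow> r x = x" for x using h0 by (simp_all add: r_def)
  have rG: "r x \<in> group_elements m n" "e (r x) \<noteq> 0" for x using r(1)[of x] by (simp_all add: S0_def)
  have "\<exists>c. substitute m n (r x) F = Const c * F" for x using r(1)[of x] by (simp add: S0_def)
  then obtain c where c: "\<And>x. substitute m n (r x) F = Const (c x) * F" by metis
  \<comment> \<open>A polynomial in one variable that vanishes at infinitely many inverses of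
    \<open>e\<close> is 0, so 0 is adherent to these inverses.\<close>
  have "cpoly_eval (\<lambda>_. 0) p = 0" if p: "\<And>x. cpoly_eval (\<lambda>_ :: unit. inverse (e (r x))) p = 0" for p
  proof -
    obtain q where q: "\<And>z. cpoly_eval (\<lambda>_ :: unit. z) p = poly q z" using cpoly_eval_unit by blast
    have "poly q (inverse (e h)) = 0" if "h \<in> S0" for h using p[of h] q r(2)[OF that] by simp
    then have "inverse ` e ` S0 \<subseteq> {z. poly q z = 0}" by auto
    moreover have "infinite (inverse ` e ` S0)" using inf0 by (simp add: finite_image_iff inj_on_def)
    ultimately have "infinite {z. poly q z = 0}" using finite_subset by blast
    then have "q = 0" using poly_roots_finite by blast
    then show ?thesis using q by simp
  qed
  from place_of_adherent_point[of "\<lambda>x _ :: unit. inverse (e (r x))" "\<lambda>_. 0", OF this]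
  obtain B \<phi> where "place B \<phi>" and B: "(\<lambda>x. inverse (e (r x))) \<in> B" "\<phi> (\<lambda>x. inverse (e (r x))) = 0" by blast
  interpret place B \<phi> by fact
  have "c x ^ d = 1" for x
  proof -
    have "c x ^ d * section_at f F = section_at f (substitute m n (r x) F)"
      by (simp only: c section_at_homogeneous[OF invariant_sectionsD(1)[OF f(1)]])
    also have "\<dots> = section_at f F" by (rule invariant_sectionsD(2)[OF f(1) rG(1) F(1)])
    finally show ?thesis using f(2) by simp
  qed
  then have cB: "c \<in> B" using power_mem_imp_mem[of c d] d by simp
  have v: "form_mem m n k l (\<lambda>x. substitute m n (r x) F)"
    unfolding form_mem_def c by (auto simp: biforms_Const_mult[OF F(1)] lookup_Const_mult mult(1)[OF cB])
  have "group_mem m n r"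
    by (rule group_mem_of_form_mem[OF pos rG(1) form_mem_const[OF F(1)] v]) (simp_all add: lim_form_const[OF F(1)] F)
  from e(2)[OF \<open>place B \<phi>\<close> this] have "(\<lambda>x. e (r x)) \<in> B" .
  from mult(2)[OF this B(1)] have "\<phi> (\<lambda>x. e (r x) * inverse (e (r x))) = 0" using B(2) by simp
  then show False using rG(2) by simp
qed

lemma inv_inj_group: "inj_on (\<lambda>g. inv\<^bsub>SLxSL m n\<^esub> g) (group_elements m n)"
  by (rule inj_on_inverseI[of _ "\<lambda>g. inv\<^bsub>SLxSL m n\<^esub> g"]) (rule inv_inv_group)

lemma Const_inverse_mult: "c \<noteq> 0 \<Longrightarrow> Const (inverse c) * (Const c * F) = F"
proof -
  assume "c \<noteq> 0"
  have "Const (inverse c) * (Const c * F) = Const (inverse c * c) * F" by (simp only: Const_mult mult.assoc)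
  then show ?thesis using \<open>c \<noteq> 0\<close> by simp
qed

lemma finite_proj_stabilizer:
  assumes "finite {h \<in> group_elements m n. \<exists>c. substitute m n h F = Const c * F}"
  shows "finite (proj_stabilizer m n F)"
proof (rule inj_on_finite[OF _ _ assms])
  show "inj_on (\<lambda>g. inv\<^bsub>SLxSL m n\<^esub> g) (proj_stabilizer m n F)"
    using inv_inj_group by (rule inj_on_subset) (auto simp: proj_stabilizer_def)
  show "(\<lambda>g. inv\<^bsub>SLxSL m n\<^esub> g) ` proj_stabilizer m n F \<subseteq> {h \<in> group_elements m n. \<exists>c. substitute m n h F = Const c * F}"
  proof
    fix h assume "h \<in> (\<lambda>g. inv\<^bsub>SLxSL m n\<^esub> g) ` proj_stabilizer m n F"
    then obtain g c where g: "h = inv\<^bsub>SLxSL m n\<^esub> g" "g \<in> group_elements m n" "c \<noteq> 0" "F = Const c * substitute m n h F"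
      by (auto simp: proj_stabilizer_def same_point_def act_eq_substitute)
    have "Const (inverse c) * F = substitute m n h F"
      using Const_inverse_mult[OF g(3), of "substitute m n h F"] g(4) by simp
    then show "h \<in> {h \<in> group_elements m n. \<exists>c. substitute m n h F = Const c * F}"
      using inv_in_group[OF g(2)] g(1) by (auto intro: exI[of _ "inverse c"])
  qed
qed

lemma finite_form_stabilizer:
  assumes "finite (proj_stabilizer m n F)"
  shows "finite {h \<in> group_elements m n. substitute m n h F = F}"
proof (rule inj_on_finite[OF _ _ assms])
  show "inj_on (\<lambda>g. inv\<^bsub>SLxSL m n\<^esub> g) {h \<in> group_elements m n. substitute m n h F = F}"
    using inv_inj_group by (rule inj_on_subset) auto
  show "(\<lambda>g. inv\<^bsub>SLxSL m n\<^esub> g) ` {h \<in> group_elements m n. substitute m n h F = F} \<subseteq> proj_stabilizer m n F"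
    by (auto simp: proj_stabilizer_def same_point_def act_eq_substitute inv_in_group inv_inv_group intro!: exI[of _ 1])
qed

text \<open>An eigenvalue 2 is a closed condition, forces infinite order, and occurs in every non-trivial
  one-parameter subgroup. So the closed set of exceptional forms contains all limits along one-parameter
  subgroups, but no form with finite stabilizer.\<close>

definition exceptional :: "nat \<Rightarrow> nat \<Rightarrow> nat \<Rightarrow> nat \<Rightarrow> bivar cpoly set" where
  "exceptional m n k l = {F \<in> biforms m n k l. \<exists>h\<in>group_elements m n.
     substitute m n h F = F \<and> (eigenvalue (fst h) 2 \<or> eigenvalue (snd h) 2)}"

lemma eigenvalue_2_powers_distinct:
  fixes A :: "complex mat"
  assumes "A \<in> carrier_mat N N" "eigenvalue A 2"
  shows "inj (\<lambda>i. A ^\<^sub>m i)"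
proof (rule injI)
  fix i j assume eq: "A ^\<^sub>m i = A ^\<^sub>m j"
  obtain v where v: "eigenvector A v 2" using assms(2) by (auto simp: eigenvalue_def)
  then have v0: "v \<in> carrier_vec N" "v \<noteq> 0\<^sub>v N" using assms(1) by (auto simp: eigenvector_def)
  then obtain a where a: "a < N" "v $ a \<noteq> 0" by (auto simp: vec_eq_iff)
  have "(2 ^ i \<cdot>\<^sub>v v) $ a = (2 ^ j \<cdot>\<^sub>v v) $ a"
    using eigenvector_pow[OF assms(1) v, of i] eigenvector_pow[OF assms(1) v, of j] eq by simp
  then have "(2 :: complex) ^ i = 2 ^ j" using a v0 by simp
  then have "(2 :: real) ^ i = 2 ^ j" by (metis of_real_eq_iff of_real_numeral of_real_power)
  then show "i = j" by (simp add: power_inject_exp)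
qed

lemma infinite_stabilizer_exceptional:
  assumes "F \<in> exceptional m n k l"
  shows "infinite {h \<in> group_elements m n. substitute m n h F = F}" (is "infinite ?S")
proof
  assume fin: "finite ?S"
  obtain h where h: "h \<in> group_elements m n" "substitute m n h F = F" "eigenvalue (fst h) 2 \<or> eigenvalue (snd h) 2" and F: "F \<in> biforms m n k l"
    using assms by (auto simp: exceptional_def)
  have c: "fst h \<in> carrier_mat (m + 1) (m + 1)" "snd h \<in> carrier_mat (n + 1) (n + 1)" using h(1) by (auto simp: group_elements_iff)
  have pow: "(fst h ^\<^sub>m i, snd h ^\<^sub>m i) \<in> ?S" for i
  proof (induction i)
    case 0
    then show ?case using c substitute_one[OF F] one_in_group[of m n] by simp
  next
    case (Suc i)
    then have i: "(fst h ^\<^sub>m i, snd h ^\<^sub>m i) \<in> group_elements m n" "substitute m n (fst h ^\<^sub>m i, snd h ^\<^sub>m i) F = F" by auto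
    then have "substitute m n (fst h ^\<^sub>m i * fst h, snd h ^\<^sub>m i * snd h) F = F"
      using substitute_mult[OF h(1) i(1) F] h(2) by (simp add: SLxSL_mult)
    then show ?case using mult_in_group[OF i(1) h(1)] by simp
  qed
  have "inj (\<lambda>i. (fst h ^\<^sub>m i, snd h ^\<^sub>m i))"
    using h(3) eigenvalue_2_powers_distinct[OF c(1)] eigenvalue_2_powers_distinct[OF c(2)] by (auto simp: inj_def)
  then have "infinite (range (\<lambda>i. (fst h ^\<^sub>m i, snd h ^\<^sub>m i)))" by (rule range_inj_infinite)
  moreover have "range (\<lambda>i. (fst h ^\<^sub>m i, snd h ^\<^sub>m i)) \<subseteq> ?S" using pow by blast
  ultimately show False using fin finite_subset by blast
qed

lemma exceptional_Const_mult: "F \<in> exceptional m n k l \<Longrightarrow> Const c * F \<in> exceptional m n k l"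
  by (simp add: exceptional_def biforms_Const_mult) metis

lemma eigenvalue_conjugate:
  fixes A P Q :: "complex mat"
  assumes "A \<in> carrier_mat N N" "P \<in> carrier_mat N N" "Q \<in> carrier_mat N N" "P * Q = 1\<^sub>m N" "Q * P = 1\<^sub>m N" "eigenvalue A c"
  shows "eigenvalue (P * A * Q) c"
proof -
  have "similar_mat (P * A * Q) A"
    using assms by (intro similar_matI[of _ _ P Q N]) auto
  then show ?thesis
    using char_poly_similar assms(1-3,6) by (metis eigenvalue_root_char_poly mult_carrier_mat)
qed

lemma exceptional_substitute:
  assumes "F \<in> exceptional m n k l" "g \<in> group_elements m n"
  shows "substitute m n g F \<in> exceptional m n k l"
proof -
  obtain h where h: "h \<in> group_elements m n" "substitute m n h F = F" "eigenvalue (fst h) 2 \<or> eigenvalue (snd h) 2" and F: "F \<in> biforms m n k l"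
    using assms(1) by (auto simp: exceptional_def)
  define g' where "g' = inv\<^bsub>SLxSL m n\<^esub> g"
  have g': "g' \<in> group_elements m n" unfolding g'_def by (rule inv_in_group[OF assms(2)])
  have inv: "fst g' * fst g = 1\<^sub>m (m + 1)" "snd g' * snd g = 1\<^sub>m (n + 1)" "fst g * fst g' = 1\<^sub>m (m + 1)" "snd g * snd g' = 1\<^sub>m (n + 1)"
    using group.l_inv[OF group_SLxSL assms(2)] group.r_inv[OF group_SLxSL assms(2)] by (simp_all add: g'_def SLxSL_mult SLxSL_one)
  let ?k = "(fst g' * fst h * fst g, snd g' * snd h * snd g)"
  have k: "?k \<in> group_elements m n" using mult_in_group[OF mult_in_group[OF g' h(1)] assms(2)] by simp
  have "eigenvalue (fst ?k) 2 \<or> eigenvalue (snd ?k) 2"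
    using h(3) eigenvalue_conjugate[of "fst h" "m + 1" "fst g'" "fst g"] eigenvalue_conjugate[of "snd h" "n + 1" "snd g'" "snd g"]
      h(1) g' assms(2) inv by (auto simp: group_elements_iff)
  moreover have "substitute m n ?k (substitute m n g F) = substitute m n g F"
  proof -
    have c: "fst g \<in> carrier_mat (m + 1) (m + 1)" "fst g' \<in> carrier_mat (m + 1) (m + 1)" "fst h \<in> carrier_mat (m + 1) (m + 1)"
      "snd g \<in> carrier_mat (n + 1) (n + 1)" "snd g' \<in> carrier_mat (n + 1) (n + 1)" "snd h \<in> carrier_mat (n + 1) (n + 1)"
      using assms(2) g' h(1) by (auto simp: group_elements_iff)
    have "fst g * (fst g' * fst h * fst g) = fst g * fst g' * (fst h * fst g)"
      using c by (simp add: assoc_mult_mat[of _ "m + 1" "m + 1" _ "m + 1" _ "m + 1"])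
    moreover have "snd g * (snd g' * snd h * snd g) = snd g * snd g' * (snd h * snd g)"
      using c by (simp add: assoc_mult_mat[of _ "n + 1" "n + 1" _ "n + 1" _ "n + 1"])
    ultimately have "substitute m n ?k (substitute m n g F) = substitute m n (fst h * fst g, snd h * snd g) F"
      using substitute_mult[OF k assms(2) F] c by (simp add: SLxSL_mult inv)
    also have "\<dots> = substitute m n g (substitute m n h F)"
      using substitute_mult[OF assms(2) h(1) F] by (simp add: SLxSL_mult)
    finally show ?thesis by (simp add: h(2))
  qed
  ultimately show ?thesis using k substitute_biforms[OF F] unfolding exceptional_def by blast
qed

lemma eigenvalue_diagonal:
  fixes f :: "nat \<Rightarrow> complex"
  assumes "N > 0" shows "eigenvalue (mat N N (\<lambda>(i, j). if i = j then f i else 0)) (f 0)"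
  unfolding eigenvalue_def eigenvector_def
proof (intro exI[of _ "unit_vec N 0"] conjI)
  show "mat N N (\<lambda>(i, j). if i = j then f i else 0) *\<^sub>v unit_vec N 0 = f 0 \<cdot>\<^sub>v unit_vec N 0"
    using assms by (intro eq_vecI) auto
qed (use assms in \<open>auto simp: vec_eq_iff\<close>)

lemma powi_eq_2: "r > 0 \<Longrightarrow> \<exists>s :: complex. s \<noteq> 0 \<and> s powi r = 2"
proof -
  assume r: "r > (0 :: int)"
  define s where "s = complex_of_real (root (nat r) 2)"
  have "s ^ nat r = 2" using r unfolding s_def by (simp flip: of_real_power)
  then show ?thesis using r by (intro exI[of _ s]) (auto simp: power_int_def power_0_left)
qed

text \<open>The limit consists of the terms of weight 0 and is fixed by the whole one-parameter
  subgroup. One of the leading weights is positive, so the parameter can be chosen with the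
  corresponding diagonal entry equal to 2.\<close>

lemma limit_exceptional:
  assumes "F \<in> biforms m n k l" "lam \<in> fundamental_set m n k l" "\<And>I. I \<in> Poly_Mapping.keys F \<Longrightarrow> 0 \<le> pairing m n I lam"
  shows "limit_curve m n k l lam F 0 \<in> exceptional m n k l"
proof -
  let ?F = "limit_curve m n k l lam F 0"
  obtain s :: complex where s: "s \<noteq> 0" "s powi (fst lam $ 0) = 2 \<or> s powi (snd lam $ 0) = 2"
    using fundamental_set_weight(2)[OF assms(2)] powi_eq_2 by metis
  have "substitute m n (one_parameter m n lam s) ?F = ?F"
  proof (rule biforms_eqI[OF substitute_biforms[OF limit_curve_biforms] limit_curve_biforms])
    fix I assume I: "I \<in> bimonomials m n k l"
    show "Poly_Mapping.lookup (substitute m n (one_parameter m n lam s) ?F) I = Poly_Mapping.lookup ?F I"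
    proof (cases "pairing m n I lam = 0")
      case True
      then show ?thesis by (simp add: lookup_one_parameter[OF s(1) limit_curve_biforms])
    next
      case False
      then have "Poly_Mapping.lookup ?F I = 0"
        using assms(3)[of I] by (cases "I \<in> Poly_Mapping.keys F") (auto simp: lookup_limit_curve[OF I] in_keys_iff power_0_left)
      then show ?thesis by (simp add: lookup_one_parameter[OF s(1) limit_curve_biforms])
    qed
  qed
  moreover have "eigenvalue (fst (one_parameter m n lam s)) 2 \<or> eigenvalue (snd (one_parameter m n lam s)) 2"
    using s(2) eigenvalue_diagonal[of "m + 1" "\<lambda>i. s powi (fst lam $ i)"] eigenvalue_diagonal[of "n + 1" "\<lambda>i. s powi (snd lam $ i)"]
    by (auto simp: one_parameter_def)
  ultimately show ?thesis
    using one_parameter_in_group[OF s(1) fundamental_set_weight(1)[OF assms(2)]] limit_curve_biforms unfolding exceptional_def by blast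
qed

text \<open>At a place where exceptional forms tend to \<open>F\<close>, properness bounds the group
  elements that fix them. Their limit fixes \<open>F\<close> and still has the eigenvalue 2, against
  the finiteness of the stabilizer.\<close>

theorem exceptional_closed:
  assumes pos: "m > 0" "n > 0" "k > 0" "l > 0" and F: "F \<in> biforms m n k l" "F \<noteq> 0" "\<not> weakly_destabilized m n k l F"
  shows "\<exists>p. (\<forall>F'\<in>exceptional m n k l. section_at p F' = 0) \<and> section_at p F \<noteq> 0"
proof (rule ccontr)
  assume contr: "\<not> ?thesis"
  let ?J = "exceptional m n k l"
  have "?J \<noteq> {}" using contr[unfolded not_ex, rule_format, of 1] by auto
  then obtain F0 where F0: "F0 \<in> ?J" by blast
  define r where "r = retract ?J F0"
  have r: "r x \<in> ?J" "x \<in> ?J \<Longrightarrow> r x = x" for x using F0 by (simp_all add: r_def)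
  have rb: "r x \<in> biforms m n k l" for x using r(1)[of x] by (simp add: exceptional_def)
  have "cpoly_eval (Poly_Mapping.lookup F) p = 0" if p: "\<And>x. cpoly_eval (Poly_Mapping.lookup (r x)) p = 0" for p
    using contr p r(2) unfolding section_at_eq_eval by metis
  from place_of_adherent_point[of "\<lambda>x. Poly_Mapping.lookup (r x)" "Poly_Mapping.lookup F", OF this]
  obtain B \<phi> where "place B \<phi>" and B: "\<And>I. (\<lambda>x. Poly_Mapping.lookup (r x) I) \<in> B" "\<And>I. \<phi> (\<lambda>x. Poly_Mapping.lookup (r x) I) = Poly_Mapping.lookup F I"
    by blast
  interpret place B \<phi> by fact
  have "\<exists>h\<in>group_elements m n. substitute m n h (r x) = r x \<and> (eigenvalue (fst h) 2 \<or> eigenvalue (snd h) 2)" for x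
    using r(1)[of x] by (simp add: exceptional_def)
  then obtain h where h: "\<And>x. h x \<in> group_elements m n" "\<And>x. substitute m n (h x) (r x) = r x"
    "\<And>x. eigenvalue (fst (h x)) 2 \<or> eigenvalue (snd (h x)) 2" by metis
  have v: "form_mem m n k l r" "form_mem m n k l (\<lambda>x. substitute m n (h x) (r x))"
    unfolding form_mem_def h(2) using rb B(1) by auto
  have lim: "lim_form m n k l r = F" by (rule lim_form_eqI[OF F(1) B(2)])
  have hB: "group_mem m n h"
    by (rule group_mem_of_form_mem[OF pos h(1) v]) (simp_all add: lim F)
  let ?a = "lim_pair m n h"
  have "substitute m n ?a F = F"
    using substitute_mem(2)[OF hB v(1)] by (simp add: h(2) lim)
  moreover have "eigenvalue (fst ?a) 2 \<or> eigenvalue (snd ?a) 2"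
  proof -
    have half: "mat_mem N (\<lambda>x. char_matrix (M x) 2)" "lim_mat N (\<lambda>x. char_matrix (M x) 2) = char_matrix (lim_mat N M) 2"
      if "mat_mem N M" for N M
    proof -
      have e: "char_matrix A 2 $$ (i, j) = A $$ (i, j) + (if i = j then -2 else 0)" if "A \<in> carrier_mat N N" "i < N" "j < N" for A :: "complex mat" and i j
        using that by (auto simp: char_matrix_def)
      have "(\<lambda>x. char_matrix (M x) 2 $$ (i, j)) \<in> B \<and> \<phi> (\<lambda>x. char_matrix (M x) 2 $$ (i, j)) = char_matrix (lim_mat N M) 2 $$ (i, j)"
        if ij: "i < N" "j < N" for i j
        unfolding e[OF lim_mat_carrier ij] e[OF mat_memD(1)[OF \<open>mat_mem N M\<close>] ij] lim_mat_index[OF ij]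
        using add[OF mat_memD(2)[OF \<open>mat_mem N M\<close> ij] const(1)] by simp
      note ij = this and cl = char_matrix_closed[OF lim_mat_carrier[of N M], of 2]
      show "mat_mem N (\<lambda>x. char_matrix (M x) 2)"
        using ij char_matrix_closed[OF mat_memD(1)[OF that]] by (simp add: mat_mem_def)
      show "lim_mat N (\<lambda>x. char_matrix (M x) 2) = char_matrix (lim_mat N M) 2"
      proof (rule eq_matI)
        fix i j assume "i < dim_row (char_matrix (lim_mat N M) 2)" "j < dim_col (char_matrix (lim_mat N M) 2)"
        then have "i < N" "j < N" using cl by auto
        then show "lim_mat N (\<lambda>x. char_matrix (M x) 2) $$ (i, j) = char_matrix (lim_mat N M) 2 $$ (i, j)"
          using ij[of i j] by (simp add: lim_mat_index)
      qed (simp_all only: carrier_matD[OF cl] carrier_matD[OF lim_mat_carrier])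
    qed
    let ?d = "\<lambda>x. det (char_matrix (fst (h x)) 2)" and ?e = "\<lambda>x. det (char_matrix (snd (h x)) 2)"
    have m: "mat_mem (m + 1) (\<lambda>x. fst (h x))" "mat_mem (n + 1) (\<lambda>x. snd (h x))" using hB by (auto simp: group_mem_def SL_mem_def)
    have c: "fst (h x) \<in> carrier_mat (m + 1) (m + 1)" "snd (h x) \<in> carrier_mat (n + 1) (n + 1)" for x using h(1)[of x] by (auto simp: group_elements_iff)
    have d: "?d \<in> B" "\<phi> ?d = det (char_matrix (fst ?a) 2)" "?e \<in> B" "\<phi> ?e = det (char_matrix (snd ?a) 2)"
      using mat_mem_det[OF half(1)[OF m(1)]] mat_mem_det[OF half(1)[OF m(2)]] half(2)[OF m(1)] half(2)[OF m(2)] by (simp_all add: lim_pair_def)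
    \<comment> \<open>Which factor has the eigenvalue 2 may depend on \<open>x\<close>; the product
      of the two determinants vanishes in either case.\<close>
    have "(\<lambda>x. ?d x * ?e x) = (\<lambda>_. 0)"
      using h(3) eigenvalue_det[OF c(1)] eigenvalue_det[OF c(2)] by fastforce
    then have "\<phi> ?d * \<phi> ?e = 0" using mult(2)[OF d(1,3)] by simp
    moreover have "fst ?a \<in> carrier_mat (m + 1) (m + 1)" "snd ?a \<in> carrier_mat (n + 1) (n + 1)" by (simp_all add: lim_pair_def)
    ultimately show ?thesis using eigenvalue_det by (auto simp: d(2,4))
  qed
  ultimately have "F \<in> ?J" using F(1) lim_pair_in_group[OF hB] unfolding exceptional_def by blast
  then have "infinite {h \<in> group_elements m n. substitute m n h F = F}" by (rule infinite_stabilizer_exceptional)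
  moreover have "{h \<in> group_elements m n. substitute m n h F = F} \<subseteq> {h \<in> group_elements m n. \<exists>c. substitute m n h F = Const c * F}"
    by (auto intro: exI[of _ 1])
  ultimately show False using finite_stabilizer[OF pos F] finite_subset by blast
qed

section \<open>Stability\<close>

lemma coefficients_zero:
  fixes a :: "nat \<Rightarrow> complex"
  assumes "\<And>c. c \<noteq> 0 \<Longrightarrow> (\<Sum>d\<le>D. c ^ d * a d) = 0" "d \<le> D"
  shows "a d = 0"
proof -
  let ?q = "\<Sum>d\<le>D. monom (a d) d"
  have "poly ?q c = 0" for c
    by (rule poly_eq_const) (use assms(1) in \<open>simp add: poly_sum poly_monom mult.commute\<close>)
  then have "?q = 0" using poly_all_0_iff_0 by blast
  then have "coeff ?q d = 0" by simp
  then show ?thesis using assms(2) by (simp add: coeff_sum coeff_monom)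
qed

lemma section_at_Const_mult_sum:
  assumes "\<And>d. f d \<in> sections m n k l d"
  shows "(\<Sum>d\<le>D. section_at (f d) (Const c * F)) = (\<Sum>d\<le>D. c ^ d * section_at (f d) F)"
  by (rule sum.cong[OF refl]) (rule section_at_homogeneous[OF assms])

lemma countable_bivar: "countable (UNIV :: bivar set)"
proof -
  have eq: "(UNIV :: bivar set) = range x_var \<union> range y_var"
  proof (intro equalityI subsetI)
    fix v :: bivar show "v \<in> range x_var \<union> range y_var" by (cases v) auto
  qed auto
  show ?thesis unfolding eq by (intro countable_Un countable_image countableI_type)
qed

text \<open>By the Nullstellensatz, the ideals of two disjoint closed sets, the orbit and the exceptional
  forms, are comaximal.\<close>

theorem separating_polynomial:
  assumes pos: "m > 0" "n > 0" "k > 0" "l > 0" and F: "F \<in> biforms m n k l" "F \<noteq> 0" "\<not> weakly_destabilized m n k l F"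
  shows "\<exists>q. (\<forall>F'\<in>exceptional m n k l. section_at q F' = 0) \<and> (\<forall>h\<in>group_elements m n. section_at q (substitute m n h F) = 1)"
proof -
  let ?J = "exceptional m n k l" and ?G = "group_elements m n"
  \<comment> \<open>This is the sum of the vanishing ideals of the orbit and of the exceptional
    forms.\<close>
  define I where "I = {p. \<exists>q. (\<forall>F'\<in>?J. section_at q F' = 0) \<and> (\<forall>h\<in>?G. section_at p (substitute m n h F) = section_at q (substitute m n h F))}"
  have I: "cpoly_ideal I"
    unfolding cpoly_ideal_def
  proof (intro conjI ballI allI)
    show "0 \<in> I" unfolding I_def by (auto intro: exI[of _ 0])
    fix p q assume "q \<in> I"
    then obtain q' where q': "\<forall>F'\<in>?J. section_at q' F' = 0" "\<forall>h\<in>?G. section_at q (substitute m n h F) = section_at q' (substitute m n h F)"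
      unfolding I_def by blast
    then show "p * q \<in> I" unfolding I_def by (auto intro!: exI[of _ "p * q'"])
    assume "p \<in> I"
    then obtain p' where "\<forall>F'\<in>?J. section_at p' F' = 0" "\<forall>h\<in>?G. section_at p (substitute m n h F) = section_at p' (substitute m n h F)"
      unfolding I_def by blast
    with q' show "p + q \<in> I" unfolding I_def by (auto intro!: exI[of _ "p' + q'"])
  qed
  have "1 \<in> I"
  proof (rule ccontr)
    assume "1 \<notin> I"
    then obtain w where w: "\<And>p. p \<in> I \<Longrightarrow> cpoly_eval w p = 0"
      using weak_nullstellensatz[OF countable_poly_mapping[OF countable_bivar] I] by blast
    \<comment> \<open>A common zero \<open>w\<close> would lie in the orbit, which is closed. The
      form there satisfies the same hypotheses as \<open>F\<close>, so some polynomial that vanishes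
      on the exceptional forms does not vanish at it.\<close>
    have "cpoly_eval w p = 0" if "\<And>h. h \<in> ?G \<Longrightarrow> section_at p (substitute m n h F) = 0" for p
      using that unfolding I_def by (intro w[unfolded I_def]) (auto intro: exI[of _ 0])
    then obtain a where a: "a \<in> ?G" "w = Poly_Mapping.lookup (substitute m n a F)"
      using orbit_closed[OF pos F, of w] by blast
    have "substitute m n a F \<in> biforms m n k l" "substitute m n a F \<noteq> 0" "\<not> weakly_destabilized m n k l (substitute m n a F)"
      using substitute_biforms[OF F(1)] substitute_eq_0_iff[OF a(1) F(1)] weakly_destabilized_substitute[OF a(1) F(1)] F(2,3) by auto
    from exceptional_closed[OF pos this] obtain p where p: "\<forall>F'\<in>?J. section_at p F' = 0" "section_at p (substitute m n a F) \<noteq> 0" by blast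
    then have "p \<in> I" unfolding I_def by blast
    then show False using w[of p] p(2) by (simp add: section_at_eq_eval a(2))
  qed
  then obtain q where "\<forall>F'\<in>?J. section_at q F' = 0" "\<forall>h\<in>?G. section_at 1 (substitute m n h F) = section_at q (substitute m n h F)"
    unfolding I_def by blast
  then show ?thesis by (intro exI[of _ q]) simp
qed

lemma invariant_sections_mult:
  assumes "f \<in> invariant_sections m n k l d" "g \<in> invariant_sections m n k l e"
  shows "f * g \<in> invariant_sections m n k l (d + e)"
  using assms sections_mult by (auto simp: invariant_sections_def)

text \<open>The exceptional forms are a cone, so the homogeneous components of the averaged separating polynomial
  vanish on them one by one.\<close>

theorem separating_invariant:
  assumes pos: "m > 0" "n > 0" "k > 0" "l > 0" and F: "F \<in> biforms m n k l" "F \<noteq> 0" "\<not> weakly_destabilized m n k l F"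
  shows "\<exists>d>0. \<exists>f\<in>invariant_sections m n k l d. section_at f F \<noteq> 0 \<and> (\<forall>F'\<in>exceptional m n k l. section_at f F' = 0)"
proof -
  let ?J = "exceptional m n k l" and ?G = "group_elements m n"
  obtain q where q: "\<And>F'. F' \<in> ?J \<Longrightarrow> section_at q F' = 0" "\<And>h. h \<in> ?G \<Longrightarrow> section_at q (substitute m n h F) = 1"
    using separating_polynomial[OF pos F] by blast
  obtain D f where f: "\<And>d. f d \<in> invariant_sections m n k l d"
    "\<And>F c. F \<in> biforms m n k l \<Longrightarrow> (\<And>h. h \<in> ?G \<Longrightarrow> section_at q (substitute m n h F) = c) \<Longrightarrow> (\<Sum>d\<le>D. section_at (f d) F) = c"
    using reynolds[of m n k l q] by metis
  have fs: "f d \<in> sections m n k l d" for d using f(1) invariant_sectionsD(1) by blast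
  have "(\<Sum>d\<le>D. section_at (f d) F) = 1" using f(2)[OF F(1)] q(2) by blast
  then obtain d where d: "d \<le> D" "section_at (f d) F \<noteq> 0" using sum.not_neutral_contains_not_neutral by force
  have J: "section_at (f d) F' = 0" if F': "F' \<in> ?J" for F'
  proof -
    have "(\<Sum>d\<le>D. c ^ d * section_at (f d) F') = 0" for c
      unfolding section_at_Const_mult_sum[OF fs, symmetric]
    proof (rule f(2))
      show "Const c * F' \<in> biforms m n k l" using F' biforms_Const_mult by (auto simp: exceptional_def)
    qed (intro q(1) exceptional_substitute exceptional_Const_mult F')
    then show ?thesis using coefficients_zero[where D = D and a = "\<lambda>d. section_at (f d) F'" and d = d] d(1) by blast
  qed
  \<comment> \<open>The degree \<open>d\<close> found so far is not known to be positive; a factor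
    of positive degree that does not vanish at \<open>F\<close> repairs this.\<close>
  obtain e g where g: "e > 0" "g \<in> invariant_sections m n k l e" "section_at g F \<noteq> 0"
    using invariant_of_not_destabilized[OF pos F(1,2) not_destabilized_of_not_weakly[OF F(3)]] by blast
  have "f d * g \<in> invariant_sections m n k l (d + e)" by (rule invariant_sections_mult[OF f(1) g(2)])
  then show ?thesis using g(1,3) d(2) J by (intro exI[of _ "d + e"] conjI bexI[of _ "f d * g"]) auto
qed

text \<open>A limit along a one-parameter subgroup with non-negative weights is exceptional, so
  \<open>f\<close> vanishes there; but an invariant has the same value at the limit as at
  \<open>F\<close>.\<close>

lemma not_weakly_destabilized_nonvanishing:
  assumes "f \<in> invariant_sections m n k l d" "\<And>F'. F' \<in> exceptional m n k l \<Longrightarrow> section_at f F' = 0"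
    and F: "F \<in> biforms m n k l" "section_at f F \<noteq> 0"
  shows "\<not> weakly_destabilized m n k l F"
proof
  assume "weakly_destabilized m n k l F"
  then obtain h lam where h: "h \<in> group_elements m n" and lam: "lam \<in> fundamental_set m n k l"
    and nn: "\<And>I. I \<in> Poly_Mapping.keys (substitute m n h F) \<Longrightarrow> 0 \<le> pairing m n I lam"
    unfolding weakly_destabilized_def by blast
  note b = substitute_biforms[OF F(1), of h]
  have "section_at f (limit_curve m n k l lam (substitute m n h F) 0) = section_at f (substitute m n h F)"
    by (rule invariant_at_limit[OF assms(1) b lam nn])
  also have "\<dots> = section_at f F" by (rule invariant_sectionsD(2)[OF assms(1) h F(1)])
  finally show False using assms(2)[OF limit_exceptional[OF b lam nn]] F(2) by simp
qed

lemma proj_orbit_iff: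
  "F' \<in> proj_orbit m n F \<longleftrightarrow> (\<exists>h\<in>group_elements m n. \<exists>c. c \<noteq> 0 \<and> F' = Const c * substitute m n h F)"
  unfolding proj_orbit_def same_point_def
  using ex_act_iff_ex_substitute[of m n "\<lambda>F''. \<exists>c. c \<noteq> 0 \<and> F' = Const c * F''"] by simp

lemma Const_mult_eq_0_iff: "Const c * F = 0 \<longleftrightarrow> c = 0 \<or> F = 0"
  using Const_inverse_mult[of c F] by (metis Const_0 mult_zero_left mult_zero_right)

text \<open>\<open>zariski_closed\<close> involves only homogeneous sections, places arbitrary
  polynomials. A polynomial that vanishes on the cone over \<open>Y\<close> has homogeneous
  components that do so as well.\<close>

lemma homogeneous_vanishing:
  assumes F: "F \<in> biforms m n k l"
    and p: "\<And>y c. y \<in> Y \<Longrightarrow> c \<noteq> 0 \<Longrightarrow> section_at p (Const c * y) = 0" and Y: "Y \<subseteq> biforms m n k l"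
    and F': "\<And>s. s \<in> (\<Union>d. sections m n k l d) \<Longrightarrow> (\<And>y. y \<in> Y \<Longrightarrow> section_at s y = 0) \<Longrightarrow> section_at s F = 0"
  shows "section_at p F = 0"
proof -
  obtain D f where f: "\<And>d. f d \<in> sections m n k l d" "\<And>F. F \<in> biforms m n k l \<Longrightarrow> section_at p F = (\<Sum>d\<le>D. section_at (f d) F)"
    using homogeneous_components[of m n k l p] by metis
  have "section_at (f d) y = 0" if "d \<le> D" "y \<in> Y" for d y
  proof (rule coefficients_zero[where D = D and a = "\<lambda>d. section_at (f d) y"])
    fix c :: complex assume "c \<noteq> 0"
    then have "section_at p (Const c * y) = 0" using p that(2) by blast
    then show "(\<Sum>d\<le>D. c ^ d * section_at (f d) y) = 0"
      using f(2)[OF biforms_Const_mult, of y c] Y that(2) by (simp add: section_at_Const_mult_sum[OF f(1)] subset_iff)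
  qed (rule that(1))
  then have "section_at (f d) F = 0" if "d \<le> D" for d using F'[of "f d"] f(1) that by blast
  then show ?thesis by (simp add: f(2)[OF F])
qed

text \<open>A point of the closure is approached by multiples with scalars \<open>c x\<close> of
  transforms of \<open>F\<close> by \<open>h x\<close>. As \<open>f\<close> does not vanish at the
  limit, \<open>c x ^ d\<close> has a finite non-zero limit, so \<open>c\<close> is a unit of the
  place. Then the transforms of \<open>F\<close> are bounded too, and properness provides a limit of
  \<open>h\<close>.\<close>

theorem orbit_closed_in_nonvanishing_locus:
  assumes pos: "m > 0" "n > 0" "k > 0" "l > 0" and d: "d > 0" and f: "f \<in> invariant_sections m n k l d"
    and F: "F \<in> nonvanishing_locus m n k l f" "\<not> weakly_destabilized m n k l F"
  shows "\<exists>Z. zariski_closed m n k l Z \<and> proj_orbit m n F = Z \<inter> nonvanishing_locus m n k l f"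
proof -
  let ?G = "group_elements m n"
  have Fb: "F \<in> biforms m n k l" "F \<noteq> 0" "section_at f F \<noteq> 0" using F(1) by (auto simp: nonvanishing_locus_def)
  have orb: "Const c * substitute m n h F \<in> biforms m n k l" "section_at f (Const c * substitute m n h F) = c ^ d * section_at f F"
    "Const c * substitute m n h F = 0 \<longleftrightarrow> c = 0" if h: "h \<in> ?G" for c h
  proof -
    show "Const c * substitute m n h F \<in> biforms m n k l" by (rule biforms_Const_mult[OF substitute_biforms[OF Fb(1)]])
    show "section_at f (Const c * substitute m n h F) = c ^ d * section_at f F"
      unfolding section_at_homogeneous[OF invariant_sectionsD(1)[OF f]] invariant_sectionsD(2)[OF f h Fb(1)] ..
    show "Const c * substitute m n h F = 0 \<longleftrightarrow> c = 0"
      unfolding Const_mult_eq_0_iff substitute_eq_0_iff[OF h Fb(1)] using Fb(2) by simp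
  qed
  define H where "H = {s \<in> (\<Union>d. sections m n k l d). \<forall>y\<in>proj_orbit m n F. section_at s y = 0}"
  define Z where "Z = {F' \<in> biforms m n k l. F' \<noteq> 0 \<and> (\<forall>s\<in>H. section_at s F' = 0)}"
  have "zariski_closed m n k l Z" unfolding zariski_closed_def Z_def H_def by blast
  moreover have "proj_orbit m n F \<subseteq> Z \<inter> nonvanishing_locus m n k l f"
  proof
    fix F' assume F': "F' \<in> proj_orbit m n F"
    then obtain h c where hc: "h \<in> ?G" "c \<noteq> 0" "F' = Const c * substitute m n h F" by (auto simp: proj_orbit_iff)
    then have b: "F' \<in> biforms m n k l" "F' \<noteq> 0" "section_at f F' \<noteq> 0" using orb[OF hc(1), of c] Fb(3) by simp_all
    then show "F' \<in> Z \<inter> nonvanishing_locus m n k l f" using F' by (simp add: Z_def H_def nonvanishing_locus_def)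
  qed
  moreover have "F' \<in> proj_orbit m n F" if F': "F' \<in> Z" "F' \<in> nonvanishing_locus m n k l f" for F'
  proof -
    have F'b: "F' \<in> biforms m n k l" "section_at f F' \<noteq> 0" using F'(2) by (auto simp: nonvanishing_locus_def)
    let ?C = "{c :: complex. c \<noteq> 0} \<times> ?G"
    define r where "r = retract ?C (1, (1\<^sub>m (m + 1), 1\<^sub>m (n + 1)))"
    define c h where "c x = fst (r x)" and "h x = snd (r x)" for x
    have one: "(1, (1\<^sub>m (m + 1), 1\<^sub>m (n + 1))) \<in> ?C" using one_in_group[of m n] by simp
    have r: "r x \<in> ?C" "x \<in> ?C \<Longrightarrow> r x = x" for x
      unfolding r_def by (rule retract(1)[OF one]) (rule retract(2))
    have ch: "c x \<noteq> 0" "h x \<in> ?G" for x using r(1)[of x] by (auto simp: c_def h_def)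
    let ?v = "\<lambda>x. Const (c x) * substitute m n (h x) F"
    have "cpoly_eval (Poly_Mapping.lookup F') p = 0" if p: "\<And>x. cpoly_eval (Poly_Mapping.lookup (?v x)) p = 0" for p
      unfolding section_at_eq_eval[symmetric]
    proof (rule homogeneous_vanishing[OF F'b(1)])
      fix y and b :: complex assume "y \<in> proj_orbit m n F" "b \<noteq> 0"
      then obtain g a where "g \<in> ?G" "a \<noteq> 0" "y = Const a * substitute m n g F" by (auto simp: proj_orbit_iff)
      then have "Const b * y = ?v (b * a, g)"
        using r(2)[of "(b * a, g)"] \<open>b \<noteq> 0\<close> by (simp add: c_def h_def Const_mult mult.assoc)
      then show "section_at p (Const b * y) = 0" using p by (simp add: section_at_eq_eval)
    next
      show "proj_orbit m n F \<subseteq> biforms m n k l" using orb(1) by (auto simp: proj_orbit_iff)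
    next
      fix s assume "s \<in> (\<Union>d. sections m n k l d)" "\<And>y. y \<in> proj_orbit m n F \<Longrightarrow> section_at s y = 0"
      then have "s \<in> H" by (simp add: H_def)
      then show "section_at s F' = 0" using F'(1) by (simp add: Z_def)
    qed
    from place_of_adherent_point[of "\<lambda>x. Poly_Mapping.lookup (?v x)" "Poly_Mapping.lookup F'", OF this]
    obtain B \<phi> where "place B \<phi>" and B: "\<And>I. (\<lambda>x. Poly_Mapping.lookup (?v x) I) \<in> B" "\<And>I. \<phi> (\<lambda>x. Poly_Mapping.lookup (?v x) I) = Poly_Mapping.lookup F' I"
      by blast
    interpret place B \<phi> by fact
    have v: "form_mem m n k l ?v" unfolding form_mem_def using B(1) orb(1)[OF ch(2)] by blast
    have lim: "lim_form m n k l ?v = F'" by (rule lim_form_eqI[OF F'b(1) B(2)])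
    have fv: "(\<lambda>x. c x ^ d * section_at f F) \<in> B" "\<phi> (\<lambda>x. c x ^ d * section_at f F) = section_at f F'"
      using section_at_mem[OF v, of f] unfolding lim orb(2)[OF ch(2)] by blast+
    have "(\<lambda>x. c x ^ d * section_at f F * inverse (section_at f F)) \<in> B" by (rule mult(1)[OF fv(1) const(1)])
    then have "(\<lambda>x. c x ^ d) \<in> B" using Fb(3) by (simp add: mult.assoc)
    then have cB: "c \<in> B" using power_mem_imp_mem d by blast
    have "\<phi> c ^ d * section_at f F = section_at f F'"
      using mult(2)[OF power(1)[OF cB, of d] const(1)] power(2)[OF cB, of d] fv(2) by simp
    then have c0: "\<phi> c \<noteq> 0" using F'b(2) d by (auto simp: power_0_left)
    have hv: "substitute m n (h x) F = Const (inverse (c x)) * ?v x" for x by (rule Const_inverse_mult[OF ch(1), symmetric])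
    have hB: "form_mem m n k l (\<lambda>x. substitute m n (h x) F)"
      unfolding form_mem_def
    proof (intro conjI allI ballI)
      show "substitute m n (h x) F \<in> biforms m n k l" for x by (rule substitute_biforms[OF Fb(1)])
      show "(\<lambda>x. Poly_Mapping.lookup (substitute m n (h x) F) I) \<in> B" for I
        by (subst hv) (simp only: lookup_Const_mult[of "inverse (c _)"] mult(1)[OF unit_inverse(1)[OF cB c0] B(1)])
    qed
    note cF = form_mem_const[OF Fb(1)] lim_form_const[OF Fb(1)]
    have gm: "group_mem m n h"
      by (rule group_mem_of_form_mem[OF pos ch(2) cF(1) hB]) (simp_all add: cF(2) Fb F(2))
    note l = substitute_mem[OF gm cF(1), unfolded cF(2)]
    have "F' = Const (\<phi> c) * substitute m n (lim_pair m n h) F"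
    proof (rule biforms_eqI[OF F'b(1) biforms_Const_mult[OF substitute_biforms[OF Fb(1)]]])
      fix I
      show "Poly_Mapping.lookup F' I = Poly_Mapping.lookup (Const (\<phi> c) * substitute m n (lim_pair m n h) F) I"
        using B(2)[of I] mult(2)[OF cB form_memD(2)[OF l(1), of I]] form_memD(3)[OF l(1), of I] l(2) by (simp add: lookup_Const_mult)
    qed
    then show ?thesis using lim_pair_in_group[OF gm] c0 by (auto simp: proj_orbit_iff)
  qed
  ultimately show ?thesis by (intro exI[of _ Z]) blast
qed

theorem stable_of_not_weakly_destabilized:
  assumes pos: "m > 0" "n > 0" "k > 0" "l > 0" and F: "F \<in> biforms m n k l" "F \<noteq> 0" "\<not> weakly_destabilized m n k l F"
  shows "stable m n k l F"
proof -
  obtain d f where d: "d > 0" and f: "f \<in> invariant_sections m n k l d" "section_at f F \<noteq> 0" "\<And>F'. F' \<in> exceptional m n k l \<Longrightarrow> section_at f F' = 0"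
    using separating_invariant[OF pos F] by blast
  have "\<exists>Z. zariski_closed m n k l Z \<and> proj_orbit m n F' = Z \<inter> nonvanishing_locus m n k l f"
    if F': "F' \<in> nonvanishing_locus m n k l f" for F'
    by (rule orbit_closed_in_nonvanishing_locus[OF pos d f(1) F'])
      (use F' not_weakly_destabilized_nonvanishing[OF f(1,3)] in \<open>auto simp: nonvanishing_locus_def\<close>)
  moreover have "F \<in> nonvanishing_locus m n k l f" using F(1,2) f(2) by (simp add: nonvanishing_locus_def)
  ultimately show ?thesis
    unfolding stable_def using finite_proj_stabilizer[OF finite_stabilizer[OF pos F]] d f(1) by blast
qed

text \<open>The limit along the one-parameter subgroup stays in the nonvanishing locus, because the
  invariant is constant along the curve, and the orbit of \<open>F\<close> is closed there. So the
  limit lies in the orbit, and since it is exceptional, \<open>F\<close> is exceptional too and has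
  an infinite stabilizer.\<close>

theorem not_weakly_destabilized_of_stable:
  assumes F: "F \<in> biforms m n k l" and st: "stable m n k l F"
  shows "\<not> weakly_destabilized m n k l F"
proof
  assume "weakly_destabilized m n k l F"
  then obtain h lam where h: "h \<in> group_elements m n" and lam: "lam \<in> fundamental_set m n k l"
    and nn: "\<And>I. I \<in> Poly_Mapping.keys (substitute m n h F) \<Longrightarrow> 0 \<le> pairing m n I lam"
    unfolding weakly_destabilized_def by blast
  obtain d f Z where d: "d > 0" and f: "f \<in> invariant_sections m n k l d" "section_at f F \<noteq> 0"
    and Z: "zariski_closed m n k l Z" "proj_orbit m n F = Z \<inter> nonvanishing_locus m n k l f"
    using st unfolding stable_def by (auto simp: nonvanishing_locus_def)
  obtain H where H: "Z = {F' \<in> biforms m n k l. F' \<noteq> 0 \<and> (\<forall>s\<in>H. section_at s F' = 0)}"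
    using Z(1) unfolding zariski_closed_def by blast
  let ?c = "limit_curve m n k l lam (substitute m n h F)"
  note b = substitute_biforms[OF F, of h]
  have "section_at f (?c 0) = section_at f F"
    using invariant_at_limit[OF f(1) b lam nn] invariant_sectionsD(2)[OF f(1) h F] by simp
  then have f0: "section_at f (?c 0) \<noteq> 0" using f(2) by simp
  have "section_at s (?c 0) = 0" if s: "s \<in> H" for s
  proof (rule section_at_limit)
    fix t :: complex assume t: "t \<noteq> 0"
    note o = one_parameter_in_group[OF t fundamental_set_weight(1)[OF lam]]
    have "?c t = substitute m n (one_parameter m n lam t) (substitute m n h F)"
      by (rule limit_curve_eq_substitute[OF t b nn])
    also have "\<dots> = Const 1 * substitute m n (h \<otimes>\<^bsub>SLxSL m n\<^esub> one_parameter m n lam t) F"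
      using substitute_mult[OF o h F] by simp
    finally have "?c t \<in> proj_orbit m n F"
      unfolding proj_orbit_iff using monoid.m_closed[OF group.is_monoid[OF group_SLxSL] h o] zero_neq_one by metis
    then show "section_at s (?c t) = 0" using s Z(2) H by blast
  qed
  moreover have "?c 0 \<noteq> 0" using f0 section_at_zero_form[OF invariant_sectionsD(1)[OF f(1)] d] by auto
  ultimately have "?c 0 \<in> proj_orbit m n F"
    unfolding Z(2) H nonvanishing_locus_def using f0 by simp
  then obtain a c where a: "a \<in> group_elements m n" "c \<noteq> 0" "?c 0 = Const c * substitute m n a F" by (auto simp: proj_orbit_iff)
  have "Const (inverse c) * ?c 0 = substitute m n a F" unfolding a(3) by (rule Const_inverse_mult[OF a(2)])
  then have "F = substitute m n (inv\<^bsub>SLxSL m n\<^esub> a) (Const (inverse c) * ?c 0)"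
    using substitute_inverse(2)[OF a(1) F] by metis
  moreover have "\<dots> \<in> exceptional m n k l"
    by (intro exceptional_substitute exceptional_Const_mult limit_exceptional[OF b lam nn] inv_in_group a(1))
  ultimately have "F \<in> exceptional m n k l" by simp
  then have "infinite {h \<in> group_elements m n. substitute m n h F = F}" by (rule infinite_stabilizer_exceptional)
  moreover have "finite (proj_stabilizer m n F)" using st by (simp add: stable_def)
  ultimately show False using finite_form_stabilizer by blast
qed

theorem theorem1p1:
  fixes m n k l :: nat and F :: "bivar cpoly"
  assumes "m > 0" and "n > 0" and "k > 0" and "l > 0"
    and "F \<in> biforms m n k l" and "F \<noteq> 0"
  shows "finite (fundamental_set m n k l) \<and>
    (\<not> stable m n k l F \<longleftrightarrow>
      (\<exists>g\<in>carrier (SLxSL m n). \<exists>lam\<in>fundamental_set m n k l. HM m n (act m n g F) lam \<ge> 0)) \<and>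
    (unstable m n k l F \<longleftrightarrow>
      (\<exists>g\<in>carrier (SLxSL m n). \<exists>lam\<in>fundamental_set m n k l. HM m n (act m n g F) lam > 0))"
proof (intro conjI)
  show "finite (fundamental_set m n k l)" by (rule finite_fundamental_set)
  have "\<not> stable m n k l F \<longleftrightarrow> weakly_destabilized m n k l F"
    using stable_of_not_weakly_destabilized[OF assms] not_weakly_destabilized_of_stable[OF assms(5)] by blast
  then show "\<not> stable m n k l F \<longleftrightarrow>
      (\<exists>g\<in>carrier (SLxSL m n). \<exists>lam\<in>fundamental_set m n k l. HM m n (act m n g F) lam \<ge> 0)"
    using destabilized_iff_HM(1)[OF assms(5,6)] by simp
  have "semistable m n k l F" if "\<not> destabilized m n k l F"
    using invariant_of_not_destabilized[OF assms that] assms(5,6) by (auto simp: semistable_def nonvanishing_locus_def)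
  then have "unstable m n k l F \<longleftrightarrow> destabilized m n k l F"
    using not_destabilized_of_semistable unfolding unstable_def by blast
  then show "unstable m n k l F \<longleftrightarrow>
      (\<exists>g\<in>carrier (SLxSL m n). \<exists>lam\<in>fundamental_set m n k l. HM m n (act m n g F) lam > 0)"
    using destabilized_iff_HM(2)[OF assms(5,6)] by simp
qed

end
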